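(* Let $\lambda:R\to S$ be a ring epimorphism and $M$ an $S$-$S$-bimodule such that $\mathrm{Tor}^R_i(M,S)=0$ for all $i\ge1$. If ${}_RS$ has a finite projective resolution by finitely generated projective $R$-modules, then (a) $\mathrm{fpd}(S\ltimes M)\le\mathrm{fpd}(S)+\mathrm{fpd}(R\ltimes M)+1$; (b) $\mathrm{fpd}(S)\le\mathrm{fpd}(R)+\mathrm{fpd}(S\ltimes M)+\max\{1,\mathrm{projdim}_RS\}+3$.
   Context: Modules are left modules; $M$ is viewed as an $R$-$R$-bimodule via $\lambda$ where needed. For a ring $A$ and an $A$-$A$-bimodule $M$, the trivial extension $A\ltimes M$ is the ring with abelian group $A\oplus M$ and multiplication $(r,m)(r',m')=(rr',rm'+mr')$. $\mathrm{fpd}(A)$ is the finitistic dimension of a ring $A$: the supremum of the projective dimensions of the $A$-modules that have a finite projective resolution by finitely generated projective $A$-modules. *)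

theory Defs
  imports "HOL-Algebra.Algebra" "HOL-Library.Extended_Nat"
begin

section \<open>Left modules over a not necessarily commutative ring\<close>

text \<open>
  The library locale \<open>module\<close> requires a commutative ring, so only its record type
  \<open>('r, 'm) module\<close> is reused here. The ring fields \<open>mult\<close> and \<open>one\<close> of that record carry
  no meaning for a module.
\<close>

locale left_module = R?: ring R + M?: abelian_group M
  for R :: "('r, 'y) ring_scheme" (structure) and M :: "('r, 'm, 'z) module_scheme" (structure) +
  assumes smult_closed [simp, intro]:
      "\<lbrakk>a \<in> carrier R; x \<in> carrier M\<rbrakk> \<Longrightarrow> a \<odot>\<^bsub>M\<^esub> x \<in> carrier M"
    and smult_l_distr:
      "\<lbrakk>a \<in> carrier R; b \<in> carrier R; x \<in> carrier M\<rbrakk> \<Longrightarrow>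
        (a \<oplus> b) \<odot>\<^bsub>M\<^esub> x = a \<odot>\<^bsub>M\<^esub> x \<oplus>\<^bsub>M\<^esub> b \<odot>\<^bsub>M\<^esub> x"
    and smult_r_distr:
      "\<lbrakk>a \<in> carrier R; x \<in> carrier M; y \<in> carrier M\<rbrakk> \<Longrightarrow>
        a \<odot>\<^bsub>M\<^esub> (x \<oplus>\<^bsub>M\<^esub> y) = a \<odot>\<^bsub>M\<^esub> x \<oplus>\<^bsub>M\<^esub> a \<odot>\<^bsub>M\<^esub> y"
    and smult_assoc1:
      "\<lbrakk>a \<in> carrier R; b \<in> carrier R; x \<in> carrier M\<rbrakk> \<Longrightarrow>
        (a \<otimes> b) \<odot>\<^bsub>M\<^esub> x = a \<odot>\<^bsub>M\<^esub> (b \<odot>\<^bsub>M\<^esub> x)"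
    and smult_one [simp]:
      "x \<in> carrier M \<Longrightarrow> \<one> \<odot>\<^bsub>M\<^esub> x = x"

definition lmod_hom ::
  "('r, 'y) ring_scheme \<Rightarrow> ('r, 'm) module \<Rightarrow> ('r, 'n) module \<Rightarrow> ('m \<Rightarrow> 'n) set" where
  "lmod_hom R M N = {f \<in> carrier M \<rightarrow> carrier N.
     (\<forall>x \<in> carrier M. \<forall>y \<in> carrier M. f (x \<oplus>\<^bsub>M\<^esub> y) = f x \<oplus>\<^bsub>N\<^esub> f y) \<and>
     (\<forall>a \<in> carrier R. \<forall>x \<in> carrier M. f (a \<odot>\<^bsub>M\<^esub> x) = a \<odot>\<^bsub>N\<^esub> f x)}"

definition lmod_ker :: "('r, 'm) module \<Rightarrow> ('r, 'n) module \<Rightarrow> ('m \<Rightarrow> 'n) \<Rightarrow> 'm set" where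
  "lmod_ker M N f = {x \<in> carrier M. f x = \<zero>\<^bsub>N\<^esub>}"

definition fin_gen :: "('r, 'y) ring_scheme \<Rightarrow> ('r, 'm) module \<Rightarrow> bool" where
  "fin_gen R M \<longleftrightarrow> (\<exists>G. finite G \<and> G \<subseteq> carrier M \<and>
     (\<forall>H. submodule H R M \<longrightarrow> G \<subseteq> H \<longrightarrow> H = carrier M))"

text \<open>
  A module is projective if maps out of it lift along surjections. A definition cannot quantify
  over types, so \<open>A\<close> and \<open>B\<close> range over fixed types. These are large enough for \<open>B = P\<close>
  and for \<open>A\<close> the free module on the set \<open>carrier P\<close>, and lemma \<open>projective_lift\<close> below
  gives the lifting property against modules with carriers in arbitrary types.
\<close>

definition projective :: "('r, 'y) ring_scheme \<Rightarrow> ('r, 'p) module \<Rightarrow> bool" where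
  "projective R P \<longleftrightarrow> left_module R P \<and>
     (\<forall>(A :: ('r, 'p \<Rightarrow> 'r) module) (B :: ('r, 'p) module) f g.
        left_module R A \<longrightarrow> left_module R B \<longrightarrow>
        g \<in> lmod_hom R A B \<longrightarrow> g ` carrier A = carrier B \<longrightarrow> f \<in> lmod_hom R P B \<longrightarrow>
        (\<exists>h \<in> lmod_hom R P A. \<forall>x \<in> carrier P. g (h x) = f x))"

section \<open>Projective resolutions and dimensions\<close>

text \<open>The complex \<open>\<dots> \<rightarrow> P 2 \<rightarrow> P 1 \<rightarrow> P 0 \<rightarrow> N \<rightarrow> 0\<close>, with \<open>d n : P (n + 1) \<rightarrow> P n\<close>
  and \<open>e : P 0 \<rightarrow> N\<close>, is exact.\<close>

definition projective_resolution ::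
  "('r, 'y) ring_scheme \<Rightarrow> ('r, 'n) module \<Rightarrow> (nat \<Rightarrow> ('r, 'p) module) \<Rightarrow>
   (nat \<Rightarrow> 'p \<Rightarrow> 'p) \<Rightarrow> ('p \<Rightarrow> 'n) \<Rightarrow> bool" where
  "projective_resolution R N P d e \<longleftrightarrow>
     left_module R N \<and> (\<forall>n. projective R (P n)) \<and>
     (\<forall>n. d n \<in> lmod_hom R (P (Suc n)) (P n)) \<and> e \<in> lmod_hom R (P 0) N \<and>
     e ` carrier (P 0) = carrier N \<and>
     d 0 ` carrier (P 1) = lmod_ker (P 0) N e \<and>
     (\<forall>n. d (Suc n) ` carrier (P (Suc (Suc n))) = lmod_ker (P (Suc n)) (P n) (d n))"

definition zero_above :: "(nat \<Rightarrow> ('r, 'p) module) \<Rightarrow> nat \<Rightarrow> bool" where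
  "zero_above P n \<longleftrightarrow> (\<forall>k > n. carrier (P k) = {\<zero>\<^bsub>P k\<^esub>})"

text \<open>
  The resolutions used below live in modules whose elements are functions from \<open>cell\<close> to the
  ring. This type is large enough to contain the successive syzygies of any \<open>N\<close>: \<open>Gen x\<close> is
  the free generator over \<open>x \<in> N\<close>, and \<open>Syz l\<close> is the free generator over the linear
  combination of cells encoded by the association list \<open>l\<close>. Hence every module has a free
  resolution in this type (lemma \<open>ex_projective_resolution\<close>), and a module with a projective
  resolution of length \<open>n\<close> (by finitely generated modules) has one inside this type: take free
  modules (of finite rank) in degrees below \<open>n\<close> and the last syzygy (\<open>N\<close> itself, transported
  into the type, if \<open>n = 0\<close>) in degree \<open>n\<close>.
\<close>

datatype ('r, 'n) cell = Gen 'n | Syz "(('r, 'n) cell \<times> 'r) list"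

type_synonym ('r, 'n) res_modules = "nat \<Rightarrow> ('r, ('r, 'n) cell \<Rightarrow> 'r) module"

text \<open>\<open>\<infinity>\<close> if there is no resolution of finite length; the zero module has projective
  dimension \<open>0\<close>.\<close>

definition projdim :: "('r, 'y) ring_scheme \<Rightarrow> ('r, 'n) module \<Rightarrow> enat" where
  "projdim R N = Inf {enat n | n. \<exists>(P :: ('r, 'n) res_modules) d e.
     projective_resolution R N P d e \<and> zero_above P n}"

definition has_finite_fg_projective_resolution ::
  "('r, 'y) ring_scheme \<Rightarrow> ('r, 'n) module \<Rightarrow> bool" where
  "has_finite_fg_projective_resolution R N \<longleftrightarrow> (\<exists>(P :: ('r, 'n) res_modules) d e n.
     projective_resolution R N P d e \<and> (\<forall>k. fin_gen R (P k)) \<and> zero_above P n)"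

text \<open>
  A module with such a resolution is finitely generated, hence isomorphic to a quotient of some
  \<open>R\<^sup>n\<close>, whose elements are cosets and so sets of functions \<open>nat \<Rightarrow> 'r\<close>
  (see lemma \<open>fin_gen_embeds\<close>).
\<close>

definition fpd :: "('r, 'y) ring_scheme \<Rightarrow> enat" where
  "fpd R = Sup {projdim R N | N :: ('r, (nat \<Rightarrow> 'r) set) module.
     left_module R N \<and> has_finite_fg_projective_resolution R N}"

section \<open>Bimodules, restriction of scalars and trivial extensions\<close>

record ('r, 'm) bimodule = "('r, 'm) module" +
  ract :: "'m \<Rightarrow> 'r \<Rightarrow> 'm"

locale bimodule = left_module A M
  for A :: "('r, 'y) ring_scheme" (structure) and M :: "('r, 'm, 'z) bimodule_scheme" (structure) +
  assumes ract_closed: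
      "\<lbrakk>x \<in> carrier M; a \<in> carrier A\<rbrakk> \<Longrightarrow> ract M x a \<in> carrier M"
    and ract_l_distr:
      "\<lbrakk>x \<in> carrier M; y \<in> carrier M; a \<in> carrier A\<rbrakk> \<Longrightarrow>
        ract M (x \<oplus>\<^bsub>M\<^esub> y) a = ract M x a \<oplus>\<^bsub>M\<^esub> ract M y a"
    and ract_r_distr:
      "\<lbrakk>x \<in> carrier M; a \<in> carrier A; b \<in> carrier A\<rbrakk> \<Longrightarrow>
        ract M x (a \<oplus> b) = ract M x a \<oplus>\<^bsub>M\<^esub> ract M x b"
    and ract_assoc:
      "\<lbrakk>x \<in> carrier M; a \<in> carrier A; b \<in> carrier A\<rbrakk> \<Longrightarrow>
        ract M x (a \<otimes> b) = ract M (ract M x a) b"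
    and ract_one:
      "x \<in> carrier M \<Longrightarrow> ract M x \<one> = x"
    and smult_ract_assoc:
      "\<lbrakk>a \<in> carrier A; x \<in> carrier M; b \<in> carrier A\<rbrakk> \<Longrightarrow>
        ract M (a \<odot>\<^bsub>M\<^esub> x) b = a \<odot>\<^bsub>M\<^esub> (ract M x b)"

definition regular_module :: "('s, 'y) ring_scheme \<Rightarrow> ('s, 's) module" where
  "regular_module S =
     \<lparr>carrier = carrier S, monoid.mult = monoid.mult S, one = \<one>\<^bsub>S\<^esub>,
     ring.zero = \<zero>\<^bsub>S\<^esub>, add = ring.add S, smult = monoid.mult S\<rparr>"

definition restrict_scalars :: "('r \<Rightarrow> 's) \<Rightarrow> ('s, 'm) module \<Rightarrow> ('r, 'm) module" where
  "restrict_scalars lam M =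
     \<lparr>carrier = carrier M, monoid.mult = monoid.mult M,
     one = \<one>\<^bsub>M\<^esub>, ring.zero = \<zero>\<^bsub>M\<^esub>, add = ring.add M, smult = (\<lambda>r x. lam r \<odot>\<^bsub>M\<^esub> x)\<rparr>"

definition restrict_bimodule :: "('r \<Rightarrow> 's) \<Rightarrow> ('s, 'm) bimodule \<Rightarrow> ('r, 'm) bimodule" where
  "restrict_bimodule lam M =
     \<lparr>carrier = carrier M, monoid.mult = monoid.mult M,
     one = \<one>\<^bsub>M\<^esub>, ring.zero = \<zero>\<^bsub>M\<^esub>, add = ring.add M, smult = (\<lambda>r x. lam r \<odot>\<^bsub>M\<^esub> x), ract = (\<lambda>x r. ract M x (lam r))\<rparr>"

definition trivial_extension ::
  "('r, 'y) ring_scheme \<Rightarrow> ('r, 'm) bimodule \<Rightarrow> ('r \<times> 'm) ring" (infixl \<open>\<ltimes>\<close> 70) where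
  "A \<ltimes> M =
     \<lparr>carrier = carrier A \<times> carrier M,
     monoid.mult = (\<lambda>(r, m) (r', m'). (r \<otimes>\<^bsub>A\<^esub> r', r \<odot>\<^bsub>M\<^esub> m' \<oplus>\<^bsub>M\<^esub> ract M m r')),
     one = (\<one>\<^bsub>A\<^esub>, \<zero>\<^bsub>M\<^esub>), ring.zero = (\<zero>\<^bsub>A\<^esub>, \<zero>\<^bsub>M\<^esub>),
     add = (\<lambda>(r, m) (r', m'). (r \<oplus>\<^bsub>A\<^esub> r', m \<oplus>\<^bsub>M\<^esub> m'))\<rparr>"

section \<open>Ring epimorphisms\<close>

text \<open>
  \<open>lam\<close> is right cancellable among unital ring homomorphisms. The test rings \<open>T\<close> have their
  carrier in a fixed type, which is large enough: the subring generated by the images of two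
  homomorphisms from \<open>S\<close> consists of sums of words in two copies of \<open>S\<close>. Lemma
  \<open>ring_epi_cancel\<close> below gives cancellation for rings with carriers in arbitrary types.
\<close>

definition ring_epi ::
  "('r, 'y) ring_scheme \<Rightarrow> ('s, 'z) ring_scheme \<Rightarrow> ('r \<Rightarrow> 's) \<Rightarrow> bool" where
  "ring_epi R S lam \<longleftrightarrow> lam \<in> ring_hom R S \<and>
     (\<forall>T :: ('s + 's) list list ring. ring T \<longrightarrow>
        (\<forall>f \<in> ring_hom S T. \<forall>g \<in> ring_hom S T.
           (\<forall>r \<in> carrier R. f (lam r) = g (lam r)) \<longrightarrow> (\<forall>s \<in> carrier S. f s = g s)))"

section \<open>Tensor products and Tor\<close>

text \<open>\<open>tensor R M N\<close> is the abelian group \<open>M \<otimes>\<^sub>R N\<close>, formed from the right action on \<open>M\<close>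
  and the left action on \<open>N\<close>. Its group operation is written multiplicatively.\<close>

definition tensor_rels ::
  "('r, 'y) ring_scheme \<Rightarrow> ('r, 'm) bimodule \<Rightarrow> ('r, 'n) module \<Rightarrow> ('m \<times> 'n \<Rightarrow>\<^sub>0 int) set" where
  "tensor_rels R M N =
     {frag_of (m \<oplus>\<^bsub>M\<^esub> m', x) - frag_of (m, x) - frag_of (m', x) | m m' x.
        m \<in> carrier M \<and> m' \<in> carrier M \<and> x \<in> carrier N} \<union>
     {frag_of (m, x \<oplus>\<^bsub>N\<^esub> x') - frag_of (m, x) - frag_of (m, x') | m x x'.
        m \<in> carrier M \<and> x \<in> carrier N \<and> x' \<in> carrier N} \<union>
     {frag_of (ract M m r, x) - frag_of (m, r \<odot>\<^bsub>N\<^esub> x) | m r x.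
        m \<in> carrier M \<and> r \<in> carrier R \<and> x \<in> carrier N}"

definition tensor_null ::
  "('r, 'y) ring_scheme \<Rightarrow> ('r, 'm) bimodule \<Rightarrow> ('r, 'n) module \<Rightarrow> ('m \<times> 'n \<Rightarrow>\<^sub>0 int) set" where
  "tensor_null R M N =
     generate (free_Abelian_group (carrier M \<times> carrier N)) (tensor_rels R M N)"

definition tensor ::
  "('r, 'y) ring_scheme \<Rightarrow> ('r, 'm) bimodule \<Rightarrow> ('r, 'n) module \<Rightarrow>
   ('m \<times> 'n \<Rightarrow>\<^sub>0 int) set monoid" where
  "tensor R M N = free_Abelian_group (carrier M \<times> carrier N) Mod tensor_null R M N"

text \<open>\<open>tensor_map R M N' f\<close> is \<open>id \<otimes> f : M \<otimes> N \<rightarrow> M \<otimes> N'\<close> for \<open>f : N \<rightarrow> N'\<close>: a coset is sent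
  to the coset of \<open>tensor_null R M N'\<close> that contains its image.\<close>

definition tensor_map ::
  "('r, 'y) ring_scheme \<Rightarrow> ('r, 'm) bimodule \<Rightarrow> ('r, 'q) module \<Rightarrow> ('n \<Rightarrow> 'q) \<Rightarrow>
   ('m \<times> 'n \<Rightarrow>\<^sub>0 int) set \<Rightarrow> ('m \<times> 'q \<Rightarrow>\<^sub>0 int) set" where
  "tensor_map R M N' f C = tensor_null R M N'
     <#>\<^bsub>free_Abelian_group (carrier M \<times> carrier N')\<^esub>
     (frag_extend (\<lambda>(m, x). frag_of (m, f x)) ` C)"

definition tensor_cycles ::
  "('r, 'y) ring_scheme \<Rightarrow> ('r, 'm) bimodule \<Rightarrow> (nat \<Rightarrow> ('r, 'p) module) \<Rightarrow>
   (nat \<Rightarrow> 'p \<Rightarrow> 'p) \<Rightarrow> nat \<Rightarrow> ('m \<times> 'p \<Rightarrow>\<^sub>0 int) set set" where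
  "tensor_cycles R M P d i = (case i of
       0 \<Rightarrow> carrier (tensor R M (P 0))
     | Suc j \<Rightarrow> {c \<in> carrier (tensor R M (P (Suc j))).
                 tensor_map R M (P j) (d j) c = \<one>\<^bsub>tensor R M (P j)\<^esub>})"

definition tensor_boundaries ::
  "('r, 'y) ring_scheme \<Rightarrow> ('r, 'm) bimodule \<Rightarrow> (nat \<Rightarrow> ('r, 'p) module) \<Rightarrow>
   (nat \<Rightarrow> 'p \<Rightarrow> 'p) \<Rightarrow> nat \<Rightarrow> ('m \<times> 'p \<Rightarrow>\<^sub>0 int) set set" where
  "tensor_boundaries R M P d i =
     tensor_map R M (P i) (d i) ` carrier (tensor R M (P (Suc i)))"

definition tensor_homology ::
  "('r, 'y) ring_scheme \<Rightarrow> ('r, 'm) bimodule \<Rightarrow> (nat \<Rightarrow> ('r, 'p) module) \<Rightarrow>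
   (nat \<Rightarrow> 'p \<Rightarrow> 'p) \<Rightarrow> nat \<Rightarrow> ('m \<times> 'p \<Rightarrow>\<^sub>0 int) set set monoid" where
  "tensor_homology R M P d i =
     (tensor R M (P i)) \<lparr>carrier := tensor_cycles R M P d i\<rparr> Mod tensor_boundaries R M P d i"

text \<open>\<open>Tor R i M N\<close> is \<open>Tor\<^sub>i\<close> over \<open>R\<close> of the right module \<open>M\<close> and the left module \<open>N\<close>, computed
  from a chosen projective resolution of \<open>N\<close>. One exists by \<open>ex_projective_resolution\<close>.\<close>

definition Tor ::
  "('r, 'y) ring_scheme \<Rightarrow> nat \<Rightarrow> ('r, 'm) bimodule \<Rightarrow> ('r, 'n) module \<Rightarrow>
   ('m \<times> (('r, 'n) cell \<Rightarrow> 'r) \<Rightarrow>\<^sub>0 int) set set monoid" where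
  "Tor R i M N =
     (let (P, d, e) = (SOME (P :: ('r, 'n) res_modules, d, e). projective_resolution R N P d e)
      in tensor_homology R M P d i)"

section \<open>Well-definedness and adequacy of the fixed types\<close>


context left_module begin

lemma smult_l_null [simp]: "x \<in> carrier M \<Longrightarrow> \<zero> \<odot>\<^bsub>M\<^esub> x = \<zero>\<^bsub>M\<^esub>"
  by (metis M.add.l_cancel_one' R.add.l_cancel_one' R.zero_closed smult_closed smult_l_distr)

lemma smult_r_null [simp]: "a \<in> carrier R \<Longrightarrow> a \<odot>\<^bsub>M\<^esub> \<zero>\<^bsub>M\<^esub> = \<zero>\<^bsub>M\<^esub>"
  by (metis M.add.l_cancel_one' M.zero_closed smult_closed smult_r_distr)

lemma smult_r_minus: "\<lbrakk>a \<in> carrier R; x \<in> carrier M\<rbrakk> \<Longrightarrow> a \<odot>\<^bsub>M\<^esub> (\<ominus>\<^bsub>M\<^esub> x) = \<ominus>\<^bsub>M\<^esub> (a \<odot>\<^bsub>M\<^esub> x)"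
  by (metis M.a_inv_closed M.minus_equality M.l_neg smult_closed smult_r_distr smult_r_null)

lemma finsum_smult:
  "\<lbrakk>finite A; a \<in> carrier R; f \<in> A \<rightarrow> carrier M\<rbrakk> \<Longrightarrow>
     a \<odot>\<^bsub>M\<^esub> (\<Oplus>\<^bsub>M\<^esub> i \<in> A. f i) = (\<Oplus>\<^bsub>M\<^esub> i \<in> A. a \<odot>\<^bsub>M\<^esub> f i)"
  by (induct set: finite) (simp_all add: Pi_def smult_r_distr)

end

lemma lmod_homD:
  assumes "f \<in> lmod_hom R M N"
  shows "x \<in> carrier M \<Longrightarrow> f x \<in> carrier N"
    and "x \<in> carrier M \<Longrightarrow> y \<in> carrier M \<Longrightarrow> f (x \<oplus>\<^bsub>M\<^esub> y) = f x \<oplus>\<^bsub>N\<^esub> f y"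
    and "a \<in> carrier R \<Longrightarrow> x \<in> carrier M \<Longrightarrow> f (a \<odot>\<^bsub>M\<^esub> x) = a \<odot>\<^bsub>N\<^esub> f x"
  using assms by (auto simp: lmod_hom_def)

lemma lmod_hom_zero:
  assumes f: "f \<in> lmod_hom R M N" and M: "left_module R M" and N: "left_module R N"
  shows "f \<zero>\<^bsub>M\<^esub> = \<zero>\<^bsub>N\<^esub>"
proof -
  interpret M: left_module R M by fact
  interpret N: left_module R N by fact
  show ?thesis
    by (metis M.M.r_zero M.M.zero_closed N.M.add.l_cancel_one' f lmod_homD(1) lmod_homD(2))
qed

lemma lmod_hom_minus:
  assumes f: "f \<in> lmod_hom R M N" and M: "left_module R M" and N: "left_module R N"
    and x: "x \<in> carrier M"
  shows "f (\<ominus>\<^bsub>M\<^esub> x) = \<ominus>\<^bsub>N\<^esub> f x"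
proof -
  interpret M: left_module R M by fact
  interpret N: left_module R N by fact
  have "f (\<ominus>\<^bsub>M\<^esub> x) \<oplus>\<^bsub>N\<^esub> f x = f (\<ominus>\<^bsub>M\<^esub> x \<oplus>\<^bsub>M\<^esub> x)"
    using lmod_homD(2)[OF f] x by simp
  also have "\<dots> = \<zero>\<^bsub>N\<^esub>" using lmod_hom_zero[OF f M N] x by (simp add: M.M.l_neg)
  finally show ?thesis using lmod_homD(1)[OF f] x by (metis M.M.a_inv_closed N.M.minus_equality)
qed

lemma lmod_hom_image_submodule:
  assumes f: "f \<in> lmod_hom R M N" and M: "left_module R M" and N: "left_module R N"
  shows "submodule (f ` carrier M) R N"
proof -
  interpret M: left_module R M by fact
  interpret N: left_module R N by fact
  note h = lmod_homD[OF f]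
  show ?thesis
  proof (intro submodule.intro subgroup.intro submodule_axioms.intro)
    show "f ` carrier M \<subseteq> carrier (add_monoid N)" using h(1) by auto
    show "x \<otimes>\<^bsub>add_monoid N\<^esub> y \<in> f ` carrier M" if "x \<in> f ` carrier M" "y \<in> f ` carrier M" for x y
      using that h(2) by (auto simp: image_iff) (metis M.M.add.m_closed)
    show "\<one>\<^bsub>add_monoid N\<^esub> \<in> f ` carrier M"
      using lmod_hom_zero[OF f M N] by (auto simp: image_iff) (metis M.M.zero_closed)
    show "inv\<^bsub>add_monoid N\<^esub> x \<in> f ` carrier M" if "x \<in> f ` carrier M" for x
      using that lmod_hom_minus[OF f M N] unfolding a_inv_def[symmetric]
      by (auto simp: image_iff) (metis M.M.a_inv_closed)
    show "a \<odot>\<^bsub>N\<^esub> x \<in> f ` carrier M" if "a \<in> carrier R" "x \<in> f ` carrier M" for a x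
      using that h(3) by (auto simp: image_iff) (metis M.smult_closed)
  qed
qed

definition free_module :: "('r, 'y) ring_scheme \<Rightarrow> 'x set \<Rightarrow> ('r, 'x \<Rightarrow> 'r) module" where
  "free_module R B =
     \<lparr>carrier = {f \<in> B \<rightarrow> carrier R. (\<forall>x. x \<notin> B \<longrightarrow> f x = \<zero>\<^bsub>R\<^esub>) \<and> finite {x. f x \<noteq> \<zero>\<^bsub>R\<^esub>}},
      monoid.mult = (\<lambda>f g. f), one = (\<lambda>x. \<zero>\<^bsub>R\<^esub>), ring.zero = (\<lambda>x. \<zero>\<^bsub>R\<^esub>),
      ring.add = (\<lambda>f g x. f x \<oplus>\<^bsub>R\<^esub> g x), smult = (\<lambda>a f x. a \<otimes>\<^bsub>R\<^esub> f x)\<rparr>"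

definition basis_elt :: "('r, 'y) ring_scheme \<Rightarrow> 'x \<Rightarrow> 'x \<Rightarrow> 'r" where
  "basis_elt R b = (\<lambda>x. if x = b then \<one>\<^bsub>R\<^esub> else \<zero>\<^bsub>R\<^esub>)"

definition free_ext ::
  "('r, 'y) ring_scheme \<Rightarrow> ('r, 'n) module \<Rightarrow> ('x \<Rightarrow> 'n) \<Rightarrow> ('x \<Rightarrow> 'r) \<Rightarrow> 'n" where
  "free_ext R N \<phi> f = (\<Oplus>\<^bsub>N\<^esub> x \<in> {x. f x \<noteq> \<zero>\<^bsub>R\<^esub>}. f x \<odot>\<^bsub>N\<^esub> \<phi> x)"

lemma free_module_carrierD:
  assumes "f \<in> carrier (free_module R B)" "ring R"
  shows "f x \<in> carrier R" "x \<notin> B \<Longrightarrow> f x = \<zero>\<^bsub>R\<^esub>" "finite {x. f x \<noteq> \<zero>\<^bsub>R\<^esub>}"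
proof -
  interpret ring R by fact
  show "f x \<in> carrier R" using assms by (cases "x \<in> B") (auto simp: free_module_def)
qed (use assms in \<open>auto simp: free_module_def\<close>)

lemma left_module_free_module:
  assumes "ring R" shows "left_module R (free_module R B)"
proof -
  interpret ring R by fact
  note c = free_module_carrierD[OF _ assms, of _ B]
  have fin: "finite {x. h x \<noteq> \<zero>\<^bsub>R\<^esub>}" if "f \<in> carrier (free_module R B)" "g \<in> carrier (free_module R B)"
      "\<And>x. f x = \<zero>\<^bsub>R\<^esub> \<Longrightarrow> g x = \<zero>\<^bsub>R\<^esub> \<Longrightarrow> h x = \<zero>\<^bsub>R\<^esub>" for f g h
    by (rule finite_subset[of _ "{x. f x \<noteq> \<zero>\<^bsub>R\<^esub>} \<union> {x. g x \<noteq> \<zero>\<^bsub>R\<^esub>}"]) (use c(3) that in auto)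
  have sm: "(\<lambda>x. a \<otimes>\<^bsub>R\<^esub> f x) \<in> carrier (free_module R B)"
    if "a \<in> carrier R" "f \<in> carrier (free_module R B)" for a f
    using c[OF that(2)] that(1) fin[OF that(2) that(2), of "\<lambda>x. a \<otimes>\<^bsub>R\<^esub> f x"]
    by (auto simp: free_module_def)
  have ad: "(\<lambda>x. f x \<oplus>\<^bsub>R\<^esub> g x) \<in> carrier (free_module R B)"
    if "f \<in> carrier (free_module R B)" "g \<in> carrier (free_module R B)" for f g
    using c[OF that(1)] c[OF that(2)] fin[OF that, of "\<lambda>x. f x \<oplus>\<^bsub>R\<^esub> g x"]
    by (auto simp: free_module_def)
  have ag: "abelian_group (free_module R B)"
  proof (rule abelian_groupI)
    fix f assume f: "f \<in> carrier (free_module R B)"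
    have "(\<lambda>x. (\<ominus>\<^bsub>R\<^esub> \<one>\<^bsub>R\<^esub>) \<otimes>\<^bsub>R\<^esub> f x) \<in> carrier (free_module R B)" by (rule sm) (use f in auto)
    moreover have "(\<lambda>x. (\<ominus>\<^bsub>R\<^esub> \<one>\<^bsub>R\<^esub>) \<otimes>\<^bsub>R\<^esub> f x) \<oplus>\<^bsub>free_module R B\<^esub> f = \<zero>\<^bsub>free_module R B\<^esub>"
      using c(1)[OF f] by (auto simp: free_module_def l_minus l_neg)
    ultimately show "\<exists>y\<in>carrier (free_module R B). y \<oplus>\<^bsub>free_module R B\<^esub> f = \<zero>\<^bsub>free_module R B\<^esub>" by blast
  next
    show "f \<oplus>\<^bsub>free_module R B\<^esub> g \<in> carrier (free_module R B)"
      if "f \<in> carrier (free_module R B)" "g \<in> carrier (free_module R B)" for f g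
      using ad[OF that] by (simp add: free_module_def)
    show "\<zero>\<^bsub>free_module R B\<^esub> \<in> carrier (free_module R B)" by (auto simp: free_module_def)
    show "f \<oplus>\<^bsub>free_module R B\<^esub> g \<oplus>\<^bsub>free_module R B\<^esub> h
        = f \<oplus>\<^bsub>free_module R B\<^esub> (g \<oplus>\<^bsub>free_module R B\<^esub> h)"
      if "f \<in> carrier (free_module R B)" "g \<in> carrier (free_module R B)"
        "h \<in> carrier (free_module R B)" for f g h
      using c(1)[OF that(1)] c(1)[OF that(2)] c(1)[OF that(3)] by (simp add: free_module_def a_assoc)
    show "f \<oplus>\<^bsub>free_module R B\<^esub> g = g \<oplus>\<^bsub>free_module R B\<^esub> f"
      if "f \<in> carrier (free_module R B)" "g \<in> carrier (free_module R B)" for f g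
      using c(1)[OF that(1)] c(1)[OF that(2)] by (simp add: free_module_def a_comm)
    show "\<zero>\<^bsub>free_module R B\<^esub> \<oplus>\<^bsub>free_module R B\<^esub> f = f"
      if "f \<in> carrier (free_module R B)" for f
      using c(1)[OF that] by (simp add: free_module_def)
  qed
  show ?thesis
  proof (intro left_module.intro ag assms left_module_axioms.intro)
    fix a f assume "a \<in> carrier R" "f \<in> carrier (free_module R B)"
    then show "a \<odot>\<^bsub>free_module R B\<^esub> f \<in> carrier (free_module R B)"
      using sm by (simp add: free_module_def)
  next
    fix a b f assume "a \<in> carrier R" "b \<in> carrier R" and f: "f \<in> carrier (free_module R B)"
    then show "(a \<oplus>\<^bsub>R\<^esub> b) \<odot>\<^bsub>free_module R B\<^esub> f =
        a \<odot>\<^bsub>free_module R B\<^esub> f \<oplus>\<^bsub>free_module R B\<^esub> b \<odot>\<^bsub>free_module R B\<^esub> f"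
      and "(a \<otimes>\<^bsub>R\<^esub> b) \<odot>\<^bsub>free_module R B\<^esub> f =
        a \<odot>\<^bsub>free_module R B\<^esub> (b \<odot>\<^bsub>free_module R B\<^esub> f)"
      using c(1)[OF f] by (simp_all add: free_module_def l_distr m_assoc)
  next
    fix a f g assume "a \<in> carrier R" and f: "f \<in> carrier (free_module R B)"
      and g: "g \<in> carrier (free_module R B)"
    then show "a \<odot>\<^bsub>free_module R B\<^esub> (f \<oplus>\<^bsub>free_module R B\<^esub> g) =
        a \<odot>\<^bsub>free_module R B\<^esub> f \<oplus>\<^bsub>free_module R B\<^esub> a \<odot>\<^bsub>free_module R B\<^esub> g"
      using c(1)[OF f] c(1)[OF g] by (simp add: free_module_def r_distr)
  next
    fix f assume f: "f \<in> carrier (free_module R B)"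
    then show "\<one>\<^bsub>R\<^esub> \<odot>\<^bsub>free_module R B\<^esub> f = f"
      using c(1)[OF f] by (simp add: free_module_def)
  qed
qed

lemma free_module_simps [simp]:
  "\<zero>\<^bsub>free_module R B\<^esub> = (\<lambda>x. \<zero>\<^bsub>R\<^esub>)"
  "f \<oplus>\<^bsub>free_module R B\<^esub> g = (\<lambda>x. f x \<oplus>\<^bsub>R\<^esub> g x)"
  "a \<odot>\<^bsub>free_module R B\<^esub> f = (\<lambda>x. a \<otimes>\<^bsub>R\<^esub> f x)"
  by (simp_all add: free_module_def)

lemma basis_elt_in: "ring R \<Longrightarrow> b \<in> B \<Longrightarrow> basis_elt R b \<in> carrier (free_module R B)"
  by (auto simp: free_module_def basis_elt_def ring.ring_simprules intro: finite_subset[of _ "{b}"])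

lemma free_ext_eq:
  assumes "left_module R N" "\<phi> \<in> B \<rightarrow> carrier N" "f \<in> carrier (free_module R B)"
    and A: "finite A" "A \<subseteq> B" "{x. f x \<noteq> \<zero>\<^bsub>R\<^esub>} \<subseteq> A"
  shows "free_ext R N \<phi> f = (\<Oplus>\<^bsub>N\<^esub> x \<in> A. f x \<odot>\<^bsub>N\<^esub> \<phi> x)"
proof -
  interpret left_module R N by fact
  note c = free_module_carrierD[OF assms(3) R.ring_axioms]
  show ?thesis unfolding free_ext_def
    by (rule M.add.finprod_mono_neutral_cong_left) (use assms c(1) in \<open>auto simp: Pi_iff\<close>)
qed

lemma free_module_supp: "f \<in> carrier (free_module R B) \<Longrightarrow> {x. f x \<noteq> \<zero>\<^bsub>R\<^esub>} \<subseteq> B"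
  by (auto simp: free_module_def)

lemma free_ext_hom:
  assumes N: "left_module R N" and \<phi>: "\<phi> \<in> B \<rightarrow> carrier N"
  shows "free_ext R N \<phi> \<in> lmod_hom R (free_module R B) N"
proof -
  interpret left_module R N by fact
  interpret F: left_module R "free_module R B" by (rule left_module_free_module) (rule R.ring_axioms)
  note c = free_module_carrierD[OF _ R.ring_axioms, of _ B]
  have cl: "free_ext R N \<phi> f \<in> carrier N" if f: "f \<in> carrier (free_module R B)" for f
    unfolding free_ext_def
    by (rule M.finsum_closed) (use c(1)[OF f] free_module_supp[OF f] \<phi> in auto)
  have add: "free_ext R N \<phi> (f \<oplus>\<^bsub>free_module R B\<^esub> g) = free_ext R N \<phi> f \<oplus>\<^bsub>N\<^esub> free_ext R N \<phi> g"
    if f: "f \<in> carrier (free_module R B)" and g: "g \<in> carrier (free_module R B)" for f g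
  proof -
    let ?A = "{x. f x \<noteq> \<zero>\<^bsub>R\<^esub>} \<union> {x. g x \<noteq> \<zero>\<^bsub>R\<^esub>}"
    have A: "finite ?A" "?A \<subseteq> B" using c(3) f g free_module_supp[OF f] free_module_supp[OF g] by auto
    have p: "\<And>x. x \<in> ?A \<Longrightarrow> \<phi> x \<in> carrier N" using A(2) \<phi> by blast
    have fg: "f \<oplus>\<^bsub>free_module R B\<^esub> g \<in> carrier (free_module R B)" using f g by (rule F.M.a_closed)
    have "free_ext R N \<phi> (f \<oplus>\<^bsub>free_module R B\<^esub> g)
        = (\<Oplus>\<^bsub>N\<^esub> x \<in> ?A. (f \<oplus>\<^bsub>free_module R B\<^esub> g) x \<odot>\<^bsub>N\<^esub> \<phi> x)"
      by (rule free_ext_eq[OF N \<phi> fg A]) auto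
    also have "\<dots> = (\<Oplus>\<^bsub>N\<^esub> x \<in> ?A. f x \<odot>\<^bsub>N\<^esub> \<phi> x \<oplus>\<^bsub>N\<^esub> g x \<odot>\<^bsub>N\<^esub> \<phi> x)"
      by (rule M.add.finprod_cong') (use c(1)[OF f] c(1)[OF g] p in \<open>auto simp: smult_l_distr\<close>)
    also have "\<dots> = (\<Oplus>\<^bsub>N\<^esub> x \<in> ?A. f x \<odot>\<^bsub>N\<^esub> \<phi> x) \<oplus>\<^bsub>N\<^esub> (\<Oplus>\<^bsub>N\<^esub> x \<in> ?A. g x \<odot>\<^bsub>N\<^esub> \<phi> x)"
      by (rule M.finsum_addf) (use c(1)[OF f] c(1)[OF g] p in auto)
    also have "\<dots> = free_ext R N \<phi> f \<oplus>\<^bsub>N\<^esub> free_ext R N \<phi> g"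
      using free_ext_eq[OF N \<phi> f A] free_ext_eq[OF N \<phi> g A] by simp
    finally show ?thesis .
  qed
  have smu: "free_ext R N \<phi> (a \<odot>\<^bsub>free_module R B\<^esub> f) = a \<odot>\<^bsub>N\<^esub> free_ext R N \<phi> f"
    if a: "a \<in> carrier R" and f: "f \<in> carrier (free_module R B)" for a f
  proof -
    let ?A = "{x. f x \<noteq> \<zero>\<^bsub>R\<^esub>}"
    have A: "finite ?A" "?A \<subseteq> B" using c(3)[OF f] free_module_supp[OF f] by auto
    have p: "\<And>x. x \<in> ?A \<Longrightarrow> \<phi> x \<in> carrier N" using A(2) \<phi> by blast
    have af: "a \<odot>\<^bsub>free_module R B\<^esub> f \<in> carrier (free_module R B)" using a f by (rule F.smult_closed)
    have "free_ext R N \<phi> (a \<odot>\<^bsub>free_module R B\<^esub> f)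
        = (\<Oplus>\<^bsub>N\<^esub> x \<in> ?A. (a \<odot>\<^bsub>free_module R B\<^esub> f) x \<odot>\<^bsub>N\<^esub> \<phi> x)"
      by (rule free_ext_eq[OF N \<phi> af A]) (use a in auto)
    also have "\<dots> = (\<Oplus>\<^bsub>N\<^esub> x \<in> ?A. a \<odot>\<^bsub>N\<^esub> (f x \<odot>\<^bsub>N\<^esub> \<phi> x))"
      by (rule M.add.finprod_cong') (use a c(1)[OF f] p in \<open>auto simp: smult_assoc1\<close>)
    also have "\<dots> = a \<odot>\<^bsub>N\<^esub> free_ext R N \<phi> f"
      unfolding free_ext_def
      by (rule finsum_smult[symmetric]) (use a A c(1)[OF f] p in auto)
    finally show ?thesis .
  qed
  show ?thesis using cl add smu unfolding lmod_hom_def by blast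
qed

lemma free_ext_basis:
  assumes N: "left_module R N" and \<phi>: "\<phi> \<in> B \<rightarrow> carrier N" and b: "b \<in> B"
  shows "free_ext R N \<phi> (basis_elt R b) = \<phi> b"
proof -
  interpret left_module R N by fact
  have \<phi>b: "\<phi> b \<in> carrier N" using \<phi> b by auto
  have "free_ext R N \<phi> (basis_elt R b) = (\<Oplus>\<^bsub>N\<^esub> x \<in> {b}. basis_elt R b x \<odot>\<^bsub>N\<^esub> \<phi> x)"
    by (rule free_ext_eq[OF N \<phi> basis_elt_in[OF R.ring_axioms b]])
      (use b in \<open>auto simp: basis_elt_def\<close>)
  also have "\<dots> = \<phi> b" using \<phi>b by (simp add: basis_elt_def)
  finally show ?thesis .
qed

lemma free_module_induct:
  assumes R: "ring R" and f: "f \<in> carrier (free_module R B)"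
    and Q0: "Q (\<lambda>x. \<zero>\<^bsub>R\<^esub>)"
    and step: "\<And>f b r. f \<in> carrier (free_module R B) \<Longrightarrow> Q f \<Longrightarrow> b \<in> B \<Longrightarrow> r \<in> carrier R \<Longrightarrow>
      Q (f \<oplus>\<^bsub>free_module R B\<^esub> r \<odot>\<^bsub>free_module R B\<^esub> basis_elt R b)"
  shows "Q f"
proof -
  interpret ring R by fact
  have "Q f" if "finite A" "f \<in> carrier (free_module R B)" "{x. f x \<noteq> \<zero>\<^bsub>R\<^esub>} \<subseteq> A" for A f
    using that
  proof (induction A arbitrary: f)
    case empty
    then have "f = (\<lambda>x. \<zero>\<^bsub>R\<^esub>)" by auto
    show ?case unfolding \<open>f = _\<close> by (rule Q0)
  next
    case (insert b A)
    note c = free_module_carrierD[OF insert.prems(1) R]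
    show ?case
    proof (cases "f b = \<zero>\<^bsub>R\<^esub>")
      case True
      then show ?thesis using insert by (metis (mono_tags, lifting) mem_Collect_eq subset_insert)
    next
      case False
      then have b: "b \<in> B" using c(2) by blast
      let ?g = "f(b := \<zero>\<^bsub>R\<^esub>)"
      have "?g \<in> carrier (free_module R B)"
        using insert.prems(1) by (auto simp: free_module_def Pi_iff intro: rev_finite_subset)
      moreover from this have "Q ?g" by (rule insert.IH) (use insert.prems(2) in auto)
      ultimately have "Q (?g \<oplus>\<^bsub>free_module R B\<^esub> f b \<odot>\<^bsub>free_module R B\<^esub> basis_elt R b)"
        using step b c(1) by blast
      moreover have "?g \<oplus>\<^bsub>free_module R B\<^esub> f b \<odot>\<^bsub>free_module R B\<^esub> basis_elt R b = f"
        using c(1) by (auto simp: basis_elt_def fun_eq_iff)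
      ultimately show ?thesis by simp
    qed
  qed
  then show ?thesis using free_module_carrierD(3)[OF f R] f by blast
qed

lemma free_hom_eqI:
  assumes N: "left_module R N"
    and h: "h \<in> lmod_hom R (free_module R B) N" and k: "k \<in> lmod_hom R (free_module R B) N"
    and eq: "\<And>b. b \<in> B \<Longrightarrow> h (basis_elt R b) = k (basis_elt R b)"
    and f: "f \<in> carrier (free_module R B)"
  shows "h f = k f"
proof -
  interpret left_module R N by fact
  interpret F: left_module R "free_module R B" by (rule left_module_free_module) (rule R.ring_axioms)
  show ?thesis
  proof (rule free_module_induct[OF R.ring_axioms f])
    show "h (\<lambda>x. \<zero>\<^bsub>R\<^esub>) = k (\<lambda>x. \<zero>\<^bsub>R\<^esub>)"
      using lmod_hom_zero[OF h F.left_module_axioms N] lmod_hom_zero[OF k F.left_module_axioms N] by simp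
  next
    fix f b r assume f: "f \<in> carrier (free_module R B)" "h f = k f" and b: "b \<in> B" and r: "r \<in> carrier R"
    have e: "basis_elt R b \<in> carrier (free_module R B)" by (rule basis_elt_in[OF R.ring_axioms b])
    then have re: "r \<odot>\<^bsub>free_module R B\<^esub> basis_elt R b \<in> carrier (free_module R B)"
      using r by (rule F.smult_closed[rotated])
    show "h (f \<oplus>\<^bsub>free_module R B\<^esub> r \<odot>\<^bsub>free_module R B\<^esub> basis_elt R b)
        = k (f \<oplus>\<^bsub>free_module R B\<^esub> r \<odot>\<^bsub>free_module R B\<^esub> basis_elt R b)"
      unfolding lmod_homD(2)[OF h f(1) re] lmod_homD(2)[OF k f(1) re]
        lmod_homD(3)[OF h r e] lmod_homD(3)[OF k r e] f(2) eq[OF b] ..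
  qed
qed

lemma lmod_hom_comp:
  "h \<in> lmod_hom R L M \<Longrightarrow> g \<in> lmod_hom R M N \<Longrightarrow> (\<lambda>x. g (h x)) \<in> lmod_hom R L N"
  by (auto simp: lmod_hom_def Pi_iff)

lemma free_module_lift:
  assumes A: "left_module R A" and C: "left_module R C"
    and g: "g \<in> lmod_hom R A C" "g ` carrier A = carrier C"
    and f: "f \<in> lmod_hom R (free_module R B) C"
  obtains h where "h \<in> lmod_hom R (free_module R B) A"
    "\<And>x. x \<in> carrier (free_module R B) \<Longrightarrow> g (h x) = f x"
proof -
  interpret A: left_module R A by fact
  define \<phi> where "\<phi> b = (SOME a. a \<in> carrier A \<and> g a = f (basis_elt R b))" for b
  have ex: "\<exists>a. a \<in> carrier A \<and> g a = f (basis_elt R b)" if "b \<in> B" for b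
  proof -
    have "f (basis_elt R b) \<in> g ` carrier A"
      unfolding g(2) by (rule lmod_homD(1)[OF f basis_elt_in[OF A.R.ring_axioms that]])
    then show ?thesis by (metis imageE)
  qed
  have s: "\<phi> b \<in> carrier A \<and> g (\<phi> b) = f (basis_elt R b)" if "b \<in> B" for b
    unfolding \<phi>_def by (rule someI_ex[OF ex[OF that]])
  have \<phi>: "\<phi> \<in> B \<rightarrow> carrier A" using s by blast
  have h: "free_ext R A \<phi> \<in> lmod_hom R (free_module R B) A" by (rule free_ext_hom[OF A \<phi>])
  show ?thesis
  proof (rule that[OF h])
    fix x assume x: "x \<in> carrier (free_module R B)"
    show "g (free_ext R A \<phi> x) = f x"
      by (rule free_hom_eqI[OF C lmod_hom_comp[OF h g(1)] f _ x])
        (simp add: free_ext_basis[OF A \<phi>] s)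
  qed
qed

lemma projective_free_module:
  fixes R :: "('r, 'y) ring_scheme" and B :: "'x set"
  assumes "ring R" shows "projective R (free_module R B)"
  unfolding projective_def
proof (intro conjI allI impI left_module_free_module[OF assms])
  fix A :: "('r, ('x \<Rightarrow> 'r) \<Rightarrow> 'r) module" and C :: "('r, 'x \<Rightarrow> 'r) module" and f g
  assume "left_module R A" "left_module R C" "g \<in> lmod_hom R A C" "g ` carrier A = carrier C"
    "f \<in> lmod_hom R (free_module R B) C"
  then show "\<exists>h \<in> lmod_hom R (free_module R B) A. \<forall>x \<in> carrier (free_module R B). g (h x) = f x"
    by (rule free_module_lift) blast
qed

lemma projective_lift:
  assumes P: "projective R P" and A: "left_module R A" and C: "left_module R C"
    and g: "g \<in> lmod_hom R A C" "g ` carrier A = carrier C" and f: "f \<in> lmod_hom R P C"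
  shows "\<exists>h \<in> lmod_hom R P A. \<forall>x \<in> carrier P. g (h x) = f x"
proof -
  interpret P: left_module R P using P by (simp add: projective_def)
  let ?F = "free_module R (carrier P)"
  have F: "left_module R ?F" by (rule left_module_free_module[OF P.R.ring_axioms])
  have p: "free_ext R P id \<in> lmod_hom R ?F P"
    by (rule free_ext_hom) (auto intro: P.left_module_axioms)
  have "x \<in> free_ext R P id ` carrier ?F" if "x \<in> carrier P" for x
    using free_ext_basis[OF P.left_module_axioms, of id "carrier P" x] that
      basis_elt_in[OF P.R.ring_axioms that] by (auto simp: image_iff intro!: bexI)
  then have surj: "free_ext R P id ` carrier ?F = carrier P" using lmod_homD(1)[OF p] by auto
  have i: "(\<lambda>x. x) \<in> lmod_hom R P P" by (auto simp: lmod_hom_def)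
  obtain s where s: "s \<in> lmod_hom R P ?F" "\<And>x. x \<in> carrier P \<Longrightarrow> free_ext R P id (s x) = x"
    using P F P.left_module_axioms p surj i unfolding projective_def by metis
  obtain h where h: "h \<in> lmod_hom R ?F A" "\<And>x. x \<in> carrier ?F \<Longrightarrow> g (h x) = f (free_ext R P id x)"
    using free_module_lift[OF A C g lmod_hom_comp[OF p f]] by metis
  show ?thesis
    by (rule bexI[OF _ lmod_hom_comp[OF s(1) h(1)]]) (use h(2) lmod_homD(1)[OF s(1)] s(2) in auto)
qed

lemma fin_gen_embeds:
  fixes N :: "('r, 'n) module"
  assumes N: "left_module R N" and fg: "fin_gen R N"
  shows "\<exists>\<phi> :: 'n \<Rightarrow> (nat \<Rightarrow> 'r) set. inj_on \<phi> (carrier N)"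
proof -
  interpret left_module R N by fact
  obtain G where G: "finite G" "G \<subseteq> carrier N"
    "\<And>H. submodule H R N \<Longrightarrow> G \<subseteq> H \<Longrightarrow> H = carrier N" using fg by (auto simp: fin_gen_def)
  obtain \<gamma> and n :: nat where \<gamma>: "\<gamma> ` {..<n} = G"
    using finite_imp_nat_seg_image_inj_on[OF G(1)] by (metis lessThan_def)
  let ?F = "free_module R {..<n}" and ?p = "free_ext R N \<gamma>"
  have \<gamma>': "\<gamma> \<in> {..<n} \<rightarrow> carrier N" using \<gamma> G(2) by auto
  have p: "?p \<in> lmod_hom R ?F N" by (rule free_ext_hom[OF N \<gamma>'])
  have "G \<subseteq> ?p ` carrier ?F"
  proof
    fix x assume "x \<in> G"
    then obtain b where b: "b \<in> {..<n}" "x = \<gamma> b" using \<gamma> by auto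
    have "x = ?p (basis_elt R b)" by (simp add: b free_ext_basis[OF N \<gamma>' b(1)])
    then show "x \<in> ?p ` carrier ?F" using basis_elt_in[OF R.ring_axioms b(1)] by blast
  qed
  then have surj: "?p ` carrier ?F = carrier N"
    using G(3) lmod_hom_image_submodule[OF p left_module_free_module[OF R.ring_axioms] N] by blast
  have "inj_on (\<lambda>x. {c \<in> carrier ?F. ?p c = x}) (carrier N)"
  proof (rule inj_onI)
    fix x y assume x: "x \<in> carrier N" and eq: "{c \<in> carrier ?F. ?p c = x} = {c \<in> carrier ?F. ?p c = y}"
    obtain c where "c \<in> carrier ?F" "?p c = x" using x surj by (metis imageE)
    then show "x = y" using eq by blast
  qed
  then show ?thesis by blast
qed


text \<open>\<open>cell_chain R l\<close> is the linear combination of cells encoded by \<open>l\<close>.\<close>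

definition cell_chain ::
  "('r, 'y) ring_scheme \<Rightarrow> (('r, 'n) cell \<times> 'r) list \<Rightarrow> ('r, 'n) cell \<Rightarrow> 'r" where
  "cell_chain R l = (\<lambda>c. case map_of l c of None \<Rightarrow> \<zero>\<^bsub>R\<^esub> | Some r \<Rightarrow> r)"

primrec cell_attach :: "('r, 'y) ring_scheme \<Rightarrow> ('r, 'n) cell \<Rightarrow> ('r, 'n) cell \<Rightarrow> 'r" where
  "cell_attach R (Syz l) = cell_chain R l"
| "cell_attach R (Gen x) = undefined"

primrec cell_gen :: "('r, 'n) cell \<Rightarrow> 'n" where
  "cell_gen (Gen x) = x"
| "cell_gen (Syz l) = undefined"

text \<open>The pair of the set of cells in degree \<open>n\<close> and the kernel of the map out of degree \<open>n\<close>.\<close>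

primrec cells ::
  "('r, 'y) ring_scheme \<Rightarrow> ('r, 'n) module \<Rightarrow> nat \<Rightarrow>
   ('r, 'n) cell set \<times> (('r, 'n) cell \<Rightarrow> 'r) set" where
  "cells R N 0 = (Gen ` carrier N,
     lmod_ker (free_module R (Gen ` carrier N)) N (free_ext R N cell_gen))"
| "cells R N (Suc n) = (let B = {Syz l | l. cell_chain R l \<in> snd (cells R N n)} in
     (B, lmod_ker (free_module R B) (free_module R (fst (cells R N n)))
           (free_ext R (free_module R (fst (cells R N n))) (cell_attach R))))"

lemma ex_cell_chain:
  fixes f :: "('r, 'n) cell \<Rightarrow> 'r"
  assumes "finite {c. f c \<noteq> \<zero>\<^bsub>R\<^esub>}"
  shows "\<exists>l. cell_chain R l = f"
proof -
  obtain xs where xs: "set xs = {c. f c \<noteq> \<zero>\<^bsub>R\<^esub>}" using finite_list[OF assms] by blast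
  have "cell_chain R (map (\<lambda>c. (c, f c)) xs) = f"
    using xs by (auto simp: cell_chain_def map_of_map_restrict restrict_map_def fun_eq_iff)
  then show ?thesis by blast
qed

lemma ex_projective_resolution:
  fixes N :: "('r, 'n) module"
  assumes N: "left_module R N"
  shows "\<exists>(P :: ('r, 'n) res_modules) d e. projective_resolution R N P d e"
proof -
  interpret left_module R N by fact
  define C where "C n = fst (cells R N n)" for n
  define Z where "Z n = snd (cells R N n)" for n
  define P :: "('r, 'n) res_modules" where "P n = free_module R (C n)" for n
  define d where "d n = free_ext R (P n) (cell_attach R)" for n
  define e :: "(('r, 'n) cell \<Rightarrow> 'r) \<Rightarrow> 'n" where "e = free_ext R N cell_gen"
  have C0: "C 0 = Gen ` carrier N" and Z0: "Z 0 = lmod_ker (P 0) N e"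
    by (simp_all add: C_def Z_def P_def e_def)
  have CS: "C (Suc n) = {Syz l | l. cell_chain R l \<in> Z n}" for n
    by (simp add: C_def Z_def Let_def)
  have ZS: "Z (Suc n) = lmod_ker (P (Suc n)) (P n) (d n)" for n
    by (simp add: C_def Z_def P_def d_def Let_def)
  have P: "left_module R (P n)" for n
    unfolding P_def by (rule left_module_free_module[OF R.ring_axioms])
  have Zsub: "Z n \<subseteq> carrier (P n)" for n
    by (cases n) (auto simp: Z0 ZS lmod_ker_def)
  have g: "cell_gen \<in> C 0 \<rightarrow> carrier N" by (auto simp: C0)
  have a: "cell_attach R \<in> C (Suc n) \<rightarrow> Z n" for n by (auto simp: CS)
  then have a': "cell_attach R \<in> C (Suc n) \<rightarrow> carrier (P n)" for n using Zsub by blast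
  have e: "e \<in> lmod_hom R (P 0) N" unfolding e_def P_def by (rule free_ext_hom[OF N g])
  have d: "d n \<in> lmod_hom R (P (Suc n)) (P n)" for n
    unfolding d_def P_def[of "Suc n"] by (rule free_ext_hom[OF P a'])
  have e_onto: "e ` carrier (P 0) = carrier N"
  proof
    show "carrier N \<subseteq> e ` carrier (P 0)"
    proof
      fix x assume "x \<in> carrier N"
      then have x: "Gen x \<in> C 0" by (simp add: C0)
      have "e (basis_elt R (Gen x)) = x" unfolding e_def using free_ext_basis[OF N g x] by simp
      then show "x \<in> e ` carrier (P 0)"
        using basis_elt_in[OF R.ring_axioms x] unfolding P_def by (metis imageI)
    qed
  qed (use lmod_homD(1)[OF e] in auto)
  have step: "p \<oplus>\<^bsub>P n\<^esub> r \<odot>\<^bsub>P n\<^esub> q \<in> lmod_ker (P n) L k"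
    if k: "k \<in> lmod_hom R (P n) L" and L: "left_module R L" and r: "r \<in> carrier R"
      and p: "p \<in> lmod_ker (P n) L k" and q: "q \<in> lmod_ker (P n) L k"
    for L :: "('r, 'l) module" and k n p q r
  proof -
    interpret L: left_module R L by fact
    interpret Pn: left_module R "P n" by (rule P)
    have pc: "p \<in> carrier (P n)" "k p = \<zero>\<^bsub>L\<^esub>" and qc: "q \<in> carrier (P n)" "k q = \<zero>\<^bsub>L\<^esub>"
      using p q by (auto simp: lmod_ker_def)
    have rq: "r \<odot>\<^bsub>P n\<^esub> q \<in> carrier (P n)" using r qc(1) by simp
    have "k (p \<oplus>\<^bsub>P n\<^esub> r \<odot>\<^bsub>P n\<^esub> q) = \<zero>\<^bsub>L\<^esub>"
      unfolding lmod_homD(2)[OF k pc(1) rq] lmod_homD(3)[OF k r qc(1)] pc(2) qc(2) using r by simp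
    then show ?thesis unfolding lmod_ker_def using pc(1) rq by simp
  qed
  have Zstep: "p \<oplus>\<^bsub>P n\<^esub> r \<odot>\<^bsub>P n\<^esub> q \<in> Z n" if "p \<in> Z n" "q \<in> Z n" "r \<in> carrier R" for n p q r
    using that step[OF e N] step[OF d P] by (cases n) (simp_all only: Z0 ZS)
  have Z_zero: "(\<lambda>x. \<zero>\<^bsub>R\<^esub>) \<in> Z n" for n
  proof (cases n)
    case 0
    interpret P0: left_module R "P 0" by (rule P)
    have "(\<lambda>x. \<zero>\<^bsub>R\<^esub>) = \<zero>\<^bsub>P 0\<^esub>" by (simp add: P_def)
    then show ?thesis unfolding 0 Z0 lmod_ker_def using lmod_hom_zero[OF e P N] by simp
  next
    case (Suc m)
    interpret Pn: left_module R "P (Suc m)" by (rule P)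
    have "(\<lambda>x. \<zero>\<^bsub>R\<^esub>) = \<zero>\<^bsub>P (Suc m)\<^esub>" by (simp add: P_def)
    then show ?thesis unfolding Suc ZS lmod_ker_def using lmod_hom_zero[OF d P P] by simp
  qed
  have d_onto: "d n ` carrier (P (Suc n)) = Z n" for n
  proof
    show "d n ` carrier (P (Suc n)) \<subseteq> Z n"
    proof (rule image_subsetI)
      fix f assume "f \<in> carrier (P (Suc n))"
      then have f: "f \<in> carrier (free_module R (C (Suc n)))" by (simp add: P_def)
      interpret PS: left_module R "P (Suc n)" by (rule P)
      show "d n f \<in> Z n"
      proof (rule free_module_induct[OF R.ring_axioms f])
        have "d n (\<lambda>x. \<zero>\<^bsub>R\<^esub>) = (\<lambda>x. \<zero>\<^bsub>R\<^esub>)" using lmod_hom_zero[OF d P P, of n] by (simp add: P_def)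
        then show "d n (\<lambda>x. \<zero>\<^bsub>R\<^esub>) \<in> Z n" using Z_zero by simp
      next
        fix f b r assume f: "f \<in> carrier (free_module R (C (Suc n)))" "d n f \<in> Z n"
          and b: "b \<in> C (Suc n)" and r: "r \<in> carrier R"
        have be: "basis_elt R b \<in> carrier (P (Suc n))"
          unfolding P_def by (rule basis_elt_in[OF R.ring_axioms b])
        have db: "d n (basis_elt R b) \<in> Z n"
          unfolding d_def using free_ext_basis[OF P a' b] a b by auto
        have rb: "r \<odot>\<^bsub>P (Suc n)\<^esub> basis_elt R b \<in> carrier (P (Suc n))" using r be by simp
        have fP: "f \<in> carrier (P (Suc n))" using f(1) by (simp add: P_def)
        have "d n (f \<oplus>\<^bsub>P (Suc n)\<^esub> r \<odot>\<^bsub>P (Suc n)\<^esub> basis_elt R b) \<in> Z n"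
          unfolding lmod_homD(2)[OF d fP rb] lmod_homD(3)[OF d r be]
          by (rule Zstep[OF f(2) db r])
        then show "d n (f \<oplus>\<^bsub>free_module R (C (Suc n))\<^esub>
            r \<odot>\<^bsub>free_module R (C (Suc n))\<^esub> basis_elt R b) \<in> Z n"
          by (simp add: P_def)
      qed
    qed
    show "Z n \<subseteq> d n ` carrier (P (Suc n))"
    proof
      fix f assume f: "f \<in> Z n"
      have "finite {c. f c \<noteq> \<zero>\<^bsub>R\<^esub>}"
        using f Zsub[of n] free_module_carrierD(3)[OF _ R.ring_axioms] unfolding P_def by blast
      then obtain l where l: "cell_chain R l = f" using ex_cell_chain by blast
      then have b: "Syz l \<in> C (Suc n)" using f by (auto simp: CS)
      have "d n (basis_elt R (Syz l)) = f"
        unfolding d_def using free_ext_basis[OF P a' b] l by simp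
      then show "f \<in> d n ` carrier (P (Suc n))"
        using basis_elt_in[OF R.ring_axioms b] unfolding P_def by (metis imageI)
    qed
  qed
  have pr: "projective R (P n)" for n
    unfolding P_def by (rule projective_free_module[OF R.ring_axioms])
  have "projective_resolution R N P d e"
    unfolding projective_resolution_def
    using N e d e_onto d_onto pr Z0 ZS
    by simp
  then show ?thesis by blast
qed

lemma ring_epi_cancel:
  fixes T :: "('t, 'v) ring_scheme"
  assumes epi: "ring_epi R S lam" and S: "ring S" and T: "ring T"
    and f: "f \<in> ring_hom S T" and g: "g \<in> ring_hom S T"
    and eq: "\<And>r. r \<in> carrier R \<Longrightarrow> f (lam r) = g (lam r)"
    and s: "s \<in> carrier S"
  shows "f s = g s"
proof -
  interpret S: ring S by fact
  interpret T: ring T by fact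
  define K where "K = Inl ` carrier S \<union> Inr ` carrier S"
  define v where "v c = (case c of Inl x \<Rightarrow> f x | Inr x \<Rightarrow> g x)" for c
  define word where "word w = foldr (\<lambda>c t. v c \<otimes>\<^bsub>T\<^esub> t) w \<one>\<^bsub>T\<^esub>" for w
  define ev where "ev ws = foldr (\<lambda>w t. word w \<oplus>\<^bsub>T\<^esub> t) ws \<zero>\<^bsub>T\<^esub>" for ws
  define L where "L = lists (lists K)"
  have v: "v c \<in> carrier T" if "c \<in> K" for c
    using that ring_hom_memE(1)[OF f] ring_hom_memE(1)[OF g] by (auto simp: v_def K_def)
  have word: "word w \<in> carrier T" if "w \<in> lists K" for w
    using that by (induction w) (auto simp: word_def v)
  have ev: "ev ws \<in> carrier T" if "ws \<in> L" for ws
    using that unfolding L_def by (induction ws) (auto simp: ev_def word)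
  have word_app: "word (w @ u) = word w \<otimes>\<^bsub>T\<^esub> word u"
    if "w \<in> lists K" "u \<in> lists K"
    for w u
    using that(1)
  proof (induction w)
    case (Cons c w)
    then show ?case using v[of c] word[of w] word[OF that(2)] by (simp add: word_def T.m_assoc)
  qed (use word[OF that(2)] in \<open>simp add: word_def\<close>)
  have ev_app: "ev (ws @ us) = ev ws \<oplus>\<^bsub>T\<^esub> ev us" if "ws \<in> L" "us \<in> L" for ws us
    using that(1) unfolding L_def
  proof (induction ws)
    case (Cons w ws)
    then show ?case
      using word[of w] ev[of ws] ev[OF that(2)] by (simp add: ev_def L_def T.a_assoc)
  qed (use ev[OF that(2)] in \<open>simp add: ev_def\<close>)
  have ev_map: "\<exists>xs \<in> L. ev xs = word w \<otimes>\<^bsub>T\<^esub> ev us"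
    if w: "w \<in> lists K" and us: "us \<in> L" for w us
  proof
    show "map ((@) w) us \<in> L" using w us unfolding L_def by (induction us) auto
    show "ev (map ((@) w) us) = word w \<otimes>\<^bsub>T\<^esub> ev us"
      using us unfolding L_def
    proof (induction us)
      case (Cons u us)
      then show ?case
        using word[OF w] word[of u] ev[of us] word_app[OF w, of u]
        by (simp add: ev_def L_def T.r_distr)
    qed (use word[OF w] in \<open>simp add: ev_def\<close>)
  qed
  have ev_mult: "\<exists>xs \<in> L. ev xs = ev ws \<otimes>\<^bsub>T\<^esub> ev us" if ws: "ws \<in> L" and us: "us \<in> L" for ws us
    using ws unfolding L_def
  proof (induction ws)
    case Nil
    show ?case using ev[OF us] by (intro bexI[of _ "[]"]) (auto simp: ev_def)
  next
    case (Cons w ws)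
    obtain xs where xs: "xs \<in> L" "ev xs = ev ws \<otimes>\<^bsub>T\<^esub> ev us" using Cons by (auto simp: L_def)
    obtain ys where ys: "ys \<in> L" "ev ys = word w \<otimes>\<^bsub>T\<^esub> ev us" using ev_map[OF _ us, of w] Cons by auto
    have "ev (ys @ xs) = ev (w # ws) \<otimes>\<^bsub>T\<^esub> ev us"
      using ev_app[OF ys(1) xs(1)] xs ys word[of w] ev[of ws] ev[OF us] Cons
      by (simp add: ev_def L_def T.l_distr)
    then show ?case using xs ys by (intro bexI[of _ "ys @ xs"]) (auto simp: L_def)
  qed
  define U where "U = ev ` L"
  have fU: "f x \<in> U" and gU: "g x \<in> U" if "x \<in> carrier S" for x
  proof -
    have "[[Inl x]] \<in> L" "[[Inr x]] \<in> L" using that by (auto simp: L_def K_def)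
    moreover have "ev [[Inl x]] = f x" "ev [[Inr x]] = g x"
      using ring_hom_memE(1)[OF f that] ring_hom_memE(1)[OF g that]
      by (simp_all add: ev_def word_def v_def)
    ultimately show "f x \<in> U" "g x \<in> U" unfolding U_def by (metis imageI)+
  qed
  have U_mult: "x \<otimes>\<^bsub>T\<^esub> y \<in> U" if "x \<in> U" "y \<in> U" for x y
  proof -
    obtain ws us where "ws \<in> L" "us \<in> L" "x = ev ws" "y = ev us" using \<open>x \<in> U\<close> \<open>y \<in> U\<close> by (auto simp: U_def)
    then show ?thesis using ev_mult[of ws us] unfolding U_def by (metis imageI)
  qed
  have U_add: "x \<oplus>\<^bsub>T\<^esub> y \<in> U" if "x \<in> U" "y \<in> U" for x y
  proof -
    obtain ws us where "ws \<in> L" "us \<in> L" "x = ev ws" "y = ev us" using \<open>x \<in> U\<close> \<open>y \<in> U\<close> by (auto simp: U_def)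
    moreover from this have "ws @ us \<in> L" by (auto simp: L_def)
    ultimately show ?thesis using ev_app[of ws us] unfolding U_def by (metis imageI)
  qed
  have U_sub: "U \<subseteq> carrier T" using ev by (auto simp: U_def)
  have U1: "\<one>\<^bsub>T\<^esub> \<in> U" using fU[of "\<one>\<^bsub>S\<^esub>"] ring_hom_memE(4)[OF f] by simp
  have m1: "\<ominus>\<^bsub>T\<^esub> \<one>\<^bsub>T\<^esub> = f (\<ominus>\<^bsub>S\<^esub> \<one>\<^bsub>S\<^esub>)"
  proof -
    have z: "f \<zero>\<^bsub>S\<^esub> = \<zero>\<^bsub>T\<^esub>" using ring_hom_zero[OF f S T] .
    have "f (\<ominus>\<^bsub>S\<^esub> \<one>\<^bsub>S\<^esub>) \<oplus>\<^bsub>T\<^esub> \<one>\<^bsub>T\<^esub> = \<zero>\<^bsub>T\<^esub>"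
      using ring_hom_memE(3)[OF f, of "\<ominus>\<^bsub>S\<^esub> \<one>\<^bsub>S\<^esub>" "\<one>\<^bsub>S\<^esub>"] ring_hom_memE(4)[OF f] z
      by (simp add: S.l_neg)
    then show ?thesis using ring_hom_memE(1)[OF f] T.minus_equality by simp
  qed
  have U_minus: "\<ominus>\<^bsub>T\<^esub> x \<in> U" if "x \<in> U" for x
  proof -
    have "\<ominus>\<^bsub>T\<^esub> x = (\<ominus>\<^bsub>T\<^esub> \<one>\<^bsub>T\<^esub>) \<otimes>\<^bsub>T\<^esub> x" using that U_sub by (auto simp: T.l_minus)
    then show ?thesis using U_mult[OF fU[of "\<ominus>\<^bsub>S\<^esub> \<one>\<^bsub>S\<^esub>"] that] m1 by simp
  qed
  have "subring U T" by (rule T.subringI[OF U_sub U1 U_minus U_mult U_add])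
  then have TU: "ring (T\<lparr>carrier := U\<rparr>)" by (rule T.subring_is_ring)
  define q where "q x = (SOME ws. ev ws = x)" for x
  have q: "ev (q x) = x" if "x \<in> U" for x
    unfolding q_def by (rule someI_ex) (use that in \<open>auto simp: U_def\<close>)
  have q_inj: "inj_on q (carrier (T\<lparr>carrier := U\<rparr>))" by (rule inj_onI) (use q in \<open>simp, metis\<close>)
  let ?T = "image_ring q (T\<lparr>carrier := U\<rparr>)"
  have T': "ring ?T" by (rule ring.inj_imp_image_ring_is_ring[OF TU q_inj])
  have qh: "q \<in> ring_hom (T\<lparr>carrier := U\<rparr>) ?T"
    using inj_imp_image_ring_iso[OF q_inj] by (simp add: ring_iso_def)
  have fh: "f \<in> ring_hom S (T\<lparr>carrier := U\<rparr>)" and gh: "g \<in> ring_hom S (T\<lparr>carrier := U\<rparr>)"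
    using f g fU gU by (auto simp: ring_hom_def)
  have "(q \<circ> f) s = (q \<circ> g) s"
    using epi[unfolded ring_epi_def, THEN conjunct2, rule_format,
        OF T' ring_hom_trans[OF fh qh] ring_hom_trans[OF gh qh] _ s] eq
    by simp
  then show ?thesis using q fU gU s by (metis comp_apply)
qed


lemma left_module_regular_module:
  assumes "ring S" shows "left_module S (regular_module S)"
proof -
  interpret ring S by fact
  have "abelian_group (regular_module S)"
  proof (rule abelian_groupI)
    fix x assume "x \<in> carrier (regular_module S)"
    then show "\<exists>y\<in>carrier (regular_module S).
        y \<oplus>\<^bsub>regular_module S\<^esub> x = \<zero>\<^bsub>regular_module S\<^esub>"
      using l_neg[of x] a_inv_closed[of x] by (auto simp: regular_module_def)
  qed (auto simp: regular_module_def add.m_ac)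
  then show ?thesis
    by (intro left_module.intro assms left_module_axioms.intro)
      (simp_all add: regular_module_def l_distr r_distr m_assoc)
qed

lemma left_module_restrict_scalars:
  assumes M: "left_module S M" and R: "ring R" and lam: "lam \<in> ring_hom R S"
  shows "left_module R (restrict_scalars lam M)"
proof -
  interpret left_module S M by fact
  note h = ring_hom_memE[OF lam]
  have "abelian_group (restrict_scalars lam M)"
  proof (rule abelian_groupI)
    fix x assume "x \<in> carrier (restrict_scalars lam M)"
    then show "\<exists>y\<in>carrier (restrict_scalars lam M).
        y \<oplus>\<^bsub>restrict_scalars lam M\<^esub> x = \<zero>\<^bsub>restrict_scalars lam M\<^esub>"
      using M.l_neg[of x] M.a_inv_closed[of x] by (auto simp: restrict_scalars_def)
  qed (auto simp: restrict_scalars_def M.add.m_ac)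
  then show ?thesis
    by (intro left_module.intro R left_module_axioms.intro)
      (simp_all add: restrict_scalars_def h smult_l_distr smult_r_distr smult_assoc1)
qed

lemma bimodule_restrict_bimodule:
  assumes M: "bimodule S M" and R: "ring R" and lam: "lam \<in> ring_hom R S"
  shows "bimodule R (restrict_bimodule lam M)"
proof -
  interpret bimodule S M by fact
  note h = ring_hom_memE[OF lam]
  have ag: "abelian_group (restrict_bimodule lam M)"
  proof (rule abelian_groupI)
    fix x assume "x \<in> carrier (restrict_bimodule lam M)"
    then show "\<exists>y\<in>carrier (restrict_bimodule lam M).
        y \<oplus>\<^bsub>restrict_bimodule lam M\<^esub> x = \<zero>\<^bsub>restrict_bimodule lam M\<^esub>"
      using M.l_neg[of x] M.a_inv_closed[of x] by (auto simp: restrict_bimodule_def)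
  qed (auto simp: restrict_bimodule_def M.add.m_ac)
  show ?thesis
    by (intro bimodule.intro left_module.intro ag R left_module_axioms.intro bimodule_axioms.intro)
      (simp_all add: restrict_bimodule_def h smult_l_distr smult_r_distr smult_assoc1
        ract_closed ract_l_distr ract_r_distr ract_assoc ract_one smult_ract_assoc)
qed

lemma ring_trivial_extension:
  assumes "bimodule A M" shows "ring (A \<ltimes> M)"
proof -
  interpret bimodule A M by fact
  have ract0: "ract M \<zero>\<^bsub>M\<^esub> a = \<zero>\<^bsub>M\<^esub>" if "a \<in> carrier A" for a
    using ract_l_distr[of "\<zero>\<^bsub>M\<^esub>" "\<zero>\<^bsub>M\<^esub>" a] ract_closed[of "\<zero>\<^bsub>M\<^esub>" a] that
    by (metis M.add.l_cancel_one' M.r_zero M.zero_closed)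
  have ag: "abelian_group (A \<ltimes> M)"
  proof (rule abelian_groupI)
    fix x assume x: "x \<in> carrier (A \<ltimes> M)"
    show "\<exists>y\<in>carrier (A \<ltimes> M). y \<oplus>\<^bsub>A \<ltimes> M\<^esub> x = \<zero>\<^bsub>A \<ltimes> M\<^esub>"
      by (rule bexI[of _ "(\<ominus>\<^bsub>A\<^esub> fst x, \<ominus>\<^bsub>M\<^esub> snd x)"])
        (use x in \<open>auto simp: trivial_extension_def R.l_neg M.l_neg\<close>)
  qed (auto simp: trivial_extension_def R.add.m_ac M.add.m_ac)
  have mo: "monoid (A \<ltimes> M)"
    by (rule monoidI)
      (auto simp: trivial_extension_def R.m_assoc ract_closed ract_one ract0 smult_r_distr
        ract_l_distr smult_assoc1 ract_assoc smult_ract_assoc M.a_assoc)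
  show ?thesis
    by (rule ringI[OF ag mo])
      (auto simp: trivial_extension_def R.l_distr R.r_distr smult_l_distr smult_r_distr
        ract_l_distr ract_r_distr ract_closed M.add.m_ac M.a_assoc)
qed

end

theory Submission
  imports Defs Complex_Main
begin

text \<open>
  Let \<open>E\<close> be the left \<open>S\<close>-module of homomorphisms from \<open>M\<close> to the multiplicative group of complex
  numbers. Characters separate points, so the adjunction between \<open>\<otimes>\<close> and Hom turns the vanishing of
  \<open>Tor\<^sub>i\<close> over \<open>R\<close> into \<open>Ext\<^sub>R\<^sup>i(S, E) = 0\<close> for \<open>i > 0\<close>, and \<open>Hom\<^sub>R(S, E) = E\<close> since \<open>\<lambda>\<close> is an epimorphism.
  Hence \<open>Ext\<^sub>S\<^sup>i(N, E) = Ext\<^sub>R\<^sup>i(N, E)\<close>. If \<open>F\<close> is a finite resolution of \<open>N\<close> by free \<open>S\<close>-modules of finite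
  rank, then \<open>N\<close> has a finite resolution over \<open>R\<close> as well, so this group vanishes for \<open>i > fpd R\<close>, and
  by duality \<open>(S \<ltimes> M) \<otimes> F\<close> is exact in degrees above \<open>fpd R\<close>. It splits \<open>fpd (S \<ltimes> M)\<close> degrees further up,
  and so does \<open>F\<close> by base change to \<open>S\<close>. This gives \<open>fpd S \<le> fpd R + fpd (S \<ltimes> M)\<close>.

  The map \<open>R \<ltimes> M \<rightarrow> S \<ltimes> M\<close> and \<open>E\<close>, as a module over \<open>S \<ltimes> M\<close>, have the same two properties. If \<open>F\<close> is a
  finite complex of free \<open>S \<ltimes> M\<close>-modules, exact in positive degrees, then duality shows that \<open>S \<otimes> F\<close> is
  exact in degrees above \<open>fpd (R \<ltimes> M) + 1\<close>, so that it splits \<open>fpd S\<close> degrees further up. A splitting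
  lifts along the nilpotent ideal \<open>M\<close>, degree by degree from the top.
\<close>

section \<open>Constructions with modules\<close>

text \<open>Characters work because the multiplicative group of the complex numbers is divisible:
  characters extend from subgroups, and roots of unity let them separate points. A free complex over
  \<open>S \<ltimes> M\<close> is an extension of its reduction F modulo M by M tensor F. The
  connecting map from the homology of F to that of M tensor F lowers the degree by one, whence the
  summand 1 in the bound for \<open>fpd (S \<ltimes> M)\<close>. The pair
  \<open>R \<ltimes> M\<close>, \<open>S \<ltimes> M\<close> inherits both properties since a free
  resolution of S over R, base changed to \<open>R \<ltimes> M\<close>, is an extension of that
  resolution by a complex whose only homology is M tensor S over R, which is M; so it resolves
  \<open>S \<ltimes> M\<close>.

  A formal obstacle shapes the whole: \<open>fpd\<close> and \<open>projdim\<close> range over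
  modules in fixed types, while cones and complements change the type. Bounds on projective
  dimension are therefore expressed by the equation d h d = d for a single differential
  (\<open>lmod_regular\<close>), which does not mention the resolved module, passes through base
  change and can be compared across types.\<close>

lemma surjE:
  assumes "f ` A = B" "y \<in> B"
  obtains x where "x \<in> A" "f x = y"
  using assms by blast

section \<open>Subtraction in abelian groups\<close>

context abelian_group
begin

lemma add_diff_cancel: "\<lbrakk>x \<in> carrier G; y \<in> carrier G\<rbrakk> \<Longrightarrow> y \<oplus> (x \<ominus> y) = x"
  by (simp add: a_minus_def a_lcomm[of y x] r_neg)

lemma diff_add_cancel': "\<lbrakk>x \<in> carrier G; y \<in> carrier G\<rbrakk> \<Longrightarrow> (x \<ominus> y) \<oplus> y = x"
  using add_diff_cancel[of x y] by (simp add: a_comm[of "x \<ominus> y" y])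

lemma add_diff_cancel_left': "\<lbrakk>x \<in> carrier G; y \<in> carrier G\<rbrakk> \<Longrightarrow> (x \<oplus> y) \<ominus> x = y"
  by (simp add: a_minus_def a_comm[of x y] a_assoc r_neg)

lemma diff_self: "x \<in> carrier G \<Longrightarrow> x \<ominus> x = \<zero>"
  by (simp add: a_minus_def r_neg)

lemma diff_eq_zeroD: "\<lbrakk>x \<in> carrier G; y \<in> carrier G; x \<ominus> y = \<zero>\<rbrakk> \<Longrightarrow> x = y"
  using add_diff_cancel[of x y] by simp

lemma diff_zero: "x \<in> carrier G \<Longrightarrow> x \<ominus> \<zero> = x"
  by (simp add: a_minus_def)

lemma zero_minus: "\<ominus> \<zero> = \<zero>"
  using add.inv_one by (simp add: a_inv_def)

lemma diff_trans: "\<lbrakk>x \<in> carrier G; y \<in> carrier G; z \<in> carrier G\<rbrakk> \<Longrightarrow> (x \<ominus> y) \<oplus> (y \<ominus> z) = x \<ominus> z"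
  by (simp add: a_minus_def a_assoc r_neg1)

lemma minus_diff: "\<lbrakk>x \<in> carrier G; y \<in> carrier G\<rbrakk> \<Longrightarrow> \<ominus> (x \<ominus> y) = y \<ominus> x"
  by (simp add: a_minus_def minus_add a_comm)

end

section \<open>Homomorphisms, submodules and transported modules\<close>

lemma lmod_homI:
  assumes "\<And>x. x \<in> carrier M \<Longrightarrow> f x \<in> carrier N"
    and "\<And>x y. x \<in> carrier M \<Longrightarrow> y \<in> carrier M \<Longrightarrow> f (x \<oplus>\<^bsub>M\<^esub> y) = f x \<oplus>\<^bsub>N\<^esub> f y"
    and "\<And>a x. a \<in> carrier R \<Longrightarrow> x \<in> carrier M \<Longrightarrow> f (a \<odot>\<^bsub>M\<^esub> x) = a \<odot>\<^bsub>N\<^esub> f x"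
  shows "f \<in> lmod_hom R M N"
  using assms by (auto simp: lmod_hom_def)

text \<open>Negatives are produced as (-1) x; the condition \<open>zs\<close> on the scalar zero is
  what makes (-1) x an additive inverse.\<close>

lemma left_moduleI:
  fixes M :: "('r, 'm, 'x) module_scheme"
  assumes R: "ring R" and zero: "\<zero>\<^bsub>M\<^esub> \<in> carrier M"
    and closed: "\<And>x y. x \<in> carrier M \<Longrightarrow> y \<in> carrier M \<Longrightarrow> x \<oplus>\<^bsub>M\<^esub> y \<in> carrier M"
    and assoc: "\<And>x y z. x \<in> carrier M \<Longrightarrow> y \<in> carrier M \<Longrightarrow> z \<in> carrier M \<Longrightarrow>
      x \<oplus>\<^bsub>M\<^esub> y \<oplus>\<^bsub>M\<^esub> z = x \<oplus>\<^bsub>M\<^esub> (y \<oplus>\<^bsub>M\<^esub> z)"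
    and comm: "\<And>x y. x \<in> carrier M \<Longrightarrow> y \<in> carrier M \<Longrightarrow> x \<oplus>\<^bsub>M\<^esub> y = y \<oplus>\<^bsub>M\<^esub> x"
    and lz: "\<And>x. x \<in> carrier M \<Longrightarrow> \<zero>\<^bsub>M\<^esub> \<oplus>\<^bsub>M\<^esub> x = x"
    and sc: "\<And>a x. a \<in> carrier R \<Longrightarrow> x \<in> carrier M \<Longrightarrow> a \<odot>\<^bsub>M\<^esub> x \<in> carrier M"
    and ld: "\<And>a b x. a \<in> carrier R \<Longrightarrow> b \<in> carrier R \<Longrightarrow> x \<in> carrier M \<Longrightarrow>
        (a \<oplus>\<^bsub>R\<^esub> b) \<odot>\<^bsub>M\<^esub> x = a \<odot>\<^bsub>M\<^esub> x \<oplus>\<^bsub>M\<^esub> b \<odot>\<^bsub>M\<^esub> x"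
    and rd: "\<And>a x y. a \<in> carrier R \<Longrightarrow> x \<in> carrier M \<Longrightarrow> y \<in> carrier M \<Longrightarrow>
        a \<odot>\<^bsub>M\<^esub> (x \<oplus>\<^bsub>M\<^esub> y) = a \<odot>\<^bsub>M\<^esub> x \<oplus>\<^bsub>M\<^esub> a \<odot>\<^bsub>M\<^esub> y"
    and as: "\<And>a b x. a \<in> carrier R \<Longrightarrow> b \<in> carrier R \<Longrightarrow> x \<in> carrier M \<Longrightarrow>
        (a \<otimes>\<^bsub>R\<^esub> b) \<odot>\<^bsub>M\<^esub> x = a \<odot>\<^bsub>M\<^esub> (b \<odot>\<^bsub>M\<^esub> x)"
    and one: "\<And>x. x \<in> carrier M \<Longrightarrow> \<one>\<^bsub>R\<^esub> \<odot>\<^bsub>M\<^esub> x = x"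
    and zs: "\<And>x. x \<in> carrier M \<Longrightarrow> \<zero>\<^bsub>R\<^esub> \<odot>\<^bsub>M\<^esub> x = \<zero>\<^bsub>M\<^esub>"
  shows "left_module R M"
proof -
  interpret R: ring R by fact
  have "abelian_group M"
  proof (rule abelian_groupI)
    fix x assume x: "x \<in> carrier M"
    have "(\<ominus>\<^bsub>R\<^esub> \<one>\<^bsub>R\<^esub>) \<odot>\<^bsub>M\<^esub> x \<oplus>\<^bsub>M\<^esub> x = (\<ominus>\<^bsub>R\<^esub> \<one>\<^bsub>R\<^esub> \<oplus>\<^bsub>R\<^esub> \<one>\<^bsub>R\<^esub>) \<odot>\<^bsub>M\<^esub> x"
      using ld[of "\<ominus>\<^bsub>R\<^esub> \<one>\<^bsub>R\<^esub>" "\<one>\<^bsub>R\<^esub>" x] one[OF x] x by simp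
    also have "\<dots> = \<zero>\<^bsub>M\<^esub>" using zs[OF x] by (simp add: R.l_neg)
    finally show "\<exists>y\<in>carrier M. y \<oplus>\<^bsub>M\<^esub> x = \<zero>\<^bsub>M\<^esub>" using sc[of "\<ominus>\<^bsub>R\<^esub> \<one>\<^bsub>R\<^esub>" x] x by auto
  qed (use assms in auto)
  then show ?thesis
    using assms by (intro left_module.intro left_module_axioms.intro) auto
qed

lemma submoduleI:
  assumes N: "left_module R N" and sub: "C \<subseteq> carrier N" and zero: "\<zero>\<^bsub>N\<^esub> \<in> C"
    and add: "\<And>x y. x \<in> C \<Longrightarrow> y \<in> C \<Longrightarrow> x \<oplus>\<^bsub>N\<^esub> y \<in> C"
    and smult: "\<And>a x. a \<in> carrier R \<Longrightarrow> x \<in> C \<Longrightarrow> a \<odot>\<^bsub>N\<^esub> x \<in> C"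
  shows "submodule C R N"
proof -
  interpret left_module R N by fact
  have "\<ominus>\<^bsub>N\<^esub> x \<in> C" if "x \<in> C" for x
  proof -
    have x: "x \<in> carrier N" using that sub by auto
    have "(\<ominus>\<^bsub>R\<^esub> \<one>\<^bsub>R\<^esub>) \<odot>\<^bsub>N\<^esub> x \<oplus>\<^bsub>N\<^esub> x = (\<ominus>\<^bsub>R\<^esub> \<one>\<^bsub>R\<^esub> \<oplus>\<^bsub>R\<^esub> \<one>\<^bsub>R\<^esub>) \<odot>\<^bsub>N\<^esub> x"
      using smult_l_distr[of "\<ominus>\<^bsub>R\<^esub> \<one>\<^bsub>R\<^esub>" "\<one>\<^bsub>R\<^esub>" x] x by simp
    also have "\<dots> = \<zero>\<^bsub>N\<^esub>" using x by (simp add: R.l_neg)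
    finally have "\<ominus>\<^bsub>N\<^esub> x = (\<ominus>\<^bsub>R\<^esub> \<one>\<^bsub>R\<^esub>) \<odot>\<^bsub>N\<^esub> x" using x by (intro M.minus_equality) auto
    then show ?thesis using smult that by simp
  qed
  then show ?thesis
    using assms by (intro submodule.intro subgroup.intro submodule_axioms.intro)
      (auto simp: a_inv_def[symmetric])
qed

lemma submoduleD:
  assumes C: "submodule C R N"
  shows "C \<subseteq> carrier N" "\<zero>\<^bsub>N\<^esub> \<in> C" "x \<in> C \<Longrightarrow> y \<in> C \<Longrightarrow> x \<oplus>\<^bsub>N\<^esub> y \<in> C"
    "a \<in> carrier R \<Longrightarrow> x \<in> C \<Longrightarrow> a \<odot>\<^bsub>N\<^esub> x \<in> C" "x \<in> C \<Longrightarrow> \<ominus>\<^bsub>N\<^esub> x \<in> C"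
proof -
  interpret submodule C R N by fact
  show "C \<subseteq> carrier N" "\<zero>\<^bsub>N\<^esub> \<in> C" "x \<in> C \<Longrightarrow> y \<in> C \<Longrightarrow> x \<oplus>\<^bsub>N\<^esub> y \<in> C"
    "a \<in> carrier R \<Longrightarrow> x \<in> C \<Longrightarrow> a \<odot>\<^bsub>N\<^esub> x \<in> C" "x \<in> C \<Longrightarrow> \<ominus>\<^bsub>N\<^esub> x \<in> C"
    using subset one_closed m_closed smult_closed m_inv_closed by (auto simp: a_inv_def)
qed

abbreviation submod :: "('r, 'm) module \<Rightarrow> 'm set \<Rightarrow> ('r, 'm) module" where
  "submod N C \<equiv> N\<lparr>carrier := C\<rparr>"

lemma left_module_submod:
  assumes N: "left_module R N" and C: "submodule C R N"
  shows "left_module R (submod N C)"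
proof -
  interpret left_module R N by fact
  note c = submoduleD[OF C]
  have [simp]: "x \<in> C \<Longrightarrow> x \<in> carrier N" for x using c(1) by auto
  show ?thesis
    by (rule left_moduleI[OF R.ring_axioms])
      (auto simp: c M.a_assoc smult_l_distr smult_r_distr smult_assoc1 intro: M.a_comm)
qed

lemma submodule_lmod_ker:
  assumes f: "f \<in> lmod_hom R M N" and M: "left_module R M" and N: "left_module R N"
  shows "submodule (lmod_ker M N f) R M"
proof -
  interpret M: left_module R M by fact
  interpret N: left_module R N by fact
  show ?thesis
    by (rule submoduleI[OF M]) (auto simp: lmod_ker_def lmod_homD[OF f] lmod_hom_zero[OF f M N])
qed

lemma lmod_hom_submod_iff:
  assumes "C \<subseteq> carrier N"
  shows "f \<in> lmod_hom R M (submod N C) \<longleftrightarrow> f \<in> lmod_hom R M N \<and> f ` carrier M \<subseteq> C"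
  using assms by (auto simp: lmod_hom_def Pi_iff)

lemma lmod_hom_restrict:
  assumes "C \<subseteq> carrier M" "f \<in> lmod_hom R M N"
  shows "f \<in> lmod_hom R (submod M C) N"
proof -
  have "x \<in> carrier M" if "x \<in> C" for x using that assms(1) by blast
  then show ?thesis by (intro lmod_homI) (simp_all add: lmod_homD[OF assms(2)])
qed

lemma lmod_hom_id: "(\<lambda>x. x) \<in> lmod_hom R M M"
  by (auto simp: lmod_hom_def)

lemma lmod_hom_const_zero: "left_module R N \<Longrightarrow> (\<lambda>x. \<zero>\<^bsub>N\<^esub>) \<in> lmod_hom R M N"
proof -
  assume "left_module R N"
  then interpret left_module R N .
  show ?thesis by (rule lmod_homI) auto
qed

lemma lmod_hom_add:
  assumes N: "left_module R N" and f: "f \<in> lmod_hom R M N" and g: "g \<in> lmod_hom R M N"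
  shows "(\<lambda>x. f x \<oplus>\<^bsub>N\<^esub> g x) \<in> lmod_hom R M N"
proof -
  interpret left_module R N by fact
  show ?thesis
    by (rule lmod_homI)
      (simp_all add: lmod_homD[OF f] lmod_homD[OF g] smult_r_distr M.add.m_ac)
qed

lemma lmod_hom_uminus:
  assumes N: "left_module R N" and f: "f \<in> lmod_hom R M N"
  shows "(\<lambda>x. \<ominus>\<^bsub>N\<^esub> f x) \<in> lmod_hom R M N"
proof -
  interpret left_module R N by fact
  show ?thesis
    by (rule lmod_homI) (simp_all add: lmod_homD[OF f] smult_r_minus M.minus_add)
qed

lemma lmod_hom_diff:
  assumes N: "left_module R N" and f: "f \<in> lmod_hom R M N" and g: "g \<in> lmod_hom R M N"
  shows "(\<lambda>x. f x \<ominus>\<^bsub>N\<^esub> g x) \<in> lmod_hom R M N"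
  unfolding a_minus_def by (intro lmod_hom_add lmod_hom_uminus assms)

lemma lmod_hom_minus_distrib:
  assumes f: "f \<in> lmod_hom R M N" and M: "left_module R M" and N: "left_module R N"
    and x: "x \<in> carrier M" and y: "y \<in> carrier M"
  shows "f (x \<ominus>\<^bsub>M\<^esub> y) = f x \<ominus>\<^bsub>N\<^esub> f y"
proof -
  interpret M: left_module R M by fact
  show ?thesis
    using x y lmod_hom_minus[OF f M N y] lmod_homD(2)[OF f x, of "\<ominus>\<^bsub>M\<^esub> y"] by (simp add: a_minus_def)
qed

text \<open>The module structure on the image of a map \<open>q\<close> whose fibres are compatible with the
  operations of \<open>N\<close>: a quotient of \<open>N\<close>, or a copy of \<open>N\<close> in another type if \<open>q\<close> is injective.\<close>

definition image_module :: "('m \<Rightarrow> 'n) \<Rightarrow> ('r, 'm) module \<Rightarrow> ('r, 'n) module" where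
  "image_module q N = \<lparr>carrier = q ` carrier N, monoid.mult = (\<lambda>x y. x), one = q \<zero>\<^bsub>N\<^esub>,
     ring.zero = q \<zero>\<^bsub>N\<^esub>,
     add = (\<lambda>u v. q (inv_into (carrier N) q u \<oplus>\<^bsub>N\<^esub> inv_into (carrier N) q v)),
     smult = (\<lambda>a u. q (a \<odot>\<^bsub>N\<^esub> inv_into (carrier N) q u))\<rparr>"

text \<open>The operations are computed on representatives chosen by \<open>inv_into\<close>.
  Compatibility of the fibres makes the result independent of the choice, and the module laws of the
  image become images under \<open>q\<close> of those of \<open>N\<close>.\<close>

lemma image_module_quotient:
  fixes N :: "('r, 'm) module"
  assumes N: "left_module R N"
    and add: "\<And>x x' y y'. \<lbrakk>x \<in> carrier N; x' \<in> carrier N; y \<in> carrier N; y' \<in> carrier N;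
      q x = q x'; q y = q y'\<rbrakk> \<Longrightarrow> q (x \<oplus>\<^bsub>N\<^esub> y) = q (x' \<oplus>\<^bsub>N\<^esub> y')"
    and smult: "\<And>a x x'. \<lbrakk>a \<in> carrier R; x \<in> carrier N; x' \<in> carrier N; q x = q x'\<rbrakk> \<Longrightarrow>
      q (a \<odot>\<^bsub>N\<^esub> x) = q (a \<odot>\<^bsub>N\<^esub> x')"
  shows "left_module R (image_module q N)" "q \<in> lmod_hom R N (image_module q N)"
    "q ` carrier N = carrier (image_module q N)"
proof -
  interpret left_module R N by fact
  let ?Q = "image_module q N" and ?i = "inv_into (carrier N) q"
  have i: "?i (q x) \<in> carrier N" "q (?i (q x)) = q x" if "x \<in> carrier N" for x
    using that by (auto intro: inv_into_into f_inv_into_f)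
  have a: "q x \<oplus>\<^bsub>?Q\<^esub> q y = q (x \<oplus>\<^bsub>N\<^esub> y)" if "x \<in> carrier N" "y \<in> carrier N" for x y
    unfolding image_module_def using add[of "?i (q x)" x "?i (q y)" y] i that by simp
  have s: "c \<odot>\<^bsub>?Q\<^esub> q x = q (c \<odot>\<^bsub>N\<^esub> x)" if "c \<in> carrier R" "x \<in> carrier N" for c x
    unfolding image_module_def using smult[of c "?i (q x)" x] i that by simp
  show car: "q ` carrier N = carrier ?Q" by (simp add: image_module_def)
  have z: "\<zero>\<^bsub>?Q\<^esub> = q \<zero>\<^bsub>N\<^esub>" by (simp add: image_module_def)
  show hom: "q \<in> lmod_hom R N ?Q"
    by (rule lmod_homI) (auto simp: a s car[symmetric])
  show "left_module R ?Q"
    by (rule left_moduleI[OF R.ring_axioms])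
      (auto simp: car[symmetric] z a s M.a_assoc smult_l_distr smult_r_distr smult_assoc1
        intro!: arg_cong[of _ _ q] intro: M.a_comm)
qed

lemma image_module_inj:
  fixes N :: "('r, 'm) module"
  assumes N: "left_module R N" and q: "inj_on q (carrier N)"
  shows "left_module R (image_module q N)" "q \<in> lmod_hom R N (image_module q N)"
    "q ` carrier N = carrier (image_module q N)"
    "inv_into (carrier N) q \<in> lmod_hom R (image_module q N) N"
proof -
  interpret left_module R N by fact
  note iq = inj_onD[OF q]
  have c: "left_module R (image_module q N) \<and> q \<in> lmod_hom R N (image_module q N)
      \<and> q ` carrier N = carrier (image_module q N)"
    by (intro conjI; rule image_module_quotient[OF N]) (metis iq)+
  then show "left_module R (image_module q N)" and h: "q \<in> lmod_hom R N (image_module q N)"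
    and e: "q ` carrier N = carrier (image_module q N)" by auto
  show "inv_into (carrier N) q \<in> lmod_hom R (image_module q N) N"
    by (rule lmod_homI)
      (auto simp: e[symmetric] lmod_homD(2,3)[OF h, symmetric] inv_into_f_f[OF q])
qed

section \<open>Direct sums\<close>

definition pair_module :: "('r, 'm) module \<Rightarrow> ('r, 'n) module \<Rightarrow> ('r, 'm \<times> 'n) module" where
  "pair_module M N = \<lparr>carrier = carrier M \<times> carrier N, monoid.mult = (\<lambda>x y. x),
     one = (\<zero>\<^bsub>M\<^esub>, \<zero>\<^bsub>N\<^esub>), ring.zero = (\<zero>\<^bsub>M\<^esub>, \<zero>\<^bsub>N\<^esub>),
     add = (\<lambda>x y. (fst x \<oplus>\<^bsub>M\<^esub> fst y, snd x \<oplus>\<^bsub>N\<^esub> snd y)),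
     smult = (\<lambda>a x. (a \<odot>\<^bsub>M\<^esub> fst x, a \<odot>\<^bsub>N\<^esub> snd x))\<rparr>"

lemma pair_module_simps [simp]:
  "carrier (pair_module M N) = carrier M \<times> carrier N"
  "\<zero>\<^bsub>pair_module M N\<^esub> = (\<zero>\<^bsub>M\<^esub>, \<zero>\<^bsub>N\<^esub>)"
  "x \<oplus>\<^bsub>pair_module M N\<^esub> y = (fst x \<oplus>\<^bsub>M\<^esub> fst y, snd x \<oplus>\<^bsub>N\<^esub> snd y)"
  "a \<odot>\<^bsub>pair_module M N\<^esub> x = (a \<odot>\<^bsub>M\<^esub> fst x, a \<odot>\<^bsub>N\<^esub> snd x)"
  by (simp_all add: pair_module_def)

lemma left_module_pair:
  assumes M: "left_module R M" and N: "left_module R N"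
  shows "left_module R (pair_module M N)"
proof -
  interpret M: left_module R M by fact
  interpret N: left_module R N by fact
  show ?thesis
    by (rule left_moduleI[OF M.R.ring_axioms])
      (auto simp: M.M.a_assoc N.M.a_assoc M.smult_l_distr M.smult_r_distr M.smult_assoc1
        N.smult_l_distr N.smult_r_distr N.smult_assoc1 intro: M.M.a_comm N.M.a_comm)
qed

lemma lmod_hom_fst: "fst \<in> lmod_hom R (pair_module M N) M"
  and lmod_hom_snd: "snd \<in> lmod_hom R (pair_module M N) N"
  by (auto simp: lmod_hom_def)

lemma lmod_hom_Pair:
  assumes "f \<in> lmod_hom R L M" "g \<in> lmod_hom R L N"
  shows "(\<lambda>x. (f x, g x)) \<in> lmod_hom R L (pair_module M N)"
  using assms by (auto simp: lmod_hom_def Pi_iff)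

lemma lmod_hom_inl: "left_module R N \<Longrightarrow> (\<lambda>x. (x, \<zero>\<^bsub>N\<^esub>)) \<in> lmod_hom R M (pair_module M N)"
  by (rule lmod_hom_Pair[OF lmod_hom_id lmod_hom_const_zero])

lemma lmod_hom_inr: "left_module R M \<Longrightarrow> (\<lambda>x. (\<zero>\<^bsub>M\<^esub>, x)) \<in> lmod_hom R N (pair_module M N)"
  by (rule lmod_hom_Pair[OF lmod_hom_const_zero lmod_hom_id])

section \<open>Projective modules, finite generation and free modules of finite rank\<close>

lemma projectiveD: "projective R P \<Longrightarrow> left_module R P"
  by (simp add: projective_def)

text \<open>A lift of f p, precomposed with i, is a lift of f. The test modules in
  \<open>projective R Q\<close> live in types attached to \<open>Q\<close>, so the lift for
  \<open>P\<close> has to come from \<open>projective_lift\<close>, which works across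
  types.\<close>

lemma projective_retract:
  fixes P :: "('r, 'p) module" and Q :: "('r, 'q) module"
  assumes P: "projective R P" and Q: "left_module R Q"
    and i: "i \<in> lmod_hom R Q P" and p: "p \<in> lmod_hom R P Q"
    and pi: "\<And>x. x \<in> carrier Q \<Longrightarrow> p (i x) = x"
  shows "projective R Q"
  unfolding projective_def
proof (intro conjI Q allI impI)
  fix A :: "('r, 'q \<Rightarrow> 'r) module" and B :: "('r, 'q) module" and f g
  assume A: "left_module R A" and B: "left_module R B" and g: "g \<in> lmod_hom R A B"
    "g ` carrier A = carrier B" and f: "f \<in> lmod_hom R Q B"
  obtain h where h: "h \<in> lmod_hom R P A" "\<And>x. x \<in> carrier P \<Longrightarrow> g (h x) = f (p x)"
    using projective_lift[OF P A B g lmod_hom_comp[OF p f]] by blast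
  show "\<exists>h\<in>lmod_hom R Q A. \<forall>x\<in>carrier Q. g (h x) = f x"
    by (rule bexI[OF _ lmod_hom_comp[OF i h(1)]]) (use h(2) pi lmod_homD(1)[OF i] in auto)
qed

lemma projective_pair:
  fixes P :: "('r, 'p) module" and Q :: "('r, 'q) module"
  assumes P: "projective R P" and Q: "projective R Q"
  shows "projective R (pair_module P Q)"
  unfolding projective_def
proof (intro conjI allI impI left_module_pair projectiveD[OF P] projectiveD[OF Q])
  fix A :: "('r, 'p \<times> 'q \<Rightarrow> 'r) module" and B :: "('r, 'p \<times> 'q) module" and f g
  assume A: "left_module R A" and B: "left_module R B" and g: "g \<in> lmod_hom R A B"
    "g ` carrier A = carrier B" and f: "f \<in> lmod_hom R (pair_module P Q) B"
  interpret A: left_module R A by fact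
  interpret P: left_module R P by (rule projectiveD[OF P])
  interpret Q: left_module R Q by (rule projectiveD[OF Q])
  obtain h where h: "h \<in> lmod_hom R P A" "\<And>x. x \<in> carrier P \<Longrightarrow> g (h x) = f (x, \<zero>\<^bsub>Q\<^esub>)"
    using projective_lift[OF P A B g lmod_hom_comp[OF lmod_hom_inl[OF Q.left_module_axioms] f]] by blast
  obtain k where k: "k \<in> lmod_hom R Q A" "\<And>x. x \<in> carrier Q \<Longrightarrow> g (k x) = f (\<zero>\<^bsub>P\<^esub>, x)"
    using projective_lift[OF Q A B g lmod_hom_comp[OF lmod_hom_inr[OF P.left_module_axioms] f]] by blast
  show "\<exists>h\<in>lmod_hom R (pair_module P Q) A. \<forall>x\<in>carrier (pair_module P Q). g (h x) = f x"
  proof (rule bexI[OF _ lmod_hom_add[OF A lmod_hom_comp[OF lmod_hom_fst h(1)] lmod_hom_comp[OF lmod_hom_snd k(1)]]],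
      intro ballI)
    fix z assume z: "z \<in> carrier (pair_module P Q)"
    then have c: "h (fst z) \<in> carrier A" "k (snd z) \<in> carrier A"
      using lmod_homD(1)[OF h(1)] lmod_homD(1)[OF k(1)] by auto
    have "g (h (fst z) \<oplus>\<^bsub>A\<^esub> k (snd z)) = f ((fst z, \<zero>\<^bsub>Q\<^esub>) \<oplus>\<^bsub>pair_module P Q\<^esub> (\<zero>\<^bsub>P\<^esub>, snd z))"
      using z lmod_homD(2)[OF g(1) c] lmod_homD(2)[OF f, of "(fst z, \<zero>\<^bsub>Q\<^esub>)" "(\<zero>\<^bsub>P\<^esub>, snd z)"]
      by (auto simp: h(2) k(2))
    then show "g (h (fst z) \<oplus>\<^bsub>A\<^esub> k (snd z)) = f z" using z by auto
  qed
qed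

text \<open>Numbering the generators turns a generating set into a surjection from a free module of
  finite rank; in this form finite generation passes to images and direct sums by composing
  maps.\<close>

lemma fin_gen_iff:
  fixes N :: "('r, 'n) module"
  assumes N: "left_module R N"
  shows "fin_gen R N \<longleftrightarrow> (\<exists>k. \<exists>p \<in> lmod_hom R (free_module R {..<k::nat}) N.
    p ` carrier (free_module R {..<k}) = carrier N)"
proof
  interpret left_module R N by fact
  assume "fin_gen R N"
  then obtain G where G: "finite G" "G \<subseteq> carrier N"
    "\<And>H. submodule H R N \<Longrightarrow> G \<subseteq> H \<Longrightarrow> H = carrier N" by (auto simp: fin_gen_def)
  obtain \<gamma> and n :: nat where \<gamma>: "\<gamma> ` {..<n} = G"
    using finite_imp_nat_seg_image_inj_on[OF G(1)] by (metis lessThan_def)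
  let ?F = "free_module R {..<n}" and ?p = "free_ext R N \<gamma>"
  have \<gamma>': "\<gamma> \<in> {..<n} \<rightarrow> carrier N" using \<gamma> G(2) by auto
  have p: "?p \<in> lmod_hom R ?F N" by (rule free_ext_hom[OF N \<gamma>'])
  have "G \<subseteq> ?p ` carrier ?F"
  proof
    fix x assume "x \<in> G"
    then obtain b where b: "b \<in> {..<n}" "x = \<gamma> b" using \<gamma> by auto
    have "x = ?p (basis_elt R b)" by (simp add: b free_ext_basis[OF N \<gamma>' b(1)])
    then show "x \<in> ?p ` carrier ?F" using basis_elt_in[OF R.ring_axioms b(1)] by blast
  qed
  then have "?p ` carrier ?F = carrier N"
    using G(3) lmod_hom_image_submodule[OF p left_module_free_module[OF R.ring_axioms] N] by blast
  then show "\<exists>k. \<exists>p \<in> lmod_hom R (free_module R {..<k::nat}) N.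
    p ` carrier (free_module R {..<k}) = carrier N" using p by blast
next
  interpret left_module R N by fact
  assume "\<exists>k. \<exists>p \<in> lmod_hom R (free_module R {..<k::nat}) N.
    p ` carrier (free_module R {..<k}) = carrier N"
  then obtain k :: nat and p where p: "p \<in> lmod_hom R (free_module R {..<k}) N"
    and s: "p ` carrier (free_module R {..<k}) = carrier N" by blast
  interpret F: left_module R "free_module R {..<k}" by (rule left_module_free_module) (rule R.ring_axioms)
  show "fin_gen R N"
    unfolding fin_gen_def
  proof (intro exI[of _ "(\<lambda>i. p (basis_elt R i)) ` {..<k}"] conjI allI impI)
    show "(\<lambda>i. p (basis_elt R i)) ` {..<k} \<subseteq> carrier N"
      by (auto intro!: lmod_homD(1)[OF p] basis_elt_in R.ring_axioms)
    fix H assume H: "submodule H R N" and G: "(\<lambda>i. p (basis_elt R i)) ` {..<k} \<subseteq> H"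
    note c = submoduleD[OF H]
    have "p f \<in> H" if f: "f \<in> carrier (free_module R {..<k})" for f
    proof (rule free_module_induct[OF R.ring_axioms f])
      show "p (\<lambda>x. \<zero>\<^bsub>R\<^esub>) \<in> H" using lmod_hom_zero[OF p F.left_module_axioms N] c(2) by simp
    next
      fix f b r assume f: "f \<in> carrier (free_module R {..<k})" "p f \<in> H" and b: "b \<in> {..<k}"
        and r: "r \<in> carrier R"
      have e: "basis_elt R b \<in> carrier (free_module R {..<k})" by (rule basis_elt_in[OF R.ring_axioms b])
      then have re: "r \<odot>\<^bsub>free_module R {..<k}\<^esub> basis_elt R b \<in> carrier (free_module R {..<k})"
        using r by (rule F.smult_closed[rotated])
      show "p (f \<oplus>\<^bsub>free_module R {..<k}\<^esub> r \<odot>\<^bsub>free_module R {..<k}\<^esub> basis_elt R b) \<in> H"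
        unfolding lmod_homD(2)[OF p f(1) re] lmod_homD(3)[OF p r e]
        by (intro c(3) c(4) f(2) r) (use G b in auto)
    qed
    then have "p ` carrier (free_module R {..<k}) \<subseteq> H" by (rule image_subsetI)
    then show "H = carrier N" using c(1) unfolding s by (rule subset_antisym[rotated])
  qed simp
qed

abbreviation fm :: "('r, 'y) ring_scheme \<Rightarrow> nat \<Rightarrow> ('r, nat \<Rightarrow> 'r) module" where
  "fm R k \<equiv> free_module R {..<k}"

lemma fin_gen_fm:
  assumes R: "ring R" shows "fin_gen R (fm R k)"
proof -
  have "(\<lambda>x. x) ` carrier (fm R k) = carrier (fm R k)" by (rule image_ident)
  then show ?thesis
    unfolding fin_gen_iff[OF left_module_free_module[OF R]] by (intro exI[of _ k] bexI[OF _ lmod_hom_id])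
qed

lemma fin_gen_image:
  assumes M: "left_module R M" and N: "left_module R N" and fg: "fin_gen R M"
    and f: "f \<in> lmod_hom R M N" "f ` carrier M = carrier N"
  shows "fin_gen R N"
proof -
  obtain k p where p: "p \<in> lmod_hom R (fm R k) M" "p ` carrier (fm R k) = carrier M"
    using fg fin_gen_iff[OF M] by blast
  have "(\<lambda>x. f (p x)) ` carrier (fm R k) = carrier N"
    using p(2) f(2) by (metis image_image)
  then show ?thesis using fin_gen_iff[OF N] lmod_hom_comp[OF p(1) f(1)] by blast
qed

lemma fm_carrier_iff:
  assumes R: "ring R"
  shows "f \<in> carrier (fm R k) \<longleftrightarrow> (\<forall>i. f i \<in> carrier R) \<and> (\<forall>i \<ge> k. f i = \<zero>\<^bsub>R\<^esub>)"
proof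
  assume "f \<in> carrier (fm R k)"
  then show "(\<forall>i. f i \<in> carrier R) \<and> (\<forall>i \<ge> k. f i = \<zero>\<^bsub>R\<^esub>)"
    using free_module_carrierD[OF _ R, of f "{..<k}"] by auto
next
  assume f: "(\<forall>i. f i \<in> carrier R) \<and> (\<forall>i \<ge> k. f i = \<zero>\<^bsub>R\<^esub>)"
  have "finite {i. f i \<noteq> \<zero>\<^bsub>R\<^esub>}"
    by (rule finite_subset[of _ "{..<k}"]) (use f in \<open>auto simp: not_less[symmetric]\<close>)
  then show "f \<in> carrier (fm R k)" using f by (auto simp: free_module_def)
qed

lemma free_module_split:
  assumes "ring R"
  obtains a b where "a \<in> lmod_hom R (pair_module (fm R m) (fm R n)) (fm R (m + n))"
    "b \<in> lmod_hom R (fm R (m + n)) (pair_module (fm R m) (fm R n))"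
    "\<And>x. x \<in> carrier (fm R (m + n)) \<Longrightarrow> a (b x) = x"
    "\<And>x. x \<in> carrier (pair_module (fm R m) (fm R n)) \<Longrightarrow> b (a x) = x"
proof -
  interpret ring R by fact
  define a where "a z i = (if i < m then fst z i else snd z (i - m))" for z :: "(nat \<Rightarrow> 'a) \<times> (nat \<Rightarrow> 'a)" and i
  define b where "b x = (\<lambda>i. if i < m then x i else \<zero>\<^bsub>R\<^esub>, \<lambda>i. x (i + m))" for x :: "nat \<Rightarrow> 'a"
  note car = fm_carrier_iff[OF assms]
  show ?thesis
    by (rule that[of a b]; (rule lmod_homI)?) (auto simp: car a_def b_def fun_eq_iff)
qed

lemma fin_gen_pair:
  assumes M: "left_module R M" and N: "left_module R N" and fM: "fin_gen R M" and fN: "fin_gen R N"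
  shows "fin_gen R (pair_module M N)"
proof -
  interpret M: left_module R M by fact
  obtain k p where p: "p \<in> lmod_hom R (fm R k) M" "p ` carrier (fm R k) = carrier M"
    using fM fin_gen_iff[OF M] by blast
  obtain l q where q: "q \<in> lmod_hom R (fm R l) N" "q ` carrier (fm R l) = carrier N"
    using fN fin_gen_iff[OF N] by blast
  obtain a b where a: "a \<in> lmod_hom R (pair_module (fm R k) (fm R l)) (fm R (k + l))"
    and b: "b \<in> lmod_hom R (fm R (k + l)) (pair_module (fm R k) (fm R l))"
    and ba: "\<And>x. x \<in> carrier (pair_module (fm R k) (fm R l)) \<Longrightarrow> b (a x) = x"
    by (rule free_module_split[OF M.R.ring_axioms, of k l]) blast
  let ?f = "\<lambda>x. (p (fst (b x)), q (snd (b x)))"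
  have f: "?f \<in> lmod_hom R (fm R (k + l)) (pair_module M N)"
    by (rule lmod_hom_Pair[OF lmod_hom_comp[OF lmod_hom_comp[OF b lmod_hom_fst] p(1)]
        lmod_hom_comp[OF lmod_hom_comp[OF b lmod_hom_snd] q(1)]])
  have "?f ` carrier (fm R (k + l)) = carrier (pair_module M N)"
  proof
    show "?f ` carrier (fm R (k + l)) \<subseteq> carrier (pair_module M N)" using lmod_homD(1)[OF f] by blast
    show "carrier (pair_module M N) \<subseteq> ?f ` carrier (fm R (k + l))"
    proof
      fix z assume z: "z \<in> carrier (pair_module M N)"
      then have "fst z \<in> carrier M" "snd z \<in> carrier N" by auto
      then obtain x y where xy: "x \<in> carrier (fm R k)" "y \<in> carrier (fm R l)" "z = (p x, q y)"
        using surjE[OF p(2)] surjE[OF q(2)] by (metis prod.collapse)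
      then have "z = ?f (a (x, y))" using ba[of "(x, y)"] by simp
      moreover have "a (x, y) \<in> carrier (fm R (k + l))" using lmod_homD(1)[OF a, of "(x, y)"] xy by simp
      ultimately show "z \<in> ?f ` carrier (fm R (k + l))" by blast
    qed
  qed
  then show ?thesis using f fin_gen_iff[OF left_module_pair[OF M N]] by blast
qed

text \<open>A surjection p from a free module of finite rank onto \<open>P\<close> splits, and
  \<open>C\<close> is its kernel. Hence the complement has functions on \<open>nat\<close> as
  elements whatever the type of \<open>P\<close> is, so complements can be formed repeatedly without
  the type growing.\<close>

lemma projective_complement:
  fixes P :: "('r, 'p) module"
  assumes P: "projective R P" and fg: "fin_gen R P"
  obtains C :: "('r, nat \<Rightarrow> 'r) module" and k a b where "projective R C" "fin_gen R C"
    "a \<in> lmod_hom R (pair_module P C) (fm R k)" "b \<in> lmod_hom R (fm R k) (pair_module P C)"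
    "\<And>x. x \<in> carrier (fm R k) \<Longrightarrow> a (b x) = x" "\<And>x. x \<in> carrier (pair_module P C) \<Longrightarrow> b (a x) = x"
proof -
  interpret P: left_module R P by (rule projectiveD[OF P])
  note Pm = P.left_module_axioms
  obtain k p where p: "p \<in> lmod_hom R (fm R k) P" "p ` carrier (fm R k) = carrier P"
    using fg fin_gen_iff[OF Pm] by blast
  interpret F: left_module R "fm R k" by (rule left_module_free_module[OF P.R.ring_axioms])
  note Fm = F.left_module_axioms
  obtain i where i: "i \<in> lmod_hom R P (fm R k)" "\<And>x. x \<in> carrier P \<Longrightarrow> p (i x) = x"
    using projective_lift[OF P Fm Pm p lmod_hom_id] by blast
  let ?K = "lmod_ker (fm R k) P p"
  define C where "C = submod (fm R k) ?K"
  have K: "submodule ?K R (fm R k)" by (rule submodule_lmod_ker[OF p(1) Fm Pm])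
  have Ksub: "?K \<subseteq> carrier (fm R k)" by (rule submoduleD(1)[OF K])
  have Cm: "left_module R C" unfolding C_def by (rule left_module_submod[OF Fm K])
  \<comment> \<open>Since i splits p, this is the projection of the free module onto the kernel of
    p.\<close>
  let ?q = "\<lambda>x. x \<ominus>\<^bsub>fm R k\<^esub> i (p x)"
  have ic: "i (p x) \<in> carrier (fm R k)" if "x \<in> carrier (fm R k)" for x
    using that lmod_homD(1)[OF p(1)] lmod_homD(1)[OF i(1)] by blast
  have qK: "?q x \<in> ?K" if "x \<in> carrier (fm R k)" for x
    unfolding lmod_ker_def
    using that ic[OF that] lmod_hom_minus_distrib[OF p(1) Fm Pm that ic[OF that]] i(2)[of "p x"]
      lmod_homD(1)[OF p(1) that]
    by (simp add: a_minus_def P.M.r_neg del: free_module_simps)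
  have q: "?q \<in> lmod_hom R (fm R k) C"
    unfolding C_def lmod_hom_submod_iff[OF Ksub]
    using qK lmod_hom_diff[OF Fm lmod_hom_id lmod_hom_comp[OF p(1) i(1)]] by blast
  have j: "(\<lambda>x. x) \<in> lmod_hom R C (fm R k)"
    unfolding C_def by (rule lmod_hom_restrict[OF Ksub lmod_hom_id])
  have qj: "?q x = x" if "x \<in> carrier C" for x
  proof -
    have "x \<in> carrier (fm R k)" "p x = \<zero>\<^bsub>P\<^esub>" using that by (auto simp: C_def lmod_ker_def)
    then show ?thesis using lmod_hom_zero[OF i(1) Pm Fm] by (simp add: a_minus_def del: free_module_simps)
  qed
  have Cp: "projective R C"
    by (rule projective_retract[OF projective_free_module[OF P.R.ring_axioms] Cm j q]) (rule qj)
  have "?q ` carrier (fm R k) = carrier C"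
  proof
    show "?q ` carrier (fm R k) \<subseteq> carrier C" using lmod_homD(1)[OF q] by blast
    have "x \<in> ?q ` carrier (fm R k)" if "x \<in> carrier C" for x
      by (rule image_eqI[where f = ?q and x = x]) (rule qj[OF that, symmetric], rule lmod_homD(1)[OF j that])
    then show "carrier C \<subseteq> ?q ` carrier (fm R k)" by blast
  qed
  then have Cf: "fin_gen R C"
    by (rule fin_gen_image[OF Fm Cm fin_gen_fm[OF P.R.ring_axioms] q])
  let ?a = "\<lambda>z. i (fst z) \<oplus>\<^bsub>fm R k\<^esub> snd z"
  have a: "?a \<in> lmod_hom R (pair_module P C) (fm R k)"
    by (rule lmod_hom_add[OF Fm lmod_hom_comp[OF lmod_hom_fst i(1)] lmod_hom_comp[OF lmod_hom_snd j]])
  show thesis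
  proof (rule that[OF Cp Cf a lmod_hom_Pair[OF p(1) q]])
    fix x assume x: "x \<in> carrier (fm R k)"
    show "?a (p x, ?q x) = x"
      using F.M.add_diff_cancel[OF x ic[OF x]] by (simp del: free_module_simps)
  next
    fix z assume "z \<in> carrier (pair_module P C)"
    then obtain x y where z: "z = (x, y)" "x \<in> carrier P" "y \<in> carrier C" by auto
    have y: "y \<in> carrier (fm R k)" "p y = \<zero>\<^bsub>P\<^esub>" using z(3) by (auto simp: C_def lmod_ker_def)
    have ix: "i x \<in> carrier (fm R k)" using lmod_homD(1)[OF i(1) z(2)] .
    have px: "p (i x \<oplus>\<^bsub>fm R k\<^esub> y) = x"
      unfolding lmod_homD(2)[OF p(1) ix y(1)] using y(2) i(2)[OF z(2)] z(2) by simp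
    show "(p (?a z), ?q (?a z)) = z"
      using F.M.add_diff_cancel_left'[OF ix y(1)] px z(1) by (simp del: free_module_simps)
  qed
qed

section \<open>Comparison of projective resolutions\<close>

text \<open>\<open>projective_lift\<close> asks for a surjection, so the target is cut down to the
  image of \<open>g\<close>. In this form it lifts maps along a differential.\<close>

lemma projective_lift_image:
  fixes P :: "('r, 'p) module" and A :: "('r, 'a) module" and B :: "('r, 'b) module"
  assumes P: "projective R P" and A: "left_module R A" and B: "left_module R B"
    and g: "g \<in> lmod_hom R A B" and f: "f \<in> lmod_hom R P B"
    and im: "\<And>x. x \<in> carrier P \<Longrightarrow> f x \<in> g ` carrier A"
  obtains h where "h \<in> lmod_hom R P A" "\<And>x. x \<in> carrier P \<Longrightarrow> g (h x) = f x"
proof -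
  have S: "submodule (g ` carrier A) R B" by (rule lmod_hom_image_submodule[OF g A B])
  let ?C = "submod B (g ` carrier A)"
  have "\<exists>h \<in> lmod_hom R P A. \<forall>x \<in> carrier P. g (h x) = f x"
    by (rule projective_lift[OF P A left_module_submod[OF B S]])
      (use f g im submoduleD(1)[OF S] in \<open>auto simp: lmod_hom_submod_iff\<close>)
  then show thesis using that by blast
qed

lemma projective_resolutionD:
  assumes "projective_resolution R N P d e"
  shows "left_module R N" "projective R (P n)" "left_module R (P n)"
    "d n \<in> lmod_hom R (P (Suc n)) (P n)" "e \<in> lmod_hom R (P 0) N"
    "e ` carrier (P 0) = carrier N"
    "d 0 ` carrier (P (Suc 0)) = lmod_ker (P 0) N e"
    "d (Suc n) ` carrier (P (Suc (Suc n))) = lmod_ker (P (Suc n)) (P n) (d n)"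
    "x \<in> carrier (P (Suc 0)) \<Longrightarrow> e (d 0 x) = \<zero>\<^bsub>N\<^esub>"
    "x \<in> carrier (P (Suc (Suc n))) \<Longrightarrow> d n (d (Suc n) x) = \<zero>\<^bsub>P n\<^esub>"
    "y \<in> carrier (P 0) \<Longrightarrow> e y = \<zero>\<^bsub>N\<^esub> \<Longrightarrow> y \<in> d 0 ` carrier (P (Suc 0))"
    "y \<in> carrier (P (Suc n)) \<Longrightarrow> d n y = \<zero>\<^bsub>P n\<^esub> \<Longrightarrow> y \<in> d (Suc n) ` carrier (P (Suc (Suc n)))"
proof -
  note a = assms[unfolded projective_resolution_def One_nat_def]
  show "left_module R N" "projective R (P n)" "left_module R (P n)"
    "d n \<in> lmod_hom R (P (Suc n)) (P n)" "e \<in> lmod_hom R (P 0) N" "e ` carrier (P 0) = carrier N"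
    "d 0 ` carrier (P (Suc 0)) = lmod_ker (P 0) N e"
    "d (Suc n) ` carrier (P (Suc (Suc n))) = lmod_ker (P (Suc n)) (P n) (d n)"
    using a projectiveD by auto
  then show "x \<in> carrier (P (Suc 0)) \<Longrightarrow> e (d 0 x) = \<zero>\<^bsub>N\<^esub>"
    "x \<in> carrier (P (Suc (Suc n))) \<Longrightarrow> d n (d (Suc n) x) = \<zero>\<^bsub>P n\<^esub>"
    "y \<in> carrier (P 0) \<Longrightarrow> e y = \<zero>\<^bsub>N\<^esub> \<Longrightarrow> y \<in> d 0 ` carrier (P (Suc 0))"
    "y \<in> carrier (P (Suc n)) \<Longrightarrow> d n y = \<zero>\<^bsub>P n\<^esub> \<Longrightarrow> y \<in> d (Suc n) ` carrier (P (Suc (Suc n)))"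
    unfolding lmod_ker_def by blast+
qed

lemma projective_resolutionI:
  assumes "left_module R N" "\<And>n. projective R (P n)" "\<And>n. d n \<in> lmod_hom R (P (Suc n)) (P n)"
    "e \<in> lmod_hom R (P 0) N" "\<And>z. z \<in> carrier N \<Longrightarrow> z \<in> e ` carrier (P 0)"
    "\<And>x. x \<in> carrier (P (Suc 0)) \<Longrightarrow> e (d 0 x) = \<zero>\<^bsub>N\<^esub>"
    "\<And>n x. x \<in> carrier (P (Suc (Suc n))) \<Longrightarrow> d n (d (Suc n) x) = \<zero>\<^bsub>P n\<^esub>"
    "\<And>y. y \<in> carrier (P 0) \<Longrightarrow> e y = \<zero>\<^bsub>N\<^esub> \<Longrightarrow> y \<in> d 0 ` carrier (P (Suc 0))"
    "\<And>n y. y \<in> carrier (P (Suc n)) \<Longrightarrow> d n y = \<zero>\<^bsub>P n\<^esub> \<Longrightarrow> y \<in> d (Suc n) ` carrier (P (Suc (Suc n)))"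
  shows "projective_resolution R N P d e"
  unfolding projective_resolution_def One_nat_def
proof (intro conjI allI assms(1-4))
  show "e ` carrier (P 0) = carrier N" using assms(5) lmod_homD(1)[OF assms(4)] by blast
  show "d 0 ` carrier (P (Suc 0)) = lmod_ker (P 0) N e"
    using assms(6,8) lmod_homD(1)[OF assms(3)[of 0]] unfolding lmod_ker_def by blast
  show "d (Suc n) ` carrier (P (Suc (Suc n))) = lmod_ker (P (Suc n)) (P n) (d n)" for n
    using assms(7,9)[of _ n] lmod_homD(1)[OF assms(3)[of "Suc n"]] unfolding lmod_ker_def by blast
qed

lemma chain_map_lift:
  fixes N :: "('r, 'n) module" and N' :: "('r, 'm) module"
    and P :: "nat \<Rightarrow> ('r, 'p) module" and Q :: "nat \<Rightarrow> ('r, 'q) module"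
  assumes P: "projective_resolution R N P d e" and Q: "projective_resolution R N' Q d' e'"
    and f: "f \<in> lmod_hom R N N'"
  obtains F where "\<And>n. F n \<in> lmod_hom R (P n) (Q n)"
    "\<And>x. x \<in> carrier (P 0) \<Longrightarrow> e' (F 0 x) = f (e x)"
    "\<And>n x. x \<in> carrier (P (Suc n)) \<Longrightarrow> d' n (F (Suc n) x) = F n (d n x)"
proof -
  note p = projective_resolutionD[OF P] and q = projective_resolutionD[OF Q]
  \<comment> \<open>Besides being a component of the chain map, \<open>g\<close> must send
    boundaries to boundaries. That is exactly the liftability condition for the next component, so
    dependent choice needs to see only the last map constructed.\<close>
  define good where "good n g \<longleftrightarrow> g \<in> lmod_hom R (P n) (Q n) \<and>
     (n = 0 \<longrightarrow> (\<forall>x \<in> carrier (P 0). e' (g x) = f (e x))) \<and>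
     (\<forall>x \<in> carrier (P (Suc n)). g (d n x) \<in> d' n ` carrier (Q (Suc n)))" for n and g :: "'p \<Rightarrow> 'q"
  have "\<exists>F. \<forall>n. good n (F n) \<and> (\<forall>x \<in> carrier (P (Suc n)). d' n (F (Suc n) x) = F n (d n x))"
  proof (rule dependent_nat_choice)
    obtain g where g: "g \<in> lmod_hom R (P 0) (Q 0)" "\<And>x. x \<in> carrier (P 0) \<Longrightarrow> e' (g x) = f (e x)"
      by (rule projective_lift_image[OF p(2) q(3) q(1) q(5) lmod_hom_comp[OF p(5) f]])
        (use q(6) lmod_homD(1)[OF f] lmod_homD(1)[OF p(5)] in auto)
    have "g (d 0 x) \<in> d' 0 ` carrier (Q (Suc 0))" if x: "x \<in> carrier (P (Suc 0))" for x
    proof (rule q(11))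
      have dx: "d 0 x \<in> carrier (P 0)" by (rule lmod_homD(1)[OF p(4) x])
      show "g (d 0 x) \<in> carrier (Q 0)" by (rule lmod_homD(1)[OF g(1) dx])
      show "e' (g (d 0 x)) = \<zero>\<^bsub>N'\<^esub>"
        using g(2)[OF dx] p(9)[OF x] lmod_hom_zero[OF f p(1) q(1)] by simp
    qed
    then show "\<exists>g. good 0 g" using g unfolding good_def by blast
  next
    fix g n assume "good n g"
    then have g: "g \<in> lmod_hom R (P n) (Q n)"
      "\<And>x. x \<in> carrier (P (Suc n)) \<Longrightarrow> g (d n x) \<in> d' n ` carrier (Q (Suc n))"
      by (auto simp: good_def)
    obtain g' where g': "g' \<in> lmod_hom R (P (Suc n)) (Q (Suc n))"
        "\<And>x. x \<in> carrier (P (Suc n)) \<Longrightarrow> d' n (g' x) = g (d n x)"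
      by (rule projective_lift_image[OF p(2) q(3) q(3) q(4) lmod_hom_comp[OF p(4) g(1)] g(2)]) (assumption | blast)+
    have "g' (d (Suc n) x) \<in> d' (Suc n) ` carrier (Q (Suc (Suc n)))"
      if x: "x \<in> carrier (P (Suc (Suc n)))" for x
    proof (rule q(12))
      have dx: "d (Suc n) x \<in> carrier (P (Suc n))" by (rule lmod_homD(1)[OF p(4) x])
      show "g' (d (Suc n) x) \<in> carrier (Q (Suc n))" by (rule lmod_homD(1)[OF g'(1) dx])
      show "d' n (g' (d (Suc n) x)) = \<zero>\<^bsub>Q n\<^esub>"
        using g'(2)[OF dx] p(10)[OF x] lmod_hom_zero[OF g(1) p(3) q(3)] by simp
    qed
    then show "\<exists>g'. good (Suc n) g' \<and> (\<forall>x \<in> carrier (P (Suc n)). d' n (g' x) = g (d n x))"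
      using g' unfolding good_def by blast
  qed
  then obtain F where F: "\<And>n. good n (F n)"
    "\<And>n x. x \<in> carrier (P (Suc n)) \<Longrightarrow> d' n (F (Suc n) x) = F n (d n x)" by blast
  show thesis by (rule that[of F]) (use F in \<open>auto simp: good_def\<close>)
qed

lemma chain_homotopy:
  fixes N :: "('r, 'n) module" and P :: "nat \<Rightarrow> ('r, 'p) module"
  assumes P: "projective_resolution R N P d e"
    and G: "\<And>n. G n \<in> lmod_hom R (P n) (P n)" "\<And>x. x \<in> carrier (P 0) \<Longrightarrow> e (G 0 x) = e x"
      "\<And>n x. x \<in> carrier (P (Suc n)) \<Longrightarrow> d n (G (Suc n) x) = G n (d n x)"
  obtains h where "\<And>n. h n \<in> lmod_hom R (P n) (P (Suc n))"
    "\<And>n x. x \<in> carrier (P (Suc n)) \<Longrightarrow>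
       x \<ominus>\<^bsub>P (Suc n)\<^esub> G (Suc n) x \<ominus>\<^bsub>P (Suc n)\<^esub> h n (d n x) = d (Suc n) (h (Suc n) x)"
proof -
  note p = projective_resolutionD[OF P]
  \<comment> \<open>What the next component of the homotopy has to hit under the differential. The
    invariant \<open>good\<close> says that it is a cycle; exactness then makes it a
    boundary.\<close>
  define t where "t n h x = x \<ominus>\<^bsub>P (Suc n)\<^esub> G (Suc n) x \<ominus>\<^bsub>P (Suc n)\<^esub> h (d n x)" for n and h :: "'p \<Rightarrow> 'p" and x
  have t: "t n h \<in> lmod_hom R (P (Suc n)) (P (Suc n))" if "h \<in> lmod_hom R (P n) (P (Suc n))" for n h
    unfolding t_def by (intro lmod_hom_diff p(3) lmod_hom_id G(1) lmod_hom_comp[OF p(4) that])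
  define good where "good n h \<longleftrightarrow> h \<in> lmod_hom R (P n) (P (Suc n)) \<and>
     (\<forall>x \<in> carrier (P (Suc n)). d n (t n h x) = \<zero>\<^bsub>P n\<^esub>)" for n h
  have dt: "d n (t n h x) = d n x \<ominus>\<^bsub>P n\<^esub> G n (d n x) \<ominus>\<^bsub>P n\<^esub> d n (h (d n x))"
    if x: "x \<in> carrier (P (Suc n))" and h: "h \<in> lmod_hom R (P n) (P (Suc n))" for n h x
  proof -
    interpret PS: left_module R "P (Suc n)" by (rule p(3))
    note c = x lmod_homD(1)[OF G(1) x] lmod_homD(1)[OF h lmod_homD(1)[OF p(4) x]]
    note m = lmod_hom_minus_distrib[OF p(4) p(3) p(3)]
    show ?thesis
      unfolding t_def m[OF PS.M.minus_closed[OF c(1,2)] c(3)] m[OF c(1,2)] G(3)[OF x] ..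
  qed
  have "\<exists>h. \<forall>n. good n (h n) \<and> (\<forall>x \<in> carrier (P (Suc n)). t n (h n) x = d (Suc n) (h (Suc n) x))"
  proof (rule dependent_nat_choice)
    interpret P0: left_module R "P 0" by (rule p(3))
    interpret N: left_module R N by (rule p(1))
    have "x \<ominus>\<^bsub>P 0\<^esub> G 0 x \<in> d 0 ` carrier (P (Suc 0))" if x: "x \<in> carrier (P 0)" for x
    proof (rule p(11))
      have g: "G 0 x \<in> carrier (P 0)" by (rule lmod_homD(1)[OF G(1) x])
      then show "x \<ominus>\<^bsub>P 0\<^esub> G 0 x \<in> carrier (P 0)" using x by simp
      show "e (x \<ominus>\<^bsub>P 0\<^esub> G 0 x) = \<zero>\<^bsub>N\<^esub>"
        unfolding lmod_hom_minus_distrib[OF p(5) p(3) p(1) x g] G(2)[OF x]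
        by (rule N.M.diff_self[OF lmod_homD(1)[OF p(5) x]])
    qed
    then obtain h where h: "h \<in> lmod_hom R (P 0) (P (Suc 0))"
      "\<And>x. x \<in> carrier (P 0) \<Longrightarrow> d 0 (h x) = x \<ominus>\<^bsub>P 0\<^esub> G 0 x"
      using projective_lift_image[OF p(2) p(3) p(3) p(4) lmod_hom_diff[OF p(3) lmod_hom_id G(1)]] by metis
    have "d 0 (t 0 h x) = \<zero>\<^bsub>P 0\<^esub>" if x: "x \<in> carrier (P (Suc 0))" for x
    proof -
      have dx: "d 0 x \<in> carrier (P 0)" by (rule lmod_homD(1)[OF p(4) x])
      show ?thesis unfolding dt[OF x h(1)] h(2)[OF dx]
        by (rule P0.M.diff_self[OF P0.M.minus_closed[OF dx lmod_homD(1)[OF G(1) dx]]])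
    qed
    then show "\<exists>h. good 0 h" using h unfolding good_def by blast
  next
    fix h n assume g: "good n h"
    then have h: "h \<in> lmod_hom R (P n) (P (Suc n))"
      "\<And>x. x \<in> carrier (P (Suc n)) \<Longrightarrow> d n (t n h x) = \<zero>\<^bsub>P n\<^esub>"
      by (auto simp: good_def)
    interpret PS: left_module R "P (Suc n)" by (rule p(3))
    obtain h' where h': "h' \<in> lmod_hom R (P (Suc n)) (P (Suc (Suc n)))"
      "\<And>x. x \<in> carrier (P (Suc n)) \<Longrightarrow> d (Suc n) (h' x) = t n h x"
      by (rule projective_lift_image[OF p(2) p(3) p(3) p(4) t[OF h(1)] p(12)[OF lmod_homD(1)[OF t[OF h(1)]] h(2)]]) (assumption | blast)+
    have "d (Suc n) (t (Suc n) h' x) = \<zero>\<^bsub>P (Suc n)\<^esub>" if x: "x \<in> carrier (P (Suc (Suc n)))" for x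
    proof -
      have dx: "d (Suc n) x \<in> carrier (P (Suc n))" by (rule lmod_homD(1)[OF p(4) x])
      have gx: "G (Suc n) (d (Suc n) x) \<in> carrier (P (Suc n))" by (rule lmod_homD(1)[OF G(1) dx])
      have "t n h (d (Suc n) x) = d (Suc n) x \<ominus>\<^bsub>P (Suc n)\<^esub> G (Suc n) (d (Suc n) x)"
        unfolding t_def p(10)[OF x] lmod_hom_zero[OF h(1) p(3) p(3)]
        by (rule PS.M.diff_zero[OF PS.M.minus_closed[OF dx gx]])
      then show ?thesis unfolding dt[OF x h'(1)] h'(2)[OF dx]
        using PS.M.diff_self[OF PS.M.minus_closed[OF dx gx]] by simp
    qed
    then show "\<exists>h'. good (Suc n) h' \<and> (\<forall>x \<in> carrier (P (Suc n)). t n h x = d (Suc n) (h' x))"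
      using h' unfolding good_def by (metis (no_types, lifting))
  qed
  then obtain h where "\<And>n. good n (h n)"
    "\<And>n x. x \<in> carrier (P (Suc n)) \<Longrightarrow> t n (h n) x = d (Suc n) (h (Suc n) x)" by blast
  then show thesis using that[of h] by (auto simp: good_def t_def)
qed

text \<open>Lifts of the identity in both directions and the homotopy on \<open>P\<close>: this is
  the data by which a property of \<open>Q\<close> is carried over to \<open>P\<close>.\<close>

lemma resolution_comparison:
  fixes P :: "nat \<Rightarrow> ('r, 'p) module" and Q :: "nat \<Rightarrow> ('r, 'q) module"
  assumes P: "projective_resolution R N P d e" and Q: "projective_resolution R N Q d' e'"
  obtains f g h where "\<And>n. f n \<in> lmod_hom R (P n) (Q n)" "\<And>n. g n \<in> lmod_hom R (Q n) (P n)"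
    "\<And>n. h n \<in> lmod_hom R (P n) (P (Suc n))"
    "\<And>n x. x \<in> carrier (P (Suc n)) \<Longrightarrow> d' n (f (Suc n) x) = f n (d n x)"
    "\<And>n x. x \<in> carrier (Q (Suc n)) \<Longrightarrow> d n (g (Suc n) x) = g n (d' n x)"
    "\<And>n x. x \<in> carrier (P (Suc n)) \<Longrightarrow>
       x \<ominus>\<^bsub>P (Suc n)\<^esub> g (Suc n) (f (Suc n) x) \<ominus>\<^bsub>P (Suc n)\<^esub> h n (d n x) = d (Suc n) (h (Suc n) x)"
proof -
  obtain f where f: "\<And>n. f n \<in> lmod_hom R (P n) (Q n)" "\<And>x. x \<in> carrier (P 0) \<Longrightarrow> e' (f 0 x) = e x"
    "\<And>n x. x \<in> carrier (P (Suc n)) \<Longrightarrow> d' n (f (Suc n) x) = f n (d n x)"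
    by (rule chain_map_lift[OF P Q lmod_hom_id]) blast
  obtain g where g: "\<And>n. g n \<in> lmod_hom R (Q n) (P n)" "\<And>x. x \<in> carrier (Q 0) \<Longrightarrow> e (g 0 x) = e' x"
    "\<And>n x. x \<in> carrier (Q (Suc n)) \<Longrightarrow> d n (g (Suc n) x) = g n (d' n x)"
    by (rule chain_map_lift[OF Q P lmod_hom_id]) blast
  have fc: "f n x \<in> carrier (Q n)" if "x \<in> carrier (P n)" for n x
    by (rule lmod_homD(1)[OF f(1) that])
  obtain h where "\<And>n. h n \<in> lmod_hom R (P n) (P (Suc n))"
    "\<And>n x. x \<in> carrier (P (Suc n)) \<Longrightarrow>
       x \<ominus>\<^bsub>P (Suc n)\<^esub> g (Suc n) (f (Suc n) x) \<ominus>\<^bsub>P (Suc n)\<^esub> h n (d n x) = d (Suc n) (h (Suc n) x)"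
    using chain_homotopy[OF P, of "\<lambda>n x. g n (f n x)"] lmod_hom_comp[OF f(1) g(1)] f(2,3) g(2,3) fc by metis
  then show thesis using that[OF f(1) g(1)] f(3) g(3) by blast
qed

text \<open>The image of \<open>d\<close> is then a direct summand; for the map \<open>d n\<close> of a projective resolution this
  means that the resolution can be truncated in degree \<open>n\<close>.\<close>

definition lmod_regular ::
  "('r, 'y) ring_scheme \<Rightarrow> ('r, 'm) module \<Rightarrow> ('r, 'n) module \<Rightarrow> ('m \<Rightarrow> 'n) \<Rightarrow> bool" where
  "lmod_regular R P Q d \<longleftrightarrow> (\<exists>h \<in> lmod_hom R Q P. \<forall>x \<in> carrier P. d (h (d x)) = d x)"

text \<open>In degree n + 1 > r the composite through \<open>Q\<close> is zero, so the homotopy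
  identity reads x - h (d x) = d (h x). Applying d gives d h d = d.\<close>

lemma regular_above_length:
  fixes P :: "nat \<Rightarrow> ('r, 'p) module" and Q :: "nat \<Rightarrow> ('r, 'q) module"
  assumes P: "projective_resolution R N P d e" and Q: "projective_resolution R N Q d' e'"
    and z: "zero_above Q r" and n: "r \<le> n"
  shows "lmod_regular R (P (Suc n)) (P n) (d n)"
proof -
  note p = projective_resolutionD[OF P] and q = projective_resolutionD[OF Q]
  obtain f g h where f: "\<And>n. f n \<in> lmod_hom R (P n) (Q n)" and g: "\<And>n. g n \<in> lmod_hom R (Q n) (P n)"
    and h: "\<And>n. h n \<in> lmod_hom R (P n) (P (Suc n))" and eq: "\<And>n x. x \<in> carrier (P (Suc n)) \<Longrightarrow>
       x \<ominus>\<^bsub>P (Suc n)\<^esub> g (Suc n) (f (Suc n) x) \<ominus>\<^bsub>P (Suc n)\<^esub> h n (d n x) = d (Suc n) (h (Suc n) x)"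
    by (rule resolution_comparison[OF P Q]) blast
  interpret PS: left_module R "P (Suc n)" by (rule p(3))
  interpret Pn: left_module R "P n" by (rule p(3))
  have "d n (h n (d n x)) = d n x" if x: "x \<in> carrier (P (Suc n))" for x
  proof -
    have dx: "d n x \<in> carrier (P n)" by (rule lmod_homD(1)[OF p(4) x])
    have hx: "h n (d n x) \<in> carrier (P (Suc n))" by (rule lmod_homD(1)[OF h dx])
    have "f (Suc n) x = \<zero>\<^bsub>Q (Suc n)\<^esub>"
      using z n lmod_homD(1)[OF f x] unfolding zero_above_def by (metis le_imp_less_Suc singletonD)
    then have "g (Suc n) (f (Suc n) x) = \<zero>\<^bsub>P (Suc n)\<^esub>" using lmod_hom_zero[OF g q(3) p(3)] by simp
    then have e: "x \<ominus>\<^bsub>P (Suc n)\<^esub> h n (d n x) = d (Suc n) (h (Suc n) x)"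
      using eq[OF x] PS.M.diff_zero[OF x] by simp
    have "d n (x \<ominus>\<^bsub>P (Suc n)\<^esub> h n (d n x)) = \<zero>\<^bsub>P n\<^esub>"
      unfolding e by (rule p(10)[OF lmod_homD(1)[OF h x]])
    then have "d n x \<ominus>\<^bsub>P n\<^esub> d n (h n (d n x)) = \<zero>\<^bsub>P n\<^esub>"
      unfolding lmod_hom_minus_distrib[OF p(4) p(3) p(3) x hx] .
    then show ?thesis using Pn.M.diff_eq_zeroD[OF dx lmod_homD(1)[OF p(4) hx]] by simp
  qed
  then show ?thesis unfolding lmod_regular_def using h by blast
qed

text \<open>Vanishing of the cohomology of \<open>Hom\<^sub>R(P, E)\<close> in degree \<open>n + 1\<close>.\<close>

definition hom_exact ::
  "('r, 'y) ring_scheme \<Rightarrow> ('r, 'e) module \<Rightarrow> (nat \<Rightarrow> ('r, 'p) module) \<Rightarrow> (nat \<Rightarrow> 'p \<Rightarrow> 'p) \<Rightarrow> nat \<Rightarrow> bool" where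
  "hom_exact R E P d n \<longleftrightarrow> (\<forall>\<chi> \<in> lmod_hom R (P (Suc n)) E.
     (\<forall>y \<in> carrier (P (Suc (Suc n))). \<chi> (d (Suc n) y) = \<zero>\<^bsub>E\<^esub>) \<longrightarrow>
     (\<exists>\<psi> \<in> lmod_hom R (P n) E. \<forall>x \<in> carrier (P (Suc n)). \<chi> x = \<psi> (d n x)))"

text \<open>Pulled back to \<open>Q\<close>, the cocycle becomes a coboundary. The homotopy identity
  adds only a term \<chi> h d, which factors through the differential as well, and a term that
  \<chi> kills.\<close>

lemma hom_exact_resolution_independent:
  fixes P :: "nat \<Rightarrow> ('r, 'p) module" and Q :: "nat \<Rightarrow> ('r, 'q) module"
  assumes P: "projective_resolution R N P d e" and Q: "projective_resolution R N Q d' e'"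
    and E: "left_module R E" and ex: "hom_exact R E Q d' n"
  shows "hom_exact R E P d n"
  unfolding hom_exact_def
proof (intro ballI impI)
  fix \<chi> assume \<chi>: "\<chi> \<in> lmod_hom R (P (Suc n)) E"
    and co: "\<forall>y \<in> carrier (P (Suc (Suc n))). \<chi> (d (Suc n) y) = \<zero>\<^bsub>E\<^esub>"
  note p = projective_resolutionD[OF P]
  interpret E: left_module R E by fact
  interpret PS: left_module R "P (Suc n)" by (rule p(3))
  obtain f g h where f: "\<And>n. f n \<in> lmod_hom R (P n) (Q n)" and g: "\<And>n. g n \<in> lmod_hom R (Q n) (P n)"
    and h: "\<And>n. h n \<in> lmod_hom R (P n) (P (Suc n))"
    and fd: "\<And>n x. x \<in> carrier (P (Suc n)) \<Longrightarrow> d' n (f (Suc n) x) = f n (d n x)"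
    and gd: "\<And>n x. x \<in> carrier (Q (Suc n)) \<Longrightarrow> d n (g (Suc n) x) = g n (d' n x)"
    and eq: "\<And>n x. x \<in> carrier (P (Suc n)) \<Longrightarrow>
       x \<ominus>\<^bsub>P (Suc n)\<^esub> g (Suc n) (f (Suc n) x) \<ominus>\<^bsub>P (Suc n)\<^esub> h n (d n x) = d (Suc n) (h (Suc n) x)"
    by (rule resolution_comparison[OF P Q]) blast
  have "\<forall>y \<in> carrier (Q (Suc (Suc n))). \<chi> (g (Suc n) (d' (Suc n) y)) = \<zero>\<^bsub>E\<^esub>"
    using co gd[of _ "Suc n"] lmod_homD(1)[OF g] by metis
  then obtain \<psi> where \<psi>: "\<psi> \<in> lmod_hom R (Q n) E"
    "\<And>x. x \<in> carrier (Q (Suc n)) \<Longrightarrow> \<chi> (g (Suc n) x) = \<psi> (d' n x)"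
    using bspec[OF ex[unfolded hom_exact_def] lmod_hom_comp[OF g \<chi>]] by blast
  have "\<chi> x = \<psi> (f n (d n x)) \<oplus>\<^bsub>E\<^esub> \<chi> (h n (d n x))" if x: "x \<in> carrier (P (Suc n))" for x
  proof -
    have gf: "g (Suc n) (f (Suc n) x) \<in> carrier (P (Suc n))"
      by (rule lmod_homD(1)[OF g lmod_homD(1)[OF f x]])
    have hd: "h n (d n x) \<in> carrier (P (Suc n))" by (rule lmod_homD(1)[OF h lmod_homD(1)[OF p(4) x]])
    have "\<chi> (x \<ominus>\<^bsub>P (Suc n)\<^esub> g (Suc n) (f (Suc n) x) \<ominus>\<^bsub>P (Suc n)\<^esub> h n (d n x)) = \<zero>\<^bsub>E\<^esub>"
      unfolding eq[OF x] using co lmod_homD(1)[OF h x] by blast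
    then have "\<chi> x \<ominus>\<^bsub>E\<^esub> \<chi> (g (Suc n) (f (Suc n) x)) \<ominus>\<^bsub>E\<^esub> \<chi> (h n (d n x)) = \<zero>\<^bsub>E\<^esub>"
      using lmod_hom_minus_distrib[OF \<chi> p(3) E] x gf hd by simp
    then have "\<chi> x \<ominus>\<^bsub>E\<^esub> \<chi> (g (Suc n) (f (Suc n) x)) = \<chi> (h n (d n x))"
      using E.M.diff_eq_zeroD lmod_homD(1)[OF \<chi>] x gf hd by (metis E.M.minus_closed)
    then have "\<chi> x = \<chi> (g (Suc n) (f (Suc n) x)) \<oplus>\<^bsub>E\<^esub> \<chi> (h n (d n x))"
      using E.M.add_diff_cancel lmod_homD(1)[OF \<chi>] x gf by metis
    then show ?thesis using \<psi>(2)[OF lmod_homD(1)[OF f x]] fd[OF x] by simp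
  qed
  then show "\<exists>\<psi> \<in> lmod_hom R (P n) E. \<forall>x \<in> carrier (P (Suc n)). \<chi> x = \<psi> (d n x)"
    by (intro bexI[OF _ lmod_hom_add[OF E lmod_hom_comp[OF f \<psi>(1)] lmod_hom_comp[OF h \<chi>]]]) blast
qed

text \<open>With d h d = d, the element x - h (d x) is a cycle, hence a boundary, hence killed by
  the cocycle \<chi>. So \<chi> = \<chi> h d is a coboundary.\<close>

lemma hom_exact_regular:
  assumes P: "\<And>n. left_module R (P n)" and d: "\<And>n. d n \<in> lmod_hom R (P (Suc n)) (P n)"
    and ex: "\<And>y. y \<in> carrier (P (Suc n)) \<Longrightarrow> d n y = \<zero>\<^bsub>P n\<^esub> \<Longrightarrow> y \<in> d (Suc n) ` carrier (P (Suc (Suc n)))"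
    and E: "left_module R E"
    and reg: "lmod_regular R (P (Suc n)) (P n) (d n)"
  shows "hom_exact R E P d n"
  unfolding hom_exact_def
proof (intro ballI impI)
  fix \<chi> assume \<chi>: "\<chi> \<in> lmod_hom R (P (Suc n)) E"
    and co: "\<forall>y \<in> carrier (P (Suc (Suc n))). \<chi> (d (Suc n) y) = \<zero>\<^bsub>E\<^esub>"
  interpret E: left_module R E by fact
  interpret PS: left_module R "P (Suc n)" by (rule P)
  interpret Pn: left_module R "P n" by (rule P)
  obtain h where h: "h \<in> lmod_hom R (P n) (P (Suc n))"
    "\<And>x. x \<in> carrier (P (Suc n)) \<Longrightarrow> d n (h (d n x)) = d n x"
    using reg unfolding lmod_regular_def by blast
  have "\<chi> x = \<chi> (h (d n x))" if x: "x \<in> carrier (P (Suc n))" for x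
  proof -
    have hd: "h (d n x) \<in> carrier (P (Suc n))" by (rule lmod_homD(1)[OF h(1) lmod_homD(1)[OF d x]])
    have "d n (x \<ominus>\<^bsub>P (Suc n)\<^esub> h (d n x)) = \<zero>\<^bsub>P n\<^esub>"
      unfolding lmod_hom_minus_distrib[OF d P P x hd] h(2)[OF x]
      by (rule Pn.M.diff_self[OF lmod_homD(1)[OF d x]])
    then obtain y where "y \<in> carrier (P (Suc (Suc n)))" "x \<ominus>\<^bsub>P (Suc n)\<^esub> h (d n x) = d (Suc n) y"
      using ex[OF PS.M.minus_closed[OF x hd]] by blast
    then have "\<chi> (x \<ominus>\<^bsub>P (Suc n)\<^esub> h (d n x)) = \<zero>\<^bsub>E\<^esub>" using co by simp
    then show ?thesis
      unfolding lmod_hom_minus_distrib[OF \<chi> P E x hd]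
      using E.M.diff_eq_zeroD lmod_homD(1)[OF \<chi>] x hd by metis
  qed
  then show "\<exists>\<psi> \<in> lmod_hom R (P n) E. \<forall>x \<in> carrier (P (Suc n)). \<chi> x = \<psi> (d n x)"
    by (intro bexI[OF _ lmod_hom_comp[OF h(1) \<chi>]]) blast
qed

section \<open>Constructions with projective resolutions\<close>

lemma resolution_iso:
  assumes P: "projective_resolution R N P d e" and P': "\<And>n. left_module R (P' n)"
    and a: "\<And>n. a n \<in> lmod_hom R (P n) (P' n)" and b: "\<And>n. b n \<in> lmod_hom R (P' n) (P n)"
    and ba: "\<And>n x. x \<in> carrier (P n) \<Longrightarrow> b n (a n x) = x"
    and ab: "\<And>n y. y \<in> carrier (P' n) \<Longrightarrow> a n (b n y) = y"
  shows "projective_resolution R N P' (\<lambda>n y. a n (d n (b (Suc n) y))) (\<lambda>y. e (b 0 y))"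
proof -
  note p = projective_resolutionD[OF P]
  have bc: "b n y \<in> carrier (P n)" if "y \<in> carrier (P' n)" for n y by (rule lmod_homD(1)[OF b that])
  have ac: "a n y \<in> carrier (P' n)" if "y \<in> carrier (P n)" for n y by (rule lmod_homD(1)[OF a that])
  have dc: "d n y \<in> carrier (P n)" if "y \<in> carrier (P (Suc n))" for n y by (rule lmod_homD(1)[OF p(4) that])
  have a0: "a n \<zero>\<^bsub>P n\<^esub> = \<zero>\<^bsub>P' n\<^esub>" for n by (rule lmod_hom_zero[OF a p(3) P'])
  show ?thesis
  proof (rule projective_resolutionI)
    show "projective R (P' n)" for n by (rule projective_retract[OF p(2) P' b a ab])
    show "(\<lambda>y. a n (d n (b (Suc n) y))) \<in> lmod_hom R (P' (Suc n)) (P' n)" for n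
      by (rule lmod_hom_comp[OF lmod_hom_comp[OF b p(4)] a])
    show "(\<lambda>y. e (b 0 y)) \<in> lmod_hom R (P' 0) N" by (rule lmod_hom_comp[OF b p(5)])
    fix z assume "z \<in> carrier N"
    then obtain x where "x \<in> carrier (P 0)" "e x = z" using surjE[OF p(6)] by metis
    then show "z \<in> (\<lambda>y. e (b 0 y)) ` carrier (P' 0)" using ac ba by (intro image_eqI[of _ _ "a 0 x"]) auto
  next
    fix x assume "x \<in> carrier (P' (Suc 0))"
    then show "e (b 0 (a 0 (d 0 (b (Suc 0) x)))) = \<zero>\<^bsub>N\<^esub>" using p(9) bc dc by (simp add: ba)
  next
    fix n x assume "x \<in> carrier (P' (Suc (Suc n)))"
    then show "a n (d n (b (Suc n) (a (Suc n) (d (Suc n) (b (Suc (Suc n)) x))))) = \<zero>\<^bsub>P' n\<^esub>"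
      using p(10) bc dc by (simp add: ba a0)
  next
    fix y assume y: "y \<in> carrier (P' 0)" and "e (b 0 y) = \<zero>\<^bsub>N\<^esub>"
    then obtain x where "x \<in> carrier (P (Suc 0))" "d 0 x = b 0 y" using p(11)[OF bc[OF y]] by force
    then show "y \<in> (\<lambda>y. a 0 (d 0 (b (Suc 0) y))) ` carrier (P' (Suc 0))"
      using y ac by (intro image_eqI[of _ _ "a (Suc 0) x"]) (auto simp: ba ab)
  next
    fix n y assume y: "y \<in> carrier (P' (Suc n))" and "a n (d n (b (Suc n) y)) = \<zero>\<^bsub>P' n\<^esub>"
    then have "b n (a n (d n (b (Suc n) y))) = \<zero>\<^bsub>P n\<^esub>" using lmod_hom_zero[OF b P' p(3)] by simp
    then have "d n (b (Suc n) y) = \<zero>\<^bsub>P n\<^esub>" using ba[OF dc[OF bc[OF y]]] by simp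
    then obtain x where "x \<in> carrier (P (Suc (Suc n)))" "d (Suc n) x = b (Suc n) y"
      using p(12)[OF bc[OF y]] by force
    then show "y \<in> (\<lambda>y. a (Suc n) (d (Suc n) (b (Suc (Suc n)) y))) ` carrier (P' (Suc (Suc n)))"
      using y ac by (intro image_eqI[of _ _ "a (Suc (Suc n)) x"]) (auto simp: ba ab)
  qed (rule p(1))
qed

lemma resolution_target:
  assumes P: "projective_resolution R N P d e" and N': "left_module R N'"
    and a: "a \<in> lmod_hom R N N'" and inj: "\<And>x. x \<in> carrier N \<Longrightarrow> a x = \<zero>\<^bsub>N'\<^esub> \<Longrightarrow> x = \<zero>\<^bsub>N\<^esub>"
    and surj: "a ` carrier N = carrier N'"
  shows "projective_resolution R N' P d (\<lambda>x. a (e x))"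
proof -
  note p = projective_resolutionD[OF P]
  show ?thesis
    by (rule projective_resolutionI)
      (use N' p(2,4,9,10,11,12) lmod_hom_comp[OF p(5) a] inj surj p(6) lmod_hom_zero[OF a p(1) N']
        lmod_homD(1)[OF p(5)] in \<open>auto simp: image_image[symmetric] simp del: image_image\<close>)
qed

text \<open>Choosing a preimage in a free module of finite rank for each element embeds
  \<open>N\<close> into the functions on \<open>nat\<close>, and from there into any type that
  receives them injectively.\<close>

lemma fin_gen_inj:
  fixes N :: "('r, 'n) module" and \<iota> :: "(nat \<Rightarrow> 'r) \<Rightarrow> 'q"
  assumes N: "left_module R N" and fg: "fin_gen R N" and \<iota>: "inj \<iota>"
  obtains \<phi> :: "'n \<Rightarrow> 'q" where "inj_on \<phi> (carrier N)"
proof -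
  obtain k p where p: "p ` carrier (fm R k) = carrier N" using fg fin_gen_iff[OF N] by blast
  have "inj_on (\<lambda>x. \<iota> (inv_into (carrier (fm R k)) p x)) (carrier N)"
    using inj_on_inv_into[of "carrier N" p "carrier (fm R k)"] p \<iota> by (auto simp: inj_on_def)
  then show thesis by (rule that)
qed

text \<open>The data behind \<open>has_finite_fg_projective_resolution\<close>, but with the type of
  \<open>P\<close> left free; \<open>resolution_transport\<close> moves between types.\<close>

definition fg_resolution where
  "fg_resolution R N P d e \<longleftrightarrow>
     projective_resolution R N P d e \<and> (\<forall>n. fin_gen R (P n)) \<and> (\<exists>n. zero_above P n)"

text \<open>Each term is finitely generated, so it has a copy in the target type, and the
  differentials are conjugated by the bijections. This is what connects constructions in arbitrary
  types with the fixed types of \<open>fpd\<close> and \<open>projdim\<close>.\<close>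

lemma resolution_transport:
  fixes P :: "nat \<Rightarrow> ('r, 'p) module" and \<iota> :: "(nat \<Rightarrow> 'r) \<Rightarrow> 'q"
  assumes P: "fg_resolution R N P d e" and \<iota>: "inj \<iota>"
  obtains P' :: "nat \<Rightarrow> ('r, 'q) module" and d' e' where "fg_resolution R N P' d' e'"
proof -
  have p1: "projective_resolution R N P d e" and fg: "\<And>n. fin_gen R (P n)"
    using P by (auto simp: fg_resolution_def)
  note p = projective_resolutionD[OF p1]
  have "\<forall>n. \<exists>\<phi> :: 'p \<Rightarrow> 'q. inj_on \<phi> (carrier (P n))" using fin_gen_inj[OF p(3) fg \<iota>] by metis
  then obtain \<phi> :: "nat \<Rightarrow> 'p \<Rightarrow> 'q" where \<phi>: "\<And>n. inj_on (\<phi> n) (carrier (P n))" by metis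
  define P' where "P' n = image_module (\<phi> n) (P n)" for n
  note im = image_module_inj[OF p(3) \<phi>, folded P'_def]
  have "projective_resolution R N P' (\<lambda>n y. \<phi> n (d n (inv_into (carrier (P (Suc n))) (\<phi> (Suc n)) y)))
      (\<lambda>y. e (inv_into (carrier (P 0)) (\<phi> 0) y))"
    by (rule resolution_iso[OF p1 im(1,2,4)])
      (use \<phi> im(3) in \<open>auto simp: f_inv_into_f inv_into_f_f\<close>)
  moreover have "fin_gen R (P' n)" for n by (rule fin_gen_image[OF p(3) im(1) fg im(2,3)])
  moreover have "zero_above P' n" if "zero_above P n" for n
    using that lmod_hom_zero[OF im(2) p(3) im(1)] im(3) unfolding zero_above_def by (metis image_empty image_insert)
  moreover obtain n where "zero_above P n" using P by (auto simp: fg_resolution_def)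
  ultimately have "fg_resolution R N P' (\<lambda>n y. \<phi> n (d n (inv_into (carrier (P (Suc n))) (\<phi> (Suc n)) y)))
      (\<lambda>y. e (inv_into (carrier (P 0)) (\<phi> 0) y))"
    unfolding fg_resolution_def by blast
  then show thesis by (rule that)
qed

lemma zero_submodule:
  assumes "left_module R N"
  shows "submodule {\<zero>\<^bsub>N\<^esub>} R N"
proof -
  interpret left_module R N by fact
  show ?thesis by (rule submoduleI[OF assms]) auto
qed

lemma projective_zero:
  assumes P: "projective R P"
  shows "projective R (submod P {\<zero>\<^bsub>P\<^esub>})" "fin_gen R P \<Longrightarrow> fin_gen R (submod P {\<zero>\<^bsub>P\<^esub>})"
proof -
  interpret left_module R P by (rule projectiveD[OF P])
  note z = left_module_submod[OF left_module_axioms zero_submodule[OF left_module_axioms]]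
  have c: "(\<lambda>x. \<zero>\<^bsub>P\<^esub>) \<in> lmod_hom R P (submod P {\<zero>\<^bsub>P\<^esub>})"
    using lmod_hom_const_zero[OF z, of P] by simp
  show "projective R (submod P {\<zero>\<^bsub>P\<^esub>})"
    by (rule projective_retract[OF P z lmod_hom_restrict[OF _ lmod_hom_id] c]) auto
  show "fin_gen R (submod P {\<zero>\<^bsub>P\<^esub>})" if "fin_gen R P"
    by (rule fin_gen_image[OF left_module_axioms z that c]) auto
qed

text \<open>The map q = 1 - d h is idempotent and kills the image of d, which is the kernel of k,
  while k q = k. Its image is therefore a direct summand that k maps injectively onto the image of
  k.\<close>

lemma regular_complement:
  assumes P: "projective R P" and Q: "left_module R Q" and d: "d \<in> lmod_hom R Q P"
    and reg: "lmod_regular R Q P d" and B: "left_module R B" and k: "k \<in> lmod_hom R P B"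
    and kd: "\<And>y. y \<in> carrier Q \<Longrightarrow> k (d y) = \<zero>\<^bsub>B\<^esub>"
    and ex: "\<And>x. x \<in> carrier P \<Longrightarrow> k x = \<zero>\<^bsub>B\<^esub> \<Longrightarrow> x \<in> d ` carrier Q"
  obtains C where "submodule C R P" "projective R (submod P C)" "k ` C = k ` carrier P"
    "\<And>x. x \<in> C \<Longrightarrow> k x = \<zero>\<^bsub>B\<^esub> \<Longrightarrow> x = \<zero>\<^bsub>P\<^esub>" "fin_gen R P \<Longrightarrow> fin_gen R (submod P C)"
proof -
  interpret P: left_module R P by (rule projectiveD[OF P])
  interpret B: left_module R B by fact
  note Pm = P.left_module_axioms
  obtain h where h: "h \<in> lmod_hom R P Q" "\<And>y. y \<in> carrier Q \<Longrightarrow> d (h (d y)) = d y"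
    using reg unfolding lmod_regular_def by blast
  define q where "q x = x \<ominus>\<^bsub>P\<^esub> d (h x)" for x
  have q: "q \<in> lmod_hom R P P"
    unfolding q_def[abs_def] by (rule lmod_hom_diff[OF Pm lmod_hom_id lmod_hom_comp[OF h(1) d]])
  have dh: "d (h x) \<in> carrier P" if "x \<in> carrier P" for x
    by (rule lmod_homD(1)[OF d lmod_homD(1)[OF h(1) that]])
  have qd: "q (d y) = \<zero>\<^bsub>P\<^esub>" if y: "y \<in> carrier Q" for y
    unfolding q_def h(2)[OF y] by (rule P.M.diff_self[OF lmod_homD(1)[OF d y]])
  have kq: "k (q x) = k x" if x: "x \<in> carrier P" for x
    unfolding q_def lmod_hom_minus_distrib[OF k Pm B x dh[OF x]] kd[OF lmod_homD(1)[OF h(1) x]]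
    by (rule B.M.diff_zero[OF lmod_homD(1)[OF k x]])
  have qq: "q (q x) = q x" if x: "x \<in> carrier P" for x
  proof -
    have "q (q x) = q x \<ominus>\<^bsub>P\<^esub> q (d (h x))"
      using lmod_hom_minus_distrib[OF q Pm Pm x dh[OF x]] by (simp add: q_def)
    then show ?thesis unfolding qd[OF lmod_homD(1)[OF h(1) x]]
      using P.M.diff_zero[OF lmod_homD(1)[OF q x]] by simp
  qed
  let ?C = "q ` carrier P"
  have C: "submodule ?C R P" by (rule lmod_hom_image_submodule[OF q Pm Pm])
  note Cs = submoduleD(1)[OF C]
  note Cm = left_module_submod[OF Pm C]
  have qC: "q \<in> lmod_hom R P (submod P ?C)" using q by (simp add: lmod_hom_submod_iff[OF Cs])
  show thesis
  proof (rule that[OF C])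
    show "projective R (submod P ?C)"
      by (rule projective_retract[OF P Cm lmod_hom_restrict[OF Cs lmod_hom_id] qC]) (auto simp: qq)
    show "k ` ?C = k ` carrier P" by (auto simp: image_image kq cong: image_cong)
    show "fin_gen R (submod P ?C)" if "fin_gen R P" by (rule fin_gen_image[OF Pm Cm that qC]) simp
    fix x assume "x \<in> ?C" and kx: "k x = \<zero>\<^bsub>B\<^esub>"
    then have x: "q x = x" "x \<in> carrier P" using qq Cs by auto
    then show "x = \<zero>\<^bsub>P\<^esub>" using ex[OF x(2) kx] qd by force
  qed
qed

text \<open>The image of \<open>d m\<close> is the kernel of the map out of degree m, so a
  complement of it embeds by that map and can serve as the last term. The cases m = 0 and m > 0
  differ in whether the map out of degree m is the augmentation or a differential.\<close>

lemma truncate_resolution: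
  fixes P :: "nat \<Rightarrow> ('r, 'p) module"
  assumes P: "projective_resolution R N P d e" and reg: "lmod_regular R (P (Suc m)) (P m) (d m)"
  obtains P' :: "nat \<Rightarrow> ('r, 'p) module" and d' e' where "projective_resolution R N P' d' e'"
    "zero_above P' m" "(\<And>n. fin_gen R (P n)) \<Longrightarrow> (\<And>n. fin_gen R (P' n))"
proof -
  note p = projective_resolutionD[OF P]
  \<comment> \<open>Above degree m the zero submodule of \<open>P n\<close> is used, which keeps all
    terms in the type of \<open>P\<close>.\<close>
  define T where "T C n = (if n < m then P n else if n = m then submod (P n) C else submod (P n) {\<zero>\<^bsub>P n\<^esub>})" for C n
  define d' where "d' n = (if n < m then d n else (\<lambda>x. \<zero>\<^bsub>P n\<^esub>))" for n
  have za: "zero_above (T C) m" for C by (auto simp: zero_above_def T_def)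
  have z[simp]: "\<zero>\<^bsub>T C n\<^esub> = \<zero>\<^bsub>P n\<^esub>" for C n by (simp add: T_def)
  have fg: "fin_gen R (T C n)" if "fin_gen R (submod (P m) C)" "\<And>n. fin_gen R (P n)" for C n
    using that projective_zero(2)[OF p(2)] by (auto simp: T_def)
  have pr: "projective R (T C n)" if "projective R (submod (P m) C)" for C n
    using that p(2) projective_zero(1)[OF p(2)] by (auto simp: T_def)
  have d'h: "d' n \<in> lmod_hom R (T C (Suc n)) (T C n)" if C: "submodule C R (P m)" for C n
  proof -
    consider "Suc n < m" | "Suc n = m" | "m \<le> n" by linarith
    then show ?thesis
    proof cases
      case 1 then show ?thesis using p(4) by (simp add: d'_def T_def)
    next
      case 2
      then show ?thesis using lmod_hom_restrict[OF _ p(4)[of n]] submoduleD(1)[OF C]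
        by (auto simp: d'_def T_def)
    next
      case 3
      have "left_module R (T C n)"
        using left_module_submod[OF p(3) C] left_module_submod[OF p(3) zero_submodule[OF p(3)]] p(3)
        by (auto simp: T_def)
      then show ?thesis using lmod_hom_const_zero[of R "T C n"] 3 by (simp add: d'_def)
    qed
  qed
  show thesis
  proof (cases m)
    case 0
    obtain C where C: "submodule C R (P 0)" "projective R (submod (P 0) C)" "e ` C = e ` carrier (P 0)"
      "\<And>x. x \<in> C \<Longrightarrow> e x = \<zero>\<^bsub>N\<^esub> \<Longrightarrow> x = \<zero>\<^bsub>P 0\<^esub>" "fin_gen R (P 0) \<Longrightarrow> fin_gen R (submod (P 0) C)"
      by (rule regular_complement[OF p(2) p(3) p(4) reg[unfolded 0] p(1) p(5) p(9) p(11)]) (assumption | blast)+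
    have "projective_resolution R N (T C) d' e"
    proof (rule projective_resolutionI[OF p(1)])
      show "e \<in> lmod_hom R (T C 0) N"
        using lmod_hom_restrict[OF submoduleD(1)[OF C(1)] p(5)] by (simp add: T_def 0)
      show "x \<in> carrier (T C (Suc 0)) \<Longrightarrow> e (d' 0 x) = \<zero>\<^bsub>N\<^esub>" for x
        using lmod_hom_zero[OF p(5) p(3) p(1)] by (simp add: d'_def 0)
      show "x \<in> e ` carrier (T C 0)" if "x \<in> carrier N" for x using that C(3) p(6) by (simp add: T_def 0)
      show "y \<in> carrier (T C 0) \<Longrightarrow> e y = \<zero>\<^bsub>N\<^esub> \<Longrightarrow> y \<in> d' 0 ` carrier (T C (Suc 0))" for y
        using C(4)[of y] by (simp add: T_def 0 d'_def)
    qed (use pr C d'h 0 in \<open>auto simp: d'_def T_def\<close>)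
    moreover have "\<And>n. fin_gen R (T C n)" if "\<And>n. fin_gen R (P n)" using fg C(5) that 0 by auto
    ultimately show thesis using that[OF _ za] by metis
  next
    case (Suc l)
    obtain C where C: "submodule C R (P m)" "projective R (submod (P m) C)" "d l ` C = d l ` carrier (P m)"
      "\<And>x. x \<in> C \<Longrightarrow> d l x = \<zero>\<^bsub>P l\<^esub> \<Longrightarrow> x = \<zero>\<^bsub>P m\<^esub>" "fin_gen R (P m) \<Longrightarrow> fin_gen R (submod (P m) C)"
      unfolding Suc
      by (rule regular_complement[OF p(2) p(3) p(4) reg[unfolded Suc] p(3) p(4) p(10) p(12)]) (assumption | blast)+
    have Cs: "C \<subseteq> carrier (P (Suc l))" using submoduleD(1)[OF C(1)] Suc by simp
    have "projective_resolution R N (T C) d' e"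
    proof (rule projective_resolutionI[OF p(1)])
      show "e \<in> lmod_hom R (T C 0) N" "x \<in> carrier N \<Longrightarrow> x \<in> e ` carrier (T C 0)" for x
        using p(5,6) by (auto simp: T_def Suc)
      show "x \<in> carrier (T C (Suc 0)) \<Longrightarrow> e (d' 0 x) = \<zero>\<^bsub>N\<^esub>" for x
        using p(9)[of x] Cs by (auto simp: T_def d'_def Suc split: if_splits)
      show "d' n (d' (Suc n) x) = \<zero>\<^bsub>T C n\<^esub>" if x: "x \<in> carrier (T C (Suc (Suc n)))" for n x
      proof -
        have "x \<in> carrier (P (Suc (Suc n)))"
          using x Cs submoduleD(2)[OF zero_submodule[OF p(3)]] submoduleD(1)[OF zero_submodule[OF p(3)]]
          by (auto simp: T_def Suc split: if_splits)
        then show ?thesis using p(10) lmod_hom_zero[OF p(4)[of n] p(3) p(3)] by (simp add: d'_def)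
      qed
      show "y \<in> d' 0 ` carrier (T C (Suc 0))" if y: "y \<in> carrier (T C 0)" "e y = \<zero>\<^bsub>N\<^esub>" for y
      proof -
        have "y \<in> d 0 ` carrier (P (Suc 0))" using p(11) y by (simp add: T_def Suc)
        then show ?thesis using C(3) by (cases "l = 0") (simp_all add: T_def Suc d'_def)
      qed
      show "y \<in> d' (Suc n) ` carrier (T C (Suc (Suc n)))"
        if y: "y \<in> carrier (T C (Suc n))" "d' n y = \<zero>\<^bsub>T C n\<^esub>" for n y
      proof -
        consider "n < l" "Suc n \<noteq> l" | "n < l" "Suc n = l" | "n = l" | "n > l" by linarith
        then show ?thesis
        proof cases
          case 1 then show ?thesis using p(12) y by (simp add: T_def Suc d'_def)
        next
          case 2 then show ?thesis using p(12)[of y n] y C(3) by (auto simp: T_def Suc d'_def)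
        next
          case 3 then show ?thesis using C(4)[of y] y by (simp add: T_def Suc d'_def)
        next
          case 4 then show ?thesis using y by (simp add: T_def Suc d'_def)
        qed
      qed
    qed (use pr C(1,2) d'h in auto)
    moreover have "\<And>n. fin_gen R (T C n)" if "\<And>n. fin_gen R (P n)" using fg C(5) that by auto
    ultimately show thesis using that[OF _ za] by metis
  qed
qed

section \<open>Direct sums of resolutions and mapping cones\<close>

lemma sum_resolution:
  assumes P: "projective_resolution R N P d e" and Q: "projective_resolution R N' Q d' e'"
  shows "projective_resolution R (pair_module N N') (\<lambda>n. pair_module (P n) (Q n))
    (\<lambda>n z. (d n (fst z), d' n (snd z))) (\<lambda>z. (e (fst z), e' (snd z)))"
proof -
  note p = projective_resolutionD[OF P] and q = projective_resolutionD[OF Q]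
  show ?thesis
  proof (rule projective_resolutionI)
    show "z \<in> (\<lambda>z. (e (fst z), e' (snd z))) ` carrier (pair_module (P 0) (Q 0))"
      if "z \<in> carrier (pair_module N N')" for z
      using that p(6) q(6) by force
    show "y \<in> (\<lambda>z. (d 0 (fst z), d' 0 (snd z))) ` carrier (pair_module (P (Suc 0)) (Q (Suc 0)))"
      if "y \<in> carrier (pair_module (P 0) (Q 0))" "(e (fst y), e' (snd y)) = \<zero>\<^bsub>pair_module N N'\<^esub>" for y
      using that p(11)[of "fst y"] q(11)[of "snd y"] by force
    show "y \<in> (\<lambda>z. (d (Suc n) (fst z), d' (Suc n) (snd z))) ` carrier (pair_module (P (Suc (Suc n))) (Q (Suc (Suc n))))"
      if "y \<in> carrier (pair_module (P (Suc n)) (Q (Suc n)))"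
        "(d n (fst y), d' n (snd y)) = \<zero>\<^bsub>pair_module (P n) (Q n)\<^esub>" for n y
      using that p(12)[of "fst y" n] q(12)[of "snd y" n] by force
    show "(\<lambda>z. (e (fst z), e' (snd z))) \<in> lmod_hom R (pair_module (P 0) (Q 0)) (pair_module N N')"
      by (rule lmod_hom_Pair[OF lmod_hom_comp[OF lmod_hom_fst p(5)] lmod_hom_comp[OF lmod_hom_snd q(5)]])
    show "(\<lambda>z. (d n (fst z), d' n (snd z))) \<in>
        lmod_hom R (pair_module (P (Suc n)) (Q (Suc n))) (pair_module (P n) (Q n))" for n
      by (rule lmod_hom_Pair[OF lmod_hom_comp[OF lmod_hom_fst p(4)] lmod_hom_comp[OF lmod_hom_snd q(4)]])
  qed (use p(9,10) q(9,10) in \<open>auto intro: left_module_pair p(1) q(1) projective_pair p(2) q(2)\<close>)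
qed

lemma hom_exact_sum:
  assumes P: "projective_resolution R N P d e" and Q: "projective_resolution R N' Q d' e'"
    and E: "left_module R E" and eP: "hom_exact R E P d n" and eQ: "hom_exact R E Q d' n"
  shows "hom_exact R E (\<lambda>n. pair_module (P n) (Q n)) (\<lambda>n z. (d n (fst z), d' n (snd z))) n"
  unfolding hom_exact_def
proof (intro ballI impI)
  note p = projective_resolutionD[OF P] and q = projective_resolutionD[OF Q]
  fix \<chi> assume \<chi>: "\<chi> \<in> lmod_hom R (pair_module (P (Suc n)) (Q (Suc n))) E"
    and co: "\<forall>y \<in> carrier (pair_module (P (Suc (Suc n))) (Q (Suc (Suc n)))).
      \<chi> (d (Suc n) (fst y), d' (Suc n) (snd y)) = \<zero>\<^bsub>E\<^esub>"
  interpret P1: left_module R "P (Suc n)" by (rule p(3))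
  interpret Q1: left_module R "Q (Suc n)" by (rule q(3))
  interpret P2: left_module R "P (Suc (Suc n))" by (rule p(3))
  interpret Q2: left_module R "Q (Suc (Suc n))" by (rule q(3))
  have z: "d (Suc n) \<zero>\<^bsub>P (Suc (Suc n))\<^esub> = \<zero>\<^bsub>P (Suc n)\<^esub>" "d' (Suc n) \<zero>\<^bsub>Q (Suc (Suc n))\<^esub> = \<zero>\<^bsub>Q (Suc n)\<^esub>"
    using lmod_hom_zero[OF p(4) p(3) p(3)] lmod_hom_zero[OF q(4) q(3) q(3)] by auto
  have "\<chi> (d (Suc n) y, \<zero>\<^bsub>Q (Suc n)\<^esub>) = \<zero>\<^bsub>E\<^esub>" if "y \<in> carrier (P (Suc (Suc n)))" for y
    using bspec[OF co, of "(y, \<zero>\<^bsub>Q (Suc (Suc n))\<^esub>)"] that z by simp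
  then obtain a where a: "a \<in> lmod_hom R (P n) E" "\<And>x. x \<in> carrier (P (Suc n)) \<Longrightarrow> \<chi> (x, \<zero>\<^bsub>Q (Suc n)\<^esub>) = a (d n x)"
    using bspec[OF eP[unfolded hom_exact_def] lmod_hom_comp[OF lmod_hom_inl[OF q(3)] \<chi>]] by blast
  have "\<chi> (\<zero>\<^bsub>P (Suc n)\<^esub>, d' (Suc n) y) = \<zero>\<^bsub>E\<^esub>" if "y \<in> carrier (Q (Suc (Suc n)))" for y
    using bspec[OF co, of "(\<zero>\<^bsub>P (Suc (Suc n))\<^esub>, y)"] that z by simp
  then obtain b where b: "b \<in> lmod_hom R (Q n) E" "\<And>x. x \<in> carrier (Q (Suc n)) \<Longrightarrow> \<chi> (\<zero>\<^bsub>P (Suc n)\<^esub>, x) = b (d' n x)"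
    using bspec[OF eQ[unfolded hom_exact_def] lmod_hom_comp[OF lmod_hom_inr[OF p(3)] \<chi>]] by blast
  have "\<chi> x = a (d n (fst x)) \<oplus>\<^bsub>E\<^esub> b (d' n (snd x))" if x: "x \<in> carrier (pair_module (P (Suc n)) (Q (Suc n)))" for x
    using lmod_homD(2)[OF \<chi>, of "(fst x, \<zero>\<^bsub>Q (Suc n)\<^esub>)" "(\<zero>\<^bsub>P (Suc n)\<^esub>, snd x)"] x a(2) b(2) by auto
  then show "\<exists>\<psi> \<in> lmod_hom R (pair_module (P n) (Q n)) E.
      \<forall>x \<in> carrier (pair_module (P (Suc n)) (Q (Suc n))). \<chi> x = \<psi> (d n (fst x), d' n (snd x))"
    by (intro bexI[OF _ lmod_hom_add[OF E lmod_hom_comp[OF lmod_hom_fst a(1)] lmod_hom_comp[OF lmod_hom_snd b(1)]]]) simp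
qed

text \<open>The mapping cone of a lift of \<open>\<iota>\<close> resolves the cokernel of \<open>\<iota>\<close>.\<close>

lemma cone_resolution:
  fixes K :: "('r, 'k) module" and L :: "('r, 'l) module" and Y :: "('r, 'y) module"
    and P :: "nat \<Rightarrow> ('r, 'p) module" and Q :: "nat \<Rightarrow> ('r, 'q) module" and E :: "('r, 'e) module"
  assumes P: "projective_resolution R K P d e" and Q: "projective_resolution R L Q d' e'"
    and Y: "left_module R Y" and \<iota>: "\<iota> \<in> lmod_hom R K L"
    and inj: "\<And>x. x \<in> carrier K \<Longrightarrow> \<iota> x = \<zero>\<^bsub>L\<^esub> \<Longrightarrow> x = \<zero>\<^bsub>K\<^esub>"
    and \<pi>: "\<pi> \<in> lmod_hom R L Y" "\<pi> ` carrier L = carrier Y"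
    and \<pi>\<iota>: "\<And>x. x \<in> carrier K \<Longrightarrow> \<pi> (\<iota> x) = \<zero>\<^bsub>Y\<^esub>"
    and ex: "\<And>x. x \<in> carrier L \<Longrightarrow> \<pi> x = \<zero>\<^bsub>Y\<^esub> \<Longrightarrow> x \<in> \<iota> ` carrier K"
    and E: "left_module R E"
  obtains C :: "nat \<Rightarrow> ('r, 'q \<times> 'p) module" and dC eC where
    "projective_resolution R Y C dC eC"
    "(\<And>n. fin_gen R (P n)) \<Longrightarrow> (\<And>n. fin_gen R (Q n)) \<Longrightarrow> (\<And>n. fin_gen R (C n))"
    "\<And>n. zero_above P n \<Longrightarrow> zero_above Q n \<Longrightarrow> zero_above C (Suc n)"
    "\<And>n. hom_exact R E Q d' n \<Longrightarrow> hom_exact R E C dC (Suc n) \<Longrightarrow> hom_exact R E P d n"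
    "\<And>g. hom_exact R E C dC 0 \<Longrightarrow> g \<in> lmod_hom R K E \<Longrightarrow>
       \<exists>g' \<in> lmod_hom R L E. \<forall>x \<in> carrier K. g' (\<iota> x) = g x"
proof -
  note p = projective_resolutionD[OF P] and q = projective_resolutionD[OF Q]
  obtain f where f: "\<And>n. f n \<in> lmod_hom R (P n) (Q n)" "\<And>x. x \<in> carrier (P 0) \<Longrightarrow> e' (f 0 x) = \<iota> (e x)"
    "\<And>n x. x \<in> carrier (P (Suc n)) \<Longrightarrow> d' n (f (Suc n) x) = f n (d n x)"
    by (rule chain_map_lift[OF P Q \<iota>]) blast
  interpret E: left_module R E by fact
  interpret L: left_module R L by (rule q(1))
  interpret Pm: left_module R "P n" for n by (rule p(3))
  interpret Qm: left_module R "Q n" for n by (rule q(3))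
  have dc: "d n y \<in> carrier (P n)" if "y \<in> carrier (P (Suc n))" for n y by (rule lmod_homD(1)[OF p(4) that])
  have d'c: "d' n y \<in> carrier (Q n)" if "y \<in> carrier (Q (Suc n))" for n y by (rule lmod_homD(1)[OF q(4) that])
  have fc: "f n y \<in> carrier (Q n)" if "y \<in> carrier (P n)" for n y by (rule lmod_homD(1)[OF f(1) that])
  \<comment> \<open>The \<open>P\<close>-part of the cone, shifted up by one degree; in degree 0 it
    is a zero module in the type of \<open>P\<close>.\<close>
  define Z where "Z n = (case n of 0 \<Rightarrow> submod (P 0) {\<zero>\<^bsub>P 0\<^esub>} | Suc m \<Rightarrow> P m)" for n
  \<comment> \<open>The sign makes the cone a complex: the two terms through the chain map f cancel
    in the square of the differential.\<close>
  define s where "s n y = (case n of 0 \<Rightarrow> \<zero>\<^bsub>P 0\<^esub> | Suc m \<Rightarrow> \<ominus>\<^bsub>P m\<^esub> d m y)" for n y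
  define C where "C n = pair_module (Q n) (Z n)" for n
  define dC where "dC n z = (d' n (fst z) \<oplus>\<^bsub>Q n\<^esub> f n (snd z), s n (snd z))" for n z
  define eC where "eC z = \<pi> (e' (fst z))" for z :: "'q \<times> 'p"
  have Z0: "Z 0 = submod (P 0) {\<zero>\<^bsub>P 0\<^esub>}" and ZS[simp]: "Z (Suc n) = P n" for n by (simp_all add: Z_def)
  have s0[simp]: "s 0 y = \<zero>\<^bsub>P 0\<^esub>" and sS[simp]: "s (Suc n) y = \<ominus>\<^bsub>P n\<^esub> d n y" for n y by (simp_all add: s_def)
  have Zp: "projective R (Z n)" for n
    by (cases n) (simp_all add: Z0 projective_zero(1) p(2))
  have s: "s n \<in> lmod_hom R (P n) (Z n)" for n
  proof (cases n)
    case 0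
    show ?thesis
      using lmod_hom_const_zero[OF projectiveD[OF Zp[of 0]], of "P 0"] unfolding 0 s_def by (simp add: Z0)
  next
    case (Suc m)
    show ?thesis using lmod_hom_uminus[OF p(3) p(4)[of m]] unfolding Suc s_def by simp
  qed
  interpret Zm: left_module R "Z n" for n by (rule projectiveD[OF Zp])
  have sd: "s n (d n y) = \<zero>\<^bsub>Z n\<^esub>" if "y \<in> carrier (P (Suc n))" for n y
    using that p(10) by (cases n) (simp_all add: Z0)
  have res: "projective_resolution R Y C dC eC"
  proof (rule projective_resolutionI)
    show "projective R (C n)" for n unfolding C_def by (rule projective_pair[OF q(2) Zp])
    show "dC n \<in> lmod_hom R (C (Suc n)) (C n)" for n
      unfolding C_def dC_def[abs_def] ZS
      by (rule lmod_hom_Pair[OF lmod_hom_add[OF q(3) lmod_hom_comp[OF lmod_hom_fst q(4)]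
            lmod_hom_comp[OF lmod_hom_snd f(1)]] lmod_hom_comp[OF lmod_hom_snd s]])
    show "eC \<in> lmod_hom R (C 0) Y"
      unfolding C_def eC_def[abs_def] by (rule lmod_hom_comp[OF lmod_hom_comp[OF lmod_hom_fst q(5)] \<pi>(1)])
    show "z \<in> eC ` carrier (C 0)" if "z \<in> carrier Y" for z
    proof -
      obtain x where x: "x \<in> carrier L" "\<pi> x = z" using surjE[OF \<pi>(2) \<open>z \<in> carrier Y\<close>] by metis
      obtain u where u: "u \<in> carrier (Q 0)" "e' u = x" using surjE[OF q(6) x(1)] by metis
      show ?thesis by (rule image_eqI[of _ _ "(u, \<zero>\<^bsub>P 0\<^esub>)"]) (use x u in \<open>auto simp: eC_def C_def Z0\<close>)
    qed
    show "eC (dC 0 x) = \<zero>\<^bsub>Y\<^esub>" if x: "x \<in> carrier (C (Suc 0))" for x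
    proof -
      have c: "fst x \<in> carrier (Q (Suc 0))" "snd x \<in> carrier (P 0)" using x by (auto simp: C_def)
      have ec: "e (snd x) \<in> carrier K" by (rule lmod_homD(1)[OF p(5) c(2)])
      have "e' (d' 0 (fst x) \<oplus>\<^bsub>Q 0\<^esub> f 0 (snd x)) = \<iota> (e (snd x))"
        unfolding lmod_homD(2)[OF q(5) d'c[OF c(1)] fc[OF c(2)]] f(2)[OF c(2)] q(9)[OF c(1)]
        using lmod_homD(1)[OF \<iota> ec] by simp
      then show ?thesis using \<pi>\<iota>[OF ec] by (simp add: eC_def dC_def)
    qed
    show "dC n (dC (Suc n) x) = \<zero>\<^bsub>C n\<^esub>" if x: "x \<in> carrier (C (Suc (Suc n)))" for n x
    proof -
      have c: "fst x \<in> carrier (Q (Suc (Suc n)))" "snd x \<in> carrier (P (Suc n))" using x by (auto simp: C_def)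
      note dx = dc[OF c(2)]
      have "d' n (d' (Suc n) (fst x) \<oplus>\<^bsub>Q (Suc n)\<^esub> f (Suc n) (snd x)) \<oplus>\<^bsub>Q n\<^esub> f n (\<ominus>\<^bsub>P n\<^esub> d n (snd x)) = \<zero>\<^bsub>Q n\<^esub>"
        unfolding lmod_homD(2)[OF q(4) d'c[OF c(1)] fc[OF c(2)]] q(10)[OF c(1)] f(3)[OF c(2)]
          lmod_hom_minus[OF f(1) p(3) q(3) dx] using fc[OF dx] by (simp add: Qm.M.r_neg)
      moreover have "s n (\<ominus>\<^bsub>P n\<^esub> d n (snd x)) = \<zero>\<^bsub>Z n\<^esub>"
        unfolding lmod_hom_minus[OF s p(3) projectiveD[OF Zp] dx] sd[OF c(2)]
        using Zm.M.zero_minus .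
      ultimately show ?thesis by (simp add: dC_def C_def)
    qed
    show "y \<in> dC 0 ` carrier (C (Suc 0))" if y: "y \<in> carrier (C 0)" "eC y = \<zero>\<^bsub>Y\<^esub>" for y
    proof -
      have c: "fst y \<in> carrier (Q 0)" "snd y = \<zero>\<^bsub>P 0\<^esub>" using y by (auto simp: C_def Z0)
      obtain k where k: "k \<in> carrier K" "e' (fst y) = \<iota> k"
        using ex[OF lmod_homD(1)[OF q(5) c(1)]] y(2) by (auto simp: eC_def)
      obtain u where u: "u \<in> carrier (P 0)" "e u = k" using surjE[OF p(6) k(1)] by metis
      have "e' (fst y \<ominus>\<^bsub>Q 0\<^esub> f 0 u) = \<zero>\<^bsub>L\<^esub>"
        unfolding lmod_hom_minus_distrib[OF q(5) q(3) q(1) c(1) fc[OF u(1)]] f(2)[OF u(1)] k(2) u(2)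
        by (rule L.M.diff_self[OF lmod_homD(1)[OF \<iota> k(1)]])
      then obtain x where x: "x \<in> carrier (Q (Suc 0))" "d' 0 x = fst y \<ominus>\<^bsub>Q 0\<^esub> f 0 u"
        using q(11)[OF Qm.M.minus_closed[OF c(1) fc[OF u(1)]]] by force
      show ?thesis
        by (rule image_eqI[of _ _ "(x, u)"])
          (use x u c Qm.M.diff_add_cancel'[OF c(1) fc[OF u(1)]] in \<open>auto simp: dC_def C_def prod_eq_iff\<close>)
    qed
    show "y \<in> dC (Suc n) ` carrier (C (Suc (Suc n)))"
      if y: "y \<in> carrier (C (Suc n))" "dC n y = \<zero>\<^bsub>C n\<^esub>" for n y
    proof -
      have c: "fst y \<in> carrier (Q (Suc n))" "snd y \<in> carrier (P n)" using y by (auto simp: C_def)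
      have eq: "d' n (fst y) \<oplus>\<^bsub>Q n\<^esub> f n (snd y) = \<zero>\<^bsub>Q n\<^esub>" "s n (snd y) = \<zero>\<^bsub>Z n\<^esub>"
        using y(2) by (auto simp: dC_def C_def)
      have "snd y \<in> d n ` carrier (P (Suc n))"
      proof (cases n)
        case 0
        have c0: "fst y \<in> carrier (Q (Suc 0))" "snd y \<in> carrier (P 0)" using c 0 by auto
        have ec: "e (snd y) \<in> carrier K" by (rule lmod_homD(1)[OF p(5) c0(2)])
        have "e' (d' 0 (fst y) \<oplus>\<^bsub>Q 0\<^esub> f 0 (snd y)) = \<iota> (e (snd y))"
          unfolding lmod_homD(2)[OF q(5) d'c[OF c0(1)] fc[OF c0(2)]] f(2)[OF c0(2)] q(9)[OF c0(1)]
          using lmod_homD(1)[OF \<iota> ec] by simp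
        then have "\<iota> (e (snd y)) = \<zero>\<^bsub>L\<^esub>" using eq(1) lmod_hom_zero[OF q(5) q(3) q(1)] 0 by simp
        then show ?thesis using p(11)[OF c0(2)] inj[OF ec] 0 by simp
      next
        case (Suc m)
        then have cm: "snd y \<in> carrier (P (Suc m))" using c by simp
        have "\<ominus>\<^bsub>P m\<^esub> d m (snd y) = \<zero>\<^bsub>P m\<^esub>" using eq(2) Suc by simp
        then have "d m (snd y) = \<zero>\<^bsub>P m\<^esub>" using dc[OF cm] by (metis Pm.M.minus_minus Pm.M.zero_minus)
        then show ?thesis using p(12)[OF cm] Suc by simp
      qed
      then obtain v where v: "v \<in> carrier (P (Suc n))" "d n v = snd y" by force
      define u where "u = \<ominus>\<^bsub>P (Suc n)\<^esub> v"
      have u: "u \<in> carrier (P (Suc n))" "\<ominus>\<^bsub>P n\<^esub> d n u = snd y" "d n u = \<ominus>\<^bsub>P n\<^esub> snd y"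
        using v lmod_hom_minus[OF p(4) p(3) p(3) v(1)] c(2) by (simp_all add: u_def)
      have "d' n (fst y \<ominus>\<^bsub>Q (Suc n)\<^esub> f (Suc n) u) = \<zero>\<^bsub>Q n\<^esub>"
        unfolding lmod_hom_minus_distrib[OF q(4) q(3) q(3) c(1) fc[OF u(1)]] f(3)[OF u(1)] u(3)
          lmod_hom_minus[OF f(1) p(3) q(3) c(2)]
        using eq(1) d'c[OF c(1)] fc[OF c(2)] by (simp add: a_minus_def)
      then obtain x where x: "x \<in> carrier (Q (Suc (Suc n)))" "d' (Suc n) x = fst y \<ominus>\<^bsub>Q (Suc n)\<^esub> f (Suc n) u"
        using q(12)[OF Qm.M.minus_closed[OF c(1) fc[OF u(1)]]] by force
      show ?thesis
        by (rule image_eqI[of _ _ "(x, u)"])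
          (use x u c Qm.M.diff_add_cancel'[OF c(1) fc[OF u(1)]] in \<open>auto simp: dC_def C_def prod_eq_iff\<close>)
    qed
  qed (rule Y)
  have fg: "fin_gen R (C n)" if "\<And>n. fin_gen R (P n)" "\<And>n. fin_gen R (Q n)" for n
    unfolding C_def
    by (rule fin_gen_pair[OF q(3) projectiveD[OF Zp] that(2)])
      (use that(1) projective_zero(2)[OF p(2)] in \<open>cases n, auto simp: Z0\<close>)
  have za: "zero_above C (Suc n)" if "zero_above P n" "zero_above Q n" for n
    unfolding zero_above_def
  proof (intro allI impI)
    fix k assume "Suc n < k"
    then obtain m where "k = Suc m" "m > n" by (cases k) auto
    then show "carrier (C k) = {\<zero>\<^bsub>C k\<^esub>}" using that by (auto simp: zero_above_def C_def)
  qed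
  \<comment> \<open>Part of the long exact sequence: if
    \<open>Ext\<^sup>n\<^sup>+\<^sup>1(L, E)\<close> and
    \<open>Ext\<^sup>n\<^sup>+\<^sup>2(Y, E)\<close> vanish, so does
    \<open>Ext\<^sup>n\<^sup>+\<^sup>1(K, E)\<close>. A cocycle on \<open>P\<close> becomes one on
    the cone by composing with the projection.\<close>
  have up: "hom_exact R E P d n" if hQ: "hom_exact R E Q d' n" and hC: "hom_exact R E C dC (Suc n)" for n
    unfolding hom_exact_def
  proof (intro ballI impI)
    fix \<chi> assume \<chi>: "\<chi> \<in> lmod_hom R (P (Suc n)) E"
      and co: "\<forall>y \<in> carrier (P (Suc (Suc n))). \<chi> (d (Suc n) y) = \<zero>\<^bsub>E\<^esub>"
    have \<chi>C: "(\<lambda>z. \<chi> (snd z)) \<in> lmod_hom R (C (Suc (Suc n))) E"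
      unfolding C_def ZS by (rule lmod_hom_comp[OF lmod_hom_snd \<chi>])
    have "\<chi> (\<ominus>\<^bsub>P (Suc n)\<^esub> d (Suc n) y) = \<zero>\<^bsub>E\<^esub>" if "y \<in> carrier (P (Suc (Suc n)))" for y
      using lmod_hom_minus[OF \<chi> p(3) E dc[OF that]] co that by simp
    then obtain \<psi> where \<psi>: "\<psi> \<in> lmod_hom R (C (Suc n)) E"
      "\<And>z. z \<in> carrier (C (Suc (Suc n))) \<Longrightarrow> \<chi> (snd z) = \<psi> (dC (Suc n) z)"
      using bspec[OF hC[unfolded hom_exact_def] \<chi>C] by (auto simp: dC_def C_def)
    define \<psi>1 where "\<psi>1 x = \<psi> (x, \<zero>\<^bsub>P n\<^esub>)" for x
    define \<psi>2 where "\<psi>2 x = \<psi> (\<zero>\<^bsub>Q (Suc n)\<^esub>, x)" for x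
    have \<psi>1: "\<psi>1 \<in> lmod_hom R (Q (Suc n)) E" and \<psi>2: "\<psi>2 \<in> lmod_hom R (P n) E"
      unfolding \<psi>1_def[abs_def] \<psi>2_def[abs_def]
      using lmod_hom_comp[OF lmod_hom_inl[OF p(3)[of n]] \<psi>(1)[unfolded C_def ZS]]
        lmod_hom_comp[OF lmod_hom_inr[OF q(3)[of "Suc n"]] \<psi>(1)[unfolded C_def ZS]] by auto
    have \<psi>12: "\<psi> (x, y) = \<psi>1 x \<oplus>\<^bsub>E\<^esub> \<psi>2 y" if "x \<in> carrier (Q (Suc n))" "y \<in> carrier (P n)" for x y
      using lmod_homD(2)[OF \<psi>(1), of "(x, \<zero>\<^bsub>P n\<^esub>)" "(\<zero>\<^bsub>Q (Suc n)\<^esub>, y)"] that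
      by (simp add: C_def \<psi>1_def \<psi>2_def)
    have "\<psi>1 (d' (Suc n) x) = \<zero>\<^bsub>E\<^esub>" if x: "x \<in> carrier (Q (Suc (Suc n)))" for x
      using \<psi>(2)[of "(x, \<zero>\<^bsub>P (Suc n)\<^esub>)"] x lmod_hom_zero[OF f(1) p(3) q(3)] lmod_hom_zero[OF p(4) p(3) p(3)]
        lmod_hom_zero[OF \<chi> p(3) E] d'c[OF x] by (simp add: C_def dC_def \<psi>1_def Pm.M.zero_minus)
    then obtain \<theta> where \<theta>: "\<theta> \<in> lmod_hom R (Q n) E" "\<And>x. x \<in> carrier (Q (Suc n)) \<Longrightarrow> \<psi>1 x = \<theta> (d' n x)"
      using bspec[OF hQ[unfolded hom_exact_def] \<psi>1] by blast
    have "\<chi> y = \<theta> (f n (d n y)) \<ominus>\<^bsub>E\<^esub> \<psi>2 (d n y)" if y: "y \<in> carrier (P (Suc n))" for y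
    proof -
      have "\<chi> y = \<psi> (f (Suc n) y, \<ominus>\<^bsub>P n\<^esub> d n y)"
        using \<psi>(2)[of "(\<zero>\<^bsub>Q (Suc (Suc n))\<^esub>, y)"] y lmod_hom_zero[OF q(4) q(3) q(3)] fc[OF y]
        by (simp add: C_def dC_def)
      also have "\<dots> = \<theta> (d' n (f (Suc n) y)) \<oplus>\<^bsub>E\<^esub> \<psi>2 (\<ominus>\<^bsub>P n\<^esub> d n y)"
        using \<psi>12[OF fc[OF y], of "\<ominus>\<^bsub>P n\<^esub> d n y"] dc[OF y] \<theta>(2)[OF fc[OF y]] by simp
      also have "\<dots> = \<theta> (f n (d n y)) \<ominus>\<^bsub>E\<^esub> \<psi>2 (d n y)"
        unfolding f(3)[OF y] lmod_hom_minus[OF \<psi>2 p(3) E dc[OF y]] by (simp add: a_minus_def)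
      finally show ?thesis .
    qed
    then show "\<exists>\<psi> \<in> lmod_hom R (P n) E. \<forall>x \<in> carrier (P (Suc n)). \<chi> x = \<psi> (d n x)"
      by (intro bexI[OF _ lmod_hom_diff[OF E lmod_hom_comp[OF f(1) \<theta>(1)] \<psi>2]]) blast
  qed
  \<comment> \<open>The low end of the same sequence: if \<open>Ext\<^sup>1(Y, E)\<close> vanishes,
    every map from \<open>K\<close> to \<open>E\<close> extends along \<iota> to
    \<open>L\<close>.\<close>
  have ext: "\<exists>g' \<in> lmod_hom R L E. \<forall>x \<in> carrier K. g' (\<iota> x) = g x"
    if hC: "hom_exact R E C dC 0" and g: "g \<in> lmod_hom R K E" for g
  proof -
    have gC: "(\<lambda>z. g (e (snd z))) \<in> lmod_hom R (C (Suc 0)) E"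
      unfolding C_def ZS by (rule lmod_hom_comp[OF lmod_hom_snd lmod_hom_comp[OF p(5) g]])
    have "g (e (\<ominus>\<^bsub>P 0\<^esub> d 0 y)) = \<zero>\<^bsub>E\<^esub>" if y: "y \<in> carrier (P (Suc 0))" for y
      using lmod_hom_minus[OF lmod_hom_comp[OF p(5) g] p(3) E dc[OF y]] p(9)[OF y]
        lmod_hom_zero[OF g p(1) E] by simp
    then obtain \<psi> where \<psi>: "\<psi> \<in> lmod_hom R (C 0) E"
      "\<And>z. z \<in> carrier (C (Suc 0)) \<Longrightarrow> g (e (snd z)) = \<psi> (dC 0 z)"
      using bspec[OF hC[unfolded hom_exact_def] gC] by (auto simp: dC_def C_def)
    define \<psi>1 where "\<psi>1 x = \<psi> (x, \<zero>\<^bsub>P 0\<^esub>)" for x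
    have \<psi>1: "\<psi>1 \<in> lmod_hom R (Q 0) E"
      unfolding \<psi>1_def[abs_def]
      using lmod_hom_comp[OF lmod_hom_inl[OF projectiveD[OF Zp[of 0]]] \<psi>(1)[unfolded C_def]] by (simp add: Z0)
    have \<psi>d: "\<psi>1 (d' 0 x) = \<zero>\<^bsub>E\<^esub>" if x: "x \<in> carrier (Q (Suc 0))" for x
      using \<psi>(2)[of "(x, \<zero>\<^bsub>P 0\<^esub>)"] x lmod_hom_zero[OF f(1) p(3) q(3)] lmod_hom_zero[OF p(5) p(3) p(1)]
        lmod_hom_zero[OF g p(1) E] d'c[OF x] by (simp add: C_def dC_def \<psi>1_def)
    have \<psi>f: "g (e y) = \<psi>1 (f 0 y)" if y: "y \<in> carrier (P 0)" for y
      using \<psi>(2)[of "(\<zero>\<^bsub>Q (Suc 0)\<^esub>, y)"] y lmod_hom_zero[OF q(4) q(3) q(3)] fc[OF y]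
      by (simp add: C_def dC_def \<psi>1_def)
    \<comment> \<open>The restriction \<psi>1 vanishes on the image of \<open>d' 0\<close>, which is
      the kernel of e', so it factors through e' and gives a map on \<open>L\<close>.\<close>
    have "\<exists>g'. \<forall>x \<in> carrier (Q 0). g' (e' x) = \<psi>1 x"
    proof (intro exI[of _ "\<lambda>y. \<psi>1 (inv_into (carrier (Q 0)) e' y)"] ballI)
      fix x assume x: "x \<in> carrier (Q 0)"
      let ?x = "inv_into (carrier (Q 0)) e' (e' x)"
      have i: "?x \<in> carrier (Q 0)" "e' ?x = e' x" using x by (auto intro: inv_into_into f_inv_into_f)
      have "e' (?x \<ominus>\<^bsub>Q 0\<^esub> x) = \<zero>\<^bsub>L\<^esub>"
        unfolding lmod_hom_minus_distrib[OF q(5) q(3) q(1) i(1) x] i(2)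
        by (rule L.M.diff_self[OF lmod_homD(1)[OF q(5) x]])
      then have "\<psi>1 (?x \<ominus>\<^bsub>Q 0\<^esub> x) = \<zero>\<^bsub>E\<^esub>" using q(11)[OF Qm.M.minus_closed[OF i(1) x]] \<psi>d by force
      then show "\<psi>1 ?x = \<psi>1 x"
        unfolding lmod_hom_minus_distrib[OF \<psi>1 q(3) E i(1) x]
        using E.M.diff_eq_zeroD lmod_homD(1)[OF \<psi>1] i(1) x by metis
    qed
    then obtain g' where g': "\<And>x. x \<in> carrier (Q 0) \<Longrightarrow> g' (e' x) = \<psi>1 x" by blast
    have "g' \<in> lmod_hom R L E"
    proof (rule lmod_homI)
      fix x assume "x \<in> carrier L"
      then obtain u where u: "u \<in> carrier (Q 0)" "e' u = x" using surjE[OF q(6)] by metis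
      then show "g' x \<in> carrier E" using g' lmod_homD(1)[OF \<psi>1] by metis
      fix a assume "a \<in> carrier R"
      then show "g' (a \<odot>\<^bsub>L\<^esub> x) = a \<odot>\<^bsub>E\<^esub> g' x"
        using u g' lmod_homD(3)[OF \<psi>1] lmod_homD(3)[OF q(5)] by (metis Qm.smult_closed)
    next
      fix x y assume "x \<in> carrier L" "y \<in> carrier L"
      then obtain u v where u: "u \<in> carrier (Q 0)" "e' u = x" "v \<in> carrier (Q 0)" "e' v = y"
        using surjE[OF q(6)] by metis
      then show "g' (x \<oplus>\<^bsub>L\<^esub> y) = g' x \<oplus>\<^bsub>E\<^esub> g' y"
        using g' lmod_homD(2)[OF \<psi>1] lmod_homD(2)[OF q(5)] by (metis Qm.M.a_closed)
    qed
    moreover have "g' (\<iota> x) = g x" if x: "x \<in> carrier K" for x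
      using surjE[OF p(6) x] f(2) \<psi>f g' fc by metis
    ultimately show ?thesis by blast
  qed
  show thesis by (rule that[OF res fg za up ext])
qed

section \<open>Complexes of free modules of finite rank\<close>

definition lmod_iso where
  "lmod_iso R M N a b \<longleftrightarrow> a \<in> lmod_hom R M N \<and> b \<in> lmod_hom R N M \<and>
     (\<forall>x \<in> carrier M. b (a x) = x) \<and> (\<forall>y \<in> carrier N. a (b y) = y)"

text \<open>Exactness is asked in positive degrees only. The resolved module, the cokernel of
  \<open>D 0\<close>, stays implicit, so that no type has to be named for it.\<close>

definition free_complex ::
  "('r, 'y) ring_scheme \<Rightarrow> (nat \<Rightarrow> nat) \<Rightarrow> (nat \<Rightarrow> (nat \<Rightarrow> 'r) \<Rightarrow> nat \<Rightarrow> 'r) \<Rightarrow> bool" where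
  "free_complex R k D \<longleftrightarrow> (\<forall>n. D n \<in> lmod_hom R (fm R (k (Suc n))) (fm R (k n))) \<and>
     (\<forall>n. D (Suc n) ` carrier (fm R (k (Suc (Suc n)))) =
        lmod_ker (fm R (k (Suc n))) (fm R (k n)) (D n))"

lemma free_complexD:
  assumes "free_complex R k D"
  shows "D n \<in> lmod_hom R (fm R (k (Suc n))) (fm R (k n))"
    "x \<in> carrier (fm R (k (Suc (Suc n)))) \<Longrightarrow> D n (D (Suc n) x) = \<zero>\<^bsub>fm R (k n)\<^esub>"
    "y \<in> carrier (fm R (k (Suc n))) \<Longrightarrow> D n y = \<zero>\<^bsub>fm R (k n)\<^esub> \<Longrightarrow>
       y \<in> D (Suc n) ` carrier (fm R (k (Suc (Suc n))))"
proof -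
  have eq: "D (Suc n) ` carrier (fm R (k (Suc (Suc n)))) = lmod_ker (fm R (k (Suc n))) (fm R (k n)) (D n)"
    using assms by (simp add: free_complex_def)
  show "D n \<in> lmod_hom R (fm R (k (Suc n))) (fm R (k n))" using assms by (simp add: free_complex_def)
  show "x \<in> carrier (fm R (k (Suc (Suc n)))) \<Longrightarrow> D n (D (Suc n) x) = \<zero>\<^bsub>fm R (k n)\<^esub>"
    using eq unfolding lmod_ker_def by blast
  show "y \<in> carrier (fm R (k (Suc n))) \<Longrightarrow> D n y = \<zero>\<^bsub>fm R (k n)\<^esub> \<Longrightarrow>
       y \<in> D (Suc n) ` carrier (fm R (k (Suc (Suc n))))"
    unfolding eq lmod_ker_def by blast
qed

lemma free_complexI:
  assumes D: "\<And>n. D n \<in> lmod_hom R (fm R (k (Suc n))) (fm R (k n))"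
    and "\<And>n x. x \<in> carrier (fm R (k (Suc (Suc n)))) \<Longrightarrow> D n (D (Suc n) x) = \<zero>\<^bsub>fm R (k n)\<^esub>"
    and "\<And>n y. y \<in> carrier (fm R (k (Suc n))) \<Longrightarrow> D n y = \<zero>\<^bsub>fm R (k n)\<^esub> \<Longrightarrow>
       y \<in> D (Suc n) ` carrier (fm R (k (Suc (Suc n))))"
  shows "free_complex R k D"
  unfolding free_complex_def
proof (intro conjI allI D)
  show "D (Suc n) ` carrier (fm R (k (Suc (Suc n)))) = lmod_ker (fm R (k (Suc n))) (fm R (k n)) (D n)" for n
    using assms(2,3)[of _ n] lmod_homD(1)[OF D[of "Suc n"]] unfolding lmod_ker_def by blast
qed

lemma fm_zero:
  assumes R: "ring R" and k: "k = 0" shows "carrier (fm R k) = {\<zero>\<^bsub>fm R k\<^esub>}"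
proof -
  interpret ring R by fact
  have "f \<in> carrier (fm R 0) \<longleftrightarrow> f = (\<lambda>x. \<zero>\<^bsub>R\<^esub>)" for f
    unfolding fm_carrier_iff[OF R] by auto
  then show ?thesis unfolding k free_module_simps by blast
qed

text \<open>If modules \<open>W n\<close> make every \<open>T n \<oplus> W n \<oplus> W (n + 1)\<close> free, adding the complexes
  \<open>0 \<rightarrow> W n \<rightarrow> W n \<rightarrow> 0\<close> replaces a projective resolution \<open>T\<close> by a complex of free modules.\<close>

lemma free_replacement:
  fixes T :: "nat \<Rightarrow> ('r, 'p) module" and W :: "nat \<Rightarrow> ('r, 'w) module"
  assumes T: "projective_resolution R N T d e" and W: "\<And>n. left_module R (W n)"
    and iso: "\<And>n. lmod_iso R (pair_module (T n) (pair_module (W n) (W (Suc n)))) (fm R (k n)) (a n) (b n)"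
  obtains D where "free_complex R k D"
    "\<And>p. lmod_regular R (fm R (k (Suc p))) (fm R (k p)) (D p) \<Longrightarrow> lmod_regular R (T (Suc p)) (T p) (d p)"
    "\<And>p. carrier (T (Suc p)) = {\<zero>\<^bsub>T (Suc p)\<^esub>} \<Longrightarrow> lmod_regular R (fm R (k (Suc p))) (fm R (k p)) (D p)"
    "carrier (W 0) = {\<zero>\<^bsub>W 0\<^esub>} \<Longrightarrow> \<exists>e'. projective_resolution R N (\<lambda>n. fm R (k n)) D e'"
proof -
  note p = projective_resolutionD[OF T]
  define V where "V n = pair_module (T n) (pair_module (W n) (W (Suc n)))" for n
  have a: "\<And>n. a n \<in> lmod_hom R (V n) (fm R (k n))" and b: "\<And>n. b n \<in> lmod_hom R (fm R (k n)) (V n)"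
    and ba: "\<And>n x. x \<in> carrier (V n) \<Longrightarrow> b n (a n x) = x"
    and ab: "\<And>n y. y \<in> carrier (fm R (k n)) \<Longrightarrow> a n (b n y) = y"
    using iso by (auto simp: lmod_iso_def V_def)
  have R: "ring R" using p(1) by (simp add: left_module_def)
  interpret Tm: left_module R "T n" for n by (rule p(3))
  interpret Wm: left_module R "W n" for n by (rule W)
  have V: "left_module R (V n)" for n unfolding V_def by (intro left_module_pair p(3) W)
  have F: "left_module R (fm R (k n))" for n by (rule left_module_free_module[OF R])
  have Vc: "carrier (V n) = carrier (T n) \<times> carrier (W n) \<times> carrier (W (Suc n))" for n by (simp add: V_def)
  have V0: "\<zero>\<^bsub>V n\<^esub> = (\<zero>\<^bsub>T n\<^esub>, \<zero>\<^bsub>W n\<^esub>, \<zero>\<^bsub>W (Suc n)\<^esub>)" for n by (simp add: V_def)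
  have ac: "a n y \<in> carrier (fm R (k n))" if "y \<in> carrier (V n)" for n y by (rule lmod_homD(1)[OF a that])
  have bc: "b n y \<in> carrier (V n)" if "y \<in> carrier (fm R (k n))" for n y by (rule lmod_homD(1)[OF b that])
  \<comment> \<open>The component in \<open>W (n + 1)\<close> is the middle one in degree n + 1 and
    the last one in degree n; \<delta> carries it over identically, and is \<open>d n\<close> on
    \<open>T\<close>.\<close>
  define \<delta> where "\<delta> n z = (d n (fst z), \<zero>\<^bsub>W n\<^esub>, fst (snd z))" for n and z :: "'p \<times> 'w \<times> 'w"
  have \<delta>: "\<delta> n \<in> lmod_hom R (V (Suc n)) (V n)" for n
    unfolding V_def \<delta>_def[abs_def]
    by (intro lmod_hom_Pair lmod_hom_const_zero W lmod_hom_comp[OF lmod_hom_fst p(4)]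
        lmod_hom_comp[OF lmod_hom_snd lmod_hom_fst])
  have \<delta>c: "\<delta> n y \<in> carrier (V n)" if "y \<in> carrier (V (Suc n))" for n y by (rule lmod_homD(1)[OF \<delta> that])
  have \<delta>\<delta>: "\<delta> n (\<delta> (Suc n) z) = \<zero>\<^bsub>V n\<^esub>" if "z \<in> carrier (V (Suc (Suc n)))" for n z
    using that p(10) by (auto simp: \<delta>_def Vc V0)
  have \<delta>ex: "\<exists>y \<in> carrier (V (Suc (Suc n))). \<delta> (Suc n) y = z"
    if z: "z \<in> carrier (V (Suc n))" "\<delta> n z = \<zero>\<^bsub>V n\<^esub>" for n z
  proof -
    obtain t w w' where zz: "z = (t, w, w')" "t \<in> carrier (T (Suc n))" "w \<in> carrier (W (Suc n))"
      "w' \<in> carrier (W (Suc (Suc n)))" using z(1) by (auto simp: Vc)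
    then have "w = \<zero>\<^bsub>W (Suc n)\<^esub>" and t: "d n t = \<zero>\<^bsub>T n\<^esub>" using z(2) by (auto simp: \<delta>_def V0)
    moreover obtain u where "u \<in> carrier (T (Suc (Suc n)))" "d (Suc n) u = t" using p(12)[OF zz(2) t] by force
    ultimately show ?thesis
      using zz by (intro bexI[of _ "(u, w', \<zero>\<^bsub>W (Suc (Suc (Suc n)))\<^esub>)"]) (auto simp: \<delta>_def Vc)
  qed
  define D where "D n x = a n (\<delta> n (b (Suc n) x))" for n x
  have D: "D n \<in> lmod_hom R (fm R (k (Suc n))) (fm R (k n))" for n
    unfolding D_def[abs_def] by (rule lmod_hom_comp[OF lmod_hom_comp[OF b \<delta>] a])
  have bD: "b n (D n x) = \<delta> n (b (Suc n) x)" if "x \<in> carrier (fm R (k (Suc n)))" for n x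
    unfolding D_def by (rule ba[OF \<delta>c[OF bc[OF that]]])
  have fc: "free_complex R k D"
  proof (rule free_complexI)
    show "D n \<in> lmod_hom R (fm R (k (Suc n))) (fm R (k n))" for n by (rule D)
    show "D n (D (Suc n) x) = \<zero>\<^bsub>fm R (k n)\<^esub>" if "x \<in> carrier (fm R (k (Suc (Suc n))))" for n x
      unfolding D_def[of n] bD[OF that] \<delta>\<delta>[OF bc[OF that]] by (rule lmod_hom_zero[OF a V F])
    show "y \<in> D (Suc n) ` carrier (fm R (k (Suc (Suc n))))"
      if y: "y \<in> carrier (fm R (k (Suc n)))" "D n y = \<zero>\<^bsub>fm R (k n)\<^esub>" for n y
    proof -
      have "\<delta> n (b (Suc n) y) = \<zero>\<^bsub>V n\<^esub>" using bD[OF y(1)] y(2) lmod_hom_zero[OF b F V] by metis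
      then obtain z where z: "z \<in> carrier (V (Suc (Suc n)))" "\<delta> (Suc n) z = b (Suc n) y"
        using \<delta>ex[OF bc[OF y(1)]] by blast
      show ?thesis
        by (rule image_eqI[OF _ ac[OF z(1)]]) (simp add: D_def ba[OF z(1)] z(2) ab[OF y(1)])
    qed
  qed
  \<comment> \<open>\<open>T\<close> is a direct summand of the enlarged complex, so a splitting is
    restricted by including \<open>T\<close> and projecting back.\<close>
  have r2: "lmod_regular R (T (Suc n)) (T n) (d n)"
    if reg: "lmod_regular R (fm R (k (Suc n))) (fm R (k n)) (D n)" for n
  proof -
    obtain h where h: "h \<in> lmod_hom R (fm R (k n)) (fm R (k (Suc n)))"
      "\<And>x. x \<in> carrier (fm R (k (Suc n))) \<Longrightarrow> D n (h (D n x)) = D n x"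
      using reg unfolding lmod_regular_def by blast
    define i where "i m t = (t, \<zero>\<^bsub>W m\<^esub>, \<zero>\<^bsub>W (Suc m)\<^esub>)" for m and t :: 'p
    have i: "i m \<in> lmod_hom R (T m) (V m)" for m
      unfolding i_def[abs_def] V_def by (intro lmod_hom_Pair lmod_hom_id lmod_hom_const_zero W)
    have V1: "fst \<in> lmod_hom R (V m) (T m)" for m unfolding V_def by (rule lmod_hom_fst)
    define g where "g t = fst (b (Suc n) (h (a n (i n t))))" for t
    have g: "g \<in> lmod_hom R (T n) (T (Suc n))"
      unfolding g_def[abs_def]
      by (rule lmod_hom_comp[OF lmod_hom_comp[OF lmod_hom_comp[OF lmod_hom_comp[OF i a] h(1)] b] V1])
    have "d n (g (d n t)) = d n t" if t: "t \<in> carrier (T (Suc n))" for t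
    proof -
      define x where "x = a (Suc n) (i (Suc n) t)"
      have ic: "i (Suc n) t \<in> carrier (V (Suc n))" by (rule lmod_homD(1)[OF i t])
      have x: "x \<in> carrier (fm R (k (Suc n)))" unfolding x_def by (rule ac[OF ic])
      have bx: "b (Suc n) x = i (Suc n) t" unfolding x_def by (rule ba[OF ic])
      have Dx: "D n x = a n (i n (d n t))" by (simp add: D_def bx) (simp add: i_def \<delta>_def)
      have hx: "h (D n x) \<in> carrier (fm R (k (Suc n)))"
        by (rule lmod_homD(1)[OF h(1) lmod_homD(1)[OF D x]])
      have "d n (g (d n t)) = fst (b n (D n (h (D n x))))" unfolding bD[OF hx] by (simp add: g_def Dx \<delta>_def)
      also have "\<dots> = d n t" unfolding h(2)[OF x] bD[OF x] bx by (simp add: \<delta>_def i_def)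
      finally show ?thesis .
    qed
    then show ?thesis using g unfolding lmod_regular_def by blast
  qed
  \<comment> \<open>When \<open>T (n + 1)\<close> is zero, \<delta> is only the identity between the
    two copies of \<open>W (n + 1)\<close>, which the map s reverses.\<close>
  have r3: "lmod_regular R (fm R (k (Suc n))) (fm R (k n)) (D n)"
    if z: "carrier (T (Suc n)) = {\<zero>\<^bsub>T (Suc n)\<^esub>}" for n
  proof -
    define s where "s z = (\<zero>\<^bsub>T (Suc n)\<^esub>, snd (snd z), \<zero>\<^bsub>W (Suc (Suc n))\<^esub>)" for z :: "'p \<times> 'w \<times> 'w"
    have s: "s \<in> lmod_hom R (V n) (V (Suc n))"
      unfolding s_def[abs_def] V_def
      by (intro lmod_hom_Pair lmod_hom_const_zero W p(3) lmod_hom_comp[OF lmod_hom_snd lmod_hom_snd])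
    have h: "(\<lambda>x. a (Suc n) (s (b n x))) \<in> lmod_hom R (fm R (k n)) (fm R (k (Suc n)))"
      by (rule lmod_hom_comp[OF lmod_hom_comp[OF b s] a])
    have "D n (a (Suc n) (s (b n (D n x)))) = D n x" if x: "x \<in> carrier (fm R (k (Suc n)))" for x
    proof -
      note c = bc[OF x]
      have t: "fst (b (Suc n) x) = \<zero>\<^bsub>T (Suc n)\<^esub>" using c unfolding Vc z mem_Times_iff by blast
      have "b (Suc n) (a (Suc n) (s (b n (D n x)))) = s (\<delta> n (b (Suc n) x))"
        unfolding bD[OF x] by (rule ba[OF lmod_homD(1)[OF s \<delta>c[OF c]]])
      then show ?thesis unfolding D_def by (simp add: \<delta>_def s_def t)
    qed
    then show ?thesis unfolding lmod_regular_def by (intro bexI[OF _ h] ballI)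
  qed
  have r4: "\<exists>e'. projective_resolution R N (\<lambda>n. fm R (k n)) D e'" if z: "carrier (W 0) = {\<zero>\<^bsub>W 0\<^esub>}"
  proof (intro exI projective_resolutionI)
    let ?e = "\<lambda>x. e (fst (b 0 x))"
    have V1: "fst \<in> lmod_hom R (V m) (T m)" for m unfolding V_def by (rule lmod_hom_fst)
    show "?e \<in> lmod_hom R (fm R (k 0)) N" by (rule lmod_hom_comp[OF lmod_hom_comp[OF b V1] p(5)])
    show "x \<in> ?e ` carrier (fm R (k 0))" if x: "x \<in> carrier N" for x
    proof -
      obtain t where t: "t \<in> carrier (T 0)" "e t = x" using surjE[OF p(6) x] by metis
      have c: "(t, \<zero>\<^bsub>W 0\<^esub>, \<zero>\<^bsub>W (Suc 0)\<^esub>) \<in> carrier (V 0)" using t by (simp add: Vc)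
      show ?thesis by (rule image_eqI[OF _ ac[OF c]]) (simp add: ba[OF c] t)
    qed
    show "?e (D 0 x) = \<zero>\<^bsub>N\<^esub>" if x: "x \<in> carrier (fm R (k (Suc 0)))" for x
      unfolding bD[OF x] using p(9) bc[OF x] by (auto simp: \<delta>_def Vc)
    show "D n (D (Suc n) x) = \<zero>\<^bsub>fm R (k n)\<^esub>" if "x \<in> carrier (fm R (k (Suc (Suc n))))" for n x
      by (rule free_complexD(2)[OF fc that])
    show "y \<in> D 0 ` carrier (fm R (k (Suc 0)))" if y: "y \<in> carrier (fm R (k 0))" "?e y = \<zero>\<^bsub>N\<^esub>" for y
    proof -
      have c: "fst (b 0 y) \<in> carrier (T 0)" "fst (snd (b 0 y)) = \<zero>\<^bsub>W 0\<^esub>" "snd (snd (b 0 y)) \<in> carrier (W (Suc 0))"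
        using bc[OF y(1)] unfolding Vc z mem_Times_iff by blast+
      obtain t where t: "t \<in> carrier (T (Suc 0))" "d 0 t = fst (b 0 y)" using p(11)[OF c(1) y(2)] by force
      have cv: "(t, snd (snd (b 0 y)), \<zero>\<^bsub>W (Suc (Suc 0))\<^esub>) \<in> carrier (V (Suc 0))" using t c by (simp add: Vc)
      have "\<delta> 0 (t, snd (snd (b 0 y)), \<zero>\<^bsub>W (Suc (Suc 0))\<^esub>) = b 0 y"
        by (simp add: \<delta>_def t(2) c(2)[symmetric])
      then show ?thesis by (intro image_eqI[OF _ ac[OF cv]]) (simp add: D_def ba[OF cv] ab[OF y(1)])
    qed
    show "y \<in> D (Suc n) ` carrier (fm R (k (Suc (Suc n))))"
      if "y \<in> carrier (fm R (k (Suc n)))" "D n y = \<zero>\<^bsub>fm R (k n)\<^esub>" for n y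
      by (rule free_complexD(3)[OF fc that])
  qed (use p(1) projective_free_module[OF R] D in auto)
  show thesis by (rule that[OF fc r2 r3 r4])
qed

text \<open>One complement of T \<oplus> W serves both orders of the last two summands: choosing the
  modules W upwards appends the new one on the right, choosing them downwards on the left.\<close>

lemma pair_complement:
  fixes T :: "('r, 'p) module" and W :: "('r, 'w) module"
  assumes T: "projective R T" "fin_gen R T" and W: "projective R W" "fin_gen R W"
  shows "\<exists>C :: ('r, nat \<Rightarrow> 'r) module. projective R C \<and> fin_gen R C \<and>
    (\<exists>k a b. lmod_iso R (pair_module T (pair_module W C)) (fm R k) a b) \<and>
    (\<exists>k a b. lmod_iso R (pair_module T (pair_module C W)) (fm R k) a b)"
proof -
  note Tm = projectiveD[OF T(1)] and Wm = projectiveD[OF W(1)]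
  obtain C :: "('r, nat \<Rightarrow> 'r) module" and k a b where C: "projective R C" "fin_gen R C"
    and a: "a \<in> lmod_hom R (pair_module (pair_module T W) C) (fm R k)"
    and b: "b \<in> lmod_hom R (fm R k) (pair_module (pair_module T W) C)"
    and ab: "\<And>x. x \<in> carrier (fm R k) \<Longrightarrow> a (b x) = x"
    and ba: "\<And>x. x \<in> carrier (pair_module (pair_module T W) C) \<Longrightarrow> b (a x) = x"
    by (rule projective_complement[OF projective_pair[OF T(1) W(1)] fin_gen_pair[OF Tm Wm T(2) W(2)]]) blast
  have r1: "(\<lambda>z. ((fst z, fst (snd z)), snd (snd z))) \<in>
      lmod_hom R (pair_module T (pair_module W C)) (pair_module (pair_module T W) C)"
    "(\<lambda>z. (fst (fst z), snd (fst z), snd z)) \<in>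
      lmod_hom R (pair_module (pair_module T W) C) (pair_module T (pair_module W C))"
    "(\<lambda>z. ((fst z, snd (snd z)), fst (snd z))) \<in>
      lmod_hom R (pair_module T (pair_module C W)) (pair_module (pair_module T W) C)"
    "(\<lambda>z. (fst (fst z), snd z, snd (fst z))) \<in>
      lmod_hom R (pair_module (pair_module T W) C) (pair_module T (pair_module C W))"
    by (auto simp: lmod_hom_def)
  have "lmod_iso R (pair_module T (pair_module W C)) (fm R k)
      (\<lambda>z. a ((fst z, fst (snd z)), snd (snd z))) (\<lambda>x. (fst (fst (b x)), snd (fst (b x)), snd (b x)))"
    unfolding lmod_iso_def
  proof (intro conjI ballI)
    fix x assume "x \<in> carrier (pair_module T (pair_module W C))"
    then show "(fst (fst (b (a ((fst x, fst (snd x)), snd (snd x))))), snd (fst (b (a ((fst x, fst (snd x)), snd (snd x))))),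
        snd (b (a ((fst x, fst (snd x)), snd (snd x))))) = x"
      by (subst (1 2 3) ba) auto
  qed (use lmod_hom_comp[OF r1(1) a] lmod_hom_comp[OF b r1(2)] ab in simp_all)
  moreover have "lmod_iso R (pair_module T (pair_module C W)) (fm R k)
      (\<lambda>z. a ((fst z, snd (snd z)), fst (snd z))) (\<lambda>x. (fst (fst (b x)), snd (b x), snd (fst (b x))))"
    unfolding lmod_iso_def
  proof (intro conjI ballI)
    fix x assume "x \<in> carrier (pair_module T (pair_module C W))"
    then show "(fst (fst (b (a ((fst x, snd (snd x)), fst (snd x))))), snd (b (a ((fst x, snd (snd x)), fst (snd x)))),
        snd (fst (b (a ((fst x, snd (snd x)), fst (snd x)))))) = x"
      by (subst (1 2 3) ba) auto
  qed (use lmod_hom_comp[OF r1(3) a] lmod_hom_comp[OF b r1(4)] ab in simp_all)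
  ultimately show ?thesis using C by blast
qed

text \<open>The modules W are chosen upwards from W 0 = 0, which leaves the cokernel equal to
  \<open>N\<close>. The resulting free resolution may be infinite; regularity in one degree records
  that it can nevertheless be truncated.\<close>

lemma free_resolution_exists:
  fixes T :: "nat \<Rightarrow> ('r, 'p) module"
  assumes T: "fg_resolution R N T d e"
  obtains k D e' m where "projective_resolution R N (\<lambda>n. fm R (k n)) D e'" "free_complex R k D"
    "lmod_regular R (fm R (k (Suc m))) (fm R (k m)) (D m)"
proof -
  obtain m where Tp: "projective_resolution R N T d e" and fg: "\<And>n. fin_gen R (T n)" and z: "zero_above T m"
    using T by (auto simp: fg_resolution_def)
  note p = projective_resolutionD[OF Tp]
  have R: "ring R" using p(1) by (simp add: left_module_def)
  have "\<exists>W :: nat \<Rightarrow> ('r, nat \<Rightarrow> 'r) module. \<forall>n. ((projective R (W n) \<and> fin_gen R (W n)) \<and> (n = 0 \<longrightarrow> W n = fm R 0)) \<and>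
     (\<exists>k a b. lmod_iso R (pair_module (T n) (pair_module (W n) (W (Suc n)))) (fm R k) a b)"
  proof (rule dependent_nat_choice)
    show "\<exists>W. (projective R W \<and> fin_gen R W) \<and> ((0::nat) = 0 \<longrightarrow> W = fm R 0)"
      using projective_free_module[OF R] fin_gen_fm[OF R] by blast
  next
    fix W :: "('r, nat \<Rightarrow> 'r) module" and n :: nat
    assume "(projective R W \<and> fin_gen R W) \<and> (n = 0 \<longrightarrow> W = fm R 0)"
    then show "\<exists>C. ((projective R C \<and> fin_gen R C) \<and> (Suc n = 0 \<longrightarrow> C = fm R 0)) \<and>
        (\<exists>k a b. lmod_iso R (pair_module (T n) (pair_module W C)) (fm R k) a b)"
      using pair_complement[OF p(2) fg, of W n] by blast
  qed
  then obtain W :: "nat \<Rightarrow> ('r, nat \<Rightarrow> 'r) module" where W: "\<And>n. projective R (W n)" "W 0 = fm R 0"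
    and ex: "\<And>n. \<exists>k a b. lmod_iso R (pair_module (T n) (pair_module (W n) (W (Suc n)))) (fm R k) a b"
    by blast
  obtain k a b where iso: "\<And>n. lmod_iso R (pair_module (T n) (pair_module (W n) (W (Suc n)))) (fm R (k n)) (a n) (b n)"
    using ex by metis
  have W0: "carrier (W 0) = {\<zero>\<^bsub>W 0\<^esub>}" unfolding W(2) by (rule fm_zero[OF R refl])
  obtain D where D: "free_complex R k D"
    "\<And>p. carrier (T (Suc p)) = {\<zero>\<^bsub>T (Suc p)\<^esub>} \<Longrightarrow> lmod_regular R (fm R (k (Suc p))) (fm R (k p)) (D p)"
    "carrier (W 0) = {\<zero>\<^bsub>W 0\<^esub>} \<Longrightarrow> \<exists>e'. projective_resolution R N (\<lambda>n. fm R (k n)) D e'"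
    by (rule free_replacement[OF Tp projectiveD[OF W(1)] iso]) blast
  have "carrier (T (Suc m)) = {\<zero>\<^bsub>T (Suc m)\<^esub>}" using z by (simp add: zero_above_def)
  then show thesis using that D W0 by blast
qed

text \<open>Here the modules \<open>W n\<close> are chosen downwards, so the complex stays finite and its
  cokernel is \<open>N \<oplus> W 0\<close>.\<close>

lemma finite_free_complex_exists:
  fixes T :: "nat \<Rightarrow> ('r, 'p) module"
  assumes T: "projective_resolution R N T d e" and fg: "\<And>n. fin_gen R (T n)" and z: "zero_above T m"
  obtains k D where "free_complex R k D" "\<And>j. j > m \<Longrightarrow> k j = 0"
    "\<And>p. lmod_regular R (fm R (k (Suc p))) (fm R (k p)) (D p) \<Longrightarrow> lmod_regular R (T (Suc p)) (T p) (d p)"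
proof -
  note p = projective_resolutionD[OF T]
  have R: "ring R" using p(1) by (simp add: left_module_def)
  have "\<exists>V :: nat \<Rightarrow> ('r, nat \<Rightarrow> 'r) module. \<forall>i. ((projective R (V i) \<and> fin_gen R (V i)) \<and> (i = 0 \<longrightarrow> V i = fm R 0)) \<and>
     (\<exists>k a b. lmod_iso R (pair_module (T (m - i)) (pair_module (V (Suc i)) (V i))) (fm R k) a b)"
  proof (rule dependent_nat_choice)
    show "\<exists>W. (projective R W \<and> fin_gen R W) \<and> ((0::nat) = 0 \<longrightarrow> W = fm R 0)"
      using projective_free_module[OF R] fin_gen_fm[OF R] by blast
  next
    fix W :: "('r, nat \<Rightarrow> 'r) module" and n :: nat
    assume "(projective R W \<and> fin_gen R W) \<and> (n = 0 \<longrightarrow> W = fm R 0)"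
    then show "\<exists>C. ((projective R C \<and> fin_gen R C) \<and> (Suc n = 0 \<longrightarrow> C = fm R 0)) \<and>
        (\<exists>k a b. lmod_iso R (pair_module (T (m - n)) (pair_module C W)) (fm R k) a b)"
      using pair_complement[OF p(2) fg, of W "m - n"] by blast
  qed
  then obtain V :: "nat \<Rightarrow> ('r, nat \<Rightarrow> 'r) module" where V: "\<And>n. projective R (V n)" "V 0 = fm R 0"
    and ex: "\<And>i. \<exists>k a b. lmod_iso R (pair_module (T (m - i)) (pair_module (V (Suc i)) (V i))) (fm R k) a b"
    by blast
  \<comment> \<open>The recursion produced the modules from degree m + 1 downwards, so the index is
    reversed. For j > m the natural subtraction yields \<open>V 0\<close>, the zero module, and the
    free complex stops at m.\<close>
  define W where "W j = V (Suc m - j)" for j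
  have exW: "\<exists>k a b. lmod_iso R (pair_module (T j) (pair_module (W j) (W (Suc j)))) (fm R k) a b \<and> (j > m \<longrightarrow> k = 0)" for j
  proof (cases "j \<le> m")
    case True
    then show ?thesis using ex[of "m - j"] by (simp add: W_def Suc_diff_le)
  next
    case False
    then have Wz: "W j = fm R 0" "W (Suc j) = fm R 0" and Tz: "carrier (T j) = {\<zero>\<^bsub>T j\<^esub>}"
      using V(2) z by (simp_all add: W_def zero_above_def)
    let ?P = "pair_module (T j) (pair_module (fm R 0) (fm R 0))"
    have m: "left_module R ?P" "left_module R (fm R 0)"
      by (intro left_module_pair p(3) left_module_free_module[OF R])+
    have Pz: "carrier ?P = {\<zero>\<^bsub>?P\<^esub>}" using Tz fm_zero[OF R, of 0] by auto
    have "lmod_iso R ?P (fm R 0) (\<lambda>x. \<zero>\<^bsub>fm R 0\<^esub>) (\<lambda>x. \<zero>\<^bsub>?P\<^esub>)"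
      unfolding lmod_iso_def Pz fm_zero[OF R refl] by (intro conjI lmod_hom_const_zero m) auto
    then show ?thesis unfolding Wz by blast
  qed
  obtain k a b where iso: "\<And>n. lmod_iso R (pair_module (T n) (pair_module (W n) (W (Suc n)))) (fm R (k n)) (a n) (b n)"
    and k: "\<And>n. n > m \<Longrightarrow> k n = 0"
    using exW by metis
  have Wm: "left_module R (W n)" for n unfolding W_def by (rule projectiveD[OF V(1)])
  show thesis by (rule free_replacement[OF T Wm iso]) (use that k in blast)
qed

section \<open>The finitistic dimension\<close>

text \<open>A number is coded by the length of a list. With it, functions on \<open>nat\<close>
  embed into functions on cells, the elements of the resolutions in terms of which
  \<open>projdim\<close> is defined.\<close>

definition cell_inj :: "nat \<Rightarrow> ('r, 'n) cell" where
  "cell_inj n = Syz (replicate n (Gen undefined, undefined))"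

lemma inj_cell_inj: "inj (cell_inj :: nat \<Rightarrow> ('r, 'n) cell)"
  by (rule injI) (simp add: cell_inj_def replicate_eq_replicate)

lemma inj_comp_inv:
  assumes "inj c" shows "inj (\<lambda>f x. f (inv_into UNIV c x))"
proof (rule injI)
  fix f g :: "'a \<Rightarrow> 'c" assume eq: "(\<lambda>x. f (inv_into UNIV c x)) = (\<lambda>x. g (inv_into UNIV c x))"
  have "f n = g n" for n using fun_cong[OF eq, of "c n"] assms by simp
  then show "f = g" by blast
qed

text \<open>A finite resolution is a direct summand of a finite free complex; a splitting of that
  complex in degree p passes to the resolution, which is then truncated to length p. So a bound on
  \<open>fpd\<close> becomes a statement about matrices alone.\<close>

lemma fpd_leI:
  fixes R :: "('r, 'y) ring_scheme"
  assumes reg: "\<And>k D m. free_complex R k D \<Longrightarrow> (\<And>j. j > m \<Longrightarrow> k j = 0) \<Longrightarrow>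
    lmod_regular R (fm R (k (Suc p))) (fm R (k p)) (D p)"
  shows "fpd R \<le> enat p"
  unfolding fpd_def
proof (rule Sup_least, clarify)
  fix N :: "('r, (nat \<Rightarrow> 'r) set) module"
  assume "has_finite_fg_projective_resolution R N"
  then obtain T :: "('r, (nat \<Rightarrow> 'r) set) res_modules" and d e n
    where T: "projective_resolution R N T d e" "\<And>k. fin_gen R (T k)" "zero_above T n"
    unfolding has_finite_fg_projective_resolution_def by blast
  obtain k D where kD: "free_complex R k D" "\<And>j. j > n \<Longrightarrow> k j = 0"
    "\<And>p. lmod_regular R (fm R (k (Suc p))) (fm R (k p)) (D p) \<Longrightarrow> lmod_regular R (T (Suc p)) (T p) (d p)"
    by (rule finite_free_complex_exists[OF T]) blast
  have "lmod_regular R (T (Suc p)) (T p) (d p)" by (rule kD(3)[OF reg[OF kD(1,2)]])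
  then obtain T' :: "('r, (nat \<Rightarrow> 'r) set) res_modules" and d' e'
    where "projective_resolution R N T' d' e'" "zero_above T' p"
    by (rule truncate_resolution[OF T(1)])
  then show "projdim R N \<le> enat p" unfolding projdim_def by (intro Inf_lower) blast
qed

lemma enat_Inf_le:
  assumes "Inf {enat n | n. Q n} \<le> enat r"
  shows "\<exists>n \<le> r. Q n"
proof (rule ccontr)
  assume "\<not> (\<exists>n \<le> r. Q n)"
  then have "enat (Suc r) \<le> x" if "x \<in> {enat n | n. Q n}" for x
    using that not_less_eq_eq by auto
  then have "enat (Suc r) \<le> Inf {enat n | n. Q n}" by (rule Inf_greatest)
  with assms have "enat (Suc r) \<le> enat r" by (rule order_trans[rotated])
  then show False by simp
qed

text \<open>The converse use of the dimension. \<open>N\<close> is replaced by a copy in the type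
  over which \<open>fpd\<close> ranges; the bound yields a resolution of length at most r in a
  further type, and comparing it with \<open>P\<close> gives the splitting.\<close>

lemma regular_above_fpd:
  fixes R :: "('r, 'y) ring_scheme" and N :: "('r, 'n) module" and P :: "nat \<Rightarrow> ('r, 'p) module"
  assumes P: "fg_resolution R N P d e" and fpd: "fpd R \<le> enat r" and j: "r \<le> j"
  shows "lmod_regular R (P (Suc j)) (P j) (d j)"
proof -
  have p1: "projective_resolution R N P d e" and fg: "\<And>n. fin_gen R (P n)"
    using P by (auto simp: fg_resolution_def)
  note p = projective_resolutionD[OF p1]
  have "fin_gen R N" by (rule fin_gen_image[OF p(3) p(1) fg p(5,6)])
  then obtain \<phi> :: "'n \<Rightarrow> (nat \<Rightarrow> 'r) set" where \<phi>: "inj_on \<phi> (carrier N)"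
    using fin_gen_embeds[OF p(1)] by blast
  define N' where "N' = image_module \<phi> N"
  note im = image_module_inj[OF p(1) \<phi>, folded N'_def]
  have N'P: "projective_resolution R N' P d (\<lambda>x. \<phi> (e x))"
    by (rule resolution_target[OF p1 im(1,2) _ im(3)])
      (metis \<phi> im(1,2) inj_onD left_module.axioms(2) lmod_hom_zero p(1) abelian_group.axioms(1) abelian_monoid.zero_closed)
  then have "fg_resolution R N' P d (\<lambda>x. \<phi> (e x))" using P by (simp add: fg_resolution_def)
  then obtain P' :: "('r, (nat \<Rightarrow> 'r) set) res_modules" and d' e' where "fg_resolution R N' P' d' e'"
    by (rule resolution_transport[OF _ inj_comp_inv[OF inj_cell_inj]])
  then have "has_finite_fg_projective_resolution R N'"
    unfolding has_finite_fg_projective_resolution_def fg_resolution_def by blast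
  then have "projdim R N' \<le> fpd R" unfolding fpd_def using im(1) by (intro Sup_upper) blast
  then have "projdim R N' \<le> enat r" using fpd by (rule order_trans)
  then have "\<exists>n \<le> r. \<exists>(Q :: ('r, (nat \<Rightarrow> 'r) set) res_modules) d e.
      projective_resolution R N' Q d e \<and> zero_above Q n"
    unfolding projdim_def by (rule enat_Inf_le)
  then obtain n and Q :: "('r, (nat \<Rightarrow> 'r) set) res_modules" and dQ eQ
    where Q: "projective_resolution R N' Q dQ eQ" "zero_above Q n" and n: "n \<le> r" by blast
  show ?thesis by (rule regular_above_length[OF N'P Q(1,2)]) (use n j in simp)
qed

text \<open>A coset is replaced by one chosen representative, so the quotient lives in the same type
  as \<open>M\<close>.\<close>

lemma cokernel:
  fixes M :: "('r, 'm) module"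
  assumes M: "left_module R M" and C: "submodule C R M"
  obtains N :: "('r, 'm) module" and q where "left_module R N" "q \<in> lmod_hom R M N"
    "q ` carrier M = carrier N" "\<And>x. x \<in> carrier M \<Longrightarrow> q x = \<zero>\<^bsub>N\<^esub> \<longleftrightarrow> x \<in> C"
proof -
  interpret left_module R M by fact
  note c = submoduleD[OF C]
  \<comment> \<open>The chosen element depends only on the coset of x, because congruent elements
    satisfy the same predicate and \<open>SOME\<close> is extensional.\<close>
  define q where "q x = (SOME y. y \<in> carrier M \<and> x \<ominus>\<^bsub>M\<^esub> y \<in> C)" for x
  have ex: "\<exists>y. y \<in> carrier M \<and> x \<ominus>\<^bsub>M\<^esub> y \<in> C" if "x \<in> carrier M" for x
    using that c(2) M.diff_self by (intro exI[of _ x]) simp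
  have q: "q x \<in> carrier M" "x \<ominus>\<^bsub>M\<^esub> q x \<in> C" if "x \<in> carrier M" for x
    using someI_ex[OF ex[OF that]] by (auto simp: q_def)
  have qq: "q x = q y \<longleftrightarrow> x \<ominus>\<^bsub>M\<^esub> y \<in> C" if x: "x \<in> carrier M" and y: "y \<in> carrier M" for x y
  proof
    assume eq: "q x = q y"
    have "x \<ominus>\<^bsub>M\<^esub> y = (x \<ominus>\<^bsub>M\<^esub> q x) \<oplus>\<^bsub>M\<^esub> \<ominus>\<^bsub>M\<^esub> (y \<ominus>\<^bsub>M\<^esub> q y)"
      using q(1)[OF y] x y eq by (simp add: M.minus_diff M.diff_trans)
    then show "x \<ominus>\<^bsub>M\<^esub> y \<in> C" using c(3)[OF q(2)[OF x] c(5)[OF q(2)[OF y]]] by simp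
  next
    assume d: "x \<ominus>\<^bsub>M\<^esub> y \<in> C"
    have "x \<ominus>\<^bsub>M\<^esub> z \<in> C \<longleftrightarrow> y \<ominus>\<^bsub>M\<^esub> z \<in> C" if z: "z \<in> carrier M" for z
      using c(3)[OF c(5)[OF d], of "x \<ominus>\<^bsub>M\<^esub> z"] c(3)[OF d, of "y \<ominus>\<^bsub>M\<^esub> z"] x y z
      by (auto simp: M.minus_diff M.diff_trans)
    then show "q x = q y" unfolding q_def by metis
  qed
  have add: "q (x \<oplus>\<^bsub>M\<^esub> y) = q (x' \<oplus>\<^bsub>M\<^esub> y')"
    if "x \<in> carrier M" "x' \<in> carrier M" "y \<in> carrier M" "y' \<in> carrier M" "q x = q x'" "q y = q y'" for x x' y y'
  proof -
    have "(x \<oplus>\<^bsub>M\<^esub> y) \<ominus>\<^bsub>M\<^esub> (x' \<oplus>\<^bsub>M\<^esub> y') = (x \<ominus>\<^bsub>M\<^esub> x') \<oplus>\<^bsub>M\<^esub> (y \<ominus>\<^bsub>M\<^esub> y')"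
      using that(1-4) by (simp add: a_minus_def M.minus_add M.a_ac)
    then show ?thesis using that c(3) by (simp add: qq)
  qed
  have smul: "q (a \<odot>\<^bsub>M\<^esub> x) = q (a \<odot>\<^bsub>M\<^esub> x')"
    if "a \<in> carrier R" "x \<in> carrier M" "x' \<in> carrier M" "q x = q x'" for a x x'
  proof -
    have "(a \<odot>\<^bsub>M\<^esub> x) \<ominus>\<^bsub>M\<^esub> (a \<odot>\<^bsub>M\<^esub> x') = a \<odot>\<^bsub>M\<^esub> (x \<ominus>\<^bsub>M\<^esub> x')"
      using that(1-3) by (simp add: a_minus_def smult_r_distr smult_r_minus)
    then show ?thesis using that c(4) by (simp add: qq)
  qed
  note im = image_module_quotient[OF M add smul]
  show thesis
  proof (rule that[OF im])
    fix x assume x: "x \<in> carrier M"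
    have "\<zero>\<^bsub>image_module q M\<^esub> = q \<zero>\<^bsub>M\<^esub>" by (simp add: image_module_def)
    then show "q x = \<zero>\<^bsub>image_module q M\<^esub> \<longleftrightarrow> x \<in> C" using qq[OF x M.zero_closed] M.diff_zero[OF x] by simp
  qed
qed

lemma free_complex_coker:
  fixes R :: "('r, 'y) ring_scheme"
  assumes R: "ring R" and F: "free_complex R k D"
  obtains N :: "('r, nat \<Rightarrow> 'r) module" and e where "projective_resolution R N (\<lambda>n. fm R (k n)) D e"
proof -
  note f = free_complexD[OF F]
  have Fm: "left_module R (fm R n)" for n by (rule left_module_free_module[OF R])
  obtain N :: "('r, nat \<Rightarrow> 'r) module" and q where q: "left_module R N" "q \<in> lmod_hom R (fm R (k 0)) N"
    "q ` carrier (fm R (k 0)) = carrier N"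
    "\<And>x. x \<in> carrier (fm R (k 0)) \<Longrightarrow> q x = \<zero>\<^bsub>N\<^esub> \<longleftrightarrow> x \<in> D 0 ` carrier (fm R (k (Suc 0)))"
    by (rule cokernel[OF Fm lmod_hom_image_submodule[OF f(1) Fm Fm]]) blast
  have "projective_resolution R N (\<lambda>n. fm R (k n)) D q"
    by (rule projective_resolutionI[OF q(1) projective_free_module[OF R] f(1) q(2)])
      (use q(3,4) lmod_homD(1)[OF f(1)] f(2,3) in \<open>auto simp del: free_module_simps\<close>)
  then show thesis by (rule that)
qed

lemma free_complex_regular:
  assumes R: "ring R" and F: "free_complex R k D" and z: "\<And>j. j > m \<Longrightarrow> k j = 0"
    and fpd: "fpd R \<le> enat r" and j: "r \<le> j"
  shows "lmod_regular R (fm R (k (Suc j))) (fm R (k j)) (D j)"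
proof -
  obtain N :: "('a, nat \<Rightarrow> 'a) module" and e where P: "projective_resolution R N (\<lambda>n. fm R (k n)) D e"
    by (rule free_complex_coker[OF R F])
  have "zero_above (\<lambda>n. fm R (k n)) m"
    unfolding zero_above_def using fm_zero[OF R] z by (auto simp del: free_module_simps)
  then have "fg_resolution R N (\<lambda>n. fm R (k n)) D e"
    using P fin_gen_fm[OF R] unfolding fg_resolution_def by blast
  from regular_above_fpd[OF this fpd j] show ?thesis .
qed

section \<open>Restriction of scalars\<close>

lemma restrict_scalars_simps [simp]:
  "carrier (restrict_scalars \<phi> M) = carrier M" "\<zero>\<^bsub>restrict_scalars \<phi> M\<^esub> = \<zero>\<^bsub>M\<^esub>"
  "x \<oplus>\<^bsub>restrict_scalars \<phi> M\<^esub> y = x \<oplus>\<^bsub>M\<^esub> y" "r \<odot>\<^bsub>restrict_scalars \<phi> M\<^esub> x = \<phi> r \<odot>\<^bsub>M\<^esub> x"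
  by (simp_all add: restrict_scalars_def)

lemma regular_module_simps [simp]:
  "carrier (regular_module S) = carrier S" "\<zero>\<^bsub>regular_module S\<^esub> = \<zero>\<^bsub>S\<^esub>"
  "x \<oplus>\<^bsub>regular_module S\<^esub> y = x \<oplus>\<^bsub>S\<^esub> y" "r \<odot>\<^bsub>regular_module S\<^esub> x = r \<otimes>\<^bsub>S\<^esub> x"
  by (simp_all add: regular_module_def)

lemma lmod_hom_restrict_scalars:
  "\<phi> \<in> ring_hom R S \<Longrightarrow> f \<in> lmod_hom S M N \<Longrightarrow> f \<in> lmod_hom R (restrict_scalars \<phi> M) (restrict_scalars \<phi> N)"
  by (auto simp: lmod_hom_def ring_hom_def Pi_iff)

lemma lmod_hom_factor:
  assumes M: "left_module R M" and N: "left_module R N" and E: "left_module R E"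
    and q: "q \<in> lmod_hom R M N" "q ` carrier M = carrier N" and f: "f \<in> lmod_hom R M E"
    and ker: "\<And>x. x \<in> carrier M \<Longrightarrow> q x = \<zero>\<^bsub>N\<^esub> \<Longrightarrow> f x = \<zero>\<^bsub>E\<^esub>"
  obtains g where "g \<in> lmod_hom R N E" "\<And>x. x \<in> carrier M \<Longrightarrow> g (q x) = f x"
proof -
  interpret M: left_module R M by fact
  interpret N: left_module R N by fact
  interpret E: left_module R E by fact
  define g where "g y = f (inv_into (carrier M) q y)" for y
  have gq: "g (q x) = f x" if x: "x \<in> carrier M" for x
  proof -
    let ?x = "inv_into (carrier M) q (q x)"
    have i: "?x \<in> carrier M" "q ?x = q x" using x by (auto intro: inv_into_into f_inv_into_f)
    have "q (?x \<ominus>\<^bsub>M\<^esub> x) = \<zero>\<^bsub>N\<^esub>"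
      unfolding lmod_hom_minus_distrib[OF q(1) M N i(1) x] i(2)
      by (rule N.M.diff_self[OF lmod_homD(1)[OF q(1) x]])
    then have "f (?x \<ominus>\<^bsub>M\<^esub> x) = \<zero>\<^bsub>E\<^esub>" by (rule ker[OF M.M.minus_closed[OF i(1) x]])
    then show ?thesis
      unfolding lmod_hom_minus_distrib[OF f M E i(1) x] g_def
      by (rule E.M.diff_eq_zeroD[OF lmod_homD(1)[OF f i(1)] lmod_homD(1)[OF f x]])
  qed
  have "g \<in> lmod_hom R N E"
    by (rule lmod_homI)
      (auto simp: q(2)[symmetric] gq lmod_homD[OF f] lmod_homD(2,3)[OF q(1), symmetric])
  then show thesis using gq by (rule that)
qed

text \<open>\<open>N\<close> has a finite resolution by finitely generated projectives and
  \<open>Ext\<^sup>i(N, E)\<close> vanishes for i > 0. The resolution is placed in the type of the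
  free modules of finite rank, so that the predicate is closed under sums;
  \<open>hom_acyclicI\<close> accepts resolutions in any type.\<close>

definition hom_acyclic ::
  "('r, 'y) ring_scheme \<Rightarrow> ('r, 'e) module \<Rightarrow> ('r, 'n) module \<Rightarrow> bool" where
  "hom_acyclic R E N \<longleftrightarrow> (\<exists>(P :: nat \<Rightarrow> ('r, nat \<Rightarrow> 'r) module) d e.
     fg_resolution R N P d e \<and> (\<forall>n. hom_exact R E P d n))"

lemma hom_acyclicI:
  fixes P :: "nat \<Rightarrow> ('r, 'p) module"
  assumes P: "fg_resolution R N P d e" and E: "left_module R E" and ex: "\<And>n. hom_exact R E P d n"
  shows "hom_acyclic R E N"
proof -
  obtain P' :: "nat \<Rightarrow> ('r, nat \<Rightarrow> 'r) module" and d' e' where P': "fg_resolution R N P' d' e'"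
    by (rule resolution_transport[OF P inj_on_id])
  have "hom_exact R E P' d' n" for n
    by (rule hom_exact_resolution_independent[OF _ _ E ex[of n]])
      (use P P' in \<open>auto simp: fg_resolution_def\<close>)
  then show ?thesis using P' unfolding hom_acyclic_def by blast
qed

lemma hom_acyclic_iso:
  assumes N: "hom_acyclic R E N" and N': "left_module R N'" and iso: "lmod_iso R N N' a b"
  shows "hom_acyclic R E N'"
proof -
  obtain P :: "nat \<Rightarrow> ('a, nat \<Rightarrow> 'a) module" and d e
    where P: "fg_resolution R N P d e" "\<And>n. hom_exact R E P d n"
    using N unfolding hom_acyclic_def by blast
  then have p: "projective_resolution R N P d e" by (simp add: fg_resolution_def)
  note pd = projective_resolutionD[OF p]
  have ab: "a \<in> lmod_hom R N N'" "b \<in> lmod_hom R N' N" "\<And>x. x \<in> carrier N \<Longrightarrow> b (a x) = x"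
    "\<And>x. x \<in> carrier N' \<Longrightarrow> a (b x) = x"
    using iso by (auto simp: lmod_iso_def)
  have "projective_resolution R N' P d (\<lambda>x. a (e x))"
  proof (rule resolution_target[OF p N' ab(1)])
    show "x = \<zero>\<^bsub>N\<^esub>" if "x \<in> carrier N" "a x = \<zero>\<^bsub>N'\<^esub>" for x
      using ab(3)[OF that(1)] that(2) lmod_hom_zero[OF ab(2) N' pd(1)] by simp
    show "a ` carrier N = carrier N'"
    proof
      show "a ` carrier N \<subseteq> carrier N'" using lmod_homD(1)[OF ab(1)] by blast
      show "carrier N' \<subseteq> a ` carrier N"
      proof
        fix y assume y: "y \<in> carrier N'"
        show "y \<in> a ` carrier N"
          by (rule image_eqI[where f = a and x = "b y"]) (simp_all add: ab(4)[OF y] lmod_homD(1)[OF ab(2) y])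
      qed
    qed
  qed
  then have "fg_resolution R N' P d (\<lambda>x. a (e x))" using P(1) by (simp add: fg_resolution_def)
  then show ?thesis using P(2) unfolding hom_acyclic_def by blast
qed

lemma hom_acyclic_pair:
  assumes E: "left_module R E" and N: "hom_acyclic R E N" and N': "hom_acyclic R E N'"
  shows "hom_acyclic R E (pair_module N N')"
proof -
  obtain P :: "nat \<Rightarrow> ('a, nat \<Rightarrow> 'a) module" and d e
    where P: "fg_resolution R N P d e" "\<And>n. hom_exact R E P d n"
    using N unfolding hom_acyclic_def by blast
  obtain Q :: "nat \<Rightarrow> ('a, nat \<Rightarrow> 'a) module" and d' e'
    where Q: "fg_resolution R N' Q d' e'" "\<And>n. hom_exact R E Q d' n"
    using N' unfolding hom_acyclic_def by blast
  have p: "projective_resolution R N P d e" "\<And>n. fin_gen R (P n)"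
    and q: "projective_resolution R N' Q d' e'" "\<And>n. fin_gen R (Q n)"
    using P(1) Q(1) by (auto simp: fg_resolution_def)
  obtain m m' where m: "zero_above P m" "zero_above Q m'" using P(1) Q(1) by (auto simp: fg_resolution_def)
  have "zero_above (\<lambda>n. pair_module (P n) (Q n)) (max m m')"
    using m by (auto simp: zero_above_def)
  moreover have "fin_gen R (pair_module (P n) (Q n))" for n
    by (rule fin_gen_pair[OF projective_resolutionD(3)[OF p(1)] projective_resolutionD(3)[OF q(1)] p(2) q(2)])
  ultimately have "fg_resolution R (pair_module N N') (\<lambda>n. pair_module (P n) (Q n))
      (\<lambda>n z. (d n (fst z), d' n (snd z))) (\<lambda>z. (e (fst z), e' (snd z)))"
    using sum_resolution[OF p(1) q(1)] unfolding fg_resolution_def by blast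
  then show ?thesis
    by (rule hom_acyclicI[OF _ E hom_exact_sum[OF p(1) q(1) E P(2) Q(2)]])
qed

lemma hom_exact_zero:
  assumes "left_module R (P (Suc n))" "left_module R E" and z: "carrier (P (Suc n)) = {\<zero>\<^bsub>P (Suc n)\<^esub>}"
  shows "hom_exact R E P d n"
  unfolding hom_exact_def z
  using lmod_hom_const_zero[OF assms(2), of "P n"] lmod_hom_zero[OF _ assms(1,2)] by fastforce

lemma zero_resolution:
  fixes N :: "('r, 'n) module"
  assumes N: "left_module R N" and z: "carrier N = {\<zero>\<^bsub>N\<^esub>}"
  shows "fg_resolution R N (\<lambda>n. fm R 0) (\<lambda>n x. \<zero>\<^bsub>fm R 0\<^esub>) (\<lambda>x. \<zero>\<^bsub>N\<^esub>)"
proof -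
  have R: "ring R" using N by (simp add: left_module_def)
  note f = fm_zero[OF R refl] left_module_free_module[OF R, of "{..<0}"]
  have "projective_resolution R N (\<lambda>n. fm R 0) (\<lambda>n x. \<zero>\<^bsub>fm R 0\<^esub>) (\<lambda>x. \<zero>\<^bsub>N\<^esub>)"
    by (rule projective_resolutionI[OF N projective_free_module[OF R] lmod_hom_const_zero[OF f(2)] lmod_hom_const_zero[OF N]])
      (simp_all only: z f(1) image_insert image_empty)
  moreover have "zero_above (\<lambda>n. fm R 0) 0" unfolding zero_above_def f(1) by blast
  ultimately show ?thesis using fin_gen_fm[OF R] unfolding fg_resolution_def by blast
qed

lemma hom_acyclic_zero:
  assumes N: "left_module R N" and E: "left_module R E" and z: "carrier N = {\<zero>\<^bsub>N\<^esub>}"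
  shows "hom_acyclic R E N"
proof -
  have R: "ring R" using N by (simp add: left_module_def)
  show ?thesis
    by (rule hom_acyclicI[OF zero_resolution[OF N z] E hom_exact_zero[OF left_module_free_module[OF R] E fm_zero[OF R refl]]])
qed

text \<open>Splitting off the last coordinate reduces rank k + 1 to rank k and the regular
  module.\<close>

lemma hom_acyclic_fm:
  assumes R: "ring R" and S: "ring S" and \<phi>: "\<phi> \<in> ring_hom R S" and E: "left_module R E"
    and acyc: "hom_acyclic R E (restrict_scalars \<phi> (regular_module S))"
  shows "hom_acyclic R E (restrict_scalars \<phi> (fm S k))"
proof (induction k)
  case 0
  show ?case
    by (rule hom_acyclic_zero[OF left_module_restrict_scalars[OF left_module_free_module[OF S] R \<phi>] E])
      (use fm_zero[OF S, of 0] in simp)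
next
  case (Suc k)
  interpret S: ring S by fact
  let ?N = "pair_module (restrict_scalars \<phi> (fm S k)) (restrict_scalars \<phi> (regular_module S))"
  have iso: "lmod_iso R ?N (restrict_scalars \<phi> (fm S (Suc k))) (\<lambda>z. (fst z)(k := snd z)) (\<lambda>x. (x(k := \<zero>\<^bsub>S\<^esub>), x k))"
    unfolding lmod_iso_def
  proof (intro conjI lmod_homI ballI)
    fix a x assume "a \<in> carrier R" "x \<in> carrier (restrict_scalars \<phi> (fm S (Suc k)))"
    then show "((a \<odot>\<^bsub>restrict_scalars \<phi> (fm S (Suc k))\<^esub> x)(k := \<zero>\<^bsub>S\<^esub>), (a \<odot>\<^bsub>restrict_scalars \<phi> (fm S (Suc k))\<^esub> x) k)
      = a \<odot>\<^bsub>?N\<^esub> (x(k := \<zero>\<^bsub>S\<^esub>), x k)"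
      using ring_hom_memE(1)[OF \<phi>] by (auto simp: fun_eq_iff)
  qed (use fm_carrier_iff[OF S] in \<open>auto simp: fun_eq_iff\<close>)
  show ?case
    by (rule hom_acyclic_iso[OF hom_acyclic_pair[OF E Suc acyc]
          left_module_restrict_scalars[OF left_module_free_module[OF S] R \<phi>] iso])
qed

text \<open>The hypotheses amount to \<open>Hom\<^sub>R(S, E) = E\<close> and \<open>Ext\<^sub>R\<^sup>i(S, E) = 0\<close> for \<open>i > 0\<close>, where \<open>S\<close> has a
  finite resolution by finitely generated projective \<open>R\<close>-modules.\<close>

locale scalar_change =
  fixes R :: "('r, 'y) ring_scheme" and S :: "('s, 'z) ring_scheme" and \<phi> :: "'r \<Rightarrow> 's"
    and E :: "('s, 'e) module"
  assumes R: "ring R" and S: "ring S" and \<phi>: "\<phi> \<in> ring_hom R S" and E: "left_module S E"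
    and hom_linear: "\<And>f s. f \<in> lmod_hom R (restrict_scalars \<phi> (regular_module S)) (restrict_scalars \<phi> E) \<Longrightarrow>
      s \<in> carrier S \<Longrightarrow> f s = s \<odot>\<^bsub>E\<^esub> f \<one>\<^bsub>S\<^esub>"
    and acyclic: "hom_acyclic R (restrict_scalars \<phi> E) (restrict_scalars \<phi> (regular_module S))"
begin

text \<open>For each basis element b, the map s \<mapsto> f (s b) is an R-homomorphism from S to E,
  to which \<open>hom_linear\<close> applies. Thus R-linear maps from free S-modules to E are
  S-linear.\<close>

lemma restricted_hom_fm:
  assumes f: "f \<in> lmod_hom R (restrict_scalars \<phi> (fm S k)) (restrict_scalars \<phi> E)"
  shows "f \<in> lmod_hom S (fm S k) E"
proof -
  interpret E: left_module S E by (rule E)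
  interpret F: left_module S "fm S k" by (rule left_module_free_module[OF S])
  note h = lmod_homD[OF f, simplified restrict_scalars_simps]
  have basis: "f (s \<odot>\<^bsub>fm S k\<^esub> basis_elt S b) = s \<odot>\<^bsub>E\<^esub> f (basis_elt S b)"
    if b: "b \<in> {..<k}" and s: "s \<in> carrier S" for s b
  proof -
    have be: "basis_elt S b \<in> carrier (fm S k)" by (rule basis_elt_in[OF S b])
    have "(\<lambda>s. f (s \<odot>\<^bsub>fm S k\<^esub> basis_elt S b)) \<in>
        lmod_hom R (restrict_scalars \<phi> (regular_module S)) (restrict_scalars \<phi> E)"
    proof (rule lmod_homI; simp only: restrict_scalars_simps regular_module_simps)
      show "f (x \<odot>\<^bsub>fm S k\<^esub> basis_elt S b) \<in> carrier E" if "x \<in> carrier S" for x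
        using h(1) F.smult_closed[OF that be] by blast
      show "f ((x \<oplus>\<^bsub>S\<^esub> y) \<odot>\<^bsub>fm S k\<^esub> basis_elt S b) = f (x \<odot>\<^bsub>fm S k\<^esub> basis_elt S b) \<oplus>\<^bsub>E\<^esub> f (y \<odot>\<^bsub>fm S k\<^esub> basis_elt S b)"
        if "x \<in> carrier S" "y \<in> carrier S" for x y
        unfolding F.smult_l_distr[OF that be] using h(2) F.smult_closed[OF _ be] that by blast
      show "f ((\<phi> a \<otimes>\<^bsub>S\<^esub> x) \<odot>\<^bsub>fm S k\<^esub> basis_elt S b) = \<phi> a \<odot>\<^bsub>E\<^esub> f (x \<odot>\<^bsub>fm S k\<^esub> basis_elt S b)"
        if "a \<in> carrier R" "x \<in> carrier S" for a x
        unfolding F.smult_assoc1[OF ring_hom_memE(1)[OF \<phi> that(1)] that(2) be]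
        using h(3) F.smult_closed[OF _ be] that by blast
    qed
    from hom_linear[OF this s] show ?thesis using F.smult_one[OF be] by (simp only:)
  qed
  show ?thesis
  proof (rule lmod_homI)
    fix a x assume a: "a \<in> carrier S" and x: "x \<in> carrier (fm S k)"
    show "f (a \<odot>\<^bsub>fm S k\<^esub> x) = a \<odot>\<^bsub>E\<^esub> f x"
    proof (rule free_module_induct[OF S x])
      have z: "(\<lambda>x. \<zero>\<^bsub>S\<^esub>) = \<zero>\<^bsub>fm S k\<^esub>" by simp
      have "f \<zero>\<^bsub>fm S k\<^esub> = \<zero>\<^bsub>E\<^esub>"
        using lmod_hom_zero[OF f left_module_restrict_scalars[OF F.left_module_axioms R \<phi>]
            left_module_restrict_scalars[OF E R \<phi>]] by (simp only: restrict_scalars_simps)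
      then show "f (a \<odot>\<^bsub>fm S k\<^esub> (\<lambda>x. \<zero>\<^bsub>S\<^esub>)) = a \<odot>\<^bsub>E\<^esub> f (\<lambda>x. \<zero>\<^bsub>S\<^esub>)"
        unfolding z F.smult_r_null[OF a] using a by (simp only: E.smult_r_null)
    next
      fix y b r assume y: "y \<in> carrier (fm S k)" "f (a \<odot>\<^bsub>fm S k\<^esub> y) = a \<odot>\<^bsub>E\<^esub> f y"
        and b: "b \<in> {..<k}" and r: "r \<in> carrier S"
      have be: "basis_elt S b \<in> carrier (fm S k)" by (rule basis_elt_in[OF S b])
      have re: "r \<odot>\<^bsub>fm S k\<^esub> basis_elt S b \<in> carrier (fm S k)" by (rule F.smult_closed[OF r be])
      have fb: "f (basis_elt S b) \<in> carrier E" "f y \<in> carrier E" using h(1) be y by auto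
      have ar: "a \<otimes>\<^bsub>S\<^esub> r \<in> carrier S" using a r by simp
      have "f (a \<odot>\<^bsub>fm S k\<^esub> (y \<oplus>\<^bsub>fm S k\<^esub> r \<odot>\<^bsub>fm S k\<^esub> basis_elt S b))
          = f (a \<odot>\<^bsub>fm S k\<^esub> y) \<oplus>\<^bsub>E\<^esub> f ((a \<otimes>\<^bsub>S\<^esub> r) \<odot>\<^bsub>fm S k\<^esub> basis_elt S b)"
        unfolding F.smult_r_distr[OF a y(1) re] F.smult_assoc1[OF a r be]
        by (rule h(2)[OF F.smult_closed[OF a y(1)] F.smult_closed[OF a re]])
      also have "\<dots> = a \<odot>\<^bsub>E\<^esub> (f y \<oplus>\<^bsub>E\<^esub> f (r \<odot>\<^bsub>fm S k\<^esub> basis_elt S b))"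
        unfolding basis[OF b ar] basis[OF b r] y(2)
        using a r fb by (simp add: E.smult_r_distr E.smult_assoc1)
      also have "\<dots> = a \<odot>\<^bsub>E\<^esub> f (y \<oplus>\<^bsub>fm S k\<^esub> r \<odot>\<^bsub>fm S k\<^esub> basis_elt S b)"
        unfolding h(2)[OF y(1) re] ..
      finally show "f (a \<odot>\<^bsub>fm S k\<^esub> (y \<oplus>\<^bsub>fm S k\<^esub> r \<odot>\<^bsub>fm S k\<^esub> basis_elt S b))
          = a \<odot>\<^bsub>E\<^esub> f (y \<oplus>\<^bsub>fm S k\<^esub> r \<odot>\<^bsub>fm S k\<^esub> basis_elt S b)" .
    qed
  qed (use h(1,2) in blast)+
qed

text \<open>Induction on the length along 0 \<rightarrow> Y' \<rightarrow> L \<rightarrow> Y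
  \<rightarrow> 0, with \<open>L\<close> free over S and Y' the first syzygy. The cone of
  R-resolutions of Y' and \<open>L\<close> resolves \<open>Y\<close>. Since the higher Ext groups of
  \<open>L\<close> over R vanish, vanishing for \<open>Y\<close> in degree i + 1 passes to Y' in
  degree i, both over R, for i > 0, and the induction hypothesis applies. Degree 1 is treated
  directly.\<close>

lemma finite_resolution_restrict:
  fixes Y :: "('s, nat \<Rightarrow> 's) module"
  assumes "projective_resolution S Y (\<lambda>n. fm S (k n)) D e" and "\<And>j. j \<ge> n \<Longrightarrow> k j = 0"
  shows "\<exists>(P :: nat \<Rightarrow> ('r, nat \<Rightarrow> 'r) module) d e'. fg_resolution R (restrict_scalars \<phi> Y) P d e' \<and>
    (\<forall>i. hom_exact R (restrict_scalars \<phi> E) P d i \<longrightarrow> hom_exact S E (\<lambda>n. fm S (k n)) D i)"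
  using assms
proof (induction n arbitrary: k D Y e)
  case 0
  note p = projective_resolutionD[OF 0(1)]
  have k: "k j = 0" for j using 0(2) by simp
  note z = fm_zero[OF S k]
  have "carrier Y = {\<zero>\<^bsub>Y\<^esub>}" using p(6) lmod_hom_zero[OF p(5) p(3) p(1)] unfolding z by auto
  then have "fg_resolution R (restrict_scalars \<phi> Y) (\<lambda>n. fm R 0) (\<lambda>n x. \<zero>\<^bsub>fm R 0\<^esub>) (\<lambda>x. \<zero>\<^bsub>restrict_scalars \<phi> Y\<^esub>)"
    by (intro zero_resolution left_module_restrict_scalars[OF p(1) R \<phi>]) simp
  moreover have "hom_exact S E (\<lambda>n. fm S (k n)) D i" for i
    by (rule hom_exact_zero[OF p(3) E z])
  ultimately show ?case by blast
next
  case (Suc n)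
  note p = projective_resolutionD[OF Suc(2)]
  let ?E = "restrict_scalars \<phi> E" and ?L = "restrict_scalars \<phi> (fm S (k 0))"
  have RE: "left_module R ?E" by (rule left_module_restrict_scalars[OF E R \<phi>])
  let ?C = "D 0 ` carrier (fm S (k (Suc 0)))"
  have C: "submodule ?C S (fm S (k 0))" by (rule lmod_hom_image_submodule[OF p(4) p(3) p(3)])
  note Cs = submoduleD(1)[OF C]
  define Y' where "Y' = submod (fm S (k 0)) ?C"
  have Y'm: "left_module S Y'" unfolding Y'_def by (rule left_module_submod[OF p(3) C])
  have Y'c: "carrier Y' = ?C" "\<zero>\<^bsub>Y'\<^esub> = \<zero>\<^bsub>fm S (k 0)\<^esub>" by (simp_all add: Y'_def)
  have D0: "D 0 \<in> lmod_hom S (fm S (k (Suc 0))) Y'"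
    unfolding Y'_def lmod_hom_submod_iff[OF Cs] using p(4) by blast
  have res': "projective_resolution S Y' (\<lambda>n. fm S (k (Suc n))) (\<lambda>n. D (Suc n)) (D 0)"
    by (rule projective_resolutionI[OF Y'm p(2) p(4) D0]) (use p(10,12) in \<open>simp_all only: Y'c\<close>)
  obtain P' :: "nat \<Rightarrow> ('r, nat \<Rightarrow> 'r) module" and d' e' where P': "fg_resolution R (restrict_scalars \<phi> Y') P' d' e'"
    and ex': "\<And>i. hom_exact R ?E P' d' i \<Longrightarrow> hom_exact S E (\<lambda>n. fm S (k (Suc n))) (\<lambda>n. D (Suc n)) i"
    using Suc.IH[OF res'] Suc(3) by (metis Suc_le_mono)
  obtain Q :: "nat \<Rightarrow> ('r, nat \<Rightarrow> 'r) module" and dQ eQ where Q: "fg_resolution R ?L Q dQ eQ"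
    and exQ: "\<And>n. hom_exact R ?E Q dQ n"
    using hom_acyclic_fm[OF R S \<phi> RE acyclic, of "k 0"] unfolding hom_acyclic_def by blast
  have pP': "projective_resolution R (restrict_scalars \<phi> Y') P' d' e'" "\<And>n. fin_gen R (P' n)"
    and pQ: "projective_resolution R ?L Q dQ eQ" "\<And>n. fin_gen R (Q n)"
    using P' Q by (auto simp: fg_resolution_def)
  obtain m m' where m: "zero_above P' m" "zero_above Q m'" using P' Q by (auto simp: fg_resolution_def)
  then have mm: "zero_above P' (max m m')" "zero_above Q (max m m')" by (auto simp: zero_above_def)
  have inc: "(\<lambda>x. x) \<in> lmod_hom R (restrict_scalars \<phi> Y') ?L"
    unfolding Y'_def by (rule lmod_hom_restrict_scalars[OF \<phi> lmod_hom_restrict[OF Cs lmod_hom_id]])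
  have eh: "e \<in> lmod_hom R ?L (restrict_scalars \<phi> Y)" by (rule lmod_hom_restrict_scalars[OF \<phi> p(5)])
  obtain C :: "nat \<Rightarrow> ('r, (nat \<Rightarrow> 'r) \<times> (nat \<Rightarrow> 'r)) module" and dC eC
    where resC: "projective_resolution R (restrict_scalars \<phi> Y) C dC eC"
    and fgC: "\<And>n. fin_gen R (C n)" and zC: "zero_above C (Suc (max m m'))"
    and up: "\<And>n. hom_exact R ?E C dC (Suc n) \<Longrightarrow> hom_exact R ?E P' d' n"
    and ext: "\<And>g. hom_exact R ?E C dC 0 \<Longrightarrow> g \<in> lmod_hom R (restrict_scalars \<phi> Y') ?E \<Longrightarrow>
       \<exists>g' \<in> lmod_hom R ?L ?E. \<forall>x \<in> carrier Y'. g' x = g x"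
  proof (rule cone_resolution[OF pP'(1) pQ(1) left_module_restrict_scalars[OF p(1) R \<phi>] inc _ eh _ _ _ RE],
      goal_cases)
    case (5 C dC eC)
    show ?case
      by (rule 5(1)[OF 5(2) 5(3)[OF pP'(2) pQ(2)] 5(4)[OF mm] 5(5)[OF exQ]]) (use 5(6) in auto)
  qed (use p(6,9,11) in \<open>auto simp: Y'c\<close>)
  have fC: "fg_resolution R (restrict_scalars \<phi> Y) C dC eC"
    using resC fgC zC unfolding fg_resolution_def by blast
  obtain P :: "nat \<Rightarrow> ('r, nat \<Rightarrow> 'r) module" and d eP where P: "fg_resolution R (restrict_scalars \<phi> Y) P d eP"
  proof (rule resolution_transport[OF fC])
    show "inj (\<lambda>x :: nat \<Rightarrow> 'r. x)" by (rule inj_on_id2)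
  qed blast
  then have pP: "projective_resolution R (restrict_scalars \<phi> Y) P d eP" by (simp add: fg_resolution_def)
  have PC: "hom_exact R ?E C dC i" if "hom_exact R ?E P d i" for i
    by (rule hom_exact_resolution_independent[OF resC pP RE that])
  have "hom_exact S E (\<lambda>n. fm S (k n)) D i" if h: "hom_exact R ?E P d i" for i
  proof (cases i)
    case 0
    show ?thesis unfolding 0 hom_exact_def
    proof (intro ballI impI)
      fix \<chi> assume \<chi>: "\<chi> \<in> lmod_hom S (fm S (k (Suc 0))) E"
        and co: "\<forall>y \<in> carrier (fm S (k (Suc (Suc 0)))). \<chi> (D (Suc 0) y) = \<zero>\<^bsub>E\<^esub>"
      have "\<chi> x = \<zero>\<^bsub>E\<^esub>" if x: "x \<in> carrier (fm S (k (Suc 0)))" "D 0 x = \<zero>\<^bsub>Y'\<^esub>" for x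
        using p(12)[OF x(1)] x(2) co unfolding Y'c by blast
      then obtain g where g: "g \<in> lmod_hom S Y' E" "\<And>x. x \<in> carrier (fm S (k (Suc 0))) \<Longrightarrow> g (D 0 x) = \<chi> x"
        using lmod_hom_factor[OF p(3) Y'm E D0 Y'c(1)[symmetric] \<chi>] by blast
      \<comment> \<open>In degree 1 an S-linear map on the syzygy extends to \<open>L\<close>, a
        priori only R-linearly; \<open>restricted_hom_fm\<close> makes the extension S-linear, hence
        a cochain over S.\<close>
      obtain g' where g': "g' \<in> lmod_hom R ?L ?E" "\<And>x. x \<in> carrier Y' \<Longrightarrow> g' x = g x"
        using ext[OF PC[OF h[unfolded 0]] lmod_hom_restrict_scalars[OF \<phi> g(1)]] by blast
      show "\<exists>\<psi> \<in> lmod_hom S (fm S (k 0)) E. \<forall>x \<in> carrier (fm S (k (Suc 0))). \<chi> x = \<psi> (D 0 x)"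
        by (rule bexI[OF _ restricted_hom_fm[OF g'(1)]]) (use g'(2) g(2) Y'c(1) in auto)
    qed
  next
    case (Suc j)
    show ?thesis using ex'[OF up[OF PC[OF h[unfolded Suc]]]] unfolding Suc hom_exact_def .
  qed
  then show ?case using P by blast
qed

text \<open>The cokernel, seen over R, has a finite resolution by finitely generated projectives.
  From degree \<open>fpd R\<close> on this resolution splits, so Ext into E vanishes over R, and
  hence over S.\<close>

lemma hom_exact_above_fpd:
  assumes F: "free_complex S k D" and z: "\<And>j. j > m \<Longrightarrow> k j = 0" and fpd: "fpd R \<le> enat r" and i: "r \<le> i"
  shows "hom_exact S E (\<lambda>n. fm S (k n)) D i"
proof -
  obtain Y :: "('s, nat \<Rightarrow> 's) module" and e where Y: "projective_resolution S Y (\<lambda>n. fm S (k n)) D e"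
    by (rule free_complex_coker[OF S F])
  obtain P :: "nat \<Rightarrow> ('r, nat \<Rightarrow> 'r) module" and d e' where P: "fg_resolution R (restrict_scalars \<phi> Y) P d e'"
    and ex: "\<And>i. hom_exact R (restrict_scalars \<phi> E) P d i \<Longrightarrow> hom_exact S E (\<lambda>n. fm S (k n)) D i"
    using finite_resolution_restrict[OF Y, of "Suc m"] z by (metis Suc_le_lessD)
  have "projective_resolution R (restrict_scalars \<phi> Y) P d e'" using P by (simp add: fg_resolution_def)
  note p = projective_resolutionD[OF this]
  show ?thesis
    by (rule ex[OF hom_exact_regular[OF p(3,4,12) left_module_restrict_scalars[OF E R \<phi>] regular_above_fpd[OF P fpd i]]])
qed

end

section \<open>Base change of free modules\<close>

text \<open>The homomorphism that f induces after extending scalars along \<phi>, in coordinates: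
  the tensor product of A with a free module of rank k is again the free module of rank k.\<close>

definition base_change ::
  "('r, 'y) ring_scheme \<Rightarrow> ('a, 'z) ring_scheme \<Rightarrow> ('r \<Rightarrow> 'a) \<Rightarrow> nat \<Rightarrow>
   ((nat \<Rightarrow> 'r) \<Rightarrow> nat \<Rightarrow> 'r) \<Rightarrow> (nat \<Rightarrow> 'a) \<Rightarrow> nat \<Rightarrow> 'a" where
  "base_change R A \<phi> l f = free_ext A (fm A l) (\<lambda>i j. \<phi> (f (basis_elt R i) j))"

lemma lmod_regular_cong:
  assumes "lmod_regular R P Q d" "\<And>x. x \<in> carrier P \<Longrightarrow> d' x = d x" "d \<in> lmod_hom R P Q"
  shows "lmod_regular R P Q d'"
proof -
  obtain h where h: "h \<in> lmod_hom R Q P" "\<And>x. x \<in> carrier P \<Longrightarrow> d (h (d x)) = d x"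
    using assms(1) unfolding lmod_regular_def by blast
  have "d' (h (d' x)) = d' x" if x: "x \<in> carrier P" for x
    unfolding assms(2)[OF x] assms(2)[OF lmod_homD(1)[OF h(1) lmod_homD(1)[OF assms(3) x]]] by (rule h(2)[OF x])
  then show ?thesis unfolding lmod_regular_def by (intro bexI[OF _ h(1)] ballI)
qed

locale ring_change =
  fixes R :: "('r, 'y) ring_scheme" and A :: "('a, 'z) ring_scheme" and \<phi> :: "'r \<Rightarrow> 'a"
  assumes R: "ring R" and A: "ring A" and \<phi>: "\<phi> \<in> ring_hom R A"
begin

sublocale R: ring R by (rule R)
sublocale A: ring A by (rule A)

lemma \<phi>_zero: "\<phi> \<zero>\<^bsub>R\<^esub> = \<zero>\<^bsub>A\<^esub>" by (rule ring_hom_zero[OF \<phi> R A])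

lemmas \<phi>_simps = ring_hom_memE[OF \<phi>]

lemma map_fm: "x \<in> carrier (fm R k) \<Longrightarrow> (\<lambda>j. \<phi> (x j)) \<in> carrier (fm A k)"
  unfolding fm_carrier_iff[OF R] fm_carrier_iff[OF A] using \<phi>_simps(1) \<phi>_zero by auto

lemma map_add: "x \<in> carrier (fm R k) \<Longrightarrow> y \<in> carrier (fm R k) \<Longrightarrow>
    (\<lambda>j. \<phi> ((x \<oplus>\<^bsub>fm R k\<^esub> y) j)) = (\<lambda>j. \<phi> (x j)) \<oplus>\<^bsub>fm A k\<^esub> (\<lambda>j. \<phi> (y j))"
  unfolding fm_carrier_iff[OF R] using \<phi>_simps(3) by auto

lemma map_smult: "a \<in> carrier R \<Longrightarrow> x \<in> carrier (fm R k) \<Longrightarrow>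
    (\<lambda>j. \<phi> ((a \<odot>\<^bsub>fm R k\<^esub> x) j)) = \<phi> a \<odot>\<^bsub>fm A k\<^esub> (\<lambda>j. \<phi> (x j))"
  unfolding fm_carrier_iff[OF R] using \<phi>_simps(2) by auto

lemma map_basis: "(\<lambda>j. \<phi> (basis_elt R i j)) = basis_elt A i"
  using \<phi>_simps(4) \<phi>_zero by (auto simp: basis_elt_def)

lemma map_hom: "(\<lambda>x j. \<phi> (x j)) \<in> lmod_hom R (fm R k) (restrict_scalars \<phi> (fm A k))"
  by (rule lmod_homI; simp only: restrict_scalars_simps) (rule map_fm map_add map_smult; assumption)+

lemma base_change_hom:
  assumes f: "f \<in> lmod_hom R (fm R k) (fm R l)"
  shows "base_change R A \<phi> l f \<in> lmod_hom A (fm A k) (fm A l)"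
  unfolding base_change_def
  by (rule free_ext_hom[OF left_module_free_module[OF A]])
    (rule funcsetI, rule map_fm, rule lmod_homD(1)[OF f], rule basis_elt_in[OF R], assumption)

lemma base_change_basis:
  assumes f: "f \<in> lmod_hom R (fm R k) (fm R l)" and i: "i \<in> {..<k}"
  shows "base_change R A \<phi> l f (basis_elt A i) = (\<lambda>j. \<phi> (f (basis_elt R i) j))"
  unfolding base_change_def
  by (rule free_ext_basis[OF left_module_free_module[OF A] _ i])
    (rule funcsetI, rule map_fm, rule lmod_homD(1)[OF f], rule basis_elt_in[OF R], assumption)

lemma semilinear_eqI:
  assumes N: "left_module A N" and g: "g \<in> lmod_hom A (fm A k) N"
    and f: "f \<in> lmod_hom R (fm R k) (restrict_scalars \<phi> N)"
    and eq: "\<And>i. i \<in> {..<k} \<Longrightarrow> g (basis_elt A i) = f (basis_elt R i)"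
    and x: "x \<in> carrier (fm R k)"
  shows "g (\<lambda>j. \<phi> (x j)) = f x"
proof -
  show ?thesis
    by (rule free_hom_eqI[OF left_module_restrict_scalars[OF N R \<phi>]
          lmod_hom_comp[OF map_hom lmod_hom_restrict_scalars[OF \<phi> g]] f _ x])
      (simp add: map_basis eq)
qed

lemma base_change_map:
  assumes f: "f \<in> lmod_hom R (fm R k) (fm R l)" and x: "x \<in> carrier (fm R k)"
  shows "base_change R A \<phi> l f (\<lambda>j. \<phi> (x j)) = (\<lambda>j. \<phi> (f x j))"
proof -
  show ?thesis
    by (rule semilinear_eqI[OF left_module_free_module[OF A] base_change_hom[OF f] lmod_hom_comp[OF f map_hom] _ x])
      (rule base_change_basis[OF f])
qed

lemma base_change_comp:
  assumes f: "f \<in> lmod_hom R (fm R k) (fm R l)" and g: "g \<in> lmod_hom R (fm R l) (fm R m)"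
    and x: "x \<in> carrier (fm A k)"
  shows "base_change R A \<phi> m g (base_change R A \<phi> l f x) = base_change R A \<phi> m (\<lambda>x. g (f x)) x"
  by (rule free_hom_eqI[OF left_module_free_module[OF A] lmod_hom_comp[OF base_change_hom[OF f] base_change_hom[OF g]]
        base_change_hom[OF lmod_hom_comp[OF f g]] _ x])
    (simp only: base_change_basis[OF f] base_change_basis[OF lmod_hom_comp[OF f g]]
      base_change_map[OF g lmod_homD(1)[OF f basis_elt_in[OF R]]])

lemma base_change_cong:
  assumes f: "f \<in> lmod_hom R (fm R k) (fm R l)" and g: "g \<in> lmod_hom R (fm R k) (fm R l)"
    and eq: "\<And>x. x \<in> carrier (fm R k) \<Longrightarrow> f x = g x" and x: "x \<in> carrier (fm A k)"
  shows "base_change R A \<phi> l f x = base_change R A \<phi> l g x"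
  by (rule free_hom_eqI[OF left_module_free_module[OF A] base_change_hom[OF f] base_change_hom[OF g] _ x])
    (simp only: base_change_basis[OF f] base_change_basis[OF g] eq[OF basis_elt_in[OF R]])

lemma base_change_zero:
  assumes f: "f \<in> lmod_hom R (fm R k) (fm R l)" and z: "\<And>x. x \<in> carrier (fm R k) \<Longrightarrow> f x = \<zero>\<^bsub>fm R l\<^esub>"
    and x: "x \<in> carrier (fm A k)"
  shows "base_change R A \<phi> l f x = \<zero>\<^bsub>fm A l\<^esub>"
proof (rule free_hom_eqI[OF left_module_free_module[OF A] base_change_hom[OF f] lmod_hom_const_zero[OF left_module_free_module[OF A]] _ x])
  fix i assume i: "i \<in> {..<k}"
  show "base_change R A \<phi> l f (basis_elt A i) = \<zero>\<^bsub>fm A l\<^esub>"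
    unfolding base_change_basis[OF f i] z[OF basis_elt_in[OF R i]] by (simp add: \<phi>_zero)
qed

lemma base_change_regular:
  assumes d: "d \<in> lmod_hom R (fm R k) (fm R l)" and reg: "lmod_regular R (fm R k) (fm R l) d"
  shows "lmod_regular A (fm A k) (fm A l) (base_change R A \<phi> l d)"
proof -
  obtain h where h: "h \<in> lmod_hom R (fm R l) (fm R k)" "\<And>x. x \<in> carrier (fm R k) \<Longrightarrow> d (h (d x)) = d x"
    using reg unfolding lmod_regular_def by blast
  have "base_change R A \<phi> l d (base_change R A \<phi> k h (base_change R A \<phi> l d x)) = base_change R A \<phi> l d x"
    if x: "x \<in> carrier (fm A k)" for x
    unfolding base_change_comp[OF d h(1) x] base_change_comp[OF lmod_hom_comp[OF d h(1)] d x]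
    by (rule base_change_cong[OF lmod_hom_comp[OF lmod_hom_comp[OF d h(1)] d] d h(2) x])
  then show ?thesis unfolding lmod_regular_def by (intro bexI[OF _ base_change_hom[OF h(1)]] ballI)
qed

end

section \<open>Trivial extensions\<close>

locale triv_ext = bimodule S M for S :: "('s, 'z) ring_scheme" and M :: "('s, 'm) bimodule"
begin

abbreviation A :: "('s \<times> 'm) ring" where "A \<equiv> S \<ltimes> M"

abbreviation \<sigma> :: "'s \<Rightarrow> 's \<times> 'm" where "\<sigma> s \<equiv> (s, \<zero>\<^bsub>M\<^esub>)"

lemma ringA: "ring A" by (rule ring_trivial_extension[OF bimodule_axioms])

lemma A_simps [simp]:
  "carrier A = carrier S \<times> carrier M" "\<one>\<^bsub>A\<^esub> = (\<one>\<^bsub>S\<^esub>, \<zero>\<^bsub>M\<^esub>)" "\<zero>\<^bsub>A\<^esub> = (\<zero>\<^bsub>S\<^esub>, \<zero>\<^bsub>M\<^esub>)"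
  "x \<otimes>\<^bsub>A\<^esub> y = (fst x \<otimes>\<^bsub>S\<^esub> fst y, fst x \<odot>\<^bsub>M\<^esub> snd y \<oplus>\<^bsub>M\<^esub> ract M (snd x) (fst y))"
  "x \<oplus>\<^bsub>A\<^esub> y = (fst x \<oplus>\<^bsub>S\<^esub> fst y, snd x \<oplus>\<^bsub>M\<^esub> snd y)"
  by (simp_all add: trivial_extension_def split_beta)

lemma ract_zero_left: "a \<in> carrier S \<Longrightarrow> ract M \<zero>\<^bsub>M\<^esub> a = \<zero>\<^bsub>M\<^esub>"
  using ract_l_distr[of "\<zero>\<^bsub>M\<^esub>" "\<zero>\<^bsub>M\<^esub>" a] ract_closed[of "\<zero>\<^bsub>M\<^esub>" a]
  by (metis M.add.l_cancel_one' M.r_zero M.zero_closed)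

lemma ract_zero_right: "x \<in> carrier M \<Longrightarrow> ract M x \<zero>\<^bsub>S\<^esub> = \<zero>\<^bsub>M\<^esub>"
  using ract_r_distr[of x "\<zero>\<^bsub>S\<^esub>" "\<zero>\<^bsub>S\<^esub>"] ract_closed[of x "\<zero>\<^bsub>S\<^esub>"]
  by (metis M.add.l_cancel_one' R.r_zero R.zero_closed)

lemma \<sigma>_hom: "\<sigma> \<in> ring_hom S A"
  by (rule ring_hom_memI) (auto simp: ract_zero_left)

lemma fst_hom: "fst \<in> ring_hom A S"
  by (rule ring_hom_memI) auto

sublocale \<sigma>: ring_change S A \<sigma>
  by (rule ring_change.intro[OF R.ring_axioms ringA \<sigma>_hom])

sublocale \<pi>: ring_change A S fst
  by (rule ring_change.intro[OF ringA R.ring_axioms fst_hom])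

text \<open>Extension of scalars along the section \<sigma> and along the projection. As the
  projection is a left inverse of \<sigma>, going up and back down changes nothing
  (\<open>down_up\<close>).\<close>

abbreviation up where "up \<equiv> base_change S A \<sigma>"
abbreviation down where "down \<equiv> base_change A S fst"

lemma fst_map: "x \<in> carrier (fm A k) \<Longrightarrow> (\<lambda>j. fst (x j)) \<in> carrier (fm S k)"
  by (rule \<pi>.map_fm)

lemma \<sigma>_map: "x \<in> carrier (fm S k) \<Longrightarrow> (\<lambda>j. \<sigma> (x j)) \<in> carrier (fm A k)"
  by (rule \<sigma>.map_fm)

lemma down_up:
  assumes d: "d \<in> lmod_hom S (fm S k) (fm S l)" and y: "y \<in> carrier (fm S k)"
  shows "down l (up l d) y = d y"
proof (rule free_hom_eqI[OF left_module_free_module[OF R.ring_axioms] \<pi>.base_change_hom[OF \<sigma>.base_change_hom[OF d]] d _ y])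
  fix i assume i: "i \<in> {..<k}"
  show "down l (up l d) (basis_elt S i) = d (basis_elt S i)"
    unfolding \<pi>.base_change_basis[OF \<sigma>.base_change_hom[OF d] i] \<sigma>.base_change_basis[OF d i] by simp
qed

lemma fst_up:
  assumes d: "d \<in> lmod_hom S (fm S k) (fm S l)" and x: "x \<in> carrier (fm A k)"
  shows "(\<lambda>j. fst (up l d x j)) = d (\<lambda>j. fst (x j))"
  unfolding \<pi>.base_change_map[OF \<sigma>.base_change_hom[OF d] x, symmetric] by (rule down_up[OF d fst_map[OF x]])

text \<open>The square of the kernel of \<open>A \<rightarrow> S\<close> is zero.\<close>

lemma kernel_hom_fst:
  assumes f: "f \<in> lmod_hom A (fm A k) (fm A l)"
    and z: "\<And>x. x \<in> carrier (fm A k) \<Longrightarrow> (\<lambda>j. fst (f x j)) = (\<lambda>j. \<zero>\<^bsub>S\<^esub>)"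
    and x: "x \<in> carrier (fm A k)" and x0: "(\<lambda>j. fst (x j)) = (\<lambda>j. \<zero>\<^bsub>S\<^esub>)"
  shows "f x = \<zero>\<^bsub>fm A l\<^esub>"
proof -
  note Fm = left_module_free_module[OF ringA]
  interpret F: left_module A "fm A k" by (rule Fm)
  have S: "ring S" by (rule R.ring_axioms)
  \<comment> \<open>Modulo multiples by elements of M, x equals the lift of its S-part. Since f
    takes values with entries in M, those multiples contribute products of two elements of M, which
    are zero.\<close>
  have "f x = f (\<lambda>j. \<sigma> (fst (x j)))"
  proof (rule free_module_induct[OF ringA x])
    show "f (\<lambda>x. \<zero>\<^bsub>A\<^esub>) = f (\<lambda>j. \<sigma> (fst ((\<lambda>x. \<zero>\<^bsub>A\<^esub>) j)))" by simp
  next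
    fix y b r assume y: "y \<in> carrier (fm A k)" "f y = f (\<lambda>j. \<sigma> (fst (y j)))"
      and b: "b \<in> {..<k}" and r: "r \<in> carrier A"
    have be: "basis_elt A b \<in> carrier (fm A k)" by (rule basis_elt_in[OF ringA b])
    have rs: "\<sigma> (fst r) \<in> carrier A" using r by auto
    have ys: "(\<lambda>j. \<sigma> (fst (y j))) \<in> carrier (fm A k)" by (rule \<sigma>_map[OF fst_map[OF y(1)]])
    have fb0: "fst (f (basis_elt A b) j) = \<zero>\<^bsub>S\<^esub>" for j
      using fun_cong[OF z[OF be], of j] by simp
    \<comment> \<open>All entries of f (basis_elt A b) lie in M, so the M-part of r annihilates
      them.\<close>
    have rf: "r \<odot>\<^bsub>fm A l\<^esub> f (basis_elt A b) = \<sigma> (fst r) \<odot>\<^bsub>fm A l\<^esub> f (basis_elt A b)"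
      using r by (auto simp: fun_eq_iff fb0 ract_zero_left ract_zero_right)
    have eq: "(\<lambda>j. \<sigma> (fst ((y \<oplus>\<^bsub>fm A k\<^esub> r \<odot>\<^bsub>fm A k\<^esub> basis_elt A b) j)))
        = (\<lambda>j. \<sigma> (fst (y j))) \<oplus>\<^bsub>fm A k\<^esub> \<sigma> (fst r) \<odot>\<^bsub>fm A k\<^esub> basis_elt A b"
      using r by (auto simp: fun_eq_iff basis_elt_def ract_zero_left)
    show "f (y \<oplus>\<^bsub>fm A k\<^esub> r \<odot>\<^bsub>fm A k\<^esub> basis_elt A b) = f (\<lambda>j. \<sigma> (fst ((y \<oplus>\<^bsub>fm A k\<^esub> r \<odot>\<^bsub>fm A k\<^esub> basis_elt A b) j)))"
      unfolding eq lmod_homD(2)[OF f y(1) F.smult_closed[OF r be]] lmod_homD(2)[OF f ys F.smult_closed[OF rs be]]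
        lmod_homD(3)[OF f r be] lmod_homD(3)[OF f rs be] rf y(2) ..
  qed
  also have "(\<lambda>j. \<sigma> (fst (x j))) = \<zero>\<^bsub>fm A k\<^esub>" using x0 by (simp add: fun_eq_iff)
  finally show ?thesis using lmod_hom_zero[OF f Fm Fm] by simp
qed

lemma fst_diff:
  assumes x: "x \<in> carrier (fm A k)" and y: "y \<in> carrier (fm A k)" and eq: "(\<lambda>j. fst (x j)) = (\<lambda>j. fst (y j))"
  shows "(\<lambda>j. fst ((x \<ominus>\<^bsub>fm A k\<^esub> y) j)) = \<zero>\<^bsub>fm S k\<^esub>"
proof -
  note Fm = left_module_free_module[OF ringA]
  have rS: "left_module A (restrict_scalars fst (fm S k))"
    by (rule left_module_restrict_scalars[OF left_module_free_module[OF R.ring_axioms] ringA fst_hom])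
  interpret rS: left_module A "restrict_scalars fst (fm S k)" by (rule rS)
  show ?thesis
    using lmod_hom_minus_distrib[OF \<pi>.map_hom Fm rS x y] rS.M.diff_self[of "\<lambda>j. fst (y j)"] fst_map[OF y]
    unfolding eq by (simp only: restrict_scalars_simps)
qed

text \<open>Let e = 1 - d h, which kills the image of d and satisfies u e = u. Lift the splitting g
  modulo M to G over A. The error \<nu> = e - e G u vanishes modulo M, so \<nu> \<nu> = 0 and 1 +
  \<nu> inverts 1 - \<nu>. The corrected map (1 + \<nu>) e G splits u.\<close>

lemma regular_lift:
  assumes d: "d \<in> lmod_hom A (fm A k2) (fm A k1)" and u: "u \<in> lmod_hom A (fm A k1) (fm A k0)"
    and ud: "\<And>x. x \<in> carrier (fm A k2) \<Longrightarrow> u (d x) = \<zero>\<^bsub>fm A k0\<^esub>"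
    and reg: "lmod_regular A (fm A k2) (fm A k1) d"
    and ex: "\<And>y. y \<in> carrier (fm S k1) \<Longrightarrow> down k0 u y = \<zero>\<^bsub>fm S k0\<^esub> \<Longrightarrow> y \<in> down k1 d ` carrier (fm S k2)"
    and regu: "lmod_regular S (fm S k1) (fm S k0) (down k0 u)"
  shows "lmod_regular A (fm A k1) (fm A k0) u"
proof -
  note Fm = left_module_free_module[OF ringA]
  note Sm = left_module_free_module[OF R.ring_axioms]
  interpret F: left_module A "fm A k1" by (rule Fm)
  interpret F0: left_module A "fm A k0" by (rule Fm)
  obtain h where h: "h \<in> lmod_hom A (fm A k1) (fm A k2)" "\<And>x. x \<in> carrier (fm A k2) \<Longrightarrow> d (h (d x)) = d x"
    using reg unfolding lmod_regular_def by blast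
  obtain g where g: "g \<in> lmod_hom S (fm S k0) (fm S k1)"
    "\<And>x. x \<in> carrier (fm S k1) \<Longrightarrow> down k0 u (g (down k0 u x)) = down k0 u x"
    using regu unfolding lmod_regular_def by blast
  define e where "e x = x \<ominus>\<^bsub>fm A k1\<^esub> d (h x)" for x
  define G where "G = up k1 g"
  define \<nu> where "\<nu> x = e x \<ominus>\<^bsub>fm A k1\<^esub> e (G (u x))" for x
  have e: "e \<in> lmod_hom A (fm A k1) (fm A k1)"
    unfolding e_def[abs_def] by (rule lmod_hom_diff[OF Fm lmod_hom_id lmod_hom_comp[OF h(1) d]])
  have G: "G \<in> lmod_hom A (fm A k0) (fm A k1)" unfolding G_def by (rule \<sigma>.base_change_hom[OF g(1)])
  note eGu = lmod_hom_comp[OF lmod_hom_comp[OF u G] e]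
  have \<nu>: "\<nu> \<in> lmod_hom A (fm A k1) (fm A k1)"
    unfolding \<nu>_def[abs_def] by (rule lmod_hom_diff[OF Fm e eGu])
  have ec: "e x \<in> carrier (fm A k1)" "\<nu> x \<in> carrier (fm A k1)" "e (G (u x)) \<in> carrier (fm A k1)"
    "G (u x) \<in> carrier (fm A k1)" "d (h x) \<in> carrier (fm A k1)" if "x \<in> carrier (fm A k1)" for x
    using lmod_homD(1)[OF e that] lmod_homD(1)[OF \<nu> that] lmod_homD(1)[OF eGu that]
      lmod_homD(1)[OF lmod_hom_comp[OF u G] that] lmod_homD(1)[OF lmod_hom_comp[OF h(1) d] that] by auto
  have ed: "e (d y) = \<zero>\<^bsub>fm A k1\<^esub>" if y: "y \<in> carrier (fm A k2)" for y
    unfolding e_def h(2)[OF y] by (rule F.M.diff_self[OF lmod_homD(1)[OF d y]])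
  have ee: "e (e x) = e x" if x: "x \<in> carrier (fm A k1)" for x
  proof -
    have "e (e x) = e x \<ominus>\<^bsub>fm A k1\<^esub> e (d (h x))"
      using lmod_hom_minus_distrib[OF e Fm Fm x ec(5)[OF x]] by (simp only: e_def[of x])
    then show ?thesis unfolding ed[OF lmod_homD(1)[OF h(1) x]] F.M.diff_zero[OF ec(1)[OF x]] .
  qed
  have ue: "u (e x) = u x" if x: "x \<in> carrier (fm A k1)" for x
    unfolding e_def lmod_hom_minus_distrib[OF u Fm Fm x ec(5)[OF x]] ud[OF lmod_homD(1)[OF h(1) x]]
    by (rule F0.M.diff_zero[OF lmod_homD(1)[OF u x]])
  have fstd: "(\<lambda>j. fst (f x j)) = down l f (\<lambda>j. fst (x j))"
    if "f \<in> lmod_hom A (fm A k) (fm A l)" "x \<in> carrier (fm A k)" for f k l x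
    by (rule \<pi>.base_change_map[OF that, symmetric])
  \<comment> \<open>Modulo M, the element x - G (u x) is a cycle for u, hence comes from d by
    exactness over S; after subtracting d W, its image under e is zero modulo M.\<close>
  have \<nu>0: "(\<lambda>j. fst (\<nu> x j)) = (\<lambda>j. \<zero>\<^bsub>S\<^esub>)" if x: "x \<in> carrier (fm A k1)" for x
  proof -
    let ?x = "\<lambda>j. fst (x j)"
    define y where "y = x \<ominus>\<^bsub>fm A k1\<^esub> G (u x)"
    have y: "y \<in> carrier (fm A k1)" unfolding y_def by (rule F.M.minus_closed[OF x ec(4)[OF x]])
    have \<nu>y: "\<nu> x = e y" unfolding \<nu>_def y_def by (rule lmod_hom_minus_distrib[OF e Fm Fm x ec(4)[OF x], symmetric])
    have uy: "down k0 u (\<lambda>j. fst (y j)) = \<zero>\<^bsub>fm S k0\<^esub>"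
    proof -
      have "(\<lambda>j. fst (u (G (u x)) j)) = (\<lambda>j. fst (u x j))"
        unfolding fstd[OF u ec(4)[OF x]] unfolding G_def fst_up[OF g(1) lmod_homD(1)[OF u x]]
        unfolding fstd[OF u x] by (rule g(2)[OF fst_map[OF x]])
      from fst_diff[OF lmod_homD(1)[OF u x] lmod_homD(1)[OF u ec(4)[OF x]] this[symmetric]]
      have "(\<lambda>j. fst (u y j)) = \<zero>\<^bsub>fm S k0\<^esub>"
        unfolding y_def lmod_hom_minus_distrib[OF u Fm Fm x ec(4)[OF x]] .
      then show ?thesis unfolding fstd[OF u y] .
    qed
    obtain w where w: "w \<in> carrier (fm S k2)" "down k1 d w = (\<lambda>j. fst (y j))"
      using ex[OF fst_map[OF y] uy] by force
    define W where "W = (\<lambda>j. \<sigma> (w j))"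
    have W: "W \<in> carrier (fm A k2)" unfolding W_def by (rule \<sigma>_map[OF w(1)])
    have dW: "d W \<in> carrier (fm A k1)" by (rule lmod_homD(1)[OF d W])
    have "(\<lambda>j. fst (d W j)) = (\<lambda>j. fst (y j))"
      unfolding fstd[OF d W] unfolding W_def fst_conv by (rule w(2))
    from fst_diff[OF y dW this[symmetric]]
    have z: "(\<lambda>j. fst ((y \<ominus>\<^bsub>fm A k1\<^esub> d W) j)) = \<zero>\<^bsub>fm S k1\<^esub>" .
    have zc: "y \<ominus>\<^bsub>fm A k1\<^esub> d W \<in> carrier (fm A k1)" by (rule F.M.minus_closed[OF y dW])
    have "e (y \<ominus>\<^bsub>fm A k1\<^esub> d W) = e y"
      unfolding lmod_hom_minus_distrib[OF e Fm Fm y dW] ed[OF W] by (rule F.M.diff_zero[OF ec(1)[OF y]])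
    then have "(\<lambda>j. fst (e y j)) = down k1 e \<zero>\<^bsub>fm S k1\<^esub>" using fstd[OF e zc] z by simp
    then show ?thesis unfolding \<nu>y using lmod_hom_zero[OF \<pi>.base_change_hom[OF e] Sm Sm] by simp
  qed
  have \<nu>\<nu>: "\<nu> (\<nu> x) = \<zero>\<^bsub>fm A k1\<^esub>" if x: "x \<in> carrier (fm A k1)" for x
    by (rule kernel_hom_fst[OF \<nu> \<nu>0 ec(2)[OF x] \<nu>0[OF x]])
  have \<nu>e: "\<nu> (e x) = \<nu> x" if x: "x \<in> carrier (fm A k1)" for x
    unfolding \<nu>_def ee[OF x] ue[OF x] ..
  have eGu': "e (G (u x)) = e x \<ominus>\<^bsub>fm A k1\<^esub> \<nu> x" if x: "x \<in> carrier (fm A k1)" for x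
    unfolding \<nu>_def
    using F.M.minus_diff[OF ec(1,3)[OF x]] F.M.add_diff_cancel[OF ec(3,1)[OF x]]
    by (simp only: a_minus_def[of _ "e x"] a_minus_def[of _ "e x" "_ \<ominus>\<^bsub>_\<^esub> _"])
  \<comment> \<open>This is (1 + \<nu>) (e - \<nu>) = e, from \<nu> e = \<nu> and \<nu> \<nu> =
    0.\<close>
  have key: "e (G (u x)) \<oplus>\<^bsub>fm A k1\<^esub> \<nu> (e (G (u x))) = e x" if x: "x \<in> carrier (fm A k1)" for x
  proof -
    have "\<nu> (e (G (u x))) = \<nu> x"
      unfolding eGu'[OF x] lmod_hom_minus_distrib[OF \<nu> Fm Fm ec(1,2)[OF x]] \<nu>e[OF x] \<nu>\<nu>[OF x]
      by (rule F.M.diff_zero[OF ec(2)[OF x]])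
    then show ?thesis unfolding eGu'[OF x] using F.M.diff_add_cancel'[OF ec(1,2)[OF x]] by (simp only:)
  qed
  have H: "(\<lambda>y. e (G y) \<oplus>\<^bsub>fm A k1\<^esub> \<nu> (e (G y))) \<in> lmod_hom A (fm A k0) (fm A k1)"
    by (rule lmod_hom_add[OF Fm lmod_hom_comp[OF G e] lmod_hom_comp[OF lmod_hom_comp[OF G e] \<nu>]])
  show ?thesis
    unfolding lmod_regular_def
  proof (rule bexI[OF _ H], rule ballI)
    fix x assume x: "x \<in> carrier (fm A k1)"
    show "u (e (G (u x)) \<oplus>\<^bsub>fm A k1\<^esub> \<nu> (e (G (u x)))) = u x"
      unfolding key[OF x] by (rule ue[OF x])
  qed
qed

end

section \<open>Characters of abelian groups\<close>

text \<open>The values are not restricted to the unit circle: the property of the target that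
  matters is divisibility.\<close>

definition character :: "('g, 'x) monoid_scheme \<Rightarrow> ('g \<Rightarrow> complex) \<Rightarrow> bool" where
  "character G c \<longleftrightarrow> (\<forall>x \<in> carrier G. c x \<noteq> 0) \<and>
     (\<forall>x \<in> carrier G. \<forall>y \<in> carrier G. c (x \<otimes>\<^bsub>G\<^esub> y) = c x * c y)"

text \<open>The graph of a character of a subgroup of \<open>G\<close>.\<close>

definition pre_character :: "('g, 'x) monoid_scheme \<Rightarrow> ('g \<times> complex) set \<Rightarrow> bool" where
  "pre_character G r \<longleftrightarrow> (\<forall>x z. (x, z) \<in> r \<longrightarrow> x \<in> carrier G \<and> z \<noteq> 0) \<and>
     (\<one>\<^bsub>G\<^esub>, 1) \<in> r \<and> (\<forall>z. (\<one>\<^bsub>G\<^esub>, z) \<in> r \<longrightarrow> z = 1) \<and>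
     (\<forall>x z y w. (x, z) \<in> r \<longrightarrow> (y, w) \<in> r \<longrightarrow> (x \<otimes>\<^bsub>G\<^esub> y, z * w) \<in> r) \<and>
     (\<forall>x z. (x, z) \<in> r \<longrightarrow> (inv\<^bsub>G\<^esub> x, inverse z) \<in> r)"

text \<open>Divisibility of the multiplicative group of the complex numbers, on which the extension
  of characters rests.\<close>

lemma complex_root_exists:
  fixes w :: complex assumes "n > 0" shows "\<exists>z. z ^ n = w"
proof -
  obtain r a where w: "w = rcis r a" and r: "r \<ge> 0"
    using rcis_cmod_Arg[of w] norm_ge_zero by metis
  have "rcis (root n r) (a / real n) ^ n = w"
    using assms r by (simp add: DeMoivre2 w)
  then show ?thesis by blast
qed

context comm_group
begin

lemma pre_characterD:
  assumes "pre_character G r"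
  shows "(x, z) \<in> r \<Longrightarrow> x \<in> carrier G" "(x, z) \<in> r \<Longrightarrow> z \<noteq> 0" "(\<one>, 1) \<in> r"
    "(\<one>, z) \<in> r \<Longrightarrow> z = 1" "(x, z) \<in> r \<Longrightarrow> (y, w) \<in> r \<Longrightarrow> (x \<otimes> y, z * w) \<in> r"
    "(x, z) \<in> r \<Longrightarrow> (inv x, inverse z) \<in> r"
  using assms unfolding pre_character_def by blast+

lemma pre_character_unique:
  assumes r: "pre_character G r" and "(x, z) \<in> r" "(x, w) \<in> r" shows "z = w"
proof -
  note d = pre_characterD[OF r]
  have "(x \<otimes> inv x, z * inverse w) \<in> r" by (rule d(5)[OF assms(2) d(6)[OF assms(3)]])
  then have "z * inverse w = 1" using d(4) r_inv[OF d(1)[OF assms(2)]] by simp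
  then show ?thesis using d(2)[OF assms(3)] by (simp add: field_simps)
qed

lemma pre_character_int_pow:
  assumes r: "pre_character G r" and xz: "(x, z) \<in> r" shows "(x [^] (k::int), z powi k) \<in> r"
proof -
  note d = pre_characterD[OF r]
  have x: "x \<in> carrier G" by (rule d(1)[OF xz])
  have nat: "(x [^] n, z ^ n) \<in> r" for n :: nat
  proof (induction n)
    case (Suc n)
    show ?case using d(5)[OF Suc xz] by (simp add: mult.commute)
  qed (simp add: d(3))
  show ?thesis
  proof (cases k rule: int_cases2)
    case (nonneg n)
    then show ?thesis using nat[of n] by (simp add: int_pow_int)
  next
    case (nonpos n)
    then show ?thesis using d(6)[OF nat[of n]] x by (simp add: int_pow_neg int_pow_int power_int_minus)
  qed
qed

text \<open>The new graph is closed under products and inverses, so single-valuedness reduces to the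
  value at the identity. If u x^k is the identity, then x^k is the inverse of u and lies in the old
  domain, where \<open>comp\<close> prescribes the value z^k.\<close>

lemma pre_character_adjoin:
  assumes r: "pre_character G r" and x: "x \<in> carrier G" and z: "z \<noteq> 0"
    and comp: "\<And>k w. (x [^] (k::int), w) \<in> r \<Longrightarrow> w = z powi k"
  obtains r' where "pre_character G r'" "r \<subseteq> r'" "(x, z) \<in> r'"
proof -
  note d = pre_characterD[OF r]
  define r' where "r' = {(y \<otimes> x [^] k, v * z powi k) | y v (k::int). (y, v) \<in> r}"
  have 1: "pre_character G r'"
    unfolding pre_character_def
  proof (intro conjI allI impI)
    fix y v assume "(y, v) \<in> r'"
    then obtain u w and k :: int where y: "y = u \<otimes> x [^] k" "v = w * z powi k" and uw: "(u, w) \<in> r"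
      by (auto simp: r'_def)
    have u: "u \<in> carrier G" by (rule d(1)[OF uw])
    show "y \<in> carrier G" "v \<noteq> 0" using u x z d(2)[OF uw] by (simp_all add: y)
    have "inv y = inv u \<otimes> x [^] (- k)" "inverse v = inverse w * z powi (- k)"
      using u x by (simp_all add: y inv_mult int_pow_neg power_int_minus inverse_mult_distrib)
    then show "(inv y, inverse v) \<in> r'" using d(6)[OF uw] unfolding r'_def by blast
    fix y' v' assume "(y', v') \<in> r'"
    then obtain u' w' and k' :: int where y': "y' = u' \<otimes> x [^] k'" "v' = w' * z powi k'" and uw': "(u', w') \<in> r"
      by (auto simp: r'_def)
    have u': "u' \<in> carrier G" by (rule d(1)[OF uw'])
    have "y \<otimes> y' = (u \<otimes> u') \<otimes> x [^] (k + k')"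
      using u u' x by (simp add: y y' int_pow_mult m_ac)
    moreover have "v * v' = (w * w') * z powi (k + k')" using z by (simp add: y y' power_int_add)
    ultimately show "(y \<otimes> y', v * v') \<in> r'" using d(5)[OF uw uw'] unfolding r'_def by blast
  next
    have "\<one> = \<one> \<otimes> x [^] (0::int)" "1 = 1 * z powi 0" by simp_all
    then show "(\<one>, 1) \<in> r'" using d(3) unfolding r'_def by blast
  next
    fix v assume "(\<one>, v) \<in> r'"
    then obtain u w and k :: int where y: "\<one> = u \<otimes> x [^] k" "v = w * z powi k" and uw: "(u, w) \<in> r"
      by (auto simp: r'_def)
    have u: "u \<in> carrier G" by (rule d(1)[OF uw])
    have xk: "x [^] k \<in> carrier G" using x by simp
    have "x [^] k = inv u" using y(1) u xk by (metis inv_char m_comm)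
    then have "(x [^] k, inverse w) \<in> r" using d(6)[OF uw] by simp
    then show "v = 1" using comp d(2)[OF uw] y(2) by (metis right_inverse)
  qed
  have 2: "(y, v) \<in> r'" if "(y, v) \<in> r" for y v
  proof -
    have "y = y \<otimes> x [^] (0::int)" "v = v * z powi 0" using d(1)[OF that] by simp_all
    then show ?thesis using that unfolding r'_def by blast
  qed
  have "x = \<one> \<otimes> x [^] (1::int)" "z = 1 * z powi 1" using x by (simp_all add: int_pow_1)
  then have 3: "(x, z) \<in> r'" using d(3) unfolding r'_def by blast
  show thesis by (rule that[OF 1 _ 3]) (use 2 in auto)
qed

text \<open>The exponents k for which x^k lies in the domain form a subgroup of the integers: it is
  zero, or generated by its least positive element n, and then the value at x^n determines all the
  others.\<close>

lemma pre_character_period: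
  assumes r: "pre_character G r" and x: "x \<in> carrier G"
  shows "(\<forall>k w. (x [^] (k::int), w) \<in> r \<longrightarrow> k = 0 \<and> w = 1) \<or>
    (\<exists>n > 0. \<exists>w. (x [^] int n, w) \<in> r \<and> (\<forall>k w'. (x [^] (k::int), w') \<in> r \<longrightarrow> (\<exists>q. k = int n * q \<and> w' = w powi q)))"
proof -
  note d = pre_characterD[OF r]
  let ?P = "\<lambda>n::nat. n > 0 \<and> (\<exists>w. (x [^] int n, w) \<in> r)"
  show ?thesis
  proof (cases "\<exists>n. ?P n")
    case True
    define n where "n = (LEAST n. ?P n)"
    have n: "?P n" unfolding n_def by (rule LeastI_ex[OF True])
    then obtain w where w: "(x [^] int n, w) \<in> r" by blast
    have "\<exists>q. k = int n * q \<and> w' = w powi q" if kw: "(x [^] (k::int), w') \<in> r" for k w'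
    proof -
      \<comment> \<open>Division with remainder: a nonzero remainder would be a smaller positive
        exponent.\<close>
      let ?q = "k div int n" and ?t = "k mod int n"
      have xq: "(x [^] (int n * ?q), w powi ?q) \<in> r"
        using pre_character_int_pow[OF r w, of ?q] x by (simp add: int_pow_pow)
      have "(x [^] k \<otimes> inv (x [^] (int n * ?q)), w' * inverse (w powi ?q)) \<in> r"
        by (rule d(5)[OF kw d(6)[OF xq]])
      moreover have "x [^] k \<otimes> inv (x [^] (int n * ?q)) = x [^] ?t"
        using x by (metis int_pow_diff minus_mult_div_eq_mod)
      ultimately have t: "(x [^] ?t, w' * inverse (w powi ?q)) \<in> r" by simp
      have "?t = 0"
      proof (rule ccontr)
        assume "?t \<noteq> 0"
        moreover have "0 \<le> ?t" "?t < int n" using n by auto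
        ultimately have "?P (nat ?t)" "nat ?t < n" using t by auto
        then show False using not_less_Least[of "nat ?t" ?P] unfolding n_def by blast
      qed
      then have k: "k = int n * ?q" by (metis add.right_neutral mult_div_mod_eq)
      then have "w' = w powi ?q" using pre_character_unique[OF r kw] xq by simp
      with k show ?thesis by blast
    qed
    then show ?thesis using n w by blast
  next
    case False
    have "k = 0 \<and> w = 1" if kw: "(x [^] (k::int), w) \<in> r" for k w
    proof -
      have "k = 0"
      proof (rule ccontr)
        assume "k \<noteq> 0"
        then consider "k > 0" | "k < 0" by linarith
        then show False
        proof cases
          case 1 then show False using False kw by (metis zero_less_imp_eq_int)
        next
          case 2
          have "(x [^] (- k), inverse w) \<in> r" using d(6)[OF kw] x by (simp add: int_pow_neg)
          then show False using False 2 by (metis neg_0_less_iff_less zero_less_imp_eq_int)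
        qed
      qed
      then show ?thesis using d(4) kw by simp
    qed
    then show ?thesis by blast
  qed
qed

text \<open>Zorn's lemma, in graphs ordered by inclusion. A maximal graph is defined everywhere:
  otherwise a missing element x could be adjoined, with an arbitrary value or with an n-th root of
  the value at x^n.\<close>

lemma pre_character_extend:
  assumes r: "pre_character G r"
  obtains c where "character G c" "\<And>x z. (x, z) \<in> r \<Longrightarrow> c x = z"
proof -
  let ?A = "{s. pre_character G s \<and> r \<subseteq> s}"
  have "\<exists>s \<in> ?A. \<forall>t \<in> ?A. s \<subseteq> t \<longrightarrow> t = s"
  proof (rule subset_Zorn_nonempty)
    show "?A \<noteq> {}" using r by blast
    fix C assume C: "C \<noteq> {}" "subset.chain ?A C"
    then have sub: "\<And>s. s \<in> C \<Longrightarrow> pre_character G s" "\<And>s. s \<in> C \<Longrightarrow> r \<subseteq> s"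
      and ch: "\<And>s t. s \<in> C \<Longrightarrow> t \<in> C \<Longrightarrow> s \<subseteq> t \<or> t \<subseteq> s"
      by (auto simp: subset_chain_def)
    note d = pre_characterD[OF sub(1)]
    have "pre_character G (\<Union>C)"
      unfolding pre_character_def
    proof (intro conjI allI impI)
      fix x z assume "(x, z) \<in> \<Union>C"
      then obtain s where s: "s \<in> C" "(x, z) \<in> s" by blast
      show "x \<in> carrier G" "z \<noteq> 0" "(inv x, inverse z) \<in> \<Union>C"
        using d(1,2,6)[OF s] s(1) by auto
      fix y w assume "(y, w) \<in> \<Union>C"
      then obtain t where t: "t \<in> C" "(y, w) \<in> t" by blast
      consider "s \<subseteq> t" | "t \<subseteq> s" using ch[OF s(1) t(1)] by blast
      then show "(x \<otimes> y, z * w) \<in> \<Union>C"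
        by cases (use d(5)[OF s(1)] d(5)[OF t(1)] s t in blast)+
    next
      show "(\<one>, 1) \<in> \<Union>C" using C(1) d(3) by blast
      show "z = 1" if "(\<one>, z) \<in> \<Union>C" for z using that d(4) by blast
    qed
    moreover have "r \<subseteq> \<Union>C" using C(1) sub(2) by blast
    ultimately show "\<Union>C \<in> ?A" by blast
  qed
  then obtain s where s': "s \<in> ?A" and m: "\<forall>t \<in> ?A. s \<subseteq> t \<longrightarrow> t = s" by (rule bexE)
  have s: "pre_character G s" "r \<subseteq> s" using s' by auto
  have max: "t = s" if "pre_character G t" "s \<subseteq> t" for t using bspec[OF m, of t] that s(2) by auto
  note d = pre_characterD[OF s(1)]
  have total: "\<exists>z. (x, z) \<in> s" if x: "x \<in> carrier G" for x
  proof -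
    have "\<exists>z. z \<noteq> 0 \<and> (\<forall>k w. (x [^] (k::int), w) \<in> s \<longrightarrow> w = z powi k)"
      using pre_character_period[OF s(1) x]
    proof (elim disjE exE conjE)
      assume "\<forall>k w. (x [^] (k::int), w) \<in> s \<longrightarrow> k = 0 \<and> w = 1"
      then show ?thesis by (intro exI[of _ 1]) auto
    next
      fix n w assume n: "0 < (n::nat)" and w: "(x [^] int n, w) \<in> s"
        and all: "\<forall>k w'. (x [^] (k::int), w') \<in> s \<longrightarrow> (\<exists>q. k = int n * q \<and> w' = w powi q)"
      obtain z where z: "z ^ n = w" using complex_root_exists[OF n] by blast
      have "z \<noteq> 0" using z d(2)[OF w] n by auto
      \<comment> \<open>Every exponent k in question is n q, where the given value is w^q = z^(n
        q).\<close>
      moreover have "w' = z powi k" if "(x [^] (k::int), w') \<in> s" for k w'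
        using all that z by (metis power_int_mult power_int_of_nat)
      ultimately show ?thesis by blast
    qed
    then obtain z where z: "z \<noteq> 0" "\<And>k w. (x [^] (k::int), w) \<in> s \<Longrightarrow> w = z powi k" by blast
    obtain t where t: "pre_character G t" "s \<subseteq> t" "(x, z) \<in> t"
      by (rule pre_character_adjoin[OF s(1) x z]) blast+
    have "(x, z) \<in> s" using t(3) max[OF t(1,2)] by simp
    then show ?thesis by blast
  qed
  define c where "c x = (SOME z. (x, z) \<in> s)" for x
  have c: "(x, c x) \<in> s" if "x \<in> carrier G" for x
    unfolding c_def by (rule someI_ex[OF total[OF that]])
  have ceq: "c x = z" if "(x, z) \<in> s" for x z
    using pre_character_unique[OF s(1) c[OF d(1)[OF that]] that] .
  have "character G c"
    unfolding character_def using d(2)[OF c] ceq[OF d(5)[OF c c]] by blast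
  then show thesis by (rule that) (use ceq s(2) in blast)
qed

text \<open>The trivial character of H is extended by a value z \<noteq> 1 at x. The admissible z
  depend on the order of x modulo H.\<close>

lemma character_separates:
  assumes H: "subgroup H G" and x: "x \<in> carrier G" "x \<notin> H"
  obtains c where "character G c" "\<And>h. h \<in> H \<Longrightarrow> c h = 1" "c x \<noteq> 1"
proof -
  interpret H: subgroup H G by fact
  have r: "pre_character G (H \<times> {1})"
    unfolding pre_character_def using H.subset H.one_closed H.m_closed H.m_inv_closed by auto
  have "\<exists>z :: complex. z \<noteq> 0 \<and> z \<noteq> 1 \<and> (\<forall>k w. (x [^] (k::int), w) \<in> H \<times> {1} \<longrightarrow> w = z powi k)"
    using pre_character_period[OF r x(1)]
  proof (elim disjE exE conjE)
    assume "\<forall>k w. (x [^] (k::int), w) \<in> H \<times> {1::complex} \<longrightarrow> k = 0 \<and> w = 1"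
    \<comment> \<open>No nonzero power of x lies in H, so any value other than 0 and 1 will
      do.\<close>
    then show ?thesis by (intro exI[of _ 2]) auto
  next
    fix n w assume n: "0 < (n::nat)" and w: "(x [^] int n, w) \<in> H \<times> {1::complex}"
      and all: "\<forall>k w'. (x [^] (k::int), w') \<in> H \<times> {1} \<longrightarrow> (\<exists>q. k = int n * q \<and> w' = w powi q)"
    have "n \<noteq> 1" using w x by (auto simp: int_pow_1)
    then have n1: "n > 1" using n by simp
    \<comment> \<open>Here x has finite order n > 1 modulo H, so z must be an n-th root of unity,
      and this one differs from 1.\<close>
    let ?z = "cis (2 * pi / real n)"
    have zn: "?z ^ n = 1" using n by (simp add: DeMoivre)
    have "?z \<noteq> 1"
    proof
      assume "?z = 1"
      then have "cos (2 * pi / real n) = 1" by (simp add: complex_eq_iff)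
      then obtain i :: int where "2 * pi / real n = of_int i * 2 * pi" using cos_one_2pi_int by auto
      note i = this
      have "(of_int i :: real) = (of_int i * 2 * pi) / (2 * pi)" by simp
      also have "\<dots> = (2 * pi / real n) / (2 * pi)" unfolding i ..
      also have "\<dots> = 1 / real n" by simp
      finally have eq: "of_int i = 1 / real n" .
      have "0 < (of_int i :: real)" "(of_int i :: real) < 1" unfolding eq using n1 by simp_all
      then have "0 < i" "i < 1" by simp_all
      then show False by simp
    qed
    moreover have "w' = ?z powi k" if kw: "(x [^] (k::int), w') \<in> H \<times> {1}" for k w'
    proof -
      obtain q where "k = int n * q" using all kw by blast
      then have "?z powi k = 1" using zn by (metis power_int_mult power_int_of_nat power_int_1_left)
      then show ?thesis using kw by simp
    qed
    ultimately show ?thesis by (intro exI[of _ ?z]) simp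
  qed
  then obtain z :: complex where z: "z \<noteq> 0" "z \<noteq> 1" "\<And>k w. (x [^] (k::int), w) \<in> H \<times> {1} \<Longrightarrow> w = z powi k" by blast
  obtain t where t: "pre_character G t" "H \<times> {1} \<subseteq> t" "(x, z) \<in> t"
    by (rule pre_character_adjoin[OF r x(1) z(1,3)]) blast+
  obtain c where c: "character G c" "\<And>x z. (x, z) \<in> t \<Longrightarrow> c x = z"
    by (rule pre_character_extend[OF t(1)]) blast
  show thesis by (rule that[OF c(1)]) (use c(2) t(2,3) z(2) in auto)
qed

end

section \<open>The character module\<close>

text \<open>The left module of homomorphisms from \<open>M\<close> to the multiplicative group of complex numbers, with
  the value \<open>1\<close> outside the carrier. Its zero is therefore the constant function \<open>1\<close>.\<close>

definition char_module :: "('r, 'm) bimodule \<Rightarrow> ('r, 'm \<Rightarrow> complex) module" where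
  "char_module M = \<lparr>carrier = {\<chi>. (\<forall>x \<in> carrier M. \<chi> x \<noteq> 0) \<and>
        (\<forall>x \<in> carrier M. \<forall>y \<in> carrier M. \<chi> (x \<oplus>\<^bsub>M\<^esub> y) = \<chi> x * \<chi> y) \<and> (\<forall>x. x \<notin> carrier M \<longrightarrow> \<chi> x = 1)},
     monoid.mult = (\<lambda>\<chi> \<psi>. \<chi>), one = (\<lambda>x. 1), ring.zero = (\<lambda>x. 1),
     add = (\<lambda>\<chi> \<psi> x. \<chi> x * \<psi> x), smult = (\<lambda>a \<chi> x. if x \<in> carrier M then \<chi> (ract M x a) else 1)\<rparr>"

lemma char_module_simps [simp]:
  "\<zero>\<^bsub>char_module M\<^esub> = (\<lambda>x. 1)" "\<chi> \<oplus>\<^bsub>char_module M\<^esub> \<psi> = (\<lambda>x. \<chi> x * \<psi> x)"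
  "a \<odot>\<^bsub>char_module M\<^esub> \<chi> = (\<lambda>x. if x \<in> carrier M then \<chi> (ract M x a) else 1)"
  by (simp_all add: char_module_def)

lemma char_module_carrier:
  "\<chi> \<in> carrier (char_module M) \<longleftrightarrow> (\<forall>x \<in> carrier M. \<chi> x \<noteq> 0) \<and>
     (\<forall>x \<in> carrier M. \<forall>y \<in> carrier M. \<chi> (x \<oplus>\<^bsub>M\<^esub> y) = \<chi> x * \<chi> y) \<and> (\<forall>x. x \<notin> carrier M \<longrightarrow> \<chi> x = 1)"
  by (simp add: char_module_def)

lemma char_module_restrict: "char_module (restrict_bimodule lam M) = restrict_scalars lam (char_module M)"
  by (simp add: char_module_def restrict_scalars_def restrict_bimodule_def cong: if_cong)

context triv_ext
begin

lemma left_module_char_module: "left_module S (char_module M)"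
proof (rule left_moduleI[OF R.ring_axioms])
  fix \<chi> assume "\<chi> \<in> carrier (char_module M)"
  then have \<chi>: "\<And>x. x \<in> carrier M \<Longrightarrow> \<chi> x \<noteq> 0" "\<And>x y. x \<in> carrier M \<Longrightarrow> y \<in> carrier M \<Longrightarrow> \<chi> (x \<oplus>\<^bsub>M\<^esub> y) = \<chi> x * \<chi> y"
    "\<And>x. x \<notin> carrier M \<Longrightarrow> \<chi> x = 1" by (auto simp: char_module_carrier)
  have "\<chi> \<zero>\<^bsub>M\<^esub> = 1" using \<chi>(2)[of "\<zero>\<^bsub>M\<^esub>" "\<zero>\<^bsub>M\<^esub>"] \<chi>(1)[of "\<zero>\<^bsub>M\<^esub>"] by simp
  then show "\<zero>\<^bsub>S\<^esub> \<odot>\<^bsub>char_module M\<^esub> \<chi> = \<zero>\<^bsub>char_module M\<^esub>" by (auto simp: ract_zero_right)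
  show "\<one>\<^bsub>S\<^esub> \<odot>\<^bsub>char_module M\<^esub> \<chi> = \<chi>" using \<chi>(3) by (auto simp: ract_one)
  fix a assume a: "a \<in> carrier S"
  show "a \<odot>\<^bsub>char_module M\<^esub> \<chi> \<in> carrier (char_module M)"
    using \<chi> a by (auto simp: char_module_carrier ract_closed ract_l_distr)
  fix b assume b: "b \<in> carrier S"
  show "(a \<oplus>\<^bsub>S\<^esub> b) \<odot>\<^bsub>char_module M\<^esub> \<chi> = a \<odot>\<^bsub>char_module M\<^esub> \<chi> \<oplus>\<^bsub>char_module M\<^esub> b \<odot>\<^bsub>char_module M\<^esub> \<chi>"
    using \<chi>(2) a b by (auto simp: ract_r_distr ract_closed)
  show "(a \<otimes>\<^bsub>S\<^esub> b) \<odot>\<^bsub>char_module M\<^esub> \<chi> = a \<odot>\<^bsub>char_module M\<^esub> (b \<odot>\<^bsub>char_module M\<^esub> \<chi>)"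
    using a b by (auto simp: ract_assoc ract_closed)
qed (auto simp: char_module_carrier)

abbreviation E where "E \<equiv> char_module M"

lemma char_app_zero: assumes "\<chi> \<in> carrier E" shows "\<chi> \<zero>\<^bsub>M\<^esub> = 1"
proof -
  have "\<chi> (\<zero>\<^bsub>M\<^esub> \<oplus>\<^bsub>M\<^esub> \<zero>\<^bsub>M\<^esub>) = \<chi> \<zero>\<^bsub>M\<^esub> * \<chi> \<zero>\<^bsub>M\<^esub>" "\<chi> \<zero>\<^bsub>M\<^esub> \<noteq> 0"
    using assms M.zero_closed unfolding char_module_carrier by blast+
  then show ?thesis by simp
qed

text \<open>The kernel of \<open>A\<^sup>k \<rightarrow> S\<^sup>k\<close> is \<open>M \<otimes> S\<^sup>k\<close>, and \<open>pairing k \<chi>\<close> is the character of it that is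
  adjoint to \<open>\<chi> : S\<^sup>k \<rightarrow> E\<close>.\<close>

definition pairing :: "nat \<Rightarrow> ((nat \<Rightarrow> 's) \<Rightarrow> 'm \<Rightarrow> complex) \<Rightarrow> (nat \<Rightarrow> 's \<times> 'm) \<Rightarrow> complex" where
  "pairing k \<chi> z = (\<Prod>i<k. \<chi> (basis_elt S i) (snd (z i)))"

lemma snd_fm: "z \<in> carrier (fm A k) \<Longrightarrow> snd (z i) \<in> carrier M"
  unfolding fm_carrier_iff[OF ringA] by (auto simp: mem_Times_iff)

lemma pairing_add:
  assumes \<chi>: "\<chi> \<in> lmod_hom S (fm S k) E" and z: "z \<in> carrier (fm A k)" "w \<in> carrier (fm A k)"
  shows "pairing k \<chi> (z \<oplus>\<^bsub>fm A k\<^esub> w) = pairing k \<chi> z * pairing k \<chi> w"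
proof -
  have "\<chi> (basis_elt S i) (snd (z i) \<oplus>\<^bsub>M\<^esub> snd (w i)) = \<chi> (basis_elt S i) (snd (z i)) * \<chi> (basis_elt S i) (snd (w i))"
    if "i < k" for i
    using lmod_homD(1)[OF \<chi> basis_elt_in[OF R.ring_axioms, of i]] that snd_fm[OF z(1)] snd_fm[OF z(2)]
    by (simp add: char_module_carrier)
  then show ?thesis by (simp add: pairing_def prod.distrib)
qed

lemma pairing_zero:
  assumes \<chi>: "\<chi> \<in> lmod_hom S (fm S k) E"
  shows "pairing k \<chi> \<zero>\<^bsub>fm A k\<^esub> = 1"
  unfolding pairing_def
  by (rule prod.neutral)
    (use char_app_zero[OF lmod_homD(1)[OF \<chi> basis_elt_in[OF R.ring_axioms]]] in auto)

text \<open>With m the M-part of r, the M-part of r x has the entries m x_j. As E carries the action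
  (a \<chi>)(m) = \<chi>(m a), the product of the values \<chi>(e_j)(m x_j) is \<chi>(x)(m). So the
  pairing sends the tensor of m and x to \<chi>(x)(m).\<close>

lemma pairing_smult_up:
  assumes \<chi>: "\<chi> \<in> lmod_hom S (fm S k) E" and r: "r \<in> carrier A" and x: "x \<in> carrier (fm S k)"
  shows "pairing k \<chi> (r \<odot>\<^bsub>fm A k\<^esub> (\<lambda>j. \<sigma> (x j))) = \<chi> x (snd r)"
proof (rule free_module_induct[OF R.ring_axioms x])
  interpret F: left_module A "fm A k" by (rule left_module_free_module[OF ringA])
  interpret SF: left_module S "fm S k" by (rule left_module_free_module[OF R.ring_axioms])
  have z: "(\<lambda>j. \<sigma> \<zero>\<^bsub>S\<^esub>) = \<zero>\<^bsub>fm A k\<^esub>" by simp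
  have "\<chi> \<zero>\<^bsub>fm S k\<^esub> = \<zero>\<^bsub>E\<^esub>" by (rule lmod_hom_zero[OF \<chi> SF.left_module_axioms left_module_char_module])
  then show "pairing k \<chi> (r \<odot>\<^bsub>fm A k\<^esub> (\<lambda>j. \<sigma> \<zero>\<^bsub>S\<^esub>)) = \<chi> (\<lambda>x. \<zero>\<^bsub>S\<^esub>) (snd r)"
    unfolding z F.smult_r_null[OF r] pairing_zero[OF \<chi>] by simp
  fix x b s assume x: "x \<in> carrier (fm S k)"
    and IH: "pairing k \<chi> (r \<odot>\<^bsub>fm A k\<^esub> (\<lambda>j. \<sigma> (x j))) = \<chi> x (snd r)" and b: "b \<in> {..<k}" and s: "s \<in> carrier S"
  have m: "snd r \<in> carrier M" "fst r \<in> carrier S" using r by auto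
  have be: "basis_elt S b \<in> carrier (fm S k)" by (rule basis_elt_in[OF R.ring_axioms b])
  have se: "s \<odot>\<^bsub>fm S k\<^esub> basis_elt S b \<in> carrier (fm S k)" by (rule SF.smult_closed[OF s be])
  note ux = \<sigma>_map[OF x] \<sigma>_map[OF se]
  have "pairing k \<chi> (r \<odot>\<^bsub>fm A k\<^esub> (\<lambda>j. \<sigma> ((s \<odot>\<^bsub>fm S k\<^esub> basis_elt S b) j))) =
      (\<Prod>i<k. if i = b then \<chi> (basis_elt S b) (ract M (snd r) s) else 1)"
    unfolding pairing_def
  proof (rule prod.cong[OF refl])
    fix i assume i: "i \<in> {..<k}"
    have "\<chi> (basis_elt S i) \<zero>\<^bsub>M\<^esub> = 1" by (rule char_app_zero[OF lmod_homD(1)[OF \<chi> basis_elt_in[OF R.ring_axioms i]]])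
    then show "\<chi> (basis_elt S i) (snd ((r \<odot>\<^bsub>fm A k\<^esub> (\<lambda>j. \<sigma> ((s \<odot>\<^bsub>fm S k\<^esub> basis_elt S b) j))) i))
        = (if i = b then \<chi> (basis_elt S b) (ract M (snd r) s) else 1)"
      using m s by (auto simp: basis_elt_def ract_zero_right ract_closed)
  qed
  also have "\<dots> = \<chi> (basis_elt S b) (ract M (snd r) s)" using b by (simp add: prod.delta)
  also have "\<dots> = \<chi> (s \<odot>\<^bsub>fm S k\<^esub> basis_elt S b) (snd r)"
    unfolding lmod_homD(3)[OF \<chi> s be] using m by simp
  finally have 1: "pairing k \<chi> (r \<odot>\<^bsub>fm A k\<^esub> (\<lambda>j. \<sigma> ((s \<odot>\<^bsub>fm S k\<^esub> basis_elt S b) j))) = \<chi> (s \<odot>\<^bsub>fm S k\<^esub> basis_elt S b) (snd r)" .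
  show "pairing k \<chi> (r \<odot>\<^bsub>fm A k\<^esub> (\<lambda>j. \<sigma> ((x \<oplus>\<^bsub>fm S k\<^esub> s \<odot>\<^bsub>fm S k\<^esub> basis_elt S b) j)))
      = \<chi> (x \<oplus>\<^bsub>fm S k\<^esub> s \<odot>\<^bsub>fm S k\<^esub> basis_elt S b) (snd r)"
    unfolding \<sigma>.map_add[OF x se] F.smult_r_distr[OF r ux] pairing_add[OF \<chi> F.smult_closed[OF r ux(1)] F.smult_closed[OF r ux(2)]]
      IH 1 lmod_homD(2)[OF \<chi> x se] by simp
qed

text \<open>Naturality of the adjunction, checked on scalar multiples of basis elements by
  \<open>pairing_smult_up\<close>. It turns coboundaries on the Hom side into statements about
  boundaries on the tensor side.\<close>

lemma pairing_up:
  assumes d: "d \<in> lmod_hom S (fm S k) (fm S l)" and \<chi>: "\<chi> \<in> lmod_hom S (fm S l) E"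
    and z: "z \<in> carrier (fm A k)"
  shows "pairing l \<chi> (up l d z) = pairing k (\<lambda>x. \<chi> (d x)) z"
proof (rule free_module_induct[OF ringA z])
  note Fm = left_module_free_module[OF ringA]
  interpret F: left_module A "fm A k" by (rule Fm)
  note u = \<sigma>.base_change_hom[OF d]
  note \<chi>d = lmod_hom_comp[OF d \<chi>]
  have "up l d \<zero>\<^bsub>fm A k\<^esub> = \<zero>\<^bsub>fm A l\<^esub>" by (rule lmod_hom_zero[OF u Fm Fm])
  then show "pairing l \<chi> (up l d (\<lambda>x. \<zero>\<^bsub>A\<^esub>)) = pairing k (\<lambda>x. \<chi> (d x)) (\<lambda>x. \<zero>\<^bsub>A\<^esub>)"
    using pairing_zero[OF \<chi>] pairing_zero[OF \<chi>d] by simp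
  fix y b r assume y: "y \<in> carrier (fm A k)" and IH: "pairing l \<chi> (up l d y) = pairing k (\<lambda>x. \<chi> (d x)) y"
    and b: "b \<in> {..<k}" and r: "r \<in> carrier A"
  have be: "basis_elt A b \<in> carrier (fm A k)" by (rule basis_elt_in[OF ringA b])
  have bS: "basis_elt S b \<in> carrier (fm S k)" by (rule basis_elt_in[OF R.ring_axioms b])
  have re: "r \<odot>\<^bsub>fm A k\<^esub> basis_elt A b \<in> carrier (fm A k)" by (rule F.smult_closed[OF r be])
  have "up l d (r \<odot>\<^bsub>fm A k\<^esub> basis_elt A b) = r \<odot>\<^bsub>fm A l\<^esub> (\<lambda>j. \<sigma> (d (basis_elt S b) j))"
    unfolding lmod_homD(3)[OF u r be] \<sigma>.base_change_basis[OF d b] ..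
  then have 1: "pairing l \<chi> (up l d (r \<odot>\<^bsub>fm A k\<^esub> basis_elt A b)) = \<chi> (d (basis_elt S b)) (snd r)"
    using pairing_smult_up[OF \<chi> r lmod_homD(1)[OF d bS]] by (simp only:)
  have 2: "pairing k (\<lambda>x. \<chi> (d x)) (r \<odot>\<^bsub>fm A k\<^esub> basis_elt A b) = \<chi> (d (basis_elt S b)) (snd r)"
    using pairing_smult_up[OF \<chi>d r bS] unfolding \<sigma>.map_basis .
  show "pairing l \<chi> (up l d (y \<oplus>\<^bsub>fm A k\<^esub> r \<odot>\<^bsub>fm A k\<^esub> basis_elt A b))
      = pairing k (\<lambda>x. \<chi> (d x)) (y \<oplus>\<^bsub>fm A k\<^esub> r \<odot>\<^bsub>fm A k\<^esub> basis_elt A b)"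
    unfolding lmod_homD(2)[OF u y re] pairing_add[OF \<chi> lmod_homD(1)[OF u y] lmod_homD(1)[OF u re]]
      pairing_add[OF \<chi>d y re] IH 1 2 ..
qed

text \<open>The copy of M tensor \<open>S\<^sup>k\<close> inside \<open>A\<^sup>k\<close>; on it
  \<open>up l d\<close> acts as the identity of M tensored with d.\<close>

definition fib :: "nat \<Rightarrow> (nat \<Rightarrow> 's \<times> 'm) set" where
  "fib k = {z \<in> carrier (fm A k). (\<lambda>j. fst (z j)) = (\<lambda>j. \<zero>\<^bsub>S\<^esub>)}"

lemma submodule_fib: "submodule (fib k) A (fm A k)"
proof -
  interpret F: left_module A "fm A k" by (rule left_module_free_module[OF ringA])
  have *: "fst (z j) = \<zero>\<^bsub>S\<^esub>" if "z \<in> fib k" for z j using that fun_cong unfolding fib_def by fastforce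
  show ?thesis
  proof (rule submoduleI[OF F.left_module_axioms])
    show "fib k \<subseteq> carrier (fm A k)" by (auto simp: fib_def)
    show "\<zero>\<^bsub>fm A k\<^esub> \<in> fib k" using F.M.zero_closed by (simp add: fib_def)
    show "x \<oplus>\<^bsub>fm A k\<^esub> y \<in> fib k" if xy: "x \<in> fib k" "y \<in> fib k" for x y
    proof -
      have "x \<oplus>\<^bsub>fm A k\<^esub> y \<in> carrier (fm A k)" using xy by (intro F.M.a_closed) (auto simp: fib_def)
      then show ?thesis using *[OF xy(1)] *[OF xy(2)] by (simp add: fib_def)
    qed
    show "a \<odot>\<^bsub>fm A k\<^esub> x \<in> fib k" if a: "a \<in> carrier A" and x: "x \<in> fib k" for a x
    proof -
      have "a \<odot>\<^bsub>fm A k\<^esub> x \<in> carrier (fm A k)" using x by (intro F.smult_closed a) (auto simp: fib_def)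
      then show ?thesis using *[OF x] a by (auto simp: fib_def)
    qed
  qed
qed

lemma fib_smult_up:
  assumes m: "m \<in> carrier M" and x: "x \<in> carrier (fm S k)"
  shows "(\<zero>\<^bsub>S\<^esub>, m) \<odot>\<^bsub>fm A k\<^esub> (\<lambda>j. \<sigma> (x j)) \<in> fib k"
proof -
  interpret F: left_module A "fm A k" by (rule left_module_free_module[OF ringA])
  have "(\<zero>\<^bsub>S\<^esub>, m) \<odot>\<^bsub>fm A k\<^esub> (\<lambda>j. \<sigma> (x j)) \<in> carrier (fm A k)"
    by (rule F.smult_closed[OF _ \<sigma>_map[OF x]]) (use m in simp)
  then show ?thesis using x[unfolded fm_carrier_iff[OF R.ring_axioms]] by (simp add: fib_def)
qed

text \<open>A character c of the ambient group that is trivial on the image and nontrivial at y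
  comes, on \<open>fib k1\<close>, from a homomorphism \<chi> into E. That c is trivial on the image
  becomes \<chi> d = 0.\<close>

lemma separating_hom:
  assumes d: "d \<in> lmod_hom S (fm S k2) (fm S k1)" and y: "y \<in> fib k1" "y \<notin> up k1 d ` fib k2"
  obtains \<chi> where "\<chi> \<in> lmod_hom S (fm S k1) E" "\<And>x. x \<in> carrier (fm S k2) \<Longrightarrow> \<chi> (d x) = \<zero>\<^bsub>E\<^esub>"
    "pairing k1 \<chi> y \<noteq> 1"
proof -
  note Fm = left_module_free_module[OF ringA]
  interpret F: left_module A "fm A k1" by (rule Fm)
  note u = \<sigma>.base_change_hom[OF d]
  have K: "submodule (fib k2) A (fm A k2)" by (rule submodule_fib)
  have "submodule (up k1 d ` carrier (submod (fm A k2) (fib k2))) A (fm A k1)"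
    by (rule lmod_hom_image_submodule[OF lmod_hom_restrict[OF submoduleD(1)[OF K] u] left_module_submod[OF Fm K] Fm])
  then have H: "subgroup (up k1 d ` fib k2) (add_monoid (fm A k1))" by (simp add: submodule_def)
  have yc: "y \<in> carrier (add_monoid (fm A k1))" using y(1) by (simp add: fib_def)
  obtain c where c: "character (add_monoid (fm A k1)) c" "\<And>h. h \<in> up k1 d ` fib k2 \<Longrightarrow> c h = 1" "c y \<noteq> 1"
    by (rule comm_group.character_separates[OF F.M.a_comm_group H yc y(2)]) blast
  have c0: "c x \<noteq> 0" "c (x \<oplus>\<^bsub>fm A k1\<^esub> w) = c x * c w"
    if "x \<in> carrier (fm A k1)" "w \<in> carrier (fm A k1)" for x w
    using c(1) that unfolding character_def by (auto simp del: free_module_simps)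
  \<comment> \<open>The value of \<chi> on the i-th basis element: the restriction of c to the i-th
    copy of M, extended by 1 outside the carrier as \<open>char_module\<close> demands.\<close>
  define \<theta> where "\<theta> i m = (if m \<in> carrier M then c ((\<zero>\<^bsub>S\<^esub>, m) \<odot>\<^bsub>fm A k1\<^esub> basis_elt A i) else 1)" for i m
  have be: "basis_elt A i \<in> carrier (fm A k1)" if "i \<in> {..<k1}" for i by (rule basis_elt_in[OF ringA that])
  have mA: "(\<zero>\<^bsub>S\<^esub>, m) \<in> carrier A" if "m \<in> carrier M" for m using that by simp
  have \<theta>: "\<theta> i \<in> carrier E" if i: "i \<in> {..<k1}" for i
    unfolding char_module_carrier
  proof (intro conjI ballI allI impI)
    fix m n assume m: "m \<in> carrier M" and n: "n \<in> carrier M"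
    have "(\<zero>\<^bsub>S\<^esub>, m \<oplus>\<^bsub>M\<^esub> n) = (\<zero>\<^bsub>S\<^esub>, m) \<oplus>\<^bsub>A\<^esub> (\<zero>\<^bsub>S\<^esub>, n)" by simp
    then show "\<theta> i (m \<oplus>\<^bsub>M\<^esub> n) = \<theta> i m * \<theta> i n"
      using m n c0(2)[OF F.smult_closed[OF mA[OF m] be[OF i]] F.smult_closed[OF mA[OF n] be[OF i]]]
        F.smult_l_distr[OF mA[OF m] mA[OF n] be[OF i]] by (simp only: \<theta>_def M.a_closed if_True)
  next
    fix m assume m: "m \<in> carrier M"
    show "\<theta> i m \<noteq> 0" using c0(1)[OF F.smult_closed[OF mA[OF m] be[OF i]] yc[simplified]] m by (simp only: \<theta>_def if_True) simp
  qed (simp add: \<theta>_def)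
  define \<chi> where "\<chi> = free_ext S E \<theta>"
  have \<chi>: "\<chi> \<in> lmod_hom S (fm S k1) E"
    unfolding \<chi>_def by (rule free_ext_hom[OF left_module_char_module]) (use \<theta> in blast)
  have \<chi>b: "\<chi> (basis_elt S i) = \<theta> i" if "i \<in> {..<k1}" for i
    unfolding \<chi>_def by (rule free_ext_basis[OF left_module_char_module _ that]) (use \<theta> in blast)
  \<comment> \<open>Clearing the S-parts makes the identity meaningful for every z in the free
    module over A, so that induction over basis elements applies; on \<open>fib k1\<close> it
    changes nothing.\<close>
  have cp: "c (\<lambda>j. (\<zero>\<^bsub>S\<^esub>, snd (z j))) = pairing k1 \<chi> z \<and> (\<lambda>j. (\<zero>\<^bsub>S\<^esub>, snd (z j))) \<in> carrier (fm A k1)"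
    if z: "z \<in> carrier (fm A k1)" for z
  proof (rule free_module_induct[OF ringA z])
    have e: "(\<lambda>j. (\<zero>\<^bsub>S\<^esub>, snd \<zero>\<^bsub>A\<^esub>)) = \<zero>\<^bsub>fm A k1\<^esub>" by simp
    have zz: "(\<lambda>x. \<zero>\<^bsub>A\<^esub>) = \<zero>\<^bsub>fm A k1\<^esub>" by simp
    have "c \<zero>\<^bsub>fm A k1\<^esub> = 1"
      using c0(1)[OF F.M.zero_closed F.M.zero_closed] c0(2)[OF F.M.zero_closed F.M.zero_closed]
        F.M.r_zero[OF F.M.zero_closed] by (metis mult_cancel_left2)
    then show "c (\<lambda>j. (\<zero>\<^bsub>S\<^esub>, snd \<zero>\<^bsub>A\<^esub>)) = pairing k1 \<chi> (\<lambda>x. \<zero>\<^bsub>A\<^esub>) \<and> (\<lambda>j. (\<zero>\<^bsub>S\<^esub>, snd \<zero>\<^bsub>A\<^esub>)) \<in> carrier (fm A k1)"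
      unfolding e zz pairing_zero[OF \<chi>] using F.M.zero_closed by blast
  next
    fix z b r assume z: "z \<in> carrier (fm A k1)"
      and IH: "c (\<lambda>j. (\<zero>\<^bsub>S\<^esub>, snd (z j))) = pairing k1 \<chi> z \<and> (\<lambda>j. (\<zero>\<^bsub>S\<^esub>, snd (z j))) \<in> carrier (fm A k1)"
      and b: "b \<in> {..<k1}" and r: "r \<in> carrier A"
    have r2: "snd r \<in> carrier M" "fst r \<in> carrier S" using r by auto
    have eq: "(\<lambda>j. (\<zero>\<^bsub>S\<^esub>, snd ((z \<oplus>\<^bsub>fm A k1\<^esub> r \<odot>\<^bsub>fm A k1\<^esub> basis_elt A b) j))) =
        (\<lambda>j. (\<zero>\<^bsub>S\<^esub>, snd (z j))) \<oplus>\<^bsub>fm A k1\<^esub> (\<zero>\<^bsub>S\<^esub>, snd r) \<odot>\<^bsub>fm A k1\<^esub> basis_elt A b"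
      using r2 by (auto simp: fun_eq_iff basis_elt_def ract_zero_right ract_one)
    have m: "(\<zero>\<^bsub>S\<^esub>, snd r) \<odot>\<^bsub>fm A k1\<^esub> basis_elt A b \<in> carrier (fm A k1)" by (rule F.smult_closed[OF mA[OF r2(1)] be[OF b]])
    have "pairing k1 \<chi> (r \<odot>\<^bsub>fm A k1\<^esub> basis_elt A b) = c ((\<zero>\<^bsub>S\<^esub>, snd r) \<odot>\<^bsub>fm A k1\<^esub> basis_elt A b)"
      using pairing_smult_up[OF \<chi> r basis_elt_in[OF R.ring_axioms b]] r2(1)
      unfolding \<sigma>.map_basis \<chi>b[OF b] by (simp only: \<theta>_def if_True)
    then show "c (\<lambda>j. (\<zero>\<^bsub>S\<^esub>, snd ((z \<oplus>\<^bsub>fm A k1\<^esub> r \<odot>\<^bsub>fm A k1\<^esub> basis_elt A b) j))) =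
        pairing k1 \<chi> (z \<oplus>\<^bsub>fm A k1\<^esub> r \<odot>\<^bsub>fm A k1\<^esub> basis_elt A b) \<and>
        (\<lambda>j. (\<zero>\<^bsub>S\<^esub>, snd ((z \<oplus>\<^bsub>fm A k1\<^esub> r \<odot>\<^bsub>fm A k1\<^esub> basis_elt A b) j))) \<in> carrier (fm A k1)"
      unfolding eq pairing_add[OF \<chi> z F.smult_closed[OF r be[OF b]]]
      using IH c0(2)[OF conjunct2[OF IH] m] F.M.a_closed[OF conjunct2[OF IH] m] by (simp only:)
  qed
  have cf: "c z = pairing k1 \<chi> z" if z: "z \<in> fib k1" for z
  proof -
    have "fst (z j) = \<zero>\<^bsub>S\<^esub>" for j using z fun_cong unfolding fib_def by fastforce
    then have "(\<lambda>j. (\<zero>\<^bsub>S\<^esub>, snd (z j))) = z" by (simp add: fun_eq_iff prod_eq_iff)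
    then show ?thesis using cp[of z] z by (simp add: fib_def)
  qed
  have "\<chi> (d x) = \<zero>\<^bsub>E\<^esub>" if x: "x \<in> carrier (fm S k2)" for x
  proof
    fix m
    have dx: "d x \<in> carrier (fm S k1)" by (rule lmod_homD(1)[OF d x])
    show "\<chi> (d x) m = \<zero>\<^bsub>E\<^esub> m"
    proof (cases "m \<in> carrier M")
      case True
      have "\<chi> (d x) m = pairing k1 \<chi> ((\<zero>\<^bsub>S\<^esub>, m) \<odot>\<^bsub>fm A k1\<^esub> (\<lambda>j. \<sigma> (d x j)))"
        using pairing_smult_up[OF \<chi> mA[OF True] dx] by simp
      also have "\<dots> = c ((\<zero>\<^bsub>S\<^esub>, m) \<odot>\<^bsub>fm A k1\<^esub> (\<lambda>j. \<sigma> (d x j)))" by (rule cf[OF fib_smult_up[OF True dx], symmetric])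
      also have "(\<zero>\<^bsub>S\<^esub>, m) \<odot>\<^bsub>fm A k1\<^esub> (\<lambda>j. \<sigma> (d x j)) = up k1 d ((\<zero>\<^bsub>S\<^esub>, m) \<odot>\<^bsub>fm A k2\<^esub> (\<lambda>j. \<sigma> (x j)))"
        unfolding lmod_homD(3)[OF u mA[OF True] \<sigma>_map[OF x]] \<sigma>.base_change_map[OF d x] ..
      also have "c \<dots> = 1" by (rule c(2)[OF imageI[OF fib_smult_up[OF True x]]])
      finally show ?thesis by simp
    next
      case False
      then show ?thesis using lmod_homD(1)[OF \<chi> dx] unfolding char_module_carrier by simp
    qed
  qed
  then show thesis using that[OF \<chi>] cf[OF y(1)] c(3) by simp
qed

lemma pairing_cong:
  assumes eq: "\<And>x. x \<in> carrier (fm S k) \<Longrightarrow> \<chi> x = \<psi> x"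
  shows "pairing k \<chi> z = pairing k \<psi> z"
  unfolding pairing_def by (rule prod.cong[OF refl]) (simp only: eq[OF basis_elt_in[OF R.ring_axioms]])

text \<open>A cycle y that is no boundary would be detected by some \<chi> vanishing on boundaries.
  Such a \<chi> is \<psi> D, so its pairing with y equals the pairing of \<psi> with the image of y,
  which is trivial.\<close>

lemma fib_exact:
  assumes D: "\<And>n. D n \<in> lmod_hom S (fm S (k (Suc n))) (fm S (k n))"
    and ex: "hom_exact S E (\<lambda>n. fm S (k n)) D n"
    and y: "y \<in> fib (k (Suc n))" and uy: "up (k n) (D n) y = \<zero>\<^bsub>fm A (k n)\<^esub>"
  shows "y \<in> up (k (Suc n)) (D (Suc n)) ` fib (k (Suc (Suc n)))"
proof (rule ccontr)
  assume n: "y \<notin> up (k (Suc n)) (D (Suc n)) ` fib (k (Suc (Suc n)))"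
  obtain \<chi> where \<chi>: "\<chi> \<in> lmod_hom S (fm S (k (Suc n))) E"
    "\<And>x. x \<in> carrier (fm S (k (Suc (Suc n)))) \<Longrightarrow> \<chi> (D (Suc n) x) = \<zero>\<^bsub>E\<^esub>"
    "pairing (k (Suc n)) \<chi> y \<noteq> 1"
    by (rule separating_hom[OF D[of "Suc n"] y n]) blast
  obtain \<psi> where \<psi>: "\<psi> \<in> lmod_hom S (fm S (k n)) E" "\<And>x. x \<in> carrier (fm S (k (Suc n))) \<Longrightarrow> \<chi> x = \<psi> (D n x)"
    using bspec[OF ex[unfolded hom_exact_def] \<chi>(1)] \<chi>(2) by blast
  have yc: "y \<in> carrier (fm A (k (Suc n)))" using y by (simp add: fib_def)
  have "pairing (k (Suc n)) \<chi> y = pairing (k (Suc n)) (\<lambda>x. \<psi> (D n x)) y" by (rule pairing_cong[OF \<psi>(2)])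
  also have "\<dots> = pairing (k n) \<psi> (up (k n) (D n) y)" by (rule pairing_up[OF D \<psi>(1) yc, symmetric])
  also have "\<dots> = 1" unfolding uy by (rule pairing_zero[OF \<psi>(1)])
  finally show False using \<chi>(3) by simp
qed

end

section \<open>From vanishing of Tor to vanishing of Ext\<close>

definition complex_units :: "complex monoid" where
  "complex_units = \<lparr>carrier = UNIV - {0}, monoid.mult = (*), one = 1\<rparr>"

lemma comm_group_complex_units: "comm_group complex_units"
proof (rule comm_groupI)
  fix x assume "x \<in> carrier complex_units"
  then show "\<exists>y\<in>carrier complex_units. y \<otimes>\<^bsub>complex_units\<^esub> x = \<one>\<^bsub>complex_units\<^esub>"
    by (intro bexI[of _ "inverse x"]) (auto simp: complex_units_def)
qed (auto simp: complex_units_def)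

lemma free_character_exists:
  fixes f :: "'a \<Rightarrow> complex"
  assumes "\<And>x. x \<in> W \<Longrightarrow> f x \<noteq> 0"
  obtains h where "character (free_Abelian_group W) h" "\<And>x. x \<in> W \<Longrightarrow> h (frag_of x) = f x"
proof -
  have "f ` W \<subseteq> carrier complex_units" using assms by (auto simp: complex_units_def)
  then obtain h where h: "h \<in> hom (free_Abelian_group W) complex_units" "\<And>x. x \<in> W \<Longrightarrow> h (frag_of x) = f x"
    by (rule comm_group.free_Abelian_group_universal[OF comm_group_complex_units]) blast
  have "character (free_Abelian_group W) h"
    using h(1) by (auto simp: character_def hom_def complex_units_def Pi_iff)
  then show thesis using h(2) by (rule that)
qed

lemma characterD:
  assumes "character (free_Abelian_group W) h"
  shows "Poly_Mapping.keys a \<subseteq> W \<Longrightarrow> h a \<noteq> 0"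
    "Poly_Mapping.keys a \<subseteq> W \<Longrightarrow> Poly_Mapping.keys b \<subseteq> W \<Longrightarrow> h (a + b) = h a * h b"
    "h 0 = 1" "Poly_Mapping.keys a \<subseteq> W \<Longrightarrow> h (- a) = inverse (h a)"
    "Poly_Mapping.keys a \<subseteq> W \<Longrightarrow> Poly_Mapping.keys b \<subseteq> W \<Longrightarrow> h (a - b) = h a / h b"
proof -
  show nz: "Poly_Mapping.keys a \<subseteq> W \<Longrightarrow> h a \<noteq> 0" for a using assms by (simp add: character_def)
  show add: "Poly_Mapping.keys a \<subseteq> W \<Longrightarrow> Poly_Mapping.keys b \<subseteq> W \<Longrightarrow> h (a + b) = h a * h b" for a b
    using assms by (simp add: character_def)
  have "h 0 * h 0 = h 0" "h 0 \<noteq> 0" using add[of 0 0] nz[of 0] by auto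
  then show z: "h 0 = 1" by simp
  show minus: "h (- a) = inverse (h a)" if a: "Poly_Mapping.keys a \<subseteq> W" for a
    using add[of a "- a"] a z nz[OF a] by (simp add: keys_minus field_simps)
  show "h (a - b) = h a / h b" if "Poly_Mapping.keys a \<subseteq> W" "Poly_Mapping.keys b \<subseteq> W"
    using add[of a "- b"] that minus[OF that(2)] by (simp add: keys_minus field_simps)
qed

text \<open>Evaluates \<open>tensor_map\<close> on a class: if a representative f goes to a null
  element, the image is the neutral coset.\<close>

lemma tensor_map_coset:
  assumes H: "subgroup T (free_Abelian_group W)" and K: "subgroup T' (free_Abelian_group W')"
    and DT: "\<And>t. t \<in> T \<Longrightarrow> D t \<in> T'" and add: "\<And>a b. D (a + b) = D a + D b"
    and f: "D f \<in> T'"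
  shows "T' <#>\<^bsub>free_Abelian_group W'\<^esub> (D ` (T #>\<^bsub>free_Abelian_group W\<^esub> f)) = T'"
proof -
  have Kadd: "a \<in> T' \<Longrightarrow> b \<in> T' \<Longrightarrow> a + b \<in> T'" for a b
    using subgroup.one_closed[OF K] subgroup.m_closed[OF K] by auto
  have Kminus: "- a \<in> T'" if "a \<in> T'" for a
    using subgroup.m_inv_closed[OF K that] subgroup.subset[OF K] that by (auto simp: carrier_free_Abelian_group_iff)
  have H0: "0 \<in> T" using subgroup.one_closed[OF H] by simp
  show ?thesis
  proof
    show "T' <#>\<^bsub>free_Abelian_group W'\<^esub> (D ` (T #>\<^bsub>free_Abelian_group W\<^esub> f)) \<subseteq> T'"
      unfolding set_mult_def r_coset_def using Kadd DT f by (auto simp: add)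
    show "T' \<subseteq> T' <#>\<^bsub>free_Abelian_group W'\<^esub> (D ` (T #>\<^bsub>free_Abelian_group W\<^esub> f))"
    proof
      fix t assume t: "t \<in> T'"
      have "f \<in> T #>\<^bsub>free_Abelian_group W\<^esub> f" unfolding r_coset_def using H0 by force
      moreover have "t - D f \<in> T'" using Kadd[OF t Kminus[OF f]] by simp
      ultimately show "t \<in> T' <#>\<^bsub>free_Abelian_group W'\<^esub> (D ` (T #>\<^bsub>free_Abelian_group W\<^esub> f))"
        unfolding set_mult_def by (auto intro!: bexI[of _ "t - D f"] bexI[of _ f])
    qed
  qed
qed

context triv_ext
begin

lemma tensor_rels_carrier:
  assumes N: "left_module S N"
  shows "tensor_rels S M N \<subseteq> carrier (free_Abelian_group (carrier M \<times> carrier N))"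
proof -
  interpret N: left_module S N by fact
  let ?F = "free_Abelian_group (carrier M \<times> carrier N)"
  have k: "a - b \<in> carrier ?F" if "a \<in> carrier ?F" "b \<in> carrier ?F" for a b
    using keys_diff[of a b] that unfolding carrier_free_Abelian_group_iff by blast
  show ?thesis
    unfolding tensor_rels_def
    by (auto simp only: Un_iff mem_Collect_eq frag_of_in_free_Abelian_group mem_Sigma_iff intro!: k)
      (auto simp: ract_closed)
qed

lemma subgroup_tensor_null:
  assumes N: "left_module S N"
  shows "subgroup (tensor_null S M N) (free_Abelian_group (carrier M \<times> carrier N))"
  unfolding tensor_null_def
  by (rule group.generate_is_subgroup[OF group_free_Abelian_group tensor_rels_carrier[OF N]])

lemma character_tensor_null:
  assumes N: "left_module S N" and h: "character (free_Abelian_group (carrier M \<times> carrier N)) h"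
    and rel: "\<And>t. t \<in> tensor_rels S M N \<Longrightarrow> h t = 1" and t: "t \<in> tensor_null S M N"
  shows "h t = 1"
  using t unfolding tensor_null_def
proof (induction rule: generate.induct)
  case one
  show ?case using characterD(3)[OF h] by simp
next
  case (inv t)
  then have "t \<in> carrier (free_Abelian_group (carrier M \<times> carrier N))" using tensor_rels_carrier[OF N] by blast
  then have "Poly_Mapping.keys t \<subseteq> carrier M \<times> carrier N" by (simp only: carrier_free_Abelian_group_iff)
  then show ?case using characterD(4)[OF h] rel[OF inv] by simp
next
  case (eng a b)
  have "a \<in> carrier (free_Abelian_group (carrier M \<times> carrier N))" "b \<in> carrier (free_Abelian_group (carrier M \<times> carrier N))"
    using subgroup.subset[OF subgroup_tensor_null[OF N], unfolded tensor_null_def] eng(1,2) by blast+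
  then show ?case using characterD(2)[OF h] eng by simp
qed (use rel in blast)

text \<open>The assignment (m, x) \<mapsto> \<chi>(x)(m) respects the tensor relations: additivity
  in m holds as values of \<chi> are characters, additivity in x as \<chi> is additive, and balance
  is the definition of the action on E.\<close>

lemma balanced_character:
  assumes N: "left_module S N" and \<chi>: "\<chi> \<in> lmod_hom S N E"
  obtains h where "character (free_Abelian_group (carrier M \<times> carrier N)) h"
    "\<And>m x. m \<in> carrier M \<Longrightarrow> x \<in> carrier N \<Longrightarrow> h (frag_of (m, x)) = \<chi> x m"
    "\<And>t. t \<in> tensor_null S M N \<Longrightarrow> h t = 1"
proof -
  interpret N: left_module S N by fact
  have c: "\<And>x m. x \<in> carrier N \<Longrightarrow> m \<in> carrier M \<Longrightarrow> \<chi> x m \<noteq> 0"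
    "\<And>x m m'. x \<in> carrier N \<Longrightarrow> m \<in> carrier M \<Longrightarrow> m' \<in> carrier M \<Longrightarrow> \<chi> x (m \<oplus>\<^bsub>M\<^esub> m') = \<chi> x m * \<chi> x m'"
    using lmod_homD(1)[OF \<chi>] unfolding char_module_carrier by auto
  obtain h where h: "character (free_Abelian_group (carrier M \<times> carrier N)) h"
    and hf: "\<And>p. p \<in> carrier M \<times> carrier N \<Longrightarrow> h (frag_of p) = \<chi> (snd p) (fst p)"
    by (rule free_character_exists[of "carrier M \<times> carrier N" "\<lambda>p. \<chi> (snd p) (fst p)"]) (use c in auto)
  have k: "Poly_Mapping.keys (frag_of q) \<subseteq> carrier M \<times> carrier N" if "q \<in> carrier M \<times> carrier N" for q
    using that by auto
  have hd: "h (frag_of p - frag_of q) = h (frag_of p) / h (frag_of q)"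
    if "p \<in> carrier M \<times> carrier N" "q \<in> carrier M \<times> carrier N" for p q
    by (rule characterD(5)[OF h k k]) (use that in auto)
  have hd2: "h (frag_of p - frag_of q - frag_of s) = h (frag_of p) / h (frag_of q) / h (frag_of s)"
    if "p \<in> carrier M \<times> carrier N" "q \<in> carrier M \<times> carrier N" "s \<in> carrier M \<times> carrier N" for p q s
  proof -
    have "Poly_Mapping.keys (frag_of p - frag_of q) \<subseteq> carrier M \<times> carrier N"
      using keys_diff[of "frag_of p" "frag_of q"] k that by blast
    then show ?thesis using characterD(5)[OF h _ k[OF that(3)]] hd[OF that(1,2)] by simp
  qed
  have "h t = 1" if "t \<in> tensor_rels S M N" for t
    using that unfolding tensor_rels_def
    by (auto simp: hd hd2 hf ract_closed c lmod_homD(2,3)[OF \<chi>])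
  then show thesis
    by (intro that[OF h _ character_tensor_null[OF N h]]) (simp_all add: hf)
qed

text \<open>The cocycle \<chi> gives a character h of M tensor P (i + 1) that is trivial on
  boundaries. Vanishing homology makes it trivial on cycles, so it descends to the image in M tensor
  P i, and divisibility extends it to a character c there. The cochain \<psi>(x)(m) = c (m, x) has
  coboundary \<chi>. All this happens in the free abelian groups, with the null subgroups
  \<open>T j\<close> carried along.\<close>

lemma hom_exact_of_trivial_tensor_homology:
  fixes P :: "nat \<Rightarrow> ('s, 'p) module"
  assumes P: "projective_resolution S N P d e"
    and triv: "trivial_group (tensor_homology S M P d (Suc i))"
  shows "hom_exact S E P d i"
  unfolding hom_exact_def
proof (intro ballI impI)
  note p = projective_resolutionD[OF P]
  fix \<chi> assume \<chi>: "\<chi> \<in> lmod_hom S (P (Suc i)) E"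
    and co: "\<forall>y \<in> carrier (P (Suc (Suc i))). \<chi> (d (Suc i) y) = \<zero>\<^bsub>E\<^esub>"
  define W where "W j = carrier M \<times> carrier (P j)" for j
  define G where "G j = free_Abelian_group (W j)" for j
  define T where "T j = tensor_null S M (P j)" for j
  define D :: "nat \<Rightarrow> ('m \<times> 'p \<Rightarrow>\<^sub>0 int) \<Rightarrow> ('m \<times> 'p \<Rightarrow>\<^sub>0 int)"
    where "D j = frag_extend (\<lambda>(m, x). frag_of (m, d j x))" for j
  interpret G: comm_group "G j" for j unfolding G_def by (rule abelian_free_Abelian_group)
  have Gc: "a \<in> carrier (G j) \<longleftrightarrow> Poly_Mapping.keys a \<subseteq> W j" for a j by (simp add: G_def)
  have Gs[simp]: "\<one>\<^bsub>G j\<^esub> = 0" "a \<otimes>\<^bsub>G j\<^esub> b = a + b" for a b j by (simp_all add: G_def)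
  have T: "subgroup (T j) (G j)" for j
    unfolding T_def G_def W_def by (rule subgroup_tensor_null[OF p(3)])
  have Tc: "t \<in> T j \<Longrightarrow> Poly_Mapping.keys t \<subseteq> W j" for t j using subgroup.subset[OF T] Gc by blast
  have T0: "0 \<in> T j" and Tadd: "a \<in> T j \<Longrightarrow> b \<in> T j \<Longrightarrow> a + b \<in> T j" for a b j
    using subgroup.one_closed[OF T] subgroup.m_closed[OF T] by fastforce+
  have Tminus: "- a \<in> T j" if "a \<in> T j" for a j
    using subgroup.m_inv_closed[OF T that] Tc[OF that] by (simp add: G_def)
  have Dadd: "D j (a + b) = D j a + D j b" for j a b by (simp add: D_def frag_extend_add)
  have Dminus: "D j (- a) = - D j a" for j a by (simp add: D_def frag_extend_minus)
  have D0: "D j 0 = 0" for j by (simp add: D_def)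
  have Dof: "D j (frag_of (m, x)) = frag_of (m, d j x)" for j m x by (simp add: D_def)
  have Dk: "Poly_Mapping.keys (D j a) \<subseteq> W j" if a: "Poly_Mapping.keys a \<subseteq> W (Suc j)" for j a
  proof -
    have "Poly_Mapping.keys (case q of (m, x) \<Rightarrow> frag_of (m, d j x)) \<subseteq> W j" if "q \<in> W (Suc j)" for q
      using that lmod_homD(1)[OF p(4)] by (auto simp: W_def)
    then show ?thesis
      unfolding D_def using keys_frag_extend[of "\<lambda>(m, x). frag_of (m, d j x)" a] a by blast
  qed
  have Drel: "D j t \<in> tensor_rels S M (P j)" if t: "t \<in> tensor_rels S M (P (Suc j))" for j t
  proof -
    note h = lmod_homD[OF p(4)[of j]]
    from t consider m m' x where "t = frag_of (m \<oplus>\<^bsub>M\<^esub> m', x) - frag_of (m, x) - frag_of (m', x)"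
        "m \<in> carrier M" "m' \<in> carrier M" "x \<in> carrier (P (Suc j))"
      | m x x' where "t = frag_of (m, x \<oplus>\<^bsub>P (Suc j)\<^esub> x') - frag_of (m, x) - frag_of (m, x')"
        "m \<in> carrier M" "x \<in> carrier (P (Suc j))" "x' \<in> carrier (P (Suc j))"
      | m r x where "t = frag_of (ract M m r, x) - frag_of (m, r \<odot>\<^bsub>P (Suc j)\<^esub> x)"
        "m \<in> carrier M" "r \<in> carrier S" "x \<in> carrier (P (Suc j))"
      unfolding tensor_rels_def by blast
    then show ?thesis
    proof cases
      case 1
      then have "D j t = frag_of (m \<oplus>\<^bsub>M\<^esub> m', d j x) - frag_of (m, d j x) - frag_of (m', d j x)"
        by (simp add: D_def frag_extend_diff)
      then show ?thesis using 1 h(1) unfolding tensor_rels_def by blast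
    next
      case 2
      then have "D j t = frag_of (m, d j x \<oplus>\<^bsub>P j\<^esub> d j x') - frag_of (m, d j x) - frag_of (m, d j x')"
        by (simp add: D_def frag_extend_diff h(2))
      then show ?thesis using 2 h(1) unfolding tensor_rels_def by blast
    next
      case 3
      then have "D j t = frag_of (ract M m r, d j x) - frag_of (m, r \<odot>\<^bsub>P j\<^esub> d j x)"
        by (simp add: D_def frag_extend_diff h(3))
      then show ?thesis using 3 h(1) unfolding tensor_rels_def by blast
    qed
  qed
  have DT: "D j t \<in> T j" if "t \<in> T (Suc j)" for j t
    using that unfolding T_def[of "Suc j"] tensor_null_def
  proof (induction rule: generate.induct)
    case one
    show ?case using D0 T0 by simp
  next
    case (incl t)
    show ?case unfolding T_def tensor_null_def by (rule generate.incl[OF Drel[OF incl]])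
  next
    case (inv t)
    have "D j t \<in> T j" unfolding T_def tensor_null_def by (rule generate.incl[OF Drel[OF inv]])
    moreover have "t \<in> carrier (free_Abelian_group (carrier M \<times> carrier (P (Suc j))))"
      using tensor_rels_carrier[OF p(3)] inv by blast
    then have "Poly_Mapping.keys t \<subseteq> carrier M \<times> carrier (P (Suc j))" by (simp only: carrier_free_Abelian_group_iff)
    ultimately show ?case using Tminus Dminus by simp
  next
    case (eng a b)
    then show ?case using Tadd Dadd by simp
  qed
  have tm: "tensor_map S M (P j) (d j) C = T j <#>\<^bsub>G j\<^esub> (D j ` C)" for j C
    by (simp add: tensor_map_def T_def G_def W_def D_def)
  have tn: "tensor S M (P j) = G j Mod T j" for j by (simp add: tensor_def G_def T_def W_def)
  have coset0: "T j #>\<^bsub>G j\<^esub> 0 = T j" for j by (simp add: r_coset_def)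
  have tmc: "T j <#>\<^bsub>G j\<^esub> (D j ` (T (Suc j) #>\<^bsub>G (Suc j)\<^esub> f)) = T j" if "D j f \<in> T j" for j f
    unfolding G_def by (rule tensor_map_coset[OF T[unfolded G_def] T[unfolded G_def] DT Dadd that])
  obtain h where h: "character (G (Suc i)) h"
    and hf: "\<And>m x. m \<in> carrier M \<Longrightarrow> x \<in> carrier (P (Suc i)) \<Longrightarrow> h (frag_of (m, x)) = \<chi> x m"
    and hT: "\<And>t. t \<in> T (Suc i) \<Longrightarrow> h t = 1"
    using balanced_character[OF p(3) \<chi>] unfolding G_def W_def T_def by blast
  note hc = characterD[OF h[unfolded G_def]]
  have hD: "h (D (Suc i) g) = 1" if "Poly_Mapping.keys g \<subseteq> W (Suc (Suc i))" for g
  proof (rule free_Abelian_group_induct[OF that])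
    show "h (D (Suc i) 0) = 1" by (simp add: D0 hc(3))
  next
    fix q assume "q \<in> W (Suc (Suc i))"
    then obtain m y where q: "q = (m, y)" "m \<in> carrier M" "y \<in> carrier (P (Suc (Suc i)))" by (auto simp: W_def)
    show "h (D (Suc i) (frag_of q)) = 1"
      unfolding q(1) Dof using hf[OF q(2) lmod_homD(1)[OF p(4) q(3)]] bspec[OF co q(3)] by simp
  next
    fix a b assume ab: "Poly_Mapping.keys a \<subseteq> W (Suc (Suc i))" "Poly_Mapping.keys b \<subseteq> W (Suc (Suc i))"
      "h (D (Suc i) a) = 1" "h (D (Suc i) b) = 1"
    have "D (Suc i) (a - b) = D (Suc i) a - D (Suc i) b" by (simp add: D_def frag_extend_diff)
    then show "h (D (Suc i) (a - b)) = 1" using hc(5)[OF Dk[OF ab(1)] Dk[OF ab(2)]] ab(3,4) by simp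
  qed
  \<comment> \<open>The coset of f is a cycle; trivial homology makes it a boundary, so f differs
    from some D x by a null element, and h is trivial on both.\<close>
  have key: "h f = 1" if f: "Poly_Mapping.keys f \<subseteq> W (Suc i)" "D i f \<in> T i" for f
  proof -
    let ?C = "T (Suc i) #>\<^bsub>G (Suc i)\<^esub> f"
    let ?cyc = "tensor_cycles S M P d (Suc i)" and ?bd = "tensor_boundaries S M P d (Suc i)"
    have fC: "f \<in> ?C" unfolding r_coset_def using T0 by force
    have Cc: "?C \<in> carrier (tensor S M (P (Suc i)))"
      unfolding tn FactGroup_def using f(1) Gc by (auto simp: RCOSETS_def)
    have "tensor_map S M (P i) (d i) ?C = \<one>\<^bsub>tensor S M (P i)\<^esub>"
      unfolding tm tmc[OF f(2)] tn by (simp add: FactGroup_def)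
    then have C: "?C \<in> ?cyc" using Cc by (simp add: tensor_cycles_def)
    have "T (Suc i) = tensor_map S M (P (Suc i)) (d (Suc i)) (T (Suc (Suc i)))"
      using tmc[of "Suc i" 0] unfolding tm D0 coset0 using T0 by simp
    moreover have "T (Suc (Suc i)) \<in> carrier (tensor S M (P (Suc (Suc i))))"
      unfolding tn FactGroup_def using coset0[of "Suc (Suc i)"] G.one_closed[of "Suc (Suc i)"] by (auto simp: RCOSETS_def)
    ultimately have Tbd: "T (Suc i) \<in> ?bd" unfolding tensor_boundaries_def by blast
    have TC: "T (Suc i) <#>\<^bsub>G (Suc i)\<^esub> ?C = ?C"
    proof (intro subset_antisym subsetI)
      fix x assume "x \<in> T (Suc i) <#>\<^bsub>G (Suc i)\<^esub> ?C"
      then obtain t t' where "t \<in> T (Suc i)" "t' \<in> T (Suc i)" "x = t + (t' + f)"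
        by (auto simp: set_mult_def r_coset_def)
      then have "t + t' \<in> T (Suc i)" "x = (t + t') + f" using Tadd by (auto simp: add.assoc)
      then show "x \<in> ?C" by (auto simp: r_coset_def)
    next
      fix x assume "x \<in> ?C"
      then obtain t where "t \<in> T (Suc i)" "x = 0 + (t + f)" by (auto simp: r_coset_def)
      then show "x \<in> T (Suc i) <#>\<^bsub>G (Suc i)\<^esub> ?C" using T0[of "Suc i"]
        unfolding set_mult_def r_coset_def Gs by blast
    qed
    let ?Z = "tensor S M (P (Suc i))\<lparr>carrier := ?cyc\<rparr>"
    have "?bd #>\<^bsub>?Z\<^esub> ?C \<in> carrier (?Z Mod ?bd)"
      unfolding FactGroup_def using C by (auto simp: RCOSETS_def)
    then have "?bd #>\<^bsub>?Z\<^esub> ?C = ?bd"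
      using triv unfolding trivial_group_def tensor_homology_def by (simp add: FactGroup_def)
    moreover have "?C \<in> ?bd #>\<^bsub>?Z\<^esub> ?C"
      using Tbd TC unfolding r_coset_def[of _ ?bd] by (auto simp: tn FactGroup_def)
    ultimately have "?C \<in> ?bd" by simp
    then obtain C2 where C2: "C2 \<in> carrier (tensor S M (P (Suc (Suc i))))"
      "?C = tensor_map S M (P (Suc i)) (d (Suc i)) C2" unfolding tensor_boundaries_def by blast
    then obtain n x where n: "n \<in> T (Suc i)" "x \<in> C2" "f = n + D (Suc i) x"
      using fC unfolding tm set_mult_def by auto
    have "Poly_Mapping.keys x \<subseteq> W (Suc (Suc i))"
    proof -
      obtain g where g: "g \<in> carrier (G (Suc (Suc i)))" "C2 = T (Suc (Suc i)) #>\<^bsub>G (Suc (Suc i))\<^esub> g"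
        using C2(1) unfolding tn by (auto simp: FactGroup_def RCOSETS_def)
      then obtain t where t: "t \<in> T (Suc (Suc i))" "x = t \<otimes>\<^bsub>G (Suc (Suc i))\<^esub> g" using n(2) by (auto simp: r_coset_def)
      have "t \<in> carrier (G (Suc (Suc i)))" using Tc[OF t(1)] Gc by simp
      then show ?thesis using G.m_closed[OF _ g(1)] t(2) Gc by blast
    qed
    then show "h f = 1" using hD hT[OF n(1)] hc(2)[OF Tc[OF n(1)] Dk] n(3) by simp
  qed
  \<comment> \<open>The graph of the character to be extended, defined on the image of D plus the
    null subgroup. That only 1 lies over the neutral element is \<open>key\<close>.\<close>
  define r where "r = {(D i f + n, h f) | f n. Poly_Mapping.keys f \<subseteq> W (Suc i) \<and> n \<in> T i}"
  have rI: "(D i f + n, h f) \<in> r" if "Poly_Mapping.keys f \<subseteq> W (Suc i)" "n \<in> T i" for f n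
    unfolding r_def using that by blast
  have r: "pre_character (G i) r"
    unfolding pre_character_def
  proof (intro conjI allI impI)
    fix x z assume "(x, z) \<in> r"
    then obtain f n where fn: "x = D i f + n" "z = h f" "Poly_Mapping.keys f \<subseteq> W (Suc i)" "n \<in> T i"
      by (auto simp: r_def)
    have cD: "D i f \<in> carrier (G i)" "n \<in> carrier (G i)" using Dk[OF fn(3)] Tc[OF fn(4)] Gc by auto
    then show xc: "x \<in> carrier (G i)" using G.m_closed[OF cD] fn(1) by simp
    show "z \<noteq> 0" using hc(1)[OF fn(3)] fn(2) by simp
    have "inv\<^bsub>G i\<^esub> x = - x" using xc Gc unfolding G_def by simp
    also have "\<dots> = D i (- f) + (- n)" by (simp add: fn(1) Dminus)
    finally show "(inv\<^bsub>G i\<^esub> x, inverse z) \<in> r"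
      using rI[of "- f" "- n"] hc(4)[OF fn(3)] Tminus[OF fn(4)] fn(2,3) by (simp add: keys_minus)
    fix y w assume "(y, w) \<in> r"
    then obtain f' n' where fn': "y = D i f' + n'" "w = h f'" "Poly_Mapping.keys f' \<subseteq> W (Suc i)" "n' \<in> T i"
      by (auto simp: r_def)
    have "x \<otimes>\<^bsub>G i\<^esub> y = D i (f + f') + (n + n')" "z * w = h (f + f')"
      using fn fn' hc(2)[OF fn(3) fn'(3)] by (simp_all add: Dadd)
    moreover have "Poly_Mapping.keys (f + f') \<subseteq> W (Suc i)" using keys_add[of f f'] fn(3) fn'(3) by blast
    ultimately show "(x \<otimes>\<^bsub>G i\<^esub> y, z * w) \<in> r" using Tadd[OF fn(4) fn'(4)] unfolding r_def by blast
  next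
    show "(\<one>\<^bsub>G i\<^esub>, 1) \<in> r" using rI[of 0 0] T0 by (simp add: D0 hc(3) G_def)
    fix z assume "(\<one>\<^bsub>G i\<^esub>, z) \<in> r"
    then obtain f n where fn: "0 = D i f + n" "z = h f" "Poly_Mapping.keys f \<subseteq> W (Suc i)" "n \<in> T i"
      by (auto simp: r_def)
    have "D i f = - n" using fn(1) by (metis eq_neg_iff_add_eq_0)
    then show "z = 1" using key[OF fn(3)] Tminus[OF fn(4)] fn(2) by simp
  qed
  obtain c where c: "character (G i) c" and cr: "\<And>x z. (x, z) \<in> r \<Longrightarrow> c x = z"
    by (rule G.pre_character_extend[OF r]) blast
  note cc = characterD[OF c[unfolded G_def]]
  have cT: "c n = 1" if "n \<in> T i" for n
  proof -
    have "(n, 1) \<in> r" using rI[of 0 n] that by (simp add: D0 hc(3))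
    then show ?thesis by (rule cr)
  qed
  have cD: "c (D i f) = h f" if "Poly_Mapping.keys f \<subseteq> W (Suc i)" for f
  proof -
    have "(D i f, h f) \<in> r" using rI[of f 0] that T0 by simp
    then show ?thesis by (rule cr)
  qed
  define \<psi> where "\<psi> x m = (if m \<in> carrier M then c (frag_of (m, x)) else 1)" for x m
  interpret Pi: left_module S "P i" by (rule p(3))
  have k: "Poly_Mapping.keys (frag_of (m, x)) \<subseteq> W i" if "m \<in> carrier M" "x \<in> carrier (P i)" for m x
    using that by (simp add: W_def)
  have rel: "c u = c v * c w" if "u - v - w \<in> T i" "Poly_Mapping.keys u \<subseteq> W i" "Poly_Mapping.keys v \<subseteq> W i" "Poly_Mapping.keys w \<subseteq> W i" for u v w
  proof -
    have "Poly_Mapping.keys (u - v) \<subseteq> W i" using keys_diff[of u v] that by blast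
    then have "c (u - v - w) = c u / c v / c w" using cc(5) that by simp
    then show ?thesis using cT[OF that(1)] cc(1) that by (simp add: field_simps)
  qed
  have rel2: "c u = c v" if "u - v \<in> T i" "Poly_Mapping.keys u \<subseteq> W i" "Poly_Mapping.keys v \<subseteq> W i" for u v
    using cT[OF that(1)] cc(5)[OF that(2,3)] cc(1)[OF that(3)] by simp
  have inT: "t \<in> T i" if "t \<in> tensor_rels S M (P i)" for t
    unfolding T_def tensor_null_def by (rule generate.incl[OF that])
  have \<psi>: "\<psi> \<in> lmod_hom S (P i) E"
  proof (rule lmod_homI)
    fix x assume x: "x \<in> carrier (P i)"
    show "\<psi> x \<in> carrier E"
      unfolding char_module_carrier
    proof (intro conjI ballI allI impI)
      fix m m' assume m: "m \<in> carrier M" "m' \<in> carrier M"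
      have "frag_of (m \<oplus>\<^bsub>M\<^esub> m', x) - frag_of (m, x) - frag_of (m', x) \<in> T i"
        by (rule inT) (use m x in \<open>auto simp: tensor_rels_def\<close>)
      then show "\<psi> x (m \<oplus>\<^bsub>M\<^esub> m') = \<psi> x m * \<psi> x m'" using rel k m x by (simp add: \<psi>_def)
    qed (use cc(1) k x in \<open>auto simp: \<psi>_def\<close>)
    fix y assume y: "y \<in> carrier (P i)"
    show "\<psi> (x \<oplus>\<^bsub>P i\<^esub> y) = \<psi> x \<oplus>\<^bsub>E\<^esub> \<psi> y"
    proof
      fix m
      have "frag_of (m, x \<oplus>\<^bsub>P i\<^esub> y) - frag_of (m, x) - frag_of (m, y) \<in> T i" if "m \<in> carrier M"
        by (rule inT) (use that x y in \<open>unfold tensor_rels_def, blast\<close>)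
      then show "\<psi> (x \<oplus>\<^bsub>P i\<^esub> y) m = (\<psi> x \<oplus>\<^bsub>E\<^esub> \<psi> y) m" using rel k x y by (simp add: \<psi>_def)
    qed
  next
    fix a x assume a: "a \<in> carrier S" and x: "x \<in> carrier (P i)"
    show "\<psi> (a \<odot>\<^bsub>P i\<^esub> x) = a \<odot>\<^bsub>E\<^esub> \<psi> x"
    proof
      fix m
      have "c (frag_of (ract M m a, x)) = c (frag_of (m, a \<odot>\<^bsub>P i\<^esub> x))" if m: "m \<in> carrier M"
      proof (rule rel2[OF inT k k])
        show "frag_of (ract M m a, x) - frag_of (m, a \<odot>\<^bsub>P i\<^esub> x) \<in> tensor_rels S M (P i)"
          unfolding tensor_rels_def using m a x by blast
      qed (use m a x in \<open>auto simp: ract_closed\<close>)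
      then show "\<psi> (a \<odot>\<^bsub>P i\<^esub> x) m = (a \<odot>\<^bsub>E\<^esub> \<psi> x) m" using a by (simp add: \<psi>_def ract_closed)
    qed
  qed
  have "\<chi> x = \<psi> (d i x)" if x: "x \<in> carrier (P (Suc i))" for x
  proof
    fix m
    show "\<chi> x m = \<psi> (d i x) m"
    proof (cases "m \<in> carrier M")
      case True
      have "c (D i (frag_of (m, x))) = h (frag_of (m, x))" by (rule cD) (use True x in \<open>simp add: W_def\<close>)
      then show ?thesis unfolding Dof using hf[OF True x] True by (simp add: \<psi>_def)
    next
      case False
      then show ?thesis using lmod_homD(1)[OF \<chi> x] unfolding char_module_carrier by (simp add: \<psi>_def)
    qed
  qed
  then show "\<exists>\<psi> \<in> lmod_hom S (P i) E. \<forall>x \<in> carrier (P (Suc i)). \<chi> x = \<psi> (d i x)" using \<psi> by blast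
qed

text \<open>\<open>Tor\<close> is computed from a resolution picked by \<open>SOME\<close>, so its
  vanishing says something about that resolution alone;
  \<open>hom_exact_resolution_independent\<close> carries the conclusion to any other.\<close>

lemma Tor_resolution:
  fixes N :: "('s, 'n) module"
  assumes N: "left_module S N" and tor: "\<forall>i \<ge> 1. trivial_group (Tor S i M N)"
  obtains P d e where "projective_resolution S N (P :: ('s, 'n) res_modules) d e" "\<And>i. hom_exact S E P d i"
proof -
  let ?Q = "\<lambda>(P :: ('s, 'n) res_modules, d, e). projective_resolution S N P d e"
  have ex: "\<exists>t. ?Q t" using ex_projective_resolution[OF N] by auto
  obtain P :: "('s, 'n) res_modules" and d e where t: "(SOME t. ?Q t) = (P, d, e)" by (metis prod_cases3)
  have P: "projective_resolution S N P d e" using someI_ex[OF ex] t by simp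
  have "trivial_group (tensor_homology S M P d (Suc i))" for i
    using tor[rule_format, of "Suc i"] unfolding Tor_def t by simp
  from that[OF P hom_exact_of_trivial_tensor_homology[OF P this]] show thesis .
qed

end

section \<open>Ring epimorphisms\<close>

text \<open>The commutator in this bimodule with a map \<open>f\<close> measures the failure of \<open>f\<close> to be
  \<open>S\<close>-linear.\<close>

definition additive_maps :: "('s, 'z) ring_scheme \<Rightarrow> ('s, 'e) module \<Rightarrow> ('s, 's \<Rightarrow> 'e) bimodule" where
  "additive_maps S E = \<lparr>carrier = {\<beta>. (\<forall>x \<in> carrier S. \<beta> x \<in> carrier E) \<and>
        (\<forall>x \<in> carrier S. \<forall>y \<in> carrier S. \<beta> (x \<oplus>\<^bsub>S\<^esub> y) = \<beta> x \<oplus>\<^bsub>E\<^esub> \<beta> y) \<and> (\<forall>x. x \<notin> carrier S \<longrightarrow> \<beta> x = \<zero>\<^bsub>E\<^esub>)},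
     monoid.mult = (\<lambda>\<beta> \<gamma>. \<beta>), one = (\<lambda>x. \<zero>\<^bsub>E\<^esub>), ring.zero = (\<lambda>x. \<zero>\<^bsub>E\<^esub>),
     add = (\<lambda>\<beta> \<gamma> x. \<beta> x \<oplus>\<^bsub>E\<^esub> \<gamma> x), smult = (\<lambda>s \<beta> x. s \<odot>\<^bsub>E\<^esub> \<beta> x),
     ract = (\<lambda>\<beta> s x. if x \<in> carrier S then \<beta> (s \<otimes>\<^bsub>S\<^esub> x) else \<zero>\<^bsub>E\<^esub>)\<rparr>"

lemma additive_maps_simps [simp]:
  "\<beta> \<in> carrier (additive_maps S E) \<longleftrightarrow> (\<forall>x \<in> carrier S. \<beta> x \<in> carrier E) \<and>
     (\<forall>x \<in> carrier S. \<forall>y \<in> carrier S. \<beta> (x \<oplus>\<^bsub>S\<^esub> y) = \<beta> x \<oplus>\<^bsub>E\<^esub> \<beta> y) \<and> (\<forall>x. x \<notin> carrier S \<longrightarrow> \<beta> x = \<zero>\<^bsub>E\<^esub>)"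
  "\<zero>\<^bsub>additive_maps S E\<^esub> = (\<lambda>x. \<zero>\<^bsub>E\<^esub>)" "\<beta> \<oplus>\<^bsub>additive_maps S E\<^esub> \<gamma> = (\<lambda>x. \<beta> x \<oplus>\<^bsub>E\<^esub> \<gamma> x)"
  "s \<odot>\<^bsub>additive_maps S E\<^esub> \<beta> = (\<lambda>x. s \<odot>\<^bsub>E\<^esub> \<beta> x)"
  "ract (additive_maps S E) \<beta> s = (\<lambda>x. if x \<in> carrier S then \<beta> (s \<otimes>\<^bsub>S\<^esub> x) else \<zero>\<^bsub>E\<^esub>)"
  by (simp_all add: additive_maps_def)

lemma bimodule_additive_maps:
  assumes S: "ring S" and E: "left_module S E"
  shows "bimodule S (additive_maps S E)"
proof -
  interpret E: left_module S E by fact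
  have c: "\<beta> x \<in> carrier E" if "\<beta> \<in> carrier (additive_maps S E)" for \<beta> x
    using that by (cases "x \<in> carrier S") auto
  have add: "(\<lambda>x. \<beta> x \<oplus>\<^bsub>E\<^esub> \<gamma> x) \<in> carrier (additive_maps S E)"
    if "\<beta> \<in> carrier (additive_maps S E)" "\<gamma> \<in> carrier (additive_maps S E)" for \<beta> \<gamma>
    using that c[OF that(1)] c[OF that(2)] by (auto simp: E.M.a_ac)
  have m: "left_module S (additive_maps S E)"
  proof (rule left_moduleI[OF S])
    fix \<beta> assume b: "\<beta> \<in> carrier (additive_maps S E)"
    show "\<zero>\<^bsub>additive_maps S E\<^esub> \<oplus>\<^bsub>additive_maps S E\<^esub> \<beta> = \<beta>" "\<one>\<^bsub>S\<^esub> \<odot>\<^bsub>additive_maps S E\<^esub> \<beta> = \<beta>"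
      "\<zero>\<^bsub>S\<^esub> \<odot>\<^bsub>additive_maps S E\<^esub> \<beta> = \<zero>\<^bsub>additive_maps S E\<^esub>"
      using c[OF b] by (simp_all del: additive_maps_simps(1))
  next
    fix \<beta> \<gamma> assume bg: "\<beta> \<in> carrier (additive_maps S E)" "\<gamma> \<in> carrier (additive_maps S E)"
    show "\<beta> \<oplus>\<^bsub>additive_maps S E\<^esub> \<gamma> \<in> carrier (additive_maps S E)"
      using add[OF bg] by (simp only: additive_maps_simps(3))
    show "\<beta> \<oplus>\<^bsub>additive_maps S E\<^esub> \<gamma> = \<gamma> \<oplus>\<^bsub>additive_maps S E\<^esub> \<beta>"
      using c[OF bg(1)] c[OF bg(2)] by (simp add: E.M.a_comm del: additive_maps_simps(1))
    fix s assume s: "s \<in> carrier S"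
    show "s \<odot>\<^bsub>additive_maps S E\<^esub> (\<beta> \<oplus>\<^bsub>additive_maps S E\<^esub> \<gamma>) = s \<odot>\<^bsub>additive_maps S E\<^esub> \<beta> \<oplus>\<^bsub>additive_maps S E\<^esub> s \<odot>\<^bsub>additive_maps S E\<^esub> \<gamma>"
      using c[OF bg(1)] c[OF bg(2)] s by (simp add: E.smult_r_distr del: additive_maps_simps(1))
  next
    fix \<beta> s assume b: "\<beta> \<in> carrier (additive_maps S E)" and s: "s \<in> carrier S"
    show "s \<odot>\<^bsub>additive_maps S E\<^esub> \<beta> \<in> carrier (additive_maps S E)"
      using b s by (auto simp: E.smult_r_distr)
    fix t assume t: "t \<in> carrier S"
    show "(s \<oplus>\<^bsub>S\<^esub> t) \<odot>\<^bsub>additive_maps S E\<^esub> \<beta> = s \<odot>\<^bsub>additive_maps S E\<^esub> \<beta> \<oplus>\<^bsub>additive_maps S E\<^esub> t \<odot>\<^bsub>additive_maps S E\<^esub> \<beta>"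
      "(s \<otimes>\<^bsub>S\<^esub> t) \<odot>\<^bsub>additive_maps S E\<^esub> \<beta> = s \<odot>\<^bsub>additive_maps S E\<^esub> (t \<odot>\<^bsub>additive_maps S E\<^esub> \<beta>)"
      using c[OF b] s t by (simp_all add: E.smult_l_distr E.smult_assoc1 del: additive_maps_simps(1))
  next
    fix \<beta> \<gamma> \<delta> assume "\<beta> \<in> carrier (additive_maps S E)" "\<gamma> \<in> carrier (additive_maps S E)" "\<delta> \<in> carrier (additive_maps S E)"
    then show "\<beta> \<oplus>\<^bsub>additive_maps S E\<^esub> \<gamma> \<oplus>\<^bsub>additive_maps S E\<^esub> \<delta> = \<beta> \<oplus>\<^bsub>additive_maps S E\<^esub> (\<gamma> \<oplus>\<^bsub>additive_maps S E\<^esub> \<delta>)"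
      using c by (simp add: E.M.a_assoc del: additive_maps_simps(1))
  qed auto
  show ?thesis
  proof (intro bimodule.intro[OF m] bimodule_axioms.intro)
    fix \<beta> assume b: "\<beta> \<in> carrier (additive_maps S E)"
    show "ract (additive_maps S E) \<beta> \<one>\<^bsub>S\<^esub> = \<beta>" using b by auto
    fix s assume s: "s \<in> carrier S"
    show "ract (additive_maps S E) \<beta> s \<in> carrier (additive_maps S E)"
      using b s by (auto simp: E.R.r_distr)
    fix \<gamma> assume g: "\<gamma> \<in> carrier (additive_maps S E)"
    show "ract (additive_maps S E) (\<beta> \<oplus>\<^bsub>additive_maps S E\<^esub> \<gamma>) s = ract (additive_maps S E) \<beta> s \<oplus>\<^bsub>additive_maps S E\<^esub> ract (additive_maps S E) \<gamma> s" by auto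
  next
    fix \<beta> s t assume b: "\<beta> \<in> carrier (additive_maps S E)" and s: "s \<in> carrier S" and t: "t \<in> carrier S"
    show "ract (additive_maps S E) \<beta> (s \<oplus>\<^bsub>S\<^esub> t) =
        ract (additive_maps S E) \<beta> s \<oplus>\<^bsub>additive_maps S E\<^esub> ract (additive_maps S E) \<beta> t"
      using b s t by (auto simp: E.R.l_distr)
    show "ract (additive_maps S E) \<beta> (s \<otimes>\<^bsub>S\<^esub> t) = ract (additive_maps S E) (ract (additive_maps S E) \<beta> s) t"
      using b s t by (auto simp: E.R.m_assoc)
  next
    fix s \<beta> t assume s: "s \<in> carrier S" and b: "\<beta> \<in> carrier (additive_maps S E)" and t: "t \<in> carrier S"
    show "ract (additive_maps S E) (s \<odot>\<^bsub>additive_maps S E\<^esub> \<beta>) t = s \<odot>\<^bsub>additive_maps S E\<^esub> ract (additive_maps S E) \<beta> t"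
      using s by auto
  qed
qed

text \<open>The commutator \<delta> s = s f - f s is a derivation, so s \<mapsto> (s, \<delta> s) is
  a ring homomorphism into the trivial extension by the additive maps. R-linearity of f makes
  \<delta> vanish on the image of \<open>lam\<close>, where the map agrees with s \<mapsto> (s, 0).
  Cancellation gives \<delta> = 0, which is evaluated at 1.\<close>

lemma ring_epi_hom_linear:
  assumes S: "ring S" and epi: "ring_epi R S lam" and E: "left_module S E"
    and f: "f \<in> lmod_hom R (restrict_scalars lam (regular_module S)) (restrict_scalars lam E)"
    and s: "s \<in> carrier S"
  shows "f s = s \<odot>\<^bsub>E\<^esub> f \<one>\<^bsub>S\<^esub>"
proof -
  interpret E: left_module S E by fact
  note h = lmod_homD[OF f, simplified]
  have lam: "lam \<in> ring_hom R S" using epi by (simp add: ring_epi_def)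
  let ?B = "additive_maps S E"
  have B: "bimodule S ?B" by (rule bimodule_additive_maps[OF S E])
  interpret T: triv_ext S ?B by (rule triv_ext.intro[OF B])
  define \<delta> where "\<delta> s = (\<lambda>x. if x \<in> carrier S then s \<odot>\<^bsub>E\<^esub> f x \<ominus>\<^bsub>E\<^esub> f (s \<otimes>\<^bsub>S\<^esub> x) else \<zero>\<^bsub>E\<^esub>)" for s
  have sub: "(a \<oplus>\<^bsub>E\<^esub> b) \<ominus>\<^bsub>E\<^esub> (a' \<oplus>\<^bsub>E\<^esub> b') = (a \<ominus>\<^bsub>E\<^esub> a') \<oplus>\<^bsub>E\<^esub> (b \<ominus>\<^bsub>E\<^esub> b')"
    if "a \<in> carrier E" "b \<in> carrier E" "a' \<in> carrier E" "b' \<in> carrier E" for a b a' b'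
    using that by (simp add: a_minus_def E.M.minus_add E.M.a_ac)
  have sd: "s \<odot>\<^bsub>E\<^esub> (a \<ominus>\<^bsub>E\<^esub> b) = s \<odot>\<^bsub>E\<^esub> a \<ominus>\<^bsub>E\<^esub> s \<odot>\<^bsub>E\<^esub> b"
    if "s \<in> carrier S" "a \<in> carrier E" "b \<in> carrier E" for s a b
    using that by (simp add: a_minus_def E.smult_r_distr E.smult_r_minus)
  have \<delta>c: "\<delta> s \<in> carrier ?B" if "s \<in> carrier S" for s
    using that h by (auto simp: \<delta>_def E.R.r_distr E.smult_r_distr sub)
  define g where "g s = (s, \<delta> s)" for s
  have gh: "g \<in> ring_hom S (S \<ltimes> ?B)"
  proof (rule ring_hom_memI)
    fix s t assume s: "s \<in> carrier S" and t: "t \<in> carrier S"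
    show "g s \<in> carrier (S \<ltimes> ?B)" using s \<delta>c by (simp add: g_def del: additive_maps_simps(1))
    have "\<delta> (s \<otimes>\<^bsub>S\<^esub> t) = (\<lambda>x. s \<odot>\<^bsub>E\<^esub> \<delta> t x \<oplus>\<^bsub>E\<^esub> (if x \<in> carrier S then \<delta> s (t \<otimes>\<^bsub>S\<^esub> x) else \<zero>\<^bsub>E\<^esub>))"
    proof
      fix x
      show "\<delta> (s \<otimes>\<^bsub>S\<^esub> t) x = s \<odot>\<^bsub>E\<^esub> \<delta> t x \<oplus>\<^bsub>E\<^esub> (if x \<in> carrier S then \<delta> s (t \<otimes>\<^bsub>S\<^esub> x) else \<zero>\<^bsub>E\<^esub>)"
        using s t h(1) by (auto simp: \<delta>_def sd E.smult_assoc1 E.R.m_assoc E.M.diff_trans)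
    qed
    then show "g (s \<otimes>\<^bsub>S\<^esub> t) = g s \<otimes>\<^bsub>S \<ltimes> ?B\<^esub> g t" by (simp add: g_def del: additive_maps_simps(1))
    have "\<delta> (s \<oplus>\<^bsub>S\<^esub> t) = (\<lambda>x. \<delta> s x \<oplus>\<^bsub>E\<^esub> \<delta> t x)"
      using s t h(1,2) by (auto simp: \<delta>_def fun_eq_iff E.R.l_distr E.smult_l_distr sub)
    then show "g (s \<oplus>\<^bsub>S\<^esub> t) = g s \<oplus>\<^bsub>S \<ltimes> ?B\<^esub> g t" by (simp add: g_def del: additive_maps_simps(1))
  next
    show "g \<one>\<^bsub>S\<^esub> = \<one>\<^bsub>S \<ltimes> ?B\<^esub>"
      using h(1) by (auto simp: g_def \<delta>_def fun_eq_iff E.M.diff_self)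
  qed
  have eq: "g (lam r) = (\<lambda>s. (s, \<zero>\<^bsub>?B\<^esub>)) (lam r)" if r: "r \<in> carrier R" for r
    using h(1) h(3)[OF r] ring_hom_memE(1)[OF lam r] by (auto simp: g_def \<delta>_def fun_eq_iff E.M.diff_self)
  have "g s = (s, \<zero>\<^bsub>?B\<^esub>)"
    by (rule ring_epi_cancel[OF epi S T.ringA gh T.\<sigma>_hom eq s])
  then have "\<delta> s \<one>\<^bsub>S\<^esub> = \<zero>\<^bsub>E\<^esub>" by (simp add: g_def)
  then have "s \<odot>\<^bsub>E\<^esub> f \<one>\<^bsub>S\<^esub> \<ominus>\<^bsub>E\<^esub> f s = \<zero>\<^bsub>E\<^esub>" using s by (simp add: \<delta>_def)
  then show ?thesis using E.M.diff_eq_zeroD[of "s \<odot>\<^bsub>E\<^esub> f \<one>\<^bsub>S\<^esub>" "f s"] h(1) s by simp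
qed

section \<open>Free complexes over a trivial extension\<close>

text \<open>Homomorphisms from a base changed free module to \<open>N\<close> correspond to
  R-homomorphisms from the original one to the restriction of \<open>N\<close>, by evaluation on the
  basis.\<close>

lemma (in ring_change) base_change_hom_exact:
  assumes N: "left_module A N" and D: "\<And>n. D n \<in> lmod_hom R (fm R (k (Suc n))) (fm R (k n))"
    and ex: "hom_exact R (restrict_scalars \<phi> N) (\<lambda>n. fm R (k n)) D i"
  shows "hom_exact A N (\<lambda>n. fm A (k n)) (\<lambda>n. base_change R A \<phi> (k n) (D n)) i"
  unfolding hom_exact_def
proof (intro ballI impI)
  fix \<chi> assume \<chi>: "\<chi> \<in> lmod_hom A (fm A (k (Suc i))) N"
    and co: "\<forall>y \<in> carrier (fm A (k (Suc (Suc i)))). \<chi> (base_change R A \<phi> (k (Suc i)) (D (Suc i)) y) = \<zero>\<^bsub>N\<^esub>"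
  have \<chi>m: "(\<lambda>x. \<chi> (\<lambda>j. \<phi> (x j))) \<in> lmod_hom R (fm R (k (Suc i))) (restrict_scalars \<phi> N)"
    by (rule lmod_hom_comp[OF map_hom lmod_hom_restrict_scalars[OF \<phi> \<chi>]])
  have "\<chi> (\<lambda>j. \<phi> (D (Suc i) y j)) = \<zero>\<^bsub>restrict_scalars \<phi> N\<^esub>" if y: "y \<in> carrier (fm R (k (Suc (Suc i))))" for y
    using bspec[OF co map_fm[OF y]] unfolding base_change_map[OF D y] by simp
  then obtain \<psi> where \<psi>: "\<psi> \<in> lmod_hom R (fm R (k i)) (restrict_scalars \<phi> N)"
    "\<And>x. x \<in> carrier (fm R (k (Suc i))) \<Longrightarrow> \<chi> (\<lambda>j. \<phi> (x j)) = \<psi> (D i x)"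
    using bspec[OF ex[unfolded hom_exact_def] \<chi>m] by blast
  have \<psi>b: "(\<lambda>b. \<psi> (basis_elt R b)) \<in> {..<k i} \<rightarrow> carrier N"
    using lmod_homD(1)[OF \<psi>(1) basis_elt_in[OF R]] by simp
  define g where "g = free_ext A N (\<lambda>b. \<psi> (basis_elt R b))"
  have g: "g \<in> lmod_hom A (fm A (k i)) N" unfolding g_def by (rule free_ext_hom[OF N \<psi>b])
  have g\<psi>: "g (\<lambda>j. \<phi> (x j)) = \<psi> x" if x: "x \<in> carrier (fm R (k i))" for x
    by (rule semilinear_eqI[OF N g \<psi>(1) _ x]) (unfold g_def, rule free_ext_basis[OF N \<psi>b])
  have "\<chi> x = g (base_change R A \<phi> (k i) (D i) x)" if x: "x \<in> carrier (fm A (k (Suc i)))" for x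
  proof (rule free_hom_eqI[OF N \<chi> lmod_hom_comp[OF base_change_hom[OF D] g] _ x])
    fix b assume b: "b \<in> {..<k (Suc i)}"
    note be = basis_elt_in[OF R b]
    show "\<chi> (basis_elt A b) = g (base_change R A \<phi> (k i) (D i) (basis_elt A b))"
      unfolding base_change_basis[OF D b] g\<psi>[OF lmod_homD(1)[OF D be]] \<psi>(2)[OF be, symmetric] map_basis ..
  qed
  then show "\<exists>\<psi> \<in> lmod_hom A (fm A (k i)) N. \<forall>x \<in> carrier (fm A (k (Suc i))).
      \<chi> x = \<psi> (base_change R A \<phi> (k i) (D i) x)" using g by blast
qed

section \<open>Passing between free complexes over S and over its trivial extension\<close>

context triv_ext
begin

lemma fib_diff:
  assumes x: "x \<in> carrier (fm A k)" and y: "y \<in> carrier (fm A k)" and eq: "(\<lambda>j. fst (x j)) = (\<lambda>j. fst (y j))"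
  shows "x \<ominus>\<^bsub>fm A k\<^esub> y \<in> fib k"
proof -
  interpret F: left_module A "fm A k" by (rule left_module_free_module[OF ringA])
  show ?thesis unfolding fib_def using fst_diff[OF x y eq] F.M.minus_closed[OF x y] by simp
qed

text \<open>Subtracting a lift w of the S-part of y leaves an element of \<open>fib k1\<close> in
  the kernel of u, where exactness is assumed. The target \<open>L\<close> is kept general so that u
  can be a differential or an augmentation.\<close>

lemma up_image:
  assumes d: "d \<in> lmod_hom S (fm S k2) (fm S k1)" and L: "left_module A L"
    and u: "u \<in> lmod_hom A (fm A k1) L" and ud: "\<And>x. x \<in> carrier (fm A k2) \<Longrightarrow> u (up k1 d x) = \<zero>\<^bsub>L\<^esub>"
    and fib: "\<And>z. z \<in> fib k1 \<Longrightarrow> u z = \<zero>\<^bsub>L\<^esub> \<Longrightarrow> z \<in> up k1 d ` fib k2"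
    and y: "y \<in> carrier (fm A k1)" "u y = \<zero>\<^bsub>L\<^esub>" and im: "(\<lambda>j. fst (y j)) \<in> d ` carrier (fm S k2)"
  shows "y \<in> up k1 d ` carrier (fm A k2)"
proof -
  note Fm = left_module_free_module[OF ringA] and ud' = \<sigma>.base_change_hom[OF d]
  interpret F: left_module A "fm A k1" by (rule Fm)
  interpret F2: left_module A "fm A k2" by (rule Fm)
  interpret L: left_module A L by (rule L)
  obtain x where x: "x \<in> carrier (fm S k2)" "d x = (\<lambda>j. fst (y j))" using im by force
  define w where "w = up k1 d (\<lambda>j. \<sigma> (x j))"
  have w: "w \<in> carrier (fm A k1)" unfolding w_def by (rule lmod_homD(1)[OF ud' \<sigma>_map[OF x(1)]])
  have fw: "(\<lambda>j. fst (y j)) = (\<lambda>j. fst (w j))"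
    unfolding w_def fst_up[OF d \<sigma>_map[OF x(1)]] by (simp add: x(2))
  have "u (y \<ominus>\<^bsub>fm A k1\<^esub> w) = \<zero>\<^bsub>L\<^esub> \<ominus>\<^bsub>L\<^esub> \<zero>\<^bsub>L\<^esub>"
    unfolding lmod_hom_minus_distrib[OF u Fm L y(1) w] y(2) unfolding w_def ud[OF \<sigma>_map[OF x(1)]] ..
  then have "u (y \<ominus>\<^bsub>fm A k1\<^esub> w) = \<zero>\<^bsub>L\<^esub>" unfolding L.M.diff_self[OF L.M.zero_closed] .
  from fib[OF fib_diff[OF y(1) w fw] this]
  obtain z where z: "z \<in> fib k2" "up k1 d z = y \<ominus>\<^bsub>fm A k1\<^esub> w" by force
  have zc: "z \<in> carrier (fm A k2)" using z(1) by (simp add: fib_def)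
  have "up k1 d (z \<oplus>\<^bsub>fm A k2\<^esub> (\<lambda>j. \<sigma> (x j))) = y"
    unfolding lmod_homD(2)[OF ud' zc \<sigma>_map[OF x(1)]] z(2) w_def[symmetric] by (rule F.M.diff_add_cancel'[OF y(1) w])
  then show ?thesis using F2.M.a_closed[OF zc \<sigma>_map[OF x(1)]] by blast
qed

text \<open>The base changed complex is an extension of F by M tensor F. F is exact in positive
  degrees, M tensor F only above degree r, so the complex is cut off at r and renumbered.\<close>

lemma free_complex_up:
  assumes F: "free_complex S k D" and ex: "\<And>i. i \<ge> r \<Longrightarrow> hom_exact S E (\<lambda>n. fm S (k n)) D i"
  shows "free_complex A (\<lambda>n. k (n + r)) (\<lambda>n. up (k (n + r)) (D (n + r)))"
proof (rule free_complexI)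
  note D = free_complexD(1)[OF F]
  have S: "ring S" by (rule R.ring_axioms)
  show "up (k (n + r)) (D (n + r)) \<in> lmod_hom A (fm A (k (Suc n + r))) (fm A (k (n + r)))" for n
    using \<sigma>.base_change_hom[OF D] by simp
  have uu: "up (k j) (D j) (up (k (Suc j)) (D (Suc j)) x) = \<zero>\<^bsub>fm A (k j)\<^esub>"
    if x: "x \<in> carrier (fm A (k (Suc (Suc j))))" for j x
    unfolding \<sigma>.base_change_comp[OF D D x]
    by (rule \<sigma>.base_change_zero[OF lmod_hom_comp[OF D D] free_complexD(2)[OF F] x])
  then show "up (k (n + r)) (D (n + r)) (up (k (Suc n + r)) (D (Suc n + r)) x) = \<zero>\<^bsub>fm A (k (n + r))\<^esub>"
    if "x \<in> carrier (fm A (k (Suc (Suc n) + r)))" for n x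
    using that by simp
  fix n y assume y: "y \<in> carrier (fm A (k (Suc n + r)))" "up (k (n + r)) (D (n + r)) y = \<zero>\<^bsub>fm A (k (n + r))\<^esub>"
  let ?j = "n + r"
  have yc: "y \<in> carrier (fm A (k (Suc ?j)))" using y(1) by simp
  have "D ?j (\<lambda>j. fst (y j)) = \<zero>\<^bsub>fm S (k ?j)\<^esub>"
    unfolding fst_up[OF D yc, symmetric] y(2) by simp
  note im = free_complexD(3)[OF F fst_map[OF yc] this]
  have fib: "z \<in> up (k (Suc ?j)) (D (Suc ?j)) ` fib (k (Suc (Suc ?j)))"
    if "z \<in> fib (k (Suc ?j))" "up (k ?j) (D ?j) z = \<zero>\<^bsub>fm A (k ?j)\<^esub>" for z
    by (rule fib_exact[where D = D and k = k, OF D ex that]) simp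
  have "y \<in> up (k (Suc ?j)) (D (Suc ?j)) ` carrier (fm A (k (Suc (Suc ?j))))"
    by (rule up_image[OF D left_module_free_module[OF ringA] \<sigma>.base_change_hom[OF D] uu fib yc y(2) im])
  then show "y \<in> up (k (Suc n + r)) (D (Suc n + r)) ` carrier (fm A (k (Suc (Suc n) + r)))" by simp
qed

text \<open>The renumbered complex splits over A in degree a, that is in the original degree a + r;
  reduction modulo M brings the splitting back to S.\<close>

lemma fpd_base_le:
  fixes R' :: "('r, 'y) ring_scheme"
  assumes sc: "scalar_change R' S \<phi> E" and R': "fpd R' \<le> enat r" and A: "fpd A \<le> enat a"
  shows "fpd S \<le> enat (a + r)"
proof (rule fpd_leI)
  fix k D m assume F: "free_complex S k D" and z: "\<And>j. j > m \<Longrightarrow> k j = 0"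
  note D = free_complexD(1)[OF F]
  have U: "free_complex A (\<lambda>n. k (n + r)) (\<lambda>n. up (k (n + r)) (D (n + r)))"
    by (rule free_complex_up[OF F]) (rule scalar_change.hom_exact_above_fpd[OF sc F z R'])
  have "lmod_regular A (fm A (k (Suc a + r))) (fm A (k (a + r))) (up (k (a + r)) (D (a + r)))"
    by (rule free_complex_regular[OF ringA U _ A order_refl, of m]) (use z in simp)
  then have "lmod_regular A (fm A (k (Suc (a + r)))) (fm A (k (a + r))) (up (k (a + r)) (D (a + r)))" by simp
  from \<pi>.base_change_regular[OF \<sigma>.base_change_hom[OF D] this]
  show "lmod_regular S (fm S (k (Suc (a + r)))) (fm S (k (a + r))) (D (a + r))"
    by (rule lmod_regular_cong[OF _ down_up[OF D, symmetric] \<pi>.base_change_hom[OF \<sigma>.base_change_hom[OF D]]])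
qed

text \<open>The difference of the two maps has values with entries in M, hence kills elements with
  entries in M. So the action of f on the M-part depends only on f modulo M.\<close>

lemma fib_up_down:
  assumes f: "f \<in> lmod_hom A (fm A k) (fm A l)" and z: "z \<in> fib k"
  shows "up l (down l f) z = f z"
proof -
  note Fm = left_module_free_module[OF ringA] and d = \<pi>.base_change_hom[OF f]
  note u = \<sigma>.base_change_hom[OF d]
  interpret G: left_module A "fm A l" by (rule Fm)
  have zc: "z \<in> carrier (fm A k)" "(\<lambda>j. fst (z j)) = (\<lambda>j. \<zero>\<^bsub>S\<^esub>)" using z by (simp_all add: fib_def)
  have "(\<lambda>j. fst ((up l (down l f) x \<ominus>\<^bsub>fm A l\<^esub> f x) j)) = (\<lambda>j. \<zero>\<^bsub>S\<^esub>)" if x: "x \<in> carrier (fm A k)" for x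
  proof -
    have "(\<lambda>j. fst (up l (down l f) x j)) = (\<lambda>j. fst (f x j))"
      unfolding fst_up[OF d x] by (rule \<pi>.base_change_map[OF f x])
    from fib_diff[OF lmod_homD(1)[OF u x] lmod_homD(1)[OF f x] this] show ?thesis by (simp add: fib_def)
  qed
  from kernel_hom_fst[OF lmod_hom_diff[OF Fm u f] this zc]
  show ?thesis by (rule G.M.diff_eq_zeroD[OF lmod_homD(1)[OF u zc(1)] lmod_homD(1)[OF f zc(1)]])
qed

text \<open>The connecting map of the snake lemma: lift the cycle y to Y; D Y is a cycle in the
  M-part, hence a boundary of some z there; then Y - z is a cycle over A, hence a boundary, and it
  reduces to y. The connecting map lowers the degree, so exactness for index p gives exactness for p
  + 1.\<close>

lemma down_exact:
  assumes F: "free_complex A k D" and ex: "hom_exact S E (\<lambda>n. fm S (k n)) (\<lambda>n. down (k n) (D n)) p"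
    and y: "y \<in> carrier (fm S (k (Suc (Suc p))))" "down (k (Suc p)) (D (Suc p)) y = \<zero>\<^bsub>fm S (k (Suc p))\<^esub>"
  shows "y \<in> down (k (Suc (Suc p))) (D (Suc (Suc p))) ` carrier (fm S (k (Suc (Suc (Suc p)))))"
proof -
  note D = free_complexD(1)[OF F] and Fm = left_module_free_module[OF ringA]
  interpret F: left_module A "fm A (k (Suc (Suc p)))" by (rule Fm)
  interpret F1: left_module A "fm A (k (Suc p))" by (rule Fm)
  define Y where "Y = (\<lambda>j. \<sigma> (y j))"
  have Y: "Y \<in> carrier (fm A (k (Suc (Suc p))))" unfolding Y_def by (rule \<sigma>_map[OF y(1)])
  have DY: "D (Suc p) Y \<in> carrier (fm A (k (Suc p)))" by (rule lmod_homD(1)[OF D Y])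
  have "(\<lambda>j. fst (D (Suc p) Y j)) = down (k (Suc p)) (D (Suc p)) (\<lambda>j. fst (Y j))"
    by (rule \<pi>.base_change_map[OF D Y, symmetric])
  then have fibY: "D (Suc p) Y \<in> fib (k (Suc p))" unfolding fib_def using DY y(2) by (simp add: Y_def)
  have "up (k p) (down (k p) (D p)) (D (Suc p) Y) = \<zero>\<^bsub>fm A (k p)\<^esub>"
    unfolding fib_up_down[OF D fibY] by (rule free_complexD(2)[OF F Y])
  from fib_exact[OF \<pi>.base_change_hom[OF D] ex fibY this]
  obtain z where z: "z \<in> fib (k (Suc (Suc p)))" "up (k (Suc p)) (down (k (Suc p)) (D (Suc p))) z = D (Suc p) Y"
    by force
  have zc: "z \<in> carrier (fm A (k (Suc (Suc p))))" using z(1) by (simp add: fib_def)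
  have Dz: "D (Suc p) z = D (Suc p) Y" using z(2) unfolding fib_up_down[OF D z(1)] .
  have "D (Suc p) (Y \<ominus>\<^bsub>fm A (k (Suc (Suc p)))\<^esub> z) = \<zero>\<^bsub>fm A (k (Suc p))\<^esub>"
    unfolding lmod_hom_minus_distrib[OF D Fm Fm Y zc] Dz by (rule F1.M.diff_self[OF DY])
  from free_complexD(3)[OF F F.M.minus_closed[OF Y zc] this]
  obtain w where w: "w \<in> carrier (fm A (k (Suc (Suc (Suc p)))))" "D (Suc (Suc p)) w = Y \<ominus>\<^bsub>fm A (k (Suc (Suc p)))\<^esub> z"
    by force
  have "down (k (Suc (Suc p))) (D (Suc (Suc p))) (\<lambda>j. fst (w j)) = (\<lambda>j. fst ((Y \<ominus>\<^bsub>fm A (k (Suc (Suc p)))\<^esub> z) j))"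
    unfolding \<pi>.base_change_map[OF D w(1)] w(2) ..
  also have "\<dots> = y"
  proof -
    let ?u = "Y \<ominus>\<^bsub>fm A (k (Suc (Suc p)))\<^esub> z"
    note uc = F.M.minus_closed[OF Y zc]
    have "Y = ?u \<oplus>\<^bsub>fm A (k (Suc (Suc p)))\<^esub> z"
      by (rule F.M.diff_add_cancel'[OF Y zc, symmetric])
    then have "(\<lambda>j. fst (Y j)) = (\<lambda>j. fst (?u j)) \<oplus>\<^bsub>fm S (k (Suc (Suc p)))\<^esub> (\<lambda>j. fst (z j))"
      using \<pi>.map_add[OF uc zc] by (simp only:)
    from fun_cong[OF this] have "fst (Y j) = fst (?u j) \<oplus>\<^bsub>S\<^esub> fst (z j)" for j by (simp only: free_module_simps)
    moreover have "fst (z j) = \<zero>\<^bsub>S\<^esub>" for j using z(1) fun_cong unfolding fib_def by fastforce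
    moreover have "fst (?u j) \<in> carrier S" for j using free_module_carrierD(1)[OF fst_map[OF uc] R.ring_axioms] .
    ultimately have "fst (?u j) = fst (Y j)" for j by (simp only: R.r_zero)
    then show ?thesis by (simp only: Y_def fst_conv)
  qed
  finally show ?thesis using fst_map[OF w(1)] by blast
qed

lemma fpd_triv_ext_le:
  fixes A' :: "('r, 'y) ring_scheme"
  assumes sc: "scalar_change A' A \<phi> (restrict_scalars fst E)"
    and A': "fpd A' \<le> enat r" and S: "fpd S \<le> enat s"
  shows "fpd A \<le> enat (s + Suc r)"
proof (rule fpd_leI)
  fix k D m assume F: "free_complex A k D" and z: "\<And>j. j > m \<Longrightarrow> k j = 0"
  note D = free_complexD(1)[OF F]
  let ?D = "\<lambda>n. down (k n) (D n)"
  have ex: "y \<in> ?D (Suc (Suc p)) ` carrier (fm S (k (Suc (Suc (Suc p)))))"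
    if "r \<le> p" "y \<in> carrier (fm S (k (Suc (Suc p))))" "?D (Suc p) y = \<zero>\<^bsub>fm S (k (Suc p))\<^esub>" for p y
  proof (rule down_exact[OF F _ that(2,3)])
    have "hom_exact A (restrict_scalars fst E) (\<lambda>n. fm A (k n)) D p"
      by (rule scalar_change.hom_exact_above_fpd[OF sc F z A' that(1)])
    then show "hom_exact S E (\<lambda>n. fm S (k n)) ?D p"
      by (rule \<pi>.base_change_hom_exact[where D = D and k = k, OF left_module_char_module D])
  qed
  \<comment> \<open>The reduced complex is exact from degree r + 2 on, and a free complex has to be
    exact in degree 1, hence the shift by r + 1.\<close>
  have "free_complex S (\<lambda>n. k (n + Suc r)) (\<lambda>n. ?D (n + Suc r))"
  proof (rule free_complexI)
    show "?D (n + Suc r) \<in> lmod_hom S (fm S (k (Suc n + Suc r))) (fm S (k (n + Suc r)))" for n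
      using \<pi>.base_change_hom[OF D] by simp
    show "?D (n + Suc r) (?D (Suc n + Suc r) x) = \<zero>\<^bsub>fm S (k (n + Suc r))\<^esub>"
      if x: "x \<in> carrier (fm S (k (Suc (Suc n) + Suc r)))" for n x
    proof -
      have x': "x \<in> carrier (fm S (k (Suc (Suc (n + Suc r)))))" using x by simp
      have "?D (n + Suc r) (?D (Suc (n + Suc r)) x) = \<zero>\<^bsub>fm S (k (n + Suc r))\<^esub>"
        unfolding \<pi>.base_change_comp[OF D D x']
        by (rule \<pi>.base_change_zero[OF lmod_hom_comp[OF D D] free_complexD(2)[OF F] x'])
      then show ?thesis by simp
    qed
    show "y \<in> ?D (Suc n + Suc r) ` carrier (fm S (k (Suc (Suc n) + Suc r)))"
      if "y \<in> carrier (fm S (k (Suc n + Suc r)))" "?D (n + Suc r) y = \<zero>\<^bsub>fm S (k (n + Suc r))\<^esub>" for n y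
      using ex[of "n + r" y] that by simp
  qed
  note C = this
  have reg: "lmod_regular S (fm S (k (Suc j))) (fm S (k j)) (?D j)" if "s + Suc r \<le> j" for j
  proof -
    have j: "s \<le> j - Suc r" "j - Suc r + Suc r = j" "Suc (j - Suc r) + Suc r = Suc j" using that by auto
    show ?thesis using free_complex_regular[OF R.ring_axioms C _ S j(1), of m] z unfolding j(2,3) by simp
  qed
  \<comment> \<open>Descending induction on j, with n bounding the distance to the top m. From m on,
    the source of \<open>D j\<close> is zero; below, \<open>regular_lift\<close> combines the
    splitting of the next differential over A with that of the reduced one over S.\<close>
  have "lmod_regular A (fm A (k (Suc j))) (fm A (k j)) (D j)" if "s + Suc r \<le> j" "m \<le> j + n" for n j
    using that
  proof (induction n arbitrary: j)
    case 0
    have d0: "carrier (fm A (k (Suc j))) = {\<zero>\<^bsub>fm A (k (Suc j))\<^esub>}"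
      by (rule fm_zero[OF ringA z]) (use 0 in simp)
    note Fm = left_module_free_module[OF ringA]
    have Z: "(\<lambda>x. \<zero>\<^bsub>fm A (k (Suc j))\<^esub>) \<in> lmod_hom A (fm A (k j)) (fm A (k (Suc j)))"
      by (rule lmod_hom_const_zero[OF Fm])
    show ?case unfolding lmod_regular_def by (rule bexI[OF _ Z]) (simp only: d0 Ball_def singleton_iff, blast)
  next
    case (Suc n)
    have "lmod_regular A (fm A (k (Suc (Suc j)))) (fm A (k (Suc j))) (D (Suc j))"
      by (rule Suc.IH) (use Suc.prems in simp_all)
    note R1 = this
    have R2: "y \<in> ?D (Suc j) ` carrier (fm S (k (Suc (Suc j))))"
      if "y \<in> carrier (fm S (k (Suc j)))" "?D j y = \<zero>\<^bsub>fm S (k j)\<^esub>" for y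
    proof -
      obtain p where "j = Suc p" "r \<le> p" using Suc.prems(1) by (cases j) auto
      then show ?thesis using ex[of p y] that by simp
    qed
    show ?case by (rule regular_lift[OF D D free_complexD(2)[OF F] R1 R2 reg[OF Suc.prems(1)]])
  qed
  from this[of "s + Suc r" m]
  show "lmod_regular A (fm A (k (Suc (s + Suc r)))) (fm A (k (s + Suc r))) (D (s + Suc r))" by simp
qed

end

section \<open>Change of scalars along a ring epimorphism\<close>

text \<open>The resolution of finite length and the one on which Tor is known to vanish may be
  different; vanishing of the cohomology is moved to the finite one.\<close>

lemma scalar_change_char_module:
  fixes R :: "('r, 'y) ring_scheme" and S :: "('s, 'z) ring_scheme" and M :: "('s, 'm) bimodule"
  assumes R: "ring R" and S: "ring S" and epi: "ring_epi R S lam" and M: "bimodule S M"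
    and tor: "\<forall>i \<ge> 1. trivial_group
      (Tor R i (restrict_bimodule lam M) (restrict_scalars lam (regular_module S)))"
    and fin: "has_finite_fg_projective_resolution R (restrict_scalars lam (regular_module S))"
  shows "scalar_change R S lam (char_module M)"
proof -
  have lam: "lam \<in> ring_hom R S" using epi by (simp add: ring_epi_def)
  interpret T: triv_ext S M by (rule triv_ext.intro[OF M])
  interpret T': triv_ext R "restrict_bimodule lam M"
    by (rule triv_ext.intro[OF bimodule_restrict_bimodule[OF M R lam]])
  note E = T.left_module_char_module
  let ?N = "restrict_scalars lam (regular_module S)"
  have N: "left_module R ?N" by (rule left_module_restrict_scalars[OF left_module_regular_module[OF S] R lam])
  have E': "left_module R (restrict_scalars lam (char_module M))" by (rule left_module_restrict_scalars[OF E R lam])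
  obtain P :: "('r, 's) res_modules" and d e n
    where P: "projective_resolution R ?N P d e" "\<forall>k. fin_gen R (P k)" "zero_above P n"
    using fin unfolding has_finite_fg_projective_resolution_def by blast
  obtain Q :: "('r, 's) res_modules" and d' e' where Q: "projective_resolution R ?N Q d' e'"
    "\<And>i. hom_exact R (char_module (restrict_bimodule lam M)) Q d' i"
    by (rule T'.Tor_resolution[OF N tor]) blast
  have ex: "hom_exact R (restrict_scalars lam (char_module M)) P d i" for i
    by (rule hom_exact_resolution_independent[OF P(1) Q(1) E' Q(2)[unfolded char_module_restrict]])
  have "fg_resolution R ?N P d e" unfolding fg_resolution_def using P by blast
  note ac = hom_acyclicI[OF this E' ex]
  show ?thesis
    by (rule scalar_change.intro[OF R S lam E _ ac]) (rule ring_epi_hom_linear[OF S epi E])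
qed

text \<open>The same adjunction as for a general base change, for a module on which M acts as zero:
  every cochain over A is determined by its restriction along \<sigma>.\<close>

lemma (in triv_ext) up_hom_exact:
  assumes N: "left_module S N" and D: "\<And>n. D n \<in> lmod_hom S (fm S (k (Suc n))) (fm S (k n))"
    and ex: "hom_exact S N (\<lambda>n. fm S (k n)) D i"
  shows "hom_exact A (restrict_scalars fst N) (\<lambda>n. fm A (k n)) (\<lambda>n. up (k n) (D n)) i"
  unfolding hom_exact_def
proof (intro ballI impI)
  have N': "left_module A (restrict_scalars fst N)" by (rule left_module_restrict_scalars[OF N ringA fst_hom])
  fix \<chi> assume \<chi>: "\<chi> \<in> lmod_hom A (fm A (k (Suc i))) (restrict_scalars fst N)"
    and co: "\<forall>y \<in> carrier (fm A (k (Suc (Suc i)))). \<chi> (up (k (Suc i)) (D (Suc i)) y) = \<zero>\<^bsub>restrict_scalars fst N\<^esub>"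
  have \<chi>m: "(\<lambda>x. \<chi> (\<lambda>j. \<sigma> (x j))) \<in> lmod_hom S (fm S (k (Suc i))) N"
  proof (rule lmod_homI)
    fix x assume x: "x \<in> carrier (fm S (k (Suc i)))"
    show "\<chi> (\<lambda>j. \<sigma> (x j)) \<in> carrier N" using lmod_homD(1)[OF \<chi> \<sigma>_map[OF x]] by simp
    show "\<chi> (\<lambda>j. \<sigma> ((x \<oplus>\<^bsub>fm S (k (Suc i))\<^esub> y) j)) = \<chi> (\<lambda>j. \<sigma> (x j)) \<oplus>\<^bsub>N\<^esub> \<chi> (\<lambda>j. \<sigma> (y j))"
      if y: "y \<in> carrier (fm S (k (Suc i)))" for y
      unfolding \<sigma>.map_add[OF x y] lmod_homD(2)[OF \<chi> \<sigma>_map[OF x] \<sigma>_map[OF y]] by simp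
    show "\<chi> (\<lambda>j. \<sigma> ((a \<odot>\<^bsub>fm S (k (Suc i))\<^esub> x) j)) = a \<odot>\<^bsub>N\<^esub> \<chi> (\<lambda>j. \<sigma> (x j))" if a: "a \<in> carrier S" for a
      unfolding \<sigma>.map_smult[OF a x] lmod_homD(3)[OF \<chi> \<sigma>.\<phi>_simps(1)[OF a] \<sigma>_map[OF x]] by simp
  qed
  have "\<chi> (\<lambda>j. \<sigma> (D (Suc i) y j)) = \<zero>\<^bsub>N\<^esub>" if y: "y \<in> carrier (fm S (k (Suc (Suc i))))" for y
    using bspec[OF co \<sigma>_map[OF y]] unfolding \<sigma>.base_change_map[OF D y] by simp
  then obtain \<psi> where \<psi>: "\<psi> \<in> lmod_hom S (fm S (k i)) N"
    "\<And>x. x \<in> carrier (fm S (k (Suc i))) \<Longrightarrow> \<chi> (\<lambda>j. \<sigma> (x j)) = \<psi> (D i x)"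
    using bspec[OF ex[unfolded hom_exact_def] \<chi>m] by blast
  have g: "(\<lambda>x. \<psi> (\<lambda>j. fst (x j))) \<in> lmod_hom A (fm A (k i)) (restrict_scalars fst N)"
    by (rule lmod_hom_comp[OF \<pi>.map_hom lmod_hom_restrict_scalars[OF fst_hom \<psi>(1)]])
  have "\<chi> x = \<psi> (\<lambda>j. fst (up (k i) (D i) x j))" if x: "x \<in> carrier (fm A (k (Suc i)))" for x
  proof (rule free_hom_eqI[OF N' \<chi> lmod_hom_comp[OF \<sigma>.base_change_hom[OF D] g] _ x])
    fix b assume b: "b \<in> {..<k (Suc i)}"
    note be = basis_elt_in[OF R.ring_axioms b]
    have "\<chi> (basis_elt A b) = \<psi> (D i (basis_elt S b))" using \<psi>(2)[OF be] unfolding \<sigma>.map_basis .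
    then show "\<chi> (basis_elt A b) = \<psi> (\<lambda>j. fst (up (k i) (D i) (basis_elt A b) j))"
      unfolding \<sigma>.base_change_basis[OF D b] by simp
  qed
  then show "\<exists>\<psi> \<in> lmod_hom A (fm A (k i)) (restrict_scalars fst N). \<forall>x \<in> carrier (fm A (k (Suc i))).
      \<chi> x = \<psi> (up (k i) (D i) x)" by (intro bexI[OF _ g] ballI)
qed

section \<open>The map of trivial extensions induced by \<lambda>\<close>

lemma restrict_bimodule_simps [simp]:
  "carrier (restrict_bimodule lam M) = carrier M" "\<zero>\<^bsub>restrict_bimodule lam M\<^esub> = \<zero>\<^bsub>M\<^esub>"
  "x \<oplus>\<^bsub>restrict_bimodule lam M\<^esub> y = x \<oplus>\<^bsub>M\<^esub> y" "r \<odot>\<^bsub>restrict_bimodule lam M\<^esub> x = lam r \<odot>\<^bsub>M\<^esub> x"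
  "ract (restrict_bimodule lam M) x r = ract M x (lam r)"
  by (simp_all add: restrict_bimodule_def)

locale triv_ext_change = T: triv_ext S M + sc: scalar_change R S lam "char_module M"
  for R :: "('r, 'y) ring_scheme" and S :: "('s, 'z) ring_scheme" and lam :: "'r \<Rightarrow> 's"
    and M :: "('s, 'm) bimodule"
begin

sublocale T': triv_ext R "restrict_bimodule lam M"
  by (rule triv_ext.intro[OF bimodule_restrict_bimodule[OF T.bimodule_axioms sc.R sc.\<phi>]])

definition \<Phi> :: "'r \<times> 'm \<Rightarrow> 's \<times> 'm" where "\<Phi> z = (lam (fst z), snd z)"

lemma lam_simps:
  "r \<in> carrier R \<Longrightarrow> lam r \<in> carrier S" "lam \<zero>\<^bsub>R\<^esub> = \<zero>\<^bsub>S\<^esub>" "lam \<one>\<^bsub>R\<^esub> = \<one>\<^bsub>S\<^esub>"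
  by (rule ring_hom_memE(1)[OF sc.\<phi>], assumption)
    (rule ring_hom_zero[OF sc.\<phi> sc.R sc.S], rule ring_hom_memE(4)[OF sc.\<phi>])

lemma \<Phi>_hom: "\<Phi> \<in> ring_hom T'.A T.A"
  by (rule ring_hom_memI) (use ring_hom_memE[OF sc.\<phi>] in \<open>auto simp: \<Phi>_def\<close>)

abbreviation NA where "NA \<equiv> restrict_scalars \<Phi> (regular_module T.A)"
abbreviation NR where "NR \<equiv> restrict_scalars lam (regular_module S)"
abbreviation EA where "EA \<equiv> restrict_scalars (fst :: 's \<times> 'm \<Rightarrow> 's) T.E"

lemma left_module_NA: "left_module T'.A NA"
  by (rule left_module_restrict_scalars[OF left_module_regular_module[OF T.ringA] T'.ringA \<Phi>_hom])

lemma left_module_NR: "left_module R NR"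
  by (rule left_module_restrict_scalars[OF left_module_regular_module[OF sc.S] sc.R sc.\<phi>])

lemma left_module_EA: "left_module T.A EA"
  by (rule left_module_restrict_scalars[OF T.left_module_char_module T.ringA T.fst_hom])

lemma restrict_EA: "restrict_scalars \<Phi> EA = restrict_scalars fst T'.E"
  unfolding char_module_restrict by (simp add: restrict_scalars_def \<Phi>_def cong: if_cong)

text \<open>On the S-part this is \<open>hom_linear\<close>. The element (0, m) already comes from
  the trivial extension of R, so f (0, m) is its multiple of f (1), which is zero because M acts as
  zero on \<open>EA\<close>.\<close>

lemma NA_hom_linear:
  assumes f: "f \<in> lmod_hom T'.A NA (restrict_scalars \<Phi> EA)" and a: "a \<in> carrier T.A"
  shows "f a = a \<odot>\<^bsub>EA\<^esub> f \<one>\<^bsub>T.A\<^esub>"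
proof -
  interpret E: left_module S T.E by (rule T.left_module_char_module)
  note fc = lmod_homD(1)[OF f, unfolded restrict_scalars_simps regular_module_simps]
    and fa = lmod_homD(2)[OF f, unfolded restrict_scalars_simps regular_module_simps]
    and fs = lmod_homD(3)[OF f, unfolded restrict_scalars_simps regular_module_simps]
  have a': "fst a \<in> carrier S" "snd a \<in> carrier M" using a by auto
  have g: "(\<lambda>s. f (T.\<sigma> s)) \<in> lmod_hom R NR (restrict_scalars lam T.E)"
  proof (rule lmod_homI; simp only: restrict_scalars_simps regular_module_simps)
    show "f (T.\<sigma> x) \<in> carrier T.E" if "x \<in> carrier S" for x by (rule fc) (use that in simp)
    show "f (T.\<sigma> (x \<oplus>\<^bsub>S\<^esub> y)) = f (T.\<sigma> x) \<oplus>\<^bsub>T.E\<^esub> f (T.\<sigma> y)" if "x \<in> carrier S" "y \<in> carrier S" for x y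
      using fa[of "T.\<sigma> x" "T.\<sigma> y"] that by simp
    show "f (T.\<sigma> (lam r \<otimes>\<^bsub>S\<^esub> x)) = lam r \<odot>\<^bsub>T.E\<^esub> f (T.\<sigma> x)" if "r \<in> carrier R" "x \<in> carrier S" for r x
      using fs[of "(r, \<zero>\<^bsub>M\<^esub>)" "T.\<sigma> x"] that lam_simps(1)[OF that(1)]
      by (simp add: \<Phi>_def T.ract_zero_left del: char_module_simps)
  qed
  have f1: "f \<one>\<^bsub>T.A\<^esub> \<in> carrier T.E" by (rule fc) simp
  have s: "f (T.\<sigma> (fst a)) = fst a \<odot>\<^bsub>T.E\<^esub> f \<one>\<^bsub>T.A\<^esub>"
    using sc.hom_linear[OF g a'(1)] by (simp del: char_module_simps)
  have "f (\<zero>\<^bsub>S\<^esub>, snd a) = \<zero>\<^bsub>S\<^esub> \<odot>\<^bsub>T.E\<^esub> f \<one>\<^bsub>T.A\<^esub>"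
    using fs[of "(\<zero>\<^bsub>R\<^esub>, snd a)" "\<one>\<^bsub>T.A\<^esub>"] a'
    by (simp add: \<Phi>_def lam_simps T.ract_one del: char_module_simps)
  then have m: "f (\<zero>\<^bsub>S\<^esub>, snd a) = \<zero>\<^bsub>T.E\<^esub>" unfolding E.smult_l_null[OF f1] .
  have "f a = f (T.\<sigma> (fst a)) \<oplus>\<^bsub>T.E\<^esub> f (\<zero>\<^bsub>S\<^esub>, snd a)"
    using fa[of "T.\<sigma> (fst a)" "(\<zero>\<^bsub>S\<^esub>, snd a)"] a' by (simp del: char_module_simps)
  also have "\<dots> = fst a \<odot>\<^bsub>T.E\<^esub> f \<one>\<^bsub>T.A\<^esub>"
    unfolding m s by (rule E.M.r_zero[OF E.smult_closed[OF a'(1) f1]])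
  finally show ?thesis by (simp only: restrict_scalars_simps)
qed

text \<open>The base changed complex is an extension of the resolution F by M tensor F. In positive
  degrees both are exact, the second by \<open>ex\<close>. In degree 0 it remains to identify the
  cokernel of the M-part with M, and this is where the linearity of homomorphisms from S to E
  enters.\<close>

lemma NA_resolution:
  assumes res: "projective_resolution R NR (\<lambda>n. fm R (k n)) D e" and F: "free_complex R k D"
    and ex: "\<And>i. hom_exact R T'.E (\<lambda>n. fm R (k n)) D i"
  shows "projective_resolution T'.A NA (\<lambda>n. fm T'.A (k n)) (\<lambda>n. T'.up (k n) (D n))
    (free_ext T'.A NA (\<lambda>i. T.\<sigma> (e (basis_elt R i))))"
proof -
  let ?A = "T'.A" and ?e = "free_ext T'.A NA (\<lambda>i. T.\<sigma> (e (basis_elt R i)))"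
  let ?D = "\<lambda>n. T'.up (k n) (D n)"
  note r = projective_resolutionD[OF res] and D = free_complexD(1)[OF F]
  note U = T'.free_complex_up[OF F, of 0, OF ex, unfolded add_0_right]
  note Fm = left_module_free_module[OF T'.ringA] and NA = left_module_NA
  interpret F0: left_module ?A "fm ?A (k 0)" by (rule Fm)
  have ec: "e x \<in> carrier S" if "x \<in> carrier (fm R (k 0))" for x using lmod_homD(1)[OF r(5) that] by simp
  have eb: "(\<lambda>i. T.\<sigma> (e (basis_elt R i))) \<in> {..<k 0} \<rightarrow> carrier NA"
    using ec[OF basis_elt_in[OF sc.R]] by simp
  have e: "?e \<in> lmod_hom ?A (fm ?A (k 0)) NA" by (rule free_ext_hom[OF NA eb])
  note h = lmod_homD[OF e, unfolded restrict_scalars_simps regular_module_simps]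
  have e\<sigma>: "?e (\<lambda>j. T'.\<sigma> (x j)) = T.\<sigma> (e x)" if x: "x \<in> carrier (fm R (k 0))" for x
  proof (rule T'.\<sigma>.semilinear_eqI[OF NA e _ free_ext_basis[OF NA eb] x])
    show "(\<lambda>x. T.\<sigma> (e x)) \<in> lmod_hom R (fm R (k 0)) (restrict_scalars T'.\<sigma> NA)"
    proof (rule lmod_homI)
      fix x assume x: "x \<in> carrier (fm R (k 0))"
      show "T.\<sigma> (e x) \<in> carrier (restrict_scalars T'.\<sigma> NA)" using ec[OF x] by simp
      show "T.\<sigma> (e (x \<oplus>\<^bsub>fm R (k 0)\<^esub> y)) = T.\<sigma> (e x) \<oplus>\<^bsub>restrict_scalars T'.\<sigma> NA\<^esub> T.\<sigma> (e y)"
        if y: "y \<in> carrier (fm R (k 0))" for y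
        unfolding lmod_homD(2)[OF r(5) x y] by simp
      show "T.\<sigma> (e (c \<odot>\<^bsub>fm R (k 0)\<^esub> x)) = c \<odot>\<^bsub>restrict_scalars T'.\<sigma> NA\<^esub> T.\<sigma> (e x)" if c: "c \<in> carrier R" for c
        unfolding lmod_homD(3)[OF r(5) c x] using lam_simps(1)[OF c] ec[OF x]
        by (simp add: \<Phi>_def T.ract_zero_left)
    qed
  qed
  have fe: "fst (?e z) = e (\<lambda>j. fst (z j))" if z: "z \<in> carrier (fm ?A (k 0))" for z
  proof (rule free_hom_eqI[OF left_module_restrict_scalars[OF left_module_NR T'.ringA T'.fst_hom] _ _ _ z])
    have "fst \<in> lmod_hom ?A NA (restrict_scalars fst NR)"
      by (rule lmod_homI) (auto simp: \<Phi>_def)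
    from lmod_hom_comp[OF e this]
    show "(\<lambda>z. fst (?e z)) \<in> lmod_hom ?A (fm ?A (k 0)) (restrict_scalars fst NR)" .
    show "(\<lambda>z. e (\<lambda>j. fst (z j))) \<in> lmod_hom ?A (fm ?A (k 0)) (restrict_scalars fst NR)"
      by (rule lmod_hom_comp[OF T'.\<pi>.map_hom lmod_hom_restrict_scalars[OF T'.fst_hom r(5)]])
    show "fst (?e (basis_elt ?A b)) = e (\<lambda>j. fst (basis_elt ?A b j))" if b: "b \<in> {..<k 0}" for b
      unfolding T'.\<pi>.map_basis free_ext_basis[OF NA eb b] by simp
  qed
  have eD: "?e (?D 0 y) = \<zero>\<^bsub>NA\<^esub>" if y: "y \<in> carrier (fm ?A (k (Suc 0)))" for y
  proof (rule free_hom_eqI[OF NA lmod_hom_comp[OF T'.\<sigma>.base_change_hom[OF D] e] lmod_hom_const_zero[OF NA] _ y])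
    fix b assume b: "b \<in> {..<k (Suc 0)}"
    note be = basis_elt_in[OF sc.R b]
    show "?e (?D 0 (basis_elt ?A b)) = \<zero>\<^bsub>NA\<^esub>"
      unfolding T'.\<sigma>.base_change_basis[OF D b] e\<sigma>[OF lmod_homD(1)[OF D be]] r(9)[OF be] by simp
  qed
  show ?thesis
  proof (rule projective_resolutionI[OF NA projective_free_module[OF T'.ringA] free_complexD(1)[OF U] e _ eD
        free_complexD(2)[OF U] _ free_complexD(3)[OF U]])
    fix z assume "z \<in> carrier NA"
    then have z: "fst z \<in> carrier S" "snd z \<in> carrier M" by auto
    obtain x where x: "x \<in> carrier (fm R (k 0))" "e x = fst z"
      using surjE[OF r(6), of "fst z"] z(1) by auto
    \<comment> \<open>An element over 1: multiplying its lift by (0, m) reaches the M-component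
      m.\<close>
    obtain x1 where x1: "x1 \<in> carrier (fm R (k 0))" "e x1 = \<one>\<^bsub>S\<^esub>"
      using surjE[OF r(6), of "\<one>\<^bsub>S\<^esub>"] by auto
    have m: "(\<zero>\<^bsub>R\<^esub>, snd z) \<in> carrier ?A" using z(2) by simp
    note x' = T'.\<sigma>_map[OF x(1)] and x1' = T'.\<sigma>_map[OF x1(1)]
    note mx = F0.smult_closed[OF m x1']
    have "?e ((\<lambda>j. T'.\<sigma> (x j)) \<oplus>\<^bsub>fm ?A (k 0)\<^esub> (\<zero>\<^bsub>R\<^esub>, snd z) \<odot>\<^bsub>fm ?A (k 0)\<^esub> (\<lambda>j. T'.\<sigma> (x1 j))) = z"
      unfolding h(2)[OF x' mx] h(3)[OF m x1'] e\<sigma>[OF x(1)] e\<sigma>[OF x1(1)] x(2) x1(2)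
      using z by (simp add: \<Phi>_def lam_simps T.ract_one prod_eq_iff)
    then show "z \<in> ?e ` carrier (fm ?A (k 0))" using F0.M.a_closed[OF x' mx] by force
  next
    fix y assume y: "y \<in> carrier (fm ?A (k 0))" "?e y = \<zero>\<^bsub>NA\<^esub>"
    have "e (\<lambda>j. fst (y j)) = \<zero>\<^bsub>NR\<^esub>" unfolding fe[OF y(1), symmetric] y(2) by simp
    note im = r(11)[OF T'.fst_map[OF y(1)] this]
    \<comment> \<open>The M-part in degree 0. An element w that is no boundary is detected by a
      \<chi> that vanishes on boundaries and hence factors through e as \<psi>.\<close>
    have fib: "w \<in> ?D 0 ` T'.fib (k (Suc 0))" if w: "w \<in> T'.fib (k 0)" "?e w = \<zero>\<^bsub>NA\<^esub>" for w
    proof (rule ccontr)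
      assume n: "w \<notin> ?D 0 ` T'.fib (k (Suc 0))"
      obtain \<chi> where \<chi>: "\<chi> \<in> lmod_hom R (fm R (k 0)) T'.E"
        "\<And>x. x \<in> carrier (fm R (k (Suc 0))) \<Longrightarrow> \<chi> (D 0 x) = \<zero>\<^bsub>T'.E\<^esub>" "T'.pairing (k 0) \<chi> w \<noteq> 1"
        by (rule T'.separating_hom[OF D w(1) n]) blast
      have \<chi>0: "\<chi> x = \<zero>\<^bsub>T'.E\<^esub>" if x: "x \<in> carrier (fm R (k 0))" "e x = \<zero>\<^bsub>NR\<^esub>" for x
        using r(11)[OF x] \<chi>(2) by force
      obtain \<psi> where \<psi>: "\<psi> \<in> lmod_hom R NR T'.E" "\<And>x. x \<in> carrier (fm R (k 0)) \<Longrightarrow> \<psi> (e x) = \<chi> x"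
        by (rule lmod_hom_factor[OF r(3) r(1) T'.left_module_char_module r(5,6) \<chi>(1) \<chi>0]) blast+
      \<comment> \<open>By linearity \<psi> is determined by its value at 1, so pairing with \<chi>
        is \<epsilon> applied to the M-component of the augmentation. On the kernel of the
        augmentation it is trivial, a contradiction.\<close>
      define \<epsilon> where "\<epsilon> = \<psi> \<one>\<^bsub>S\<^esub>"
      have \<epsilon>: "\<epsilon> \<in> carrier T.E"
        using lmod_homD(1)[OF \<psi>(1), of "\<one>\<^bsub>S\<^esub>"] unfolding char_module_restrict \<epsilon>_def by simp
      have \<chi>e: "\<chi> x m = \<epsilon> (ract M m (e x))" if x: "x \<in> carrier (fm R (k 0))" and m: "m \<in> carrier M" for x m
        using sc.hom_linear[OF \<psi>(1)[unfolded char_module_restrict] ec[OF x]] \<psi>(2)[OF x] m by (simp add: \<epsilon>_def)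
      have "T'.pairing (k 0) \<chi> z = \<epsilon> (snd (?e z))" if z: "z \<in> carrier (fm ?A (k 0))" for z
      proof (rule free_module_induct[OF T'.ringA z])
        have "?e \<zero>\<^bsub>fm ?A (k 0)\<^esub> = \<zero>\<^bsub>NA\<^esub>" by (rule lmod_hom_zero[OF e Fm NA])
        then show "T'.pairing (k 0) \<chi> (\<lambda>x. \<zero>\<^bsub>?A\<^esub>) = \<epsilon> (snd (?e (\<lambda>x. \<zero>\<^bsub>?A\<^esub>)))"
          using T'.pairing_zero[OF \<chi>(1)] T.char_app_zero[OF \<epsilon>] by simp
      next
        fix z b a assume z: "z \<in> carrier (fm ?A (k 0))" "T'.pairing (k 0) \<chi> z = \<epsilon> (snd (?e z))"
          and b: "b \<in> {..<k 0}" and a: "a \<in> carrier ?A"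
        note be = basis_elt_in[OF T'.ringA b] and bR = basis_elt_in[OF sc.R b]
        have a': "snd a \<in> carrier M" "fst a \<in> carrier R" using a by auto
        have "T'.pairing (k 0) \<chi> (a \<odot>\<^bsub>fm ?A (k 0)\<^esub> basis_elt ?A b) = \<epsilon> (ract M (snd a) (e (basis_elt R b)))"
          using T'.pairing_smult_up[OF \<chi>(1) a bR] \<chi>e[OF bR a'(1)] unfolding T'.\<sigma>.map_basis by simp
        also have "ract M (snd a) (e (basis_elt R b)) = snd (?e (a \<odot>\<^bsub>fm ?A (k 0)\<^esub> basis_elt ?A b))"
          unfolding h(3)[OF a be] free_ext_basis[OF NA eb b]
          using a' lam_simps(1)[OF a'(2)] ec[OF bR] by (simp add: \<Phi>_def T.ract_closed)
        finally have s: "T'.pairing (k 0) \<chi> (a \<odot>\<^bsub>fm ?A (k 0)\<^esub> basis_elt ?A b) =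
          \<epsilon> (snd (?e (a \<odot>\<^bsub>fm ?A (k 0)\<^esub> basis_elt ?A b)))" .
        note sc = F0.smult_closed[OF a be]
        have c: "snd (?e z) \<in> carrier M" "snd (?e (a \<odot>\<^bsub>fm ?A (k 0)\<^esub> basis_elt ?A b)) \<in> carrier M"
          using h(1)[OF z(1)] h(1)[OF sc] by auto
        show "T'.pairing (k 0) \<chi> (z \<oplus>\<^bsub>fm ?A (k 0)\<^esub> a \<odot>\<^bsub>fm ?A (k 0)\<^esub> basis_elt ?A b) =
          \<epsilon> (snd (?e (z \<oplus>\<^bsub>fm ?A (k 0)\<^esub> a \<odot>\<^bsub>fm ?A (k 0)\<^esub> basis_elt ?A b)))"
          unfolding T'.pairing_add[OF \<chi>(1) z(1) sc] h(2)[OF z(1) sc] z(2) s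
          using \<epsilon> c unfolding char_module_carrier by simp
      qed
      then have "T'.pairing (k 0) \<chi> w = \<epsilon> (snd (?e w))" using w(1) by (simp add: T'.fib_def)
      also have "\<dots> = 1" unfolding w(2) using T.char_app_zero[OF \<epsilon>] by simp
      finally show False using \<chi>(3) by simp
    qed
    show "y \<in> ?D 0 ` carrier (fm ?A (k (Suc 0)))"
      by (rule T'.up_image[OF D NA e eD fib y im])
  qed
qed

text \<open>Base change is defined for free modules, so a possibly infinite free resolution of S is
  taken; its splitting in degree m survives base change, and truncation there gives a finite
  resolution of \<open>NA\<close>.\<close>

lemma scalar_change_triv_ext: "scalar_change T'.A T.A \<Phi> EA"
proof (rule scalar_change.intro[OF T'.ringA T.ringA \<Phi>_hom left_module_EA NA_hom_linear])
  obtain P :: "nat \<Rightarrow> ('r, nat \<Rightarrow> 'r) module" and d e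
    where P: "fg_resolution R NR P d e" "\<And>n. hom_exact R (restrict_scalars lam T.E) P d n"
    using sc.acyclic unfolding hom_acyclic_def by blast
  obtain k D e' m where F: "projective_resolution R NR (\<lambda>n. fm R (k n)) D e'" "free_complex R k D"
    "lmod_regular R (fm R (k (Suc m))) (fm R (k m)) (D m)"
    by (rule free_resolution_exists[OF P(1)]) blast
  note D = free_complexD(1)[OF F(2)]
  have E': "left_module R (restrict_scalars lam T.E)"
    by (rule left_module_restrict_scalars[OF T.left_module_char_module sc.R sc.\<phi>])
  have pP: "projective_resolution R NR P d e" using P(1) by (simp add: fg_resolution_def)
  have ex: "hom_exact R T'.E (\<lambda>n. fm R (k n)) D i" for i
    unfolding char_module_restrict by (rule hom_exact_resolution_independent[OF F(1) pP E' P(2)])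
  note U = NA_resolution[OF F(1,2) ex]
  note reg = T'.\<sigma>.base_change_regular[OF D F(3)]
  obtain P' :: "nat \<Rightarrow> ('r \<times> 'm, nat \<Rightarrow> 'r \<times> 'm) module" and d' e'' where P':
    "projective_resolution T'.A NA P' d' e''" "zero_above P' m" "\<And>n. fin_gen T'.A (P' n)"
    by (rule truncate_resolution[OF U reg]) (use fin_gen_fm[OF T'.ringA] in blast)
  have E'': "left_module T'.A (restrict_scalars \<Phi> EA)"
    by (rule left_module_restrict_scalars[OF left_module_EA T'.ringA \<Phi>_hom])
  have "hom_exact T'.A (restrict_scalars \<Phi> EA) (\<lambda>n. fm T'.A (k n)) (\<lambda>n. T'.up (k n) (D n)) i" for i
    unfolding restrict_EA by (rule T'.up_hom_exact[where D = D and k = k, OF T'.left_module_char_module D ex])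
  note ex' = hom_exact_resolution_independent[OF P'(1) U E'' this]
  have "fg_resolution T'.A NA P' d' e''" unfolding fg_resolution_def using P' by blast
  from hom_acyclicI[OF this E'' ex']
  show "hom_acyclic T'.A (restrict_scalars \<Phi> EA) NA" .
qed

end

section \<open>The two inequalities\<close>

theorem corollary5p9:
  fixes R :: "('r, 'y) ring_scheme" and S :: "('s, 'z) ring_scheme"
    and lam :: "'r \<Rightarrow> 's" and M :: "('s, 'm) bimodule"
  assumes "ring R" and "ring S"
    and "ring_epi R S lam"
    and "bimodule S M"
    and "\<forall>i \<ge> 1. trivial_group
           (Tor R i (restrict_bimodule lam M) (restrict_scalars lam (regular_module S)))"
    and "has_finite_fg_projective_resolution R (restrict_scalars lam (regular_module S))"
  shows "fpd (S \<ltimes> M) \<le> fpd S + fpd (R \<ltimes> restrict_bimodule lam M) + 1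
    \<and> fpd S \<le> fpd R + fpd (S \<ltimes> M)
              + max 1 (projdim R (restrict_scalars lam (regular_module S))) + 3"
proof -
  have sc: "scalar_change R S lam (char_module M)" by (rule scalar_change_char_module[OF assms])
  interpret triv_ext_change R S lam M by (rule triv_ext_change.intro[OF triv_ext.intro[OF assms(4)] sc])
  have a: "fpd (S \<ltimes> M) \<le> fpd S + fpd (R \<ltimes> restrict_bimodule lam M) + 1"
  proof (cases "fpd S"; cases "fpd (R \<ltimes> restrict_bimodule lam M)")
    fix s r assume "fpd S = enat s" "fpd (R \<ltimes> restrict_bimodule lam M) = enat r"
    with T.fpd_triv_ext_le[OF scalar_change_triv_ext, of r s] show ?thesis by (simp add: one_enat_def)
  qed simp_all
  have "fpd S \<le> fpd R + fpd (S \<ltimes> M)"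
  proof (cases "fpd R"; cases "fpd (S \<ltimes> M)")
    fix r t assume "fpd R = enat r" "fpd (S \<ltimes> M) = enat t"
    with T.fpd_base_le[OF sc, of r t] show ?thesis by (simp add: add.commute)
  qed simp_all
  \<comment> \<open>The remaining summands are extended natural numbers, so adding them only
    enlarges the bound.\<close>
  also have "\<dots> \<le> fpd R + fpd (S \<ltimes> M) + max 1 (projdim R (restrict_scalars lam (regular_module S))) + 3"
    by (metis add.assoc le_iff_add)
  finally show ?thesis using a by blast
qed

end
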